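(* Let $X\subset\mathbb R^n$ be a domain and $\theta\in(-\pi,\pi]$. For $f\in C^2(X)$ put $C_\theta(f)=\mathrm{Re}\big(e^{-\sqrt{-1}\theta}\det(I+\sqrt{-1}\nabla^2f)\big)\,dx^1\wedge\cdots\wedge dx^n$, an $n$-form with (signed Borel measure) coefficient. (i) The map $C_\theta$ on $\mathcal P(X)\cap C^2(X)$ (resp. on $-\mathcal P(X)\cap C^2(X)$) admits a unique continuous extension to $\mathcal P(X)$ (resp. $-\mathcal P(X)$): namely, if $f_i\in\pm\mathcal P(X)\cap C^2(X)$ converge to $f\in\pm\mathcal P(X)$ uniformly on compact subsets of $X$, then $C_\theta(f_i)$ converges weakly (as measures) to $C_\theta(f)$. (ii) Let $c\in[(n-1)\pi/2,n\pi/2)$ with $c\equiv\theta-\pi/2\pmod{2\pi}$ (resp. $c\in(-n\pi/2,-(n-1)\pi/2]$ with $c\equiv\theta+\pi/2\pmod{2\pi}$). If $f\in F_c(X)$ (resp. $-f\in F_{-c}(X)$), then $C_\theta(f)$ is a positive measure.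
   Context: $\mathcal P(X)$ denotes the convex functions on $X$ (equivalently, functions of type $\mathcal P$, $\mathcal P$ = positive semidefinite matrices), and $-\mathcal P(X)=\{-f:f\in\mathcal P(X)\}$. $F_c=\{A\in\mathrm{Sym}(\mathbb R^n):\mathrm{tr}\tan^{-1}A\ge c\}$ with $\tan^{-1}\in(-\pi/2,\pi/2)$ applied via eigenvalues. For $F\subset\mathrm{Sym}(\mathbb R^n)$ with dual $\widetilde F=\mathrm{Sym}(\mathbb R^n)\setminus(-\mathrm{Int}F)$: an upper semicontinuous $u$ on $X$ is subaffine if for all compact $K\subset X$ and affine $a$, $u\le a$ on $\partial K$ implies $u\le a$ on $K$; $u\in F(X)$ if $u$ is upper semicontinuous and $u+v$ is subaffine for all $v\in C^2(X)$ with $\nabla^2v\in\widetilde F$ everywhere. *)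

theory Defs
  imports "HOL-Analysis.Analysis"
begin

definition grad :: "(real^'n \<Rightarrow> real) \<Rightarrow> real^'n \<Rightarrow> real^'n" where
  "grad f x = (\<chi> i. frechet_derivative f (at x) (axis i 1))"

definition hess :: "(real^'n \<Rightarrow> real) \<Rightarrow> real^'n \<Rightarrow> real^'n^'n" where
  "hess f x = jacobian (grad f) (at x)"

definition C2_on :: "(real^'n) set \<Rightarrow> (real^'n \<Rightarrow> real) \<Rightarrow> bool" where
  "C2_on X f \<longleftrightarrow> (\<forall>x\<in>X. f differentiable (at x) \<and> grad f differentiable (at x))
                   \<and> continuous_on X (hess f)"

definition domain :: "(real^'n) set \<Rightarrow> bool" where
  "domain X \<longleftrightarrow> open X \<and> connected X \<and> X \<noteq> {}"

definition Sym :: "(real^'n^'n) set" where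
  "Sym = {A. transpose A = A}"

definition PSD :: "(real^'n^'n) set" where
  "PSD = {A \<in> Sym. \<forall>x. x \<bullet> (A *v x) \<ge> 0}"

definition diagm :: "('n \<Rightarrow> real) \<Rightarrow> real^'n^'n" where
  "diagm l = (\<chi> i j. if i = j then l i else 0)"

text \<open>tr arctan A >= c, arctan applied to A through its eigenvalues (spectral decomposition)\<close>
definition Fc :: "real \<Rightarrow> (real^'n^'n) set" where
  "Fc c = {A \<in> Sym. \<exists>U l. orthogonal_matrix U \<and> A = U ** diagm l ** transpose U
                             \<and> (\<Sum>i\<in>UNIV. arctan (l i)) \<ge> c}"

definition sym_interior :: "(real^'n^'n) set \<Rightarrow> (real^'n^'n) set" where
  "sym_interior F = {A \<in> F. \<exists>e>0. \<forall>B\<in>Sym. dist A B < e \<longrightarrow> B \<in> F}"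

definition dual :: "(real^'n^'n) set \<Rightarrow> (real^'n^'n) set" where
  "dual F = Sym - uminus ` sym_interior F"

definition usc_on :: "(real^'n) set \<Rightarrow> (real^'n \<Rightarrow> real) \<Rightarrow> bool" where
  "usc_on X u \<longleftrightarrow> (\<forall>x\<in>X. \<forall>a. u x < a \<longrightarrow> (\<exists>e>0. \<forall>y\<in>X. dist y x < e \<longrightarrow> u y < a))"

definition subaffine :: "(real^'n) set \<Rightarrow> (real^'n \<Rightarrow> real) \<Rightarrow> bool" where
  "subaffine X u \<longleftrightarrow> usc_on X u \<and>
     (\<forall>K b (d::real). compact K \<and> K \<subseteq> X \<longrightarrow>
        (\<forall>x\<in>frontier K. u x \<le> b \<bullet> x + d) \<longrightarrow> (\<forall>x\<in>K. u x \<le> b \<bullet> x + d))"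

definition Fsub :: "(real^'n^'n) set \<Rightarrow> (real^'n) set \<Rightarrow> (real^'n \<Rightarrow> real) \<Rightarrow> bool" where
  "Fsub F X u \<longleftrightarrow> usc_on X u \<and>
     (\<forall>v. C2_on X v \<and> (\<forall>x\<in>X. hess v x \<in> dual F) \<longrightarrow> subaffine X (\<lambda>x. u x + v x))"

text \<open>P(X): functions of type P (= convex functions on X)\<close>
abbreviation Pfun :: "(real^'n) set \<Rightarrow> (real^'n \<Rightarrow> real) \<Rightarrow> bool" where
  "Pfun X u \<equiv> Fsub PSD X u"

definition test_fun :: "(real^'n) set \<Rightarrow> (real^'n \<Rightarrow> real) \<Rightarrow> bool" where
  "test_fun X \<phi> \<longleftrightarrow> continuous_on UNIV \<phi> \<and> compact (closure {x. \<phi> x \<noteq> 0})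
                      \<and> closure {x. \<phi> x \<noteq> 0} \<subseteq> X"

text \<open>a linear functional on C_c(X), bounded on test functions supported in each compact K,
  i.e. (by Riesz) a signed Radon measure on X\<close>
definition signed_radon :: "(real^'n) set \<Rightarrow> ((real^'n \<Rightarrow> real) \<Rightarrow> real) \<Rightarrow> bool" where
  "signed_radon X T \<longleftrightarrow>
     (\<forall>\<phi> \<psi> a b. test_fun X \<phi> \<and> test_fun X \<psi> \<longrightarrow>
        T (\<lambda>x. a * \<phi> x + b * \<psi> x) = a * T \<phi> + b * T \<psi>) \<and>
     (\<forall>K. compact K \<and> K \<subseteq> X \<longrightarrow> (\<exists>C. \<forall>\<phi>. test_fun X \<phi> \<and> {x. \<phi> x \<noteq> 0} \<subseteq> K \<longrightarrow>
        \<bar>T \<phi>\<bar> \<le> C * (SUP x. \<bar>\<phi> x\<bar>)))"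

definition positive_measure :: "(real^'n) set \<Rightarrow> ((real^'n \<Rightarrow> real) \<Rightarrow> real) \<Rightarrow> bool" where
  "positive_measure X T \<longleftrightarrow> (\<forall>\<phi>. test_fun X \<phi> \<and> (\<forall>x. \<phi> x \<ge> 0) \<longrightarrow> T \<phi> \<ge> 0)"

definition Cdens :: "real \<Rightarrow> (real^'n \<Rightarrow> real) \<Rightarrow> real^'n \<Rightarrow> real" where
  "Cdens \<theta> f x = Re (exp (- \<i> * complex_of_real \<theta>) *
      det (\<chi> i j. (if i = j then 1 else 0) + \<i> * complex_of_real (hess f x $ i $ j)))"

definition Cmeas :: "(real^'n) set \<Rightarrow> real \<Rightarrow> (real^'n \<Rightarrow> real) \<Rightarrow> (real^'n \<Rightarrow> real) \<Rightarrow> real" where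
  "Cmeas X \<theta> f \<phi> = integral X (\<lambda>x. \<phi> x * Cdens \<theta> f x)"

definition cont_ext :: "(real^'n) set \<Rightarrow> real \<Rightarrow> ((real^'n \<Rightarrow> real) \<Rightarrow> bool)
     \<Rightarrow> ((real^'n \<Rightarrow> real) \<Rightarrow> (real^'n \<Rightarrow> real) \<Rightarrow> real) \<Rightarrow> bool" where
  "cont_ext X \<theta> S T \<longleftrightarrow>
     (\<forall>f. S f \<and> C2_on X f \<longrightarrow> (\<forall>\<phi>. test_fun X \<phi> \<longrightarrow> T f \<phi> = Cmeas X \<theta> f \<phi>)) \<and>
     (\<forall>fs f. (\<forall>k. S (fs k) \<and> C2_on X (fs k)) \<and> S f \<and>
        (\<forall>K. compact K \<and> K \<subseteq> X \<longrightarrow> uniform_limit K fs f sequentially) \<longrightarrow>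
        (\<forall>\<phi>. test_fun X \<phi> \<longrightarrow> (\<lambda>k. T (fs k) \<phi>) \<longlonglongrightarrow> T f \<phi>))"

end

theory Submission
  imports Defs "HOL-Computational_Algebra.Polynomial" "HOL-Library.Function_Algebras"
begin

text \<open>By polynomial interpolation in m, the density of \<open>C\<^sub>\<theta>(f)\<close> is a linear combination of the determinants
  \<open>det (I + m D\<^sup>2f)\<close>, \<open>m = 0, \<dots>, n\<close>. For convex f this determinant is the Jacobian of the gradient map
  of \<open>|x|\<^sup>2/2 + m f\<close>, whose inverse sends p to the minimiser of \<open>|x|\<^sup>2/2 + m f - p \<bullet> x\<close>. After this change of
  variables the integral of a test function contains only the minimiser, which depends continuously on f
  in the uniform topology. Together with an approximation of convex functions by C2 ones (mollification
  with a slowly varying radius, plus a small multiple of \<open>|x|\<^sup>2\<close>), this gives the extension.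

  Among the positive semidefinite matrices, \<open>F\<^sub>c\<close> is cut out by half-spaces \<open>\<Sum>\<^sub>i w\<^sub>i \<bullet> M w\<^sub>i \<ge> \<beta>\<close> with positive semidefinite
  normals. A function of type \<open>F\<^sub>c\<close> is therefore a viscosity subsolution of linear elliptic equations with
  constant coefficients, a property that averaging over translates preserves, by comparison with solutions of
  a Dirichlet problem. Hence mollifications are again of type \<open>F\<^sub>c\<close>, their density is nonnegative, and one
  passes to the limit.\<close>

section \<open>Functions of class C2\<close>

text \<open>The nodes m of the interpolation are nonnegative reals for a reason: |x|^2/2 + m f is
  then strongly convex, so its minimiser is unique, moves by at most |p - q| when the slope p
  becomes q, and by at most the square root of 2 m sup|f - g| when f becomes g. Limit passages for
  nonsmooth f rest on the last bound, which contains no derivative of f. All of this is local: f is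
  convex only on balls inside X, so test functions are cut into pieces supported in small balls, and
  the minimiser is taken over a closed ball; a piece supported well inside confines p to a bounded
  set. Two mollifications occur. Uniqueness of the extension demands approximants that are C2 and of
  type P on the whole of X, hence the variable radius. Positivity can be tested ball by ball, so a
  constant radius serves there. The bound c >= (n - 1) pi/2 forces nonnegative eigenvalues, where
  arctan is concave: this gives the half-spaces. It also gives 0 <= s - c <= pi/2 for the sum s of
  the arctangents, and the density is a positive multiple of sin (s - c).\<close>

abbreviation dd :: "('a::real_normed_vector \<Rightarrow> 'b::real_normed_vector) \<Rightarrow> 'a \<Rightarrow> 'a \<Rightarrow> 'b" where
  "dd f v \<equiv> (\<lambda>x. frechet_derivative f (at x) v)"

text \<open>Every level stays scalar-valued: a function is C^(n+1) when it is differentiable and all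
  its directional derivatives are C^n. Closure properties then follow by induction on the order,
  with no spaces of multilinear maps. \<open>C2_on_iff_Ck\<close> ties order 2 to
  \<open>C2_on\<close>.\<close>

primrec Ck :: "nat \<Rightarrow> 'a::euclidean_space set \<Rightarrow> ('a \<Rightarrow> real) \<Rightarrow> bool" where
  "Ck 0 S f \<longleftrightarrow> continuous_on S f"
| "Ck (Suc n) S f \<longleftrightarrow> (\<forall>x\<in>S. f differentiable (at x)) \<and> (\<forall>v. Ck n S (dd f v))"

lemma dd_eq: "(f has_derivative f') (at x) \<Longrightarrow> dd f v x = f' v"
  using frechet_derivative_at by metis

lemma dd_works: "f differentiable (at x) \<Longrightarrow> (f has_derivative (\<lambda>v. dd f v x)) (at x)"
  by (rule iffD1[OF frechet_derivative_works])

lemma has_derivative_cong_open: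
  assumes "open S" "x \<in> S" "\<And>y. y \<in> S \<Longrightarrow> f y = g y" "(f has_derivative f') (at x)"
  shows "(g has_derivative f') (at x)"
  using has_derivative_transform_within_open[OF assms(4,1,2)] assms(3) by simp

lemma dd_cong_open:
  assumes "open S" "x \<in> S" "\<And>y. y \<in> S \<Longrightarrow> f y = g y"
  shows "dd f v x = dd g v x"
proof -
  have "(f has_derivative D) (at x) \<longleftrightarrow> (g has_derivative D) (at x)" for D
    using has_derivative_cong_open[OF assms(1,2), of f g] has_derivative_cong_open[OF assms(1,2), of g f]
      assms(3) by auto
  then show ?thesis by (simp add: frechet_derivative_def)
qed

lemma Ck_cong:
  assumes "open S" "Ck n S f" "\<And>x. x \<in> S \<Longrightarrow> f x = g x"
  shows "Ck n S g"
  using assms(2,3)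
proof (induction n arbitrary: f g)
  case 0
  then show ?case by (simp cong: continuous_on_cong)
next
  case (Suc n)
  have "g differentiable (at x)" if "x \<in> S" for x
  proof -
    have "f differentiable (at x)" using Suc.prems(1) that by simp
    then show ?thesis
      using has_derivative_cong_open[OF assms(1) that, of f g] Suc.prems(2)
      unfolding differentiable_def by blast
  qed
  moreover have "Ck n S (dd g v)" for v
    by (rule Suc.IH[of "dd f v"]) (use Suc.prems dd_cong_open[OF assms(1), of _ f g] in auto)
  ultimately show ?case by simp
qed

lemma Ck_continuous: "Ck n S f \<Longrightarrow> continuous_on S f"
proof (cases n)
  case (Suc m)
  assume "Ck n S f"
  then have "isCont f x" if "x \<in> S" for x
    using that Suc differentiable_imp_continuous_within by auto
  then show ?thesis by (simp add: continuous_at_imp_continuous_on)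
qed auto

lemma Ck_SucD: "Ck (Suc n) S f \<Longrightarrow> Ck n S f"
proof (induction n arbitrary: f)
  case 0
  then show ?case using Ck_continuous[OF 0] by simp
qed auto

lemma Ck_subset: "Ck n S f \<Longrightarrow> T \<subseteq> S \<Longrightarrow> Ck n T f"
  by (induction n arbitrary: f) (auto intro: continuous_on_subset)

lemma Ck_differentiable: "Ck (Suc n) S f \<Longrightarrow> x \<in> S \<Longrightarrow> f differentiable (at x)"
  by simp

text \<open>Openness of \<open>S\<close> lets an explicit formula for the derivative replace
  \<open>frechet_derivative\<close> at the next level; later smoothness proofs enter here.\<close>

lemma Ck_SucI:
  assumes "open S" "\<And>x. x \<in> S \<Longrightarrow> (f has_derivative (\<lambda>v. f' v x)) (at x)" "\<And>v. Ck n S (f' v)"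
  shows "Ck (Suc n) S f"
proof -
  have "Ck n S (dd f v)" for v
    by (rule Ck_cong[OF assms(1) assms(3)]) (simp add: dd_eq[OF assms(2)])
  moreover have "f differentiable (at x)" if "x \<in> S" for x
    using assms(2) that unfolding differentiable_def by blast
  ultimately show ?thesis by simp
qed

declare Ck.simps(2) [simp del]
lemmas Ck_Suc = Ck.simps(2)

lemma Ck_const [simp]: "open S \<Longrightarrow> Ck n S (\<lambda>x. c)"
proof (induction n arbitrary: c)
  case (Suc n)
  then show ?case
    by (intro Ck_SucI[where f' = "\<lambda>v x. 0"]) auto
qed simp

lemma Ck_bounded_linear:
  assumes "open S" "bounded_linear L" shows "Ck n S L"
proof (cases n)
  case 0
  then show ?thesis using assms linear_continuous_on by auto
next
  case (Suc m)
  show ?thesis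
    unfolding Suc by (rule Ck_SucI[where f' = "\<lambda>v x. L v"])
      (use assms in \<open>auto intro: bounded_linear_imp_has_derivative\<close>)
qed

lemma Ck_add:
  assumes "open S" "Ck n S f" "Ck n S g" shows "Ck n S (\<lambda>x. f x + g x)"
  using assms(2,3)
proof (induction n arbitrary: f g)
  case (Suc n)
  then show ?case using assms(1)
    by (intro Ck_SucI[where f' = "\<lambda>v x. dd f v x + dd g v x"])
      (auto simp: Ck_Suc intro!: has_derivative_add dd_works)
qed (auto intro: continuous_on_add)

lemma Ck_mult:
  assumes "open S" "Ck n S f" "Ck n S g" shows "Ck n S (\<lambda>x. f x * g x)"
  using assms(2,3)
proof (induction n arbitrary: f g)
  case (Suc n)
  have "Ck n S f" "Ck n S g" using Suc.prems Ck_SucD by blast+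
  then show ?case using assms(1) Suc
    by (intro Ck_SucI[where f' = "\<lambda>v x. f x * dd g v x + dd f v x * g x"])
      (auto simp: Ck_Suc intro!: has_derivative_mult dd_works Ck_add)
qed (auto intro: continuous_on_mult)

lemma Ck_cmult: "open S \<Longrightarrow> Ck n S f \<Longrightarrow> Ck n S (\<lambda>x. c * f x)"
  using Ck_mult[of S n "\<lambda>x. c" f] by simp

lemma Ck_minus: "open S \<Longrightarrow> Ck n S f \<Longrightarrow> Ck n S (\<lambda>x. - f x)"
  using Ck_cmult[of S n f "-1"] by simp

lemma Ck_diff: "open S \<Longrightarrow> Ck n S f \<Longrightarrow> Ck n S g \<Longrightarrow> Ck n S (\<lambda>x. f x - g x)"
  using Ck_add[OF _ _ Ck_minus, of S n f g] by simp

lemma Ck_sum: "open S \<Longrightarrow> (\<And>i. i \<in> I \<Longrightarrow> Ck n S (f i)) \<Longrightarrow> Ck n S (\<lambda>x. \<Sum>i\<in>I. f i x)"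
proof (induction I rule: infinite_finite_induct)
  case (insert i I)
  then have "Ck n S (\<lambda>x. f i x + (\<Sum>j\<in>I. f j x))" by (intro Ck_add) auto
  then show ?case using insert by simp
qed auto

lemma Ck_power: "open S \<Longrightarrow> Ck n S f \<Longrightarrow> Ck n S (\<lambda>x. f x ^ k)"
proof (induction k)
  case (Suc k)
  then have "Ck n S (\<lambda>x. f x * f x ^ k)" by (intro Ck_mult)
  then show ?case by simp
qed simp

lemma Ck_inner:
  fixes L :: "'a::euclidean_space \<Rightarrow> 'b::euclidean_space"
  assumes "open S" "bounded_linear L" "bounded_linear M"
  shows "Ck n S (\<lambda>x. L x \<bullet> M x)"
proof -
  have "Ck n S (\<lambda>x. \<Sum>b\<in>Basis. (L x \<bullet> b) * (M x \<bullet> b))"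
    using assms by (intro Ck_sum Ck_mult Ck_bounded_linear bounded_linear_inner_left_comp) auto
  moreover have "(\<lambda>x. \<Sum>b\<in>Basis. (L x \<bullet> b) * (M x \<bullet> b)) = (\<lambda>x. L x \<bullet> M x)"
    by (intro ext) (rule euclidean_inner[symmetric])
  ultimately show ?thesis by simp
qed

lemma Ck_compose_real:
  assumes "open S" "open T" "f ` S \<subseteq> T" "Ck n S f" "Ck n T h"
  shows "Ck n S (\<lambda>x. h (f x))"
  using assms(4,5)
proof (induction n arbitrary: h)
  case 0
  then show ?case using continuous_on_compose2 assms(3) by auto
next
  case (Suc n)
  have f: "Ck n S f" using Suc.prems Ck_SucD by blast
  have der: "((\<lambda>x. h (f x)) has_derivative (\<lambda>v. dd h 1 (f x) * dd f v x)) (at x)" if "x \<in> S" for x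
  proof -
    have h: "(h has_derivative (\<lambda>v. dd h v (f x))) (at (f x))"
      using Suc.prems assms(3) that by (intro dd_works) (auto simp: Ck_Suc)
    have "(f has_derivative (\<lambda>v. dd f v x)) (at x)"
      using Suc.prems that by (intro dd_works) (auto simp: Ck_Suc)
    from has_derivative_compose[OF this, of h "\<lambda>v. dd h v (f x)"] h
    have "((\<lambda>x. h (f x)) has_derivative (\<lambda>v. dd h (dd f v x) (f x))) (at x)" .
    moreover have "dd h (dd f v x) (f x) = dd h 1 (f x) * dd f v x" for v
      using linear_scale[OF has_derivative_linear[OF h], of "dd f v x" 1] by (simp add: mult.commute)
    ultimately show ?thesis by (simp only:)
  qed
  show ?case
  proof (rule Ck_SucI[OF assms(1) der])
    show "Ck n S (\<lambda>x. dd h 1 (f x) * dd f v x)" for v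
      using Suc.IH[OF f, of "dd h 1"] Suc.prems assms(1) by (intro Ck_mult) (simp_all add: Ck_Suc)
  qed
qed

lemma Ck_compose_linear:
  assumes "open S" "open T" "bounded_linear L" "\<And>x. x \<in> S \<Longrightarrow> L x + c \<in> T" "Ck n T h"
  shows "Ck n S (\<lambda>x. h (L x + c))"
  using assms(5)
proof (induction n arbitrary: h)
  case 0
  then show ?case
    using assms(3,4) continuous_on_compose2[of T h S "\<lambda>x. L x + c"]
      continuous_on_add[OF linear_continuous_on[OF assms(3), of S] continuous_on_const[of S c]] by auto
next
  case (Suc n)
  have der: "((\<lambda>x. h (L x + c)) has_derivative (\<lambda>v. dd h (L v) (L x + c))) (at x)" if "x \<in> S" for x
  proof -
    have h: "(h has_derivative (\<lambda>v. dd h v (L x + c))) (at (L x + c))"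
      using Suc.prems assms(4) that by (intro dd_works) (auto simp: Ck_Suc)
    have "((\<lambda>x. L x + c) has_derivative L) (at x)"
      using has_derivative_add[OF bounded_linear_imp_has_derivative[OF assms(3)] has_derivative_const[of c]]
      by simp
    from has_derivative_compose[OF this, of h "\<lambda>v. dd h v (L x + c)"] h
    show ?thesis .
  qed
  show ?case
  proof (rule Ck_SucI[OF assms(1) der])
    show "Ck n S (\<lambda>x. dd h (L v) (L x + c))" for v
      using Suc.IH[of "dd h (L v)"] Suc.prems by (simp add: Ck_Suc)
  qed
qed

lemma Ck_inverse: "Ck n {0<..} (inverse :: real \<Rightarrow> real)"
proof (induction n)
  case (Suc n)
  have "Ck n {0<..} (\<lambda>x::real. - v * (inverse x * inverse x))" for v
    using Suc by (intro Ck_cmult Ck_mult) auto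
  then show ?case
    by (intro Ck_SucI[where f' = "\<lambda>v x. - v * (inverse x * inverse x)"])
      (auto intro!: derivative_eq_intros simp: )
qed (auto intro!: continuous_intros)

lemma dd_sum_axis:
  fixes f :: "real^'n \<Rightarrow> real"
  assumes "f differentiable (at x)"
  shows "dd f v x = (\<Sum>i\<in>UNIV. v$i * dd f (axis i 1) x)"
proof -
  have lin: "linear (\<lambda>v. dd f v x)"
    using has_derivative_linear[OF dd_works[OF assms]] .
  have "dd f v x = dd f (\<Sum>i\<in>UNIV. v$i *\<^sub>R axis i 1) x"
    using basis_expansion[of v] by (simp add: scalar_mult_eq_scaleR)
  also have "\<dots> = (\<Sum>i\<in>UNIV. v$i * dd f (axis i 1) x)"
    using linear_sum[OF lin, of "\<lambda>i. v$i *\<^sub>R axis i 1" UNIV] linear_scale[OF lin] by simp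
  finally show ?thesis .
qed

lemma grad_nth: "grad f x $ i = dd f (axis i 1) x"
  by (simp add: grad_def)

lemma dd_grad: "f differentiable (at x) \<Longrightarrow> dd f v x = grad f x \<bullet> v"
  by (simp add: dd_sum_axis inner_vec_def grad_nth mult.commute)

text \<open>Row i of the Jacobian of the gradient differentiates the i-th partial derivative, so the
  left factor \<open>v\<close> is the direction that is differentiated first. Symmetry comes only
  with \<open>hess_Sym\<close>.\<close>

lemma hess_mult:
  assumes "open X" "x \<in> X" "\<And>y. y \<in> X \<Longrightarrow> f differentiable (at y)" "grad f differentiable (at x)"
  shows "v \<bullet> (hess f x *v w) = dd (dd f v) w x"
proof -
  have g: "(grad f has_derivative (\<lambda>w. dd (grad f) w x)) (at x)"
    using dd_works[OF assms(4)] .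
  have "((\<lambda>y. v \<bullet> grad f y) has_derivative (\<lambda>w. v \<bullet> dd (grad f) w x)) (at x)"
    by (rule has_derivative_inner_right[OF g])
  then have "(dd f v has_derivative (\<lambda>w. v \<bullet> dd (grad f) w x)) (at x)"
    by (rule has_derivative_cong_open[OF assms(1,2), rotated])
      (use assms(3) in \<open>simp add: dd_grad inner_commute\<close>)
  then have "dd (dd f v) w x = v \<bullet> dd (grad f) w x" by (rule dd_eq)
  moreover have "hess f x *v w = dd (grad f) w x"
    unfolding hess_def jacobian_def
    using matrix_works[OF linear_matrix_vector_mul_eq[THEN iffD2, OF has_derivative_linear[OF g]]] by simp
  ultimately show ?thesis by simp
qed

lemma hess_axis: "hess f x $ i $ j = axis i 1 \<bullet> (hess f x *v axis j 1)"
  by (simp add: inner_axis' matrix_vector_mult_basis column_def)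

lemma C2_on_iff_Ck:
  fixes f :: "real^'n \<Rightarrow> real"
  assumes "open X"
  shows "C2_on X f \<longleftrightarrow> Ck 2 X f"
proof
  assume C2: "C2_on X f"
  then have f: "\<And>y. y \<in> X \<Longrightarrow> f differentiable (at y)" and g: "\<And>y. y \<in> X \<Longrightarrow> grad f differentiable (at y)"
    and h: "continuous_on X (hess f)" by (auto simp: C2_on_def)
  have c: "continuous_on X (dd (dd f v) w)" for v w
  proof -
    have "continuous_on X (\<lambda>x. v \<bullet> (hess f x *v w))"
      using h by (auto intro!: continuous_intros simp: matrix_vector_mult_def)
    then show ?thesis using hess_mult[OF assms _ f g] by (simp cong: continuous_on_cong)
  qed
  have "dd f v differentiable (at x)" if x: "x \<in> X" for v x
  proof -
    have "((\<lambda>y. grad f y \<bullet> v) has_derivative (\<lambda>w. dd (grad f) w x \<bullet> v)) (at x)"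
      by (rule has_derivative_inner_left[OF dd_works[OF g[OF x]]])
    then have "(dd f v has_derivative (\<lambda>w. dd (grad f) w x \<bullet> v)) (at x)"
      by (rule has_derivative_cong_open[OF assms x, rotated]) (simp add: dd_grad f)
    then show ?thesis unfolding differentiable_def by blast
  qed
  then show "Ck 2 X f" using f c by (simp add: numeral_2_eq_2 Ck_Suc)
next
  assume C: "Ck 2 X f"
  then have f: "\<And>y. y \<in> X \<Longrightarrow> f differentiable (at y)"
    and d: "\<And>y v. y \<in> X \<Longrightarrow> dd f v differentiable (at y)"
    and c: "\<And>v w. continuous_on X (dd (dd f v) w)" by (auto simp: numeral_2_eq_2 Ck_Suc)
  have g: "grad f differentiable (at y)" if "y \<in> X" for y
  proof -
    have "(\<lambda>x. grad f x \<bullet> b) differentiable (at y)" if "b \<in> Basis" for b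
    proof -
      from that obtain i where "b = axis i 1" by (auto simp: Basis_vec_def)
      then show ?thesis using d[OF \<open>y \<in> X\<close>, of b] by (simp add: inner_axis grad_nth)
    qed
    then show ?thesis using differentiable_componentwise_within[of "grad f" y UNIV] by blast
  qed
  have "continuous_on X (\<lambda>x. \<chi> i j. hess f x $ i $ j)"
  proof (intro continuous_on_vec_lambda)
    fix i j
    have "hess f x $ i $ j = dd (dd f (axis i 1)) (axis j 1) x" if "x \<in> X" for x
      using hess_mult[OF assms that f g[OF that]] hess_axis[of f x i j] by simp
    then show "continuous_on X (\<lambda>x. hess f x $ i $ j)"
      using c[of "axis i 1" "axis j 1"] by (simp cong: continuous_on_cong)
  qed
  then show "C2_on X f" using f g by (auto simp: C2_on_def)
qed

lemma hess_inner:
  fixes f :: "real^'n \<Rightarrow> real"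
  assumes "open X" "x \<in> X" "Ck 2 X f"
  shows "v \<bullet> (hess f x *v w) = dd (dd f v) w x"
  using assms C2_on_iff_Ck[OF assms(1), of f] by (intro hess_mult[OF assms(1)]) (auto simp: C2_on_def)

lemma hess_nth:
  fixes f :: "real^'n \<Rightarrow> real"
  assumes "open X" "x \<in> X" "Ck 2 X f"
  shows "hess f x $ i $ j = dd (dd f (axis i 1)) (axis j 1) x"
  using hess_inner[OF assms] hess_axis[of f x i j] by simp

section \<open>Second derivatives along lines: symmetry and maxima\<close>

lemma has_derivative_on_line:
  assumes "f differentiable (at (x + t *\<^sub>R v))"
  shows "((\<lambda>t. f (x + t *\<^sub>R v)) has_real_derivative dd f v (x + t *\<^sub>R v)) (at t)"
proof -
  have f: "(f has_derivative (\<lambda>v'. dd f v' (x + t *\<^sub>R v))) (at (x + t *\<^sub>R v))"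
    using dd_works[OF assms] .
  have "((\<lambda>t. x + t *\<^sub>R v) has_derivative (\<lambda>s. s *\<^sub>R v)) (at t)"
    by (auto intro!: derivative_eq_intros)
  from has_derivative_compose[OF this, of f "\<lambda>v'. dd f v' (x + t *\<^sub>R v)"] f
  have "((\<lambda>t. f (x + t *\<^sub>R v)) has_derivative (\<lambda>s. dd f (s *\<^sub>R v) (x + t *\<^sub>R v))) (at t)" .
  moreover have "dd f (s *\<^sub>R v) (x + t *\<^sub>R v) = dd f v (x + t *\<^sub>R v) * s" for s
    using linear_scale[OF has_derivative_linear[OF f], of s v] by (simp add: mult.commute)
  ultimately show ?thesis by (simp only: has_field_derivative_def)
qed

lemma Ck_2D:
  assumes "Ck 2 S f" "x \<in> S"
  shows "f differentiable (at x)" "dd f v differentiable (at x)"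
  using assms by (auto simp: numeral_2_eq_2 Ck_Suc)

lemma Ck_2_cont: "Ck 2 S f \<Longrightarrow> continuous_on S (dd (dd f v) w)"
  by (auto simp: numeral_2_eq_2 Ck_Suc)

text \<open>The second difference is the increment along \<open>u\<close> of t -> f (x + s v + t u)
  - f (x + t u). The mean value theorem there, and then along \<open>v\<close> for
  \<open>dd f u\<close>, turns it into a mixed derivative.\<close>

lemma second_difference_mvt:
  assumes C: "Ck 2 S f" and s: "s > 0"
    and S: "\<And>a b. 0 \<le> a \<Longrightarrow> a \<le> s \<Longrightarrow> 0 \<le> b \<Longrightarrow> b \<le> s \<Longrightarrow> x + a *\<^sub>R u + b *\<^sub>R v \<in> S"
  shows "\<exists>a b. 0 \<le> a \<and> a \<le> s \<and> 0 \<le> b \<and> b \<le> s \<and>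
    f (x + s *\<^sub>R u + s *\<^sub>R v) - f (x + s *\<^sub>R u) - f (x + s *\<^sub>R v) + f x
      = s * s * dd (dd f u) v (x + a *\<^sub>R u + b *\<^sub>R v)"
proof -
  let ?g = "\<lambda>a. f ((x + s *\<^sub>R v) + a *\<^sub>R u) - f (x + a *\<^sub>R u)"
  let ?g' = "\<lambda>a. dd f u ((x + s *\<^sub>R v) + a *\<^sub>R u) - dd f u (x + a *\<^sub>R u)"
  have "\<exists>a. 0 < a \<and> a < s \<and> ?g s - ?g 0 = (s - 0) * ?g' a"
  proof (rule MVT2[OF s])
    fix a assume "0 \<le> a" "a \<le> s"
    then have "(x + s *\<^sub>R v) + a *\<^sub>R u \<in> S" "x + a *\<^sub>R u \<in> S"
      using S[of a s] S[of a 0] s by (simp_all add: algebra_simps)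
    then show "(?g has_real_derivative ?g' a) (at a)"
      by (intro DERIV_diff has_derivative_on_line Ck_2D[OF C])
  qed
  then obtain a where a: "0 < a" "a < s" "?g s - ?g 0 = s * ?g' a" by auto
  let ?h = "\<lambda>b. dd f u ((x + a *\<^sub>R u) + b *\<^sub>R v)"
  have "\<exists>b. 0 < b \<and> b < s \<and> ?h s - ?h 0 = (s - 0) * dd (dd f u) v ((x + a *\<^sub>R u) + b *\<^sub>R v)"
  proof (rule MVT2[OF s])
    fix b assume "0 \<le> b" "b \<le> s"
    then show "(?h has_real_derivative dd (dd f u) v ((x + a *\<^sub>R u) + b *\<^sub>R v)) (at b)"
      using a S[of a b] by (intro has_derivative_on_line Ck_2D[OF C]) simp
  qed
  then obtain b where b: "0 < b" "b < s" "?h s - ?h 0 = s * dd (dd f u) v (x + a *\<^sub>R u + b *\<^sub>R v)" by auto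
  have "f (x + s *\<^sub>R u + s *\<^sub>R v) - f (x + s *\<^sub>R u) - f (x + s *\<^sub>R v) + f x = ?g s - ?g 0"
    by (simp add: algebra_simps)
  also have "\<dots> = s * (?h s - ?h 0)" using a(3) by (simp add: algebra_simps)
  finally show ?thesis using a b by (intro exI[of _ a] exI[of _ b]) simp
qed

text \<open>The second difference is symmetric in \<open>u\<close> and \<open>v\<close>, so the two
  mixed derivatives agree at two points close to \<open>x\<close>; continuity carries this to
  \<open>x\<close> itself. With \<open>e\<close> half of the gap, two errors below \<open>e\<close>
  cannot bridge it.\<close>

lemma dd_commute:
  fixes f :: "'a::euclidean_space \<Rightarrow> real"
  assumes S: "open S" "x \<in> S" and C: "Ck 2 S f"
  shows "dd (dd f u) v x = dd (dd f v) u x"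
proof (rule ccontr)
  let ?A = "dd (dd f u) v" and ?B = "dd (dd f v) u"
  assume ne: "?A x \<noteq> ?B x"
  define e where "e = \<bar>?A x - ?B x\<bar> / 2"
  have e: "e > 0" using ne by (simp add: e_def)
  have cont: "isCont ?A x" "isCont ?B x"
    using Ck_2_cont[OF C] S continuous_on_eq_continuous_at by blast+
  obtain d1 where d1: "d1 > 0" "\<And>y. dist y x < d1 \<Longrightarrow> dist (?A y) (?A x) < e"
    using cont(1) e unfolding continuous_at_eps_delta by blast
  obtain d2 where d2: "d2 > 0" "\<And>y. dist y x < d2 \<Longrightarrow> dist (?B y) (?B x) < e"
    using cont(2) e unfolding continuous_at_eps_delta by blast
  note d = d1(1) d2(1) d1(2) d2(2)
  obtain d3 where d3: "d3 > 0" "ball x d3 \<subseteq> S" using S open_contains_ball by blast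
  define d where "d = min d1 (min d2 d3)"
  have dpos: "d > 0" using d d3 by (simp add: d_def)
  \<comment> \<open>The summand 1 keeps \<open>k\<close> positive when both directions vanish;
    \<open>s\<close> then keeps the whole parallelogram within \<open>d / 2\<close> of
    \<open>x\<close>.\<close>
  define k where "k = norm u + norm v + 1"
  define s where "s = d / (2 * k)"
  have np: "k > 0" unfolding k_def using norm_ge_zero[of u] norm_ge_zero[of v] by linarith
  then have s: "s > 0" using dpos by (simp add: s_def)
  have near: "dist (x + a *\<^sub>R u + b *\<^sub>R v) x < d" if "0 \<le> a" "a \<le> s" "0 \<le> b" "b \<le> s" for a b
  proof -
    have "dist (x + a *\<^sub>R u + b *\<^sub>R v) x \<le> a * norm u + b * norm v"
      using norm_triangle_ineq[of "a *\<^sub>R u" "b *\<^sub>R v"] that by (simp add: dist_norm add.assoc)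
    also have "\<dots> \<le> s * k"
      using that mult_right_mono[of a s "norm u"] mult_right_mono[of b s "norm v"] s
      by (simp add: k_def algebra_simps)
    also have "\<dots> = d / 2" using np by (simp add: s_def)
    finally show ?thesis using dpos by linarith
  qed
  then have inS: "x + a *\<^sub>R u + b *\<^sub>R v \<in> S" if "0 \<le> a" "a \<le> s" "0 \<le> b" "b \<le> s" for a b
    using near[OF that] d3 by (auto simp: d_def dist_commute subset_iff)
  obtain a b where 1: "0 \<le> a" "a \<le> s" "0 \<le> b" "b \<le> s"
    "f (x + s *\<^sub>R u + s *\<^sub>R v) - f (x + s *\<^sub>R u) - f (x + s *\<^sub>R v) + f x
      = s * s * ?A (x + a *\<^sub>R u + b *\<^sub>R v)"
    using second_difference_mvt[OF C s inS] by blast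
  have inS': "x + a *\<^sub>R v + b *\<^sub>R u \<in> S" if "0 \<le> a" "a \<le> s" "0 \<le> b" "b \<le> s" for a b
    using inS[of b a] that by (simp add: algebra_simps)
  obtain a' b' where 2: "0 \<le> a'" "a' \<le> s" "0 \<le> b'" "b' \<le> s"
    "f (x + s *\<^sub>R v + s *\<^sub>R u) - f (x + s *\<^sub>R v) - f (x + s *\<^sub>R u) + f x
      = s * s * ?B (x + a' *\<^sub>R v + b' *\<^sub>R u)"
    using second_difference_mvt[OF C s inS'] by blast
  have "s * s * ?A (x + a *\<^sub>R u + b *\<^sub>R v) = s * s * ?B (x + a' *\<^sub>R v + b' *\<^sub>R u)"
    using 1(5) 2(5) by (simp add: algebra_simps)
  then have eq: "?A (x + a *\<^sub>R u + b *\<^sub>R v) = ?B (x + b' *\<^sub>R u + a' *\<^sub>R v)"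
    using s by (simp add: algebra_simps)
  have 3: "dist (?A (x + a *\<^sub>R u + b *\<^sub>R v)) (?A x) < e"
    using d near[OF 1(1-4)] by (simp add: d_def)
  have 4: "dist (?B (x + b' *\<^sub>R u + a' *\<^sub>R v)) (?B x) < e"
    using d near[OF 2(3,4,1,2)] by (simp add: d_def)
  have "dist (?A x) (?B x) < e + e"
    using dist_triangle3[of "?A x" "?B x" "?B (x + b' *\<^sub>R u + a' *\<^sub>R v)"] 3 4 unfolding eq by linarith
  then show False by (simp add: e_def dist_real_def)
qed

lemma hess_Sym:
  fixes f :: "real^'n \<Rightarrow> real"
  assumes "open X" "x \<in> X" "Ck 2 X f"
  shows "hess f x \<in> Sym"
  using hess_nth[OF assms] dd_commute[OF assms]
  by (simp add: Sym_def transpose_def vec_eq_iff)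

text \<open>Along the line the first derivative vanishes at the maximum; were the second one
  positive, the first would be positive just to the right, and the mean value theorem would produce
  a larger value.\<close>

lemma second_derivative_max:
  fixes f :: "'a::euclidean_space \<Rightarrow> real"
  assumes S: "open S" "x \<in> S" and C: "Ck 2 S f" and e: "e > 0"
    and max: "\<And>y. dist y x < e \<Longrightarrow> f y \<le> f x"
  shows "dd (dd f v) v x \<le> 0"
proof (rule ccontr)
  assume "\<not> dd (dd f v) v x \<le> 0"
  then have pos: "dd (dd f v) v x > 0" by simp
  obtain d0 where d0: "d0 > 0" "ball x d0 \<subseteq> S" using S open_contains_ball by blast
  define d where "d = min e d0 / (norm v + 1)"
  have np: "norm v + 1 > 0" using norm_ge_zero[of v] by linarith
  have d: "d > 0" using e d0 np by (simp add: d_def)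
  have near: "dist (x + t *\<^sub>R v) x < min e d0" if "\<bar>t\<bar> < d" for t
  proof -
    have "dist (x + t *\<^sub>R v) x \<le> \<bar>t\<bar> * (norm v + 1)" by (simp add: dist_norm algebra_simps)
    also have "\<dots> < d * (norm v + 1)" using that np by simp
    finally show ?thesis using np by (simp add: d_def)
  qed
  have inS: "x + t *\<^sub>R v \<in> S" if "\<bar>t\<bar> < d" for t
    using near[OF that] d0 by (auto simp: dist_commute subset_iff)
  let ?p = "\<lambda>t. f (x + t *\<^sub>R v)" and ?p' = "\<lambda>t. dd f v (x + t *\<^sub>R v)"
  have p: "(?p has_real_derivative ?p' t) (at t)" if "\<bar>t\<bar> < d" for t
    by (intro has_derivative_on_line Ck_2D[OF C] inS that)
  have p': "(?p' has_real_derivative dd (dd f v) v x) (at 0)"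
    using has_derivative_on_line[OF Ck_2D(2)[OF C inS], of 0 v] d by simp
  have "?p' 0 = 0"
  proof (rule DERIV_local_max[OF p d])
    show "\<forall>y. \<bar>0 - y\<bar> < d \<longrightarrow> ?p y \<le> ?p 0" using max near by simp
  qed (use d in auto)
  moreover obtain c where c: "c > 0" "\<And>h. 0 < h \<Longrightarrow> h < c \<Longrightarrow> ?p' 0 < ?p' (0 + h)"
    using DERIV_pos_inc_right[OF p' pos] by blast
  define h where "h = min c d / 2"
  have h: "0 < h" "h < c" "h < d" using c d by (auto simp: h_def)
  obtain z where z: "0 < z" "z < h" "?p h - ?p 0 = (h - 0) * ?p' z"
    using MVT2[OF h(1), of ?p ?p'] p h by force
  ultimately have "?p' z > 0" using c(2)[of z] h by simp
  then have "?p h > ?p 0" using z h by (metis diff_gt_0_iff_gt diff_zero zero_less_mult_iff)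
  moreover have "?p h \<le> ?p 0" using max near[of h] h by simp
  ultimately show False by simp
qed

lemma dd2_add:
  fixes f g :: "'a::euclidean_space \<Rightarrow> real"
  assumes S: "open S" "x \<in> S" and C: "Ck 2 S f" "Ck 2 S g"
  shows "dd (dd (\<lambda>x. f x + g x) u) v x = dd (dd f u) v x + dd (dd g u) v x"
proof -
  have "dd (\<lambda>x. f x + g x) u y = dd f u y + dd g u y" if "y \<in> S" for y
    by (rule dd_eq[OF has_derivative_add]) (use that C in \<open>auto intro!: dd_works Ck_2D\<close>)
  then have "dd (dd (\<lambda>x. f x + g x) u) v x = dd (\<lambda>y. dd f u y + dd g u y) v x"
    by (intro dd_cong_open[OF S])
  also have "\<dots> = dd (dd f u) v x + dd (dd g u) v x"
    by (rule dd_eq[OF has_derivative_add]) (use S C in \<open>auto intro!: dd_works Ck_2D\<close>)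
  finally show ?thesis .
qed

lemma dd2_cmult:
  fixes f :: "'a::euclidean_space \<Rightarrow> real"
  assumes S: "open S" "x \<in> S" and C: "Ck 2 S f"
  shows "dd (dd (\<lambda>x. c * f x) u) v x = c * dd (dd f u) v x"
proof -
  have "dd (\<lambda>x. c * f x) u y = c * dd f u y" if "y \<in> S" for y
    by (rule dd_eq[OF has_derivative_mult_right]) (intro dd_works Ck_2D[OF C] that)
  then have "dd (dd (\<lambda>x. c * f x) u) v x = dd (\<lambda>y. c * dd f u y) v x"
    by (intro dd_cong_open[OF S])
  also have "\<dots> = c * dd (dd f u) v x"
    by (rule dd_eq[OF has_derivative_mult_right]) (intro dd_works Ck_2D[OF C] S)
  finally show ?thesis .
qed

definition quad :: "real^'n^'n \<Rightarrow> real^'n \<Rightarrow> real \<Rightarrow> real^'n \<Rightarrow> real" where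
  "quad N b d x = x \<bullet> (N *v x) + b \<bullet> x + d"

lemma Ck_quad: "open S \<Longrightarrow> Ck n S (quad N b d)"
  unfolding quad_def[abs_def]
  by (intro Ck_add Ck_inner Ck_const bounded_linear_ident bounded_linear_zero
      matrix_vector_mul_bounded_linear Ck_bounded_linear[of S "\<lambda>x. b \<bullet> x"] bounded_linear_inner_right)

lemma dd_quad:
  assumes "N \<in> Sym"
  shows "dd (quad N b d) v x = 2 * (v \<bullet> (N *v x)) + b \<bullet> v"
    and "dd (dd (quad N b d) v) w x = 2 * (v \<bullet> (N *v w))"
proof -
  have sym: "y \<bullet> (N *v z) = z \<bullet> (N *v y)" for y z
    using assms dot_lmul_matrix[of y N z] by (simp add: Sym_def inner_commute flip: matrix_vector_mul_assoc vector_transpose_matrix)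
  show 1: "dd (quad N b d) v x = 2 * (v \<bullet> (N *v x)) + b \<bullet> v" for v x
  proof (rule dd_eq[THEN trans])
    show "(quad N b d has_derivative (\<lambda>v. x \<bullet> (N *v v) + v \<bullet> (N *v x) + b \<bullet> v + 0)) (at x)"
      unfolding quad_def[abs_def]
      by (intro has_derivative_add has_derivative_inner has_derivative_ident has_derivative_const
          bounded_linear_imp_has_derivative matrix_vector_mul_bounded_linear bounded_linear_inner_right)
  qed (use sym in simp)
  have "dd (quad N b d) v = (\<lambda>x. 2 * (v \<bullet> (N *v x)) + b \<bullet> v)" using 1 by auto
  moreover have "dd (\<lambda>x. 2 * (v \<bullet> (N *v x)) + b \<bullet> v) w x = 2 * (v \<bullet> (N *v w))"
  proof (rule dd_eq[THEN trans])
    show "((\<lambda>x. 2 * (v \<bullet> (N *v x)) + b \<bullet> v) has_derivative (\<lambda>w. 2 * (v \<bullet> (N *v w)) + 0)) (at x)"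
      by (intro has_derivative_add has_derivative_mult_right has_derivative_inner_right has_derivative_const
          bounded_linear_imp_has_derivative matrix_vector_mul_bounded_linear)
  qed simp
  ultimately show "dd (dd (quad N b d) v) w x = 2 * (v \<bullet> (N *v w))" by simp
qed

section \<open>Functions of type P are convex\<close>

text \<open>A crude constant: it only serves to pass from closeness of matrices to closeness of
  their forms.\<close>

lemma quadratic_form_bound:
  fixes M :: "real^'n^'n"
  shows "\<bar>v \<bullet> (M *v v)\<bar> \<le> norm M * (real CARD('n))\<^sup>2 * (norm v)\<^sup>2"
proof -
  have e: "\<bar>v$i * (M$i$j * v$j)\<bar> \<le> norm M * (norm v)\<^sup>2" for i j
  proof -
    have "\<bar>M$i$j\<bar> \<le> norm M"
      using component_le_norm_cart[of "M$i" j] Finite_Cartesian_Product.norm_nth_le[of M i] by linarith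
    moreover have "\<bar>v$i\<bar> \<le> norm v" "\<bar>v$j\<bar> \<le> norm v" by (auto intro: component_le_norm_cart)
    ultimately have "\<bar>v$i\<bar> * (\<bar>M$i$j\<bar> * \<bar>v$j\<bar>) \<le> norm v * (norm M * norm v)"
      by (intro mult_mono) auto
    then show ?thesis by (simp add: abs_mult power2_eq_square mult_ac)
  qed
  have "v \<bullet> (M *v v) = (\<Sum>i\<in>UNIV. \<Sum>j\<in>UNIV. v$i * (M$i$j * v$j))"
    by (simp add: inner_vec_def matrix_vector_mult_def sum_distrib_left)
  also have "\<bar>\<dots>\<bar> \<le> (\<Sum>i\<in>(UNIV::'n set). \<Sum>j\<in>(UNIV::'n set). norm M * (norm v)\<^sup>2)"
    by (rule order_trans[OF sum_abs] sum_mono e)+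
  finally show ?thesis by (simp add: power2_eq_square mult_ac)
qed

lemma uminus_matrix_vector_mult: "(- A) *v x = - (A *v (x :: real^'n))"
  using matrix_vector_mult_diff_rdistrib[of 0 A x] by simp

text \<open>If -B were interior to \<open>PSD\<close>, then -B - s I would still be positive
  semidefinite for some s > 0, but its form at \<open>v\<close> is negative. With
  \<open>dual_PSD_D\<close>: the dual consists of the symmetric matrices that are nonnegative in
  some direction.\<close>

lemma dual_PSD_I:
  fixes B :: "real^'n^'n"
  assumes "B \<in> Sym" "v \<noteq> 0" "v \<bullet> (B *v v) \<ge> 0"
  shows "B \<in> dual PSD"
proof -
  have "- B \<notin> sym_interior PSD"
  proof
    assume "- B \<in> sym_interior PSD"
    then obtain e where e: "e > 0" "\<And>C. C \<in> Sym \<Longrightarrow> dist (- B) C < e \<Longrightarrow> C \<in> PSD"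
      by (auto simp: sym_interior_def)
    define k where "k = norm (mat 1 :: real^'n^'n) + 1"
    define s where "s = e / (2 * k)"
    have np: "k > 0" unfolding k_def using norm_ge_zero[of "mat 1 :: real^'n^'n"] by linarith
    then have s: "s > 0" using e by (simp add: s_def)
    let ?C = "- B - s *\<^sub>R mat 1"
    have "?C \<in> Sym" using assms(1)
      by (auto simp: Sym_def transpose_def vec_eq_iff mat_def)
    moreover have "dist (- B) ?C < e"
    proof -
      have "dist (- B) ?C = s * norm (mat 1 :: real^'n^'n)" using s by (simp add: dist_norm)
      also have "\<dots> \<le> s * k" using s by (simp add: k_def)
      also have "\<dots> < e" using np e by (simp add: s_def)
      finally show ?thesis .
    qed
    ultimately have "v \<bullet> (?C *v v) \<ge> 0" using e by (auto simp: PSD_def)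
    moreover have "v \<bullet> (?C *v v) = - (v \<bullet> (B *v v)) - s * (v \<bullet> v)"
      by (simp add: matrix_vector_mult_diff_rdistrib uminus_matrix_vector_mult scaleR_matrix_vector_assoc[symmetric] inner_diff_right)
    moreover have "s * (v \<bullet> v) > 0" using s assms by simp
    ultimately show False using assms(3) by linarith
  qed
  moreover have "- (- B) = B" by simp
  ultimately show ?thesis unfolding dual_def using assms(1) by (metis DiffI imageE minus_minus)
qed

text \<open>A form negative on all nonzero vectors has a negative maximum -m on the unit sphere, by
  compactness; by \<open>quadratic_form_bound\<close>, perturbations smaller than m / n^2 keep -B
  positive semidefinite, so -B would be interior.\<close>

lemma dual_PSD_D:
  fixes B :: "real^'n^'n"
  assumes "B \<in> dual PSD"
  shows "\<exists>v. v \<noteq> 0 \<and> v \<bullet> (B *v v) \<ge> 0"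
proof (rule ccontr)
  assume "\<not> ?thesis"
  then have neg: "\<And>v. v \<noteq> 0 \<Longrightarrow> v \<bullet> (B *v v) < 0" by force
  have sym: "B \<in> Sym" and ni: "- B \<notin> sym_interior PSD"
    using assms by (auto simp: dual_def image_iff)
  let ?S = "sphere (0::real^'n) 1"
  have "continuous_on ?S (\<lambda>v. v \<bullet> (B *v v))"
    by (intro continuous_intros linear_continuous_on matrix_vector_mul_bounded_linear)
  moreover have "axis undefined 1 \<in> ?S" by simp
  ultimately obtain w where w: "w \<in> ?S" "\<And>v. v \<in> ?S \<Longrightarrow> v \<bullet> (B *v v) \<le> w \<bullet> (B *v w)"
    using continuous_attains_sup[OF compact_sphere, of 0 1 "\<lambda>v. v \<bullet> (B *v v)"] by blast
  define m where "m = - (w \<bullet> (B *v w))"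
  have "w \<noteq> 0" using w(1) by auto
  then have m: "m > 0" using neg[of w] by (simp add: m_def)
  have mb: "v \<bullet> (B *v v) \<le> - m * (norm v)\<^sup>2" for v
  proof (cases "v = 0")
    case False
    let ?u = "(1 / norm v) *\<^sub>R v"
    have "?u \<in> ?S" using False by simp
    from w(2)[OF this] have "(1 / norm v) * ((1 / norm v) * (v \<bullet> (B *v v))) \<le> - m"
      by (simp add: m_def matrix_vector_mult_scaleR)
    then show ?thesis using False by (simp add: field_simps power2_eq_square)
  qed simp
  define e where "e = m / (real CARD('n))\<^sup>2"
  have e: "e > 0" using m by (simp add: e_def)
  have "C \<in> PSD" if C: "C \<in> Sym" "dist (- B) C < e" for C
  proof -
    have "v \<bullet> (C *v v) \<ge> 0" for v
    proof -
      have "norm (C + B) < e" using C(2) by (simp add: dist_norm norm_minus_commute)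
      then have "norm (C + B) * (real CARD('n))\<^sup>2 \<le> m"
        by (simp add: e_def pos_less_divide_eq)
      then have "norm (C + B) * (real CARD('n))\<^sup>2 * (norm v)\<^sup>2 \<le> m * (norm v)\<^sup>2"
        by (rule mult_right_mono) simp
      then have "\<bar>v \<bullet> ((C + B) *v v)\<bar> \<le> m * (norm v)\<^sup>2"
        using quadratic_form_bound[of v "C + B"] by linarith
      moreover have "v \<bullet> ((C + B) *v v) = v \<bullet> (C *v v) + v \<bullet> (B *v v)"
        by (simp add: matrix_vector_mult_add_rdistrib inner_add_right)
      ultimately show ?thesis using mb[of v] by linarith
    qed
    then show ?thesis using C by (simp add: PSD_def)
  qed
  moreover have "- B \<in> PSD"
  proof -
    have "v \<bullet> (B *v v) \<le> 0" for v using neg[of v] by (cases "v = 0") auto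
    moreover have "- B \<in> Sym" using sym by (auto simp: Sym_def transpose_def vec_eq_iff)
    ultimately show ?thesis by (simp add: PSD_def uminus_matrix_vector_mult)
  qed
  ultimately have "- B \<in> sym_interior PSD" unfolding sym_interior_def using e by blast
  then show False using ni by simp
qed

lemma continuous_usc: "continuous_on X u \<Longrightarrow> usc_on X u"
  unfolding usc_on_def
proof (intro ballI allI impI)
  fix x a assume c: "continuous_on X u" and x: "x \<in> X" "u x < a"
  then obtain e where "e > 0" "\<And>y. y \<in> X \<Longrightarrow> dist y x < e \<Longrightarrow> dist (u y) (u x) < a - u x"
    unfolding continuous_on_iff by (metis diff_gt_0_iff_gt)
  then show "\<exists>e>0. \<forall>y\<in>X. dist y x < e \<longrightarrow> u y < a"
    by (intro exI[of _ e]) (force simp: dist_real_def)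
qed

text \<open>Adding a small \<eta>|x|^2 makes the second derivative along \<open>v\<close> strictly
  positive, which is impossible at an interior maximum of w minus the affine function; so the
  maximum over \<open>K\<close> sits on the frontier.\<close>

lemma subaffine_C2:
  fixes w :: "real^'n \<Rightarrow> real"
  assumes X: "open X" and C: "Ck 2 X w"
    and pos: "\<And>x. x \<in> X \<Longrightarrow> \<exists>v. v \<noteq> 0 \<and> dd (dd w v) v x \<ge> 0"
  shows "subaffine X w"
  unfolding subaffine_def
proof (intro conjI allI impI ballI)
  show "usc_on X w" using Ck_continuous[OF C] by (rule continuous_usc)
  fix K b and d::real and x1
  assume K: "compact K \<and> K \<subseteq> X" and fr: "\<forall>x\<in>frontier K. w x \<le> b \<bullet> x + d" and x1: "x1 \<in> K"
  show "w x1 \<le> b \<bullet> x1 + d"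
  proof (rule ccontr)
    define h0 where "h0 = w x1 - (b \<bullet> x1 + d)"
    assume "\<not> w x1 \<le> b \<bullet> x1 + d"
    then have h0: "h0 > 0" by (simp add: h0_def)
    obtain R where R: "R > 0" "\<And>x. x \<in> K \<Longrightarrow> norm x \<le> R"
      using K compact_imp_bounded bounded_pos by metis
    \<comment> \<open>So small that \<eta>|x|^2 is at most h0/2 on \<open>K\<close>: the boundary
      values cannot be lifted up to the supposed excess \<open>h0\<close>.\<close>
    define \<eta> where "\<eta> = h0 / (2 * R\<^sup>2)"
    have \<eta>: "\<eta> > 0" using h0 R by (simp add: \<eta>_def)
    let ?N = "\<eta> *\<^sub>R mat 1 :: real^'n^'n"
    have N: "?N \<in> Sym" by (auto simp: Sym_def transpose_def vec_eq_iff mat_def)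
    define h where "h = (\<lambda>x. w x + quad ?N (- b) (- d) x)"
    have h: "h x = w x - (b \<bullet> x + d) + \<eta> * (norm x)\<^sup>2" for x
      by (simp add: h_def quad_def scaleR_matrix_vector_assoc[symmetric] power2_norm_eq_inner)
    have hC: "Ck 2 X h" unfolding h_def by (intro Ck_add C Ck_quad X)
    have "continuous_on K h" using Ck_continuous[OF hC] K continuous_on_subset by blast
    then obtain z where z: "z \<in> K" "\<And>x. x \<in> K \<Longrightarrow> h x \<le> h z"
      using continuous_attains_sup[of K h] K x1 by blast
    have hz: "h z \<ge> h0" using z(2)[OF x1] \<eta> by (simp add: h h0_def) (smt (verit) zero_le_mult_iff zero_le_power2)
    have "z \<notin> frontier K"
    proof
      assume "z \<in> frontier K"
      then have "h z \<le> \<eta> * (norm z)\<^sup>2" using fr by (simp add: h)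
      also have "\<dots> \<le> \<eta> * R\<^sup>2" using R(2)[OF z(1)] \<eta> by (intro mult_left_mono power_mono) auto
      also have "\<dots> = h0 / 2" using R by (simp add: \<eta>_def)
      finally show False using hz h0 by linarith
    qed
    then have "z \<in> interior K" using z(1) closure_subset by (auto simp: frontier_def)
    then obtain e where e: "e > 0" "ball z e \<subseteq> K" by (meson mem_interior)
    have zX: "z \<in> X" using z K by auto
    obtain v where v: "v \<noteq> 0" "dd (dd w v) v z \<ge> 0" using pos[OF zX] by blast
    have "dd (dd h v) v z \<le> 0"
      by (rule second_derivative_max[OF X zX hC e(1)]) (use e z in \<open>auto simp: dist_commute subset_iff\<close>)
    moreover have "dd (dd h v) v z = dd (dd w v) v z + 2 * (v \<bullet> (?N *v v))"
      unfolding h_def using dd2_add[OF X zX C Ck_quad[OF X]] dd_quad(2)[OF N] by simp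
    moreover have "v \<bullet> (?N *v v) > 0" using v \<eta> by (simp add: scaleR_matrix_vector_assoc[symmetric])
    ultimately show False using v(2) by linarith
  qed
qed

text \<open>A test function for \<open>PSD\<close> has at each point a direction of nonnegative
  second derivative; adding that of \<open>f\<close> keeps the sign, so \<open>subaffine_C2\<close>
  applies.\<close>

lemma C2_PSD_Pfun:
  fixes f :: "real^'n \<Rightarrow> real"
  assumes X: "open X" and C: "Ck 2 X f" and pos: "\<And>x v. x \<in> X \<Longrightarrow> dd (dd f v) v x \<ge> 0"
  shows "Pfun X f"
  unfolding Fsub_def
proof (intro conjI allI impI)
  show "usc_on X f" using Ck_continuous[OF C] by (rule continuous_usc)
  fix v assume v: "C2_on X v \<and> (\<forall>x\<in>X. hess v x \<in> dual PSD)"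
  then have vC: "Ck 2 X v" using C2_on_iff_Ck[OF X] by blast
  show "subaffine X (\<lambda>x. f x + v x)"
  proof (rule subaffine_C2[OF X Ck_add[OF X C vC]])
    fix x assume x: "x \<in> X"
    then obtain u where u: "u \<noteq> 0" "u \<bullet> (hess v x *v u) \<ge> 0" using v dual_PSD_D by blast
    then have "dd (dd (\<lambda>x. f x + v x) u) u x \<ge> 0"
      using dd2_add[OF X x C vC] pos[OF x] hess_inner[OF X x vC] by simp
    then show "\<exists>u. u \<noteq> 0 \<and> dd (dd (\<lambda>x. f x + v x) u) u x \<ge> 0" using u by blast
  qed
qed

lemma usc_bounded_above:
  assumes "usc_on X u" "compact K" "K \<subseteq> X"
  shows "\<exists>C. \<forall>x\<in>K. u x \<le> C"
proof (rule ccontr)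
  assume "\<not> ?thesis"
  then have "\<forall>k::nat. \<exists>x\<in>K. u x > real k" by (meson not_le)
  then obtain s where s: "\<And>k. s k \<in> K" "\<And>k. u (s k) > real k" by metis
  obtain l r where l: "l \<in> K" and r: "strict_mono (r::nat\<Rightarrow>nat)" "(s \<circ> r) \<longlonglongrightarrow> l"
    using assms(2) s(1) unfolding compact_def by blast
  obtain e where e: "e > 0" "\<And>y. y \<in> X \<Longrightarrow> dist y l < e \<Longrightarrow> u y < u l + 1"
    using assms(1,3) l unfolding usc_on_def by (metis less_add_one subsetD)
  obtain N where N: "\<And>k. k \<ge> N \<Longrightarrow> dist ((s \<circ> r) k) l < e"
    using r(2) e(1) unfolding lim_sequentially by blast
  obtain k where k: "real k > u l + 1" using reals_Archimedean2 by blast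
  define m where "m = max N k"
  have "u (s (r m)) < u l + 1" using e(2) N[of m] s(1) assms(3) by (auto simp: m_def)
  moreover have "r m \<ge> k" using seq_suble[OF r(1), of m] by (simp add: m_def)
  ultimately show False using s(2)[of "r m"] k by linarith
qed

lemma norm_diff_scaleR_power2:
  "(norm (y - r *\<^sub>R e))\<^sup>2 = y \<bullet> y - 2 * r * (y \<bullet> e) + r\<^sup>2 * (e \<bullet> e)"
  unfolding power2_norm_eq_inner
  by (simp add: inner_diff_left inner_diff_right inner_commute[of e y] power2_eq_square algebra_simps)

text \<open>The test function penalises the squared distance to the line through a and b, so subaffinity
  on a thin tube around the segment compares f with its chord.\<close>
lemma Pfun_convex_on_ball:
  fixes f :: "real^'n \<Rightarrow> real"
  assumes X: "open X" and P: "Pfun X f" and B: "ball x0 R \<subseteq> X"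
  shows "convex_on (ball x0 R) f"
proof (rule convex_onI)
  fix t a b assume t: "0 < t" "t < (1::real)" and ab: "a \<in> ball x0 R" "b \<in> ball x0 R"
  define m where "m = (1 - t) *\<^sub>R a + t *\<^sub>R b"
  show "f ((1 - t) *\<^sub>R a + t *\<^sub>R b) \<le> (1 - t) * f a + t * f b"
  proof (cases "a = b")
    case True
    then show ?thesis by (simp add: algebra_simps scaleR_add_left[symmetric])
  next
    case False
    define e where "e = b - a"
    define E where "E = e \<bullet> e"
    have E: "E > 0" using False by (simp add: E_def e_def)
    have usc: "usc_on X f" using P by (simp add: Fsub_def)
    \<comment> \<open>\<open>s\<close> is the parameter of the foot of the perpendicular on the line
      through \<open>a\<close> and \<open>b\<close>, \<open>l\<close> the chord of \<open>f\<close>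
      as a function of it, and \<tau> the squared distance to that line.\<close>
    define s where "s = (\<lambda>x. ((x - a) \<bullet> e) / E)"
    define l where "l = (\<lambda>x. f a + (f b - f a) * s x)"
    define \<tau> where "\<tau> = (\<lambda>x. (x - a) \<bullet> (x - a) - E * (s x)\<^sup>2)"
    have \<tau>: "\<tau> x = (norm (x - (a + s x *\<^sub>R e)))\<^sup>2" for x
    proof -
      have "(x - a) \<bullet> e = s x * E" using E by (simp add: s_def)
      then have "(norm ((x - a) - s x *\<^sub>R e))\<^sup>2 = (x - a) \<bullet> (x - a) - 2 * s x * (s x * E) + (s x)\<^sup>2 * E"
        by (simp add: norm_diff_scaleR_power2 E_def)
      then show ?thesis by (simp add: \<tau>_def power2_eq_square algebra_simps)
    qed
    have sm: "s m = t" using E by (simp add: s_def m_def e_def E_def algebra_simps) (simp add: field_simps)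
    have m_line: "a + s m *\<^sub>R e = m" unfolding sm by (simp add: m_def e_def algebra_simps)
    show ?thesis
    proof (rule ccontr)
      define \<eta> where "\<eta> = f m - l m"
      assume "\<not> ?thesis"
      then have "(1 - t) * f a + t * f b < f m" unfolding m_def by simp
      then have \<eta>: "\<eta> > 0" by (simp add: \<eta>_def l_def sm algebra_simps)
      have "a \<in> X" "b \<in> X" using ab B by auto
      then obtain ea eb where ea: "ea > 0" "\<And>y. y \<in> X \<Longrightarrow> dist y a < ea \<Longrightarrow> f y < f a + \<eta> / 2"
        and eb: "eb > 0" "\<And>y. y \<in> X \<Longrightarrow> dist y b < eb \<Longrightarrow> f y < f b + \<eta> / 2"
        using usc \<eta> unfolding usc_on_def by (metis half_gt_zero less_add_same_cancel1)
      define M0 where "M0 = max (dist x0 a) (dist x0 b)"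
      have M0: "M0 < R" using ab by (simp add: M0_def)
      \<comment> \<open>Half of the minimum, so that all inequalities are strict: the end faces stay
        in the neighbourhoods given by semicontinuity and the tube stays inside the ball.\<close>
      define \<rho> where "\<rho> = min (min ea eb) (R - M0) / 2"
      have \<rho>: "\<rho> > 0" "\<rho> < ea" "\<rho> < eb" "\<rho> < R - M0" using ea eb M0 by (auto simp: \<rho>_def)
      define K where "K = {x. \<tau> x \<le> \<rho>\<^sup>2} \<inter> {x. 0 \<le> s x} \<inter> {x. s x \<le> 1}"
      have cs: "continuous_on UNIV s" unfolding s_def using E by (intro continuous_intros) auto
      have c\<tau>: "continuous_on UNIV \<tau>" unfolding \<tau>_def by (intro continuous_intros cs)
      have Kb: "K \<subseteq> ball x0 R"
      proof
        fix x assume "x \<in> K"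
        then have x: "\<tau> x \<le> \<rho>\<^sup>2" "0 \<le> s x" "s x \<le> 1" by (auto simp: K_def)
        have "norm (x - (a + s x *\<^sub>R e)) \<le> \<rho>"
          using x(1) \<rho>(1) unfolding \<tau> by (simp add: power2_le_iff_abs_le)
        moreover have "dist x0 (a + s x *\<^sub>R e) \<le> M0"
        proof -
          have "a + s x *\<^sub>R e = (1 - s x) *\<^sub>R a + s x *\<^sub>R b" by (simp add: e_def algebra_simps)
          moreover have "(1 - s x) *\<^sub>R a + s x *\<^sub>R b \<in> cball x0 M0"
            using x by (intro convexD[OF convex_cball]) (auto simp: M0_def)
          ultimately show ?thesis by simp
        qed
        ultimately have "dist x0 x < R"
          using dist_triangle[of x0 x "a + s x *\<^sub>R e"] \<rho>(4) by (simp add: dist_norm norm_minus_commute)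
        then show "x \<in> ball x0 R" by simp
      qed
      have clK: "closed K" unfolding K_def
        by (intro closed_Int closed_Collect_le cs c\<tau> continuous_intros)
      then have Kc: "compact K" using Kb bounded_ball bounded_subset compact_eq_bounded_closed by blast
      obtain C where C: "\<And>x. x \<in> K \<Longrightarrow> f x \<le> C"
        using usc_bounded_above[OF usc Kc] Kb B by blast
      define D where "D = \<bar>f a\<bar> + \<bar>f b - f a\<bar>"
      \<comment> \<open>On the lateral side \<tau> = \<rho>^2, and this slope makes the penalty
        there outweigh both the bound \<open>C\<close> of \<open>f\<close> and the bound
        \<open>D\<close> of the chord.\<close>
      define M where "M = (\<bar>C\<bar> + D) / \<rho>\<^sup>2"
      have M: "M \<ge> 0" "M * \<rho>\<^sup>2 = \<bar>C\<bar> + D" using \<rho> by (auto simp: M_def D_def)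
      define v where "v = (\<lambda>x. - M * \<tau> x - l x)"
      \<comment> \<open>The form of \<open>N\<close> is -M times the squared distance to the line
        spanned by \<open>e\<close>, hence zero on \<open>e\<close>: this null direction puts the
        Hessian of \<open>v\<close> in the dual of \<open>PSD\<close>.\<close>
      define N :: "real^'n^'n" where "N = (\<chi> i j. M * (e$i * e$j / E - (if i = j then 1 else 0)))"
      have NS: "N \<in> Sym" by (auto simp: N_def Sym_def transpose_def vec_eq_iff)
      have Nv: "y \<bullet> (N *v z) = M * ((y \<bullet> e) * (z \<bullet> e) / E - y \<bullet> z)" for y z
      proof -
        have "(N *v z) $ i = M * (e$i * (z \<bullet> e) / E - z $ i)" for i
          by (simp add: N_def matrix_vector_mult_def inner_vec_def algebra_simps sum_subtractf
              sum_distrib_left sum_divide_distrib if_distrib[of "\<lambda>q. q * _"] if_distrib[of "\<lambda>q. _ * q"] sum.delta cong: if_cong)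
        then have Nz: "N *v z = M *\<^sub>R (((z \<bullet> e) / E) *\<^sub>R e - z)"
          by (simp add: vec_eq_iff algebra_simps)
        show ?thesis unfolding Nz by (simp add: inner_diff_right algebra_simps)
      qed
      define b0 where "b0 = - ((f b - f a) / E) *\<^sub>R e - 2 *\<^sub>R (N *v a)"
      define d0 where "d0 = a \<bullet> (N *v a) - f a + (f b - f a) / E * (a \<bullet> e)"
      have vq: "v = quad N b0 d0"
      proof
        fix x
        have key: "M * (p * p / E - q) = - M * (q - E * (p / E)\<^sup>2)" for p q
          using E by (simp add: power2_eq_square field_simps)
        have "(x - a) \<bullet> (N *v (x - a)) = - M * \<tau> x"
          unfolding Nv \<tau>_def s_def by (rule key)
        moreover have "(x - a) \<bullet> (N *v (x - a)) = x \<bullet> (N *v x) - 2 * (x \<bullet> (N *v a)) + a \<bullet> (N *v a)"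
          by (simp add: Nv inner_diff_left inner_diff_right inner_commute algebra_simps add_divide_distrib diff_divide_distrib)
        moreover have "l x = f a + (f b - f a) / E * (x \<bullet> e) - (f b - f a) / E * (a \<bullet> e)"
          using E by (simp add: l_def s_def inner_diff_left algebra_simps diff_divide_distrib)
        ultimately show "v x = quad N b0 d0 x"
          by (simp add: v_def quad_def b0_def d0_def inner_diff_left inner_diff_right inner_commute algebra_simps)
      qed
      have hv: "hess v x \<in> dual PSD" for x
      proof (rule dual_PSD_I)
        have Cv: "Ck 2 UNIV v" unfolding vq by (rule Ck_quad) simp
        show "hess v x \<in> Sym" by (rule hess_Sym[OF open_UNIV _ Cv]) simp
        show "e \<noteq> 0" using E by (auto simp: E_def)
        have "e \<bullet> (hess v x *v e) = 2 * (e \<bullet> (N *v e))"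
          using hess_inner[OF open_UNIV _ Cv, of x e e] dd_quad(2)[OF NS] by (simp add: vq)
        then show "0 \<le> e \<bullet> (hess v x *v e)" using E by (simp add: Nv E_def[symmetric])
      qed
      have "C2_on X v" using C2_on_iff_Ck[OF X] Ck_quad[OF X] vq by blast
      then have sub: "subaffine X (\<lambda>x. f x + v x)" using P hv by (simp add: Fsub_def)
      \<comment> \<open>The affine function is the constant \<eta>/2: on the frontier of the tube f
        + v does not exceed it, while at \<open>m\<close> the sum equals \<eta>.\<close>
      have "f m + v m \<le> 0 \<bullet> m + \<eta> / 2"
      proof (rule sub[unfolded subaffine_def, THEN conjunct2, rule_format, of K])
        show "compact K \<and> K \<subseteq> X" using Kc Kb B by blast
        show "m \<in> K" using t \<rho> m_line by (simp add: K_def sm \<tau>)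
        fix x assume fx: "x \<in> frontier K"
        then have xK: "x \<in> K" using clK frontier_subset_closed by blast
        then have x: "\<tau> x \<le> \<rho>\<^sup>2" "0 \<le> s x" "s x \<le> 1" by (auto simp: K_def)
        have xX: "x \<in> X" using xK Kb B by auto
        have no: "x \<notin> interior K" using fx by (simp add: frontier_def)
        have ne: "\<tau> x \<ge> 0" by (simp add: \<tau>)
        then have M\<tau>: "M * \<tau> x \<ge> 0" using M by simp
        have nrm: "norm (x - (a + s x *\<^sub>R e)) \<le> \<rho>"
          using x(1) \<rho>(1) unfolding \<tau> by (simp add: power2_le_iff_abs_le)
        consider "\<tau> x = \<rho>\<^sup>2" | "s x = 0" | "s x = 1" | "\<tau> x < \<rho>\<^sup>2" "0 < s x" "s x < 1"
          using x by linarith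
        then show "f x + v x \<le> 0 \<bullet> x + \<eta> / 2"
        proof cases
          case 1
          have "\<bar>(f b - f a) * s x\<bar> \<le> \<bar>f b - f a\<bar> * 1"
            unfolding abs_mult using x by (intro mult_left_mono) auto
          then have "\<bar>l x\<bar> \<le> D"
            unfolding l_def D_def by (intro order_trans[OF abs_triangle_ineq]) simp
          moreover have "M * \<tau> x = \<bar>C\<bar> + D" using 1 M by simp
          ultimately show ?thesis using C[OF xK] \<eta> by (simp add: v_def)
        next
          case 2
          then have "dist x a < ea" using nrm \<rho> by (simp add: dist_norm)
          then show ?thesis using ea(2)[OF xX] M\<tau> 2 by (simp add: v_def l_def)
        next
          case 3
          then have "dist x b < eb" using nrm \<rho> by (simp add: dist_norm e_def)
          then show ?thesis using eb(2)[OF xX] M\<tau> 3 by (simp add: v_def l_def)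
        next
          case 4
          let ?U = "{x. \<tau> x < \<rho>\<^sup>2} \<inter> {x. 0 < s x} \<inter> {x. s x < 1}"
          have "open ?U" by (intro open_Int open_Collect_less cs c\<tau> continuous_intros)
          moreover have "?U \<subseteq> K" by (auto simp: K_def)
          ultimately have "?U \<subseteq> interior K" by (simp add: interior_maximal)
          then show ?thesis using 4 no by auto
        qed
      qed
      moreover have "v m = - l m" by (simp add: v_def \<tau> m_line)
      ultimately show False using \<eta> by (simp add: \<eta>_def)
    qed
  qed
qed simp

section \<open>Spectral decomposition and the sets Fc\<close>

lemma Sym_inner_commute: "A \<in> Sym \<Longrightarrow> x \<bullet> (A *v y) = y \<bullet> (A *v x)"
proof -
  assume "A \<in> Sym"
  then have "x v* A = A *v x" using transpose_matrix_vector[of A x] by (simp add: Sym_def)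
  then show ?thesis using dot_lmul_matrix[of x A y] by (simp add: inner_commute)
qed

text \<open>A maximiser \<open>w\<close> of the quadratic form on the unit sphere of
  \<open>V\<close> is an eigenvector: the residual u = A w - c w is orthogonal to \<open>w\<close>
  and, by invariance, in \<open>V\<close>; maximality along w + t u gives 2 t |u|^2 <= t^2 k for all
  t, which forces u = 0.\<close>

lemma symmetric_has_eigenvector:
  fixes A :: "real^'n^'n"
  assumes A: "A \<in> Sym" and V: "subspace V" "V \<noteq> {0}" and inv: "\<And>v. v \<in> V \<Longrightarrow> A *v v \<in> V"
  shows "\<exists>w c. w \<in> V \<and> norm w = 1 \<and> A *v w = c *\<^sub>R w"
proof -
  let ?S = "sphere 0 1 \<inter> V"
  have "compact ?S" by (intro compact_Int_closed compact_sphere closed_subspace V)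
  moreover have "?S \<noteq> {}"
  proof -
    obtain v where v: "v \<in> V" "v \<noteq> 0" using V subspace_0 by blast
    then have "(1 / norm v) *\<^sub>R v \<in> ?S" using V(1) by (auto simp: subspace_scale)
    then show ?thesis by blast
  qed
  moreover have "continuous_on ?S (\<lambda>v. v \<bullet> (A *v v))"
    by (intro continuous_intros linear_continuous_on matrix_vector_mul_bounded_linear)
  ultimately obtain w where w: "w \<in> ?S" "\<And>v. v \<in> ?S \<Longrightarrow> v \<bullet> (A *v v) \<le> w \<bullet> (A *v w)"
    using continuous_attains_sup[of ?S "\<lambda>v. v \<bullet> (A *v v)"] by blast
  define c where "c = w \<bullet> (A *v w)"
  have wV: "w \<in> V" and ww: "w \<bullet> w = 1" using w(1) by (auto simp: norm_eq_1)
  have R: "v \<bullet> (A *v v) \<le> c * (v \<bullet> v)" if "v \<in> V" for v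
  proof (cases "v = 0")
    case False
    let ?u = "(1 / norm v) *\<^sub>R v"
    have "?u \<in> ?S" using False that V(1) by (auto simp: subspace_scale)
    from w(2)[OF this] have "(1 / norm v) * ((1 / norm v) * (v \<bullet> (A *v v))) \<le> c"
      by (simp add: c_def matrix_vector_mult_scaleR)
    then show ?thesis using False by (simp add: field_simps power2_norm_eq_inner[symmetric] power2_eq_square)
  qed simp
  define u where "u = A *v w - c *\<^sub>R w"
  have uV: "u \<in> V" unfolding u_def by (intro subspace_diff subspace_scale V inv wV)
  have wu: "w \<bullet> u = 0" by (simp add: u_def inner_diff_right ww c_def)
  have uAw: "u \<bullet> (A *v w) = u \<bullet> u"
  proof -
    have "A *v w = u + c *\<^sub>R w" by (simp add: u_def)
    then show ?thesis using wu by (simp add: inner_add_right inner_commute[of u w])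
  qed
  define k where "k = c * (u \<bullet> u) - u \<bullet> (A *v u)"
  have ineq: "2 * t * (u \<bullet> u) \<le> t * t * k" for t
  proof -
    have h1: "(w + t *\<^sub>R u) \<bullet> (A *v (w + t *\<^sub>R u)) \<le> c * ((w + t *\<^sub>R u) \<bullet> (w + t *\<^sub>R u))"
      by (intro R subspace_add subspace_scale V wV uV)
    have h2: "(w + t *\<^sub>R u) \<bullet> (A *v (w + t *\<^sub>R u)) = c + 2 * t * (u \<bullet> u) + t * t * (u \<bullet> (A *v u))"
      using Sym_inner_commute[OF A, of w u] uAw
      by (simp add: matrix_vector_right_distrib matrix_vector_mult_scaleR inner_add_left inner_add_right c_def distrib_left)
    have h3: "(w + t *\<^sub>R u) \<bullet> (w + t *\<^sub>R u) = 1 + t * t * (u \<bullet> u)"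
      using wu ww by (simp add: inner_add_left inner_add_right inner_commute[of u w])
    show ?thesis using h1 unfolding h2 h3 by (simp add: k_def distrib_left right_diff_distrib mult_ac)
  qed
  have "u = 0"
  proof (rule ccontr)
    assume "u \<noteq> 0"
    then have q: "u \<bullet> u > 0" by simp
    \<comment> \<open>Small enough that t k <= |u|^2; the summand 1 guards against k = 0.\<close>
    define t where "t = (u \<bullet> u) / (\<bar>k\<bar> + 1)"
    have t: "t > 0" using q by (simp add: t_def)
    have "t * (2 * (u \<bullet> u)) \<le> t * (t * k)" using ineq[of t] by (simp add: mult_ac)
    then have "2 * (u \<bullet> u) \<le> t * k" using t by simp
    also have "\<dots> \<le> t * (\<bar>k\<bar> + 1)" using t by (intro mult_left_mono) auto
    also have "\<dots> = u \<bullet> u" by (simp add: t_def)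
    finally show False using q by linarith
  qed
  then have "A *v w = c *\<^sub>R w" by (simp add: u_def)
  then show ?thesis using w(1) wV by auto
qed

text \<open>Induction on the dimension: the orthogonal complement of an eigenvector within
  \<open>V\<close> is again invariant, because \<open>A\<close> is symmetric.\<close>

lemma symmetric_eigenbasis_subspace:
  fixes A :: "real^'n^'n"
  assumes A: "A \<in> Sym"
  shows "subspace V \<Longrightarrow> (\<And>v. v \<in> V \<Longrightarrow> A *v v \<in> V) \<Longrightarrow>
    \<exists>B. B \<subseteq> V \<and> V \<subseteq> span B \<and> pairwise orthogonal B \<and> (\<forall>b\<in>B. norm b = 1 \<and> (\<exists>c. A *v b = c *\<^sub>R b))"
proof (induction "dim V" arbitrary: V rule: less_induct)
  case less
  show ?case
  proof (cases "V = {0}")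
    case True
    then show ?thesis by (intro exI[of _ "{}"]) auto
  next
    case False
    then obtain w c where w: "w \<in> V" "norm w = 1" "A *v w = c *\<^sub>R w"
      using symmetric_has_eigenvector[OF A less.prems(1) False less.prems(2)] by blast
    define W where "W = {v \<in> V. w \<bullet> v = 0}"
    have W: "subspace W" using less.prems(1)
      by (auto simp: W_def subspace_def inner_add_right)
    have ww: "w \<bullet> w = 1" using w(2) by (simp add: norm_eq_1)
    have "w \<notin> W" using ww by (simp add: W_def)
    moreover have "W \<subseteq> V" by (auto simp: W_def)
    ultimately have "W \<subset> V" using w(1) by blast
    then have "dim W < dim V"
      using W less.prems(1) by (intro dim_psubset) (simp add: span_eq_iff[THEN iffD2])
    moreover have "A *v v \<in> W" if "v \<in> W" for v
      using that less.prems(2) Sym_inner_commute[OF A, of w v] w(3) by (simp add: W_def inner_commute)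
    ultimately obtain B where B: "B \<subseteq> W" "W \<subseteq> span B" "pairwise orthogonal B"
      "\<And>b. b \<in> B \<Longrightarrow> norm b = 1 \<and> (\<exists>c. A *v b = c *\<^sub>R b)"
      using less.hyps[OF _ W] by blast
    have "V \<subseteq> span (insert w B)"
    proof
      fix v assume v: "v \<in> V"
      have "v - (w \<bullet> v) *\<^sub>R w \<in> W"
        using v w(1) ww less.prems(1) by (simp add: W_def subspace_diff subspace_scale inner_diff_right)
      then have "v - (w \<bullet> v) *\<^sub>R w \<in> span B" using B(2) by blast
      then show "v \<in> span (insert w B)" by (auto simp: span_insert)
    qed
    moreover have "pairwise orthogonal (insert w B)"
      using B(1,3) by (auto simp: pairwise_insert orthogonal_def W_def inner_commute)
    moreover have "insert w B \<subseteq> V" using w B(1) by (auto simp: W_def)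
    ultimately show ?thesis using B(4) w by (intro exI[of _ "insert w B"]) auto
  qed
qed

lemma matrix_mult_axis: "A *v axis i 1 = column i (A :: real^'n^'m)"
  by (simp add: matrix_vector_mult_basis)

lemma symmetric_eigenbasis:
  fixes A :: "real^'n^'n"
  assumes A: "A \<in> Sym"
  obtains U l where "orthogonal_matrix U" "\<And>i. A *v column i U = l i *\<^sub>R column i U"
proof -
  obtain B where B: "(UNIV :: (real^'n) set) \<subseteq> span B" "pairwise orthogonal B"
      "\<And>b. b \<in> B \<Longrightarrow> norm b = 1 \<and> (\<exists>c. A *v b = c *\<^sub>R b)"
    using symmetric_eigenbasis_subspace[OF A subspace_UNIV] by auto
  have ind: "independent B"
    using B(2) B(3)[of 0] by (intro pairwise_orthogonal_independent) auto
  have fin: "finite B" using ind independent_imp_finite by blast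
  have "dim (UNIV :: (real^'n) set) = card B"
    using ind B(1) basis_card_eq_dim[of B UNIV] by auto
  then have "card B = CARD('n)" by simp
  then obtain f :: "'n \<Rightarrow> real^'n" where f: "bij_betw f UNIV B"
    using finite_same_card_bij[of "UNIV :: 'n set" B] fin by auto
  define U :: "real^'n^'n" where "U = (\<chi> i j. f j $ i)"
  have col: "column j U = f j" for j by (simp add: U_def column_def vec_eq_iff)
  have fB: "f j \<in> B" for j using f by (auto simp: bij_betw_def)
  have "orthogonal_matrix U"
    unfolding orthogonal_matrix_orthonormal_columns col
  proof (intro conjI allI impI)
    show "norm (f i) = 1" for i using B(3)[OF fB] by blast
    fix i j :: 'n assume "i \<noteq> j"
    then have "f i \<noteq> f j" using f by (auto simp: bij_betw_def inj_on_def)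
    then show "orthogonal (f i) (f j)" using pairwiseD[OF B(2) fB fB] by blast
  qed
  moreover obtain l where "\<And>i. A *v f i = l i *\<^sub>R f i" using B(3)[OF fB] by metis
  ultimately show ?thesis using that col by metis
qed

lemma spectral_decomposition:
  fixes A :: "real^'n^'n"
  assumes U: "orthogonal_matrix U" and e: "\<And>i. A *v column i U = l i *\<^sub>R column i U"
  shows "A = U ** diagm l ** transpose U"
proof -
  have "A ** U = U ** diagm l"
  proof -
    have "(A ** U) $ i $ j = (U ** diagm l) $ i $ j" for i j
    proof -
      have "(A ** U) $ i $ j = (A *v column j U) $ i"
        by (simp add: matrix_matrix_mult_def matrix_vector_mult_def column_def)
      also have "\<dots> = l j * U $ i $ j" unfolding e by (simp add: column_def)
      also have "\<dots> = (U ** diagm l) $ i $ j"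
        by (simp add: matrix_matrix_mult_def diagm_def if_distrib[of "\<lambda>x. _ * x"] cong: if_cong)
      finally show ?thesis .
    qed
    then show ?thesis by (simp add: vec_eq_iff)
  qed
  then have "(A ** U) ** transpose U = U ** diagm l ** transpose U" by simp
  then show ?thesis using U by (simp add: orthogonal_matrix_def flip: matrix_mul_assoc)
qed

lemma diagm_column: "(diagm l :: real^'n^'n) *v axis i 1 = l i *\<^sub>R axis i 1"
  by (auto simp: vec_eq_iff matrix_vector_mult_def diagm_def axis_def if_distrib[of "\<lambda>y. y * _"] cong: if_cong)

lemma spectral_eigenvector:
  fixes A :: "real^'n^'n"
  assumes U: "orthogonal_matrix U" and A: "A = U ** diagm l ** transpose U"
  shows "A *v column i U = l i *\<^sub>R column i U"
proof -
  have "transpose U *v column i U = axis i 1"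
  proof -
    have "transpose U *v column i U = (transpose U ** U) *v axis i 1"
      by (simp add: matrix_mult_axis[symmetric] matrix_vector_mul_assoc)
    then show ?thesis using U by (simp add: orthogonal_matrix_def)
  qed
  then have "A *v column i U = U *v (diagm l *v axis i 1)"
    by (simp add: A flip: matrix_vector_mul_assoc)
  then show ?thesis unfolding diagm_column by (simp add: matrix_vector_mult_scaleR matrix_mult_axis)
qed

lemma orthogonal_matrix_columns:
  assumes "orthogonal_matrix (U :: real^'n^'n)"
  shows "column i U \<bullet> column j U = (if i = j then 1 else 0)"
  using assms unfolding orthogonal_matrix_orthonormal_columns by (auto simp: orthogonal_def norm_eq_1)

lemma orthogonal_matrix_parseval:
  assumes U: "orthogonal_matrix (U :: real^'n^'n)"
  shows "(\<Sum>i\<in>UNIV. (column i U \<bullet> x)\<^sup>2) = x \<bullet> x"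
proof -
  have "(transpose U *v x) $ i = column i U \<bullet> x" for i
    by (simp add: matrix_vector_mult_def transpose_def inner_vec_def column_def)
  then have "(\<Sum>i\<in>UNIV. (column i U \<bullet> x)\<^sup>2) = (transpose U *v x) \<bullet> (transpose U *v x)"
    by (simp add: inner_vec_def power2_eq_square)
  also have "\<dots> = x \<bullet> x"
    using U orthogonal_transformation_matrix[of "(*v) (transpose U)"]
    by (simp add: orthogonal_matrix_transpose orthogonal_transformation_def)
  finally show ?thesis .
qed

lemma spectral_quadratic_form:
  fixes A :: "real^'n^'n"
  assumes U: "orthogonal_matrix U" and A: "A = U ** diagm l ** transpose U"
  shows "x \<bullet> (A *v x) = (\<Sum>i\<in>UNIV. l i * (column i U \<bullet> x)\<^sup>2)"
proof -
  have c: "(transpose U *v x) $ i = column i U \<bullet> x" for i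
    by (simp add: matrix_vector_mult_def transpose_def inner_vec_def column_def)
  have d: "y \<bullet> (diagm l *v y) = (\<Sum>i\<in>UNIV. l i * (y $ i)\<^sup>2)" for y
    by (simp add: inner_vec_def matrix_vector_mult_def diagm_def power2_eq_square
        if_distrib[of "\<lambda>z. z * _"] cong: if_cong) (simp add: mult_ac)
  have "x \<bullet> (A *v x) = x \<bullet> (U *v (diagm l *v (transpose U *v x)))"
    by (simp add: A flip: matrix_vector_mul_assoc)
  also have "\<dots> = (transpose U *v x) \<bullet> (diagm l *v (transpose U *v x))"
    using dot_lmul_matrix[of x U] transpose_matrix_vector[of U x] by simp
  also have "\<dots> = (\<Sum>i\<in>UNIV. l i * (column i U \<bullet> x)\<^sup>2)" unfolding d c ..
  finally show ?thesis .
qed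

lemma PSD_eigenvalues_nonneg:
  fixes A :: "real^'n^'n"
  assumes "A \<in> PSD" "orthogonal_matrix U" "A = U ** diagm l ** transpose U"
  shows "l i \<ge> 0"
proof -
  have "column i U \<bullet> (A *v column i U) \<ge> 0" using assms by (simp add: PSD_def)
  then show ?thesis
    using spectral_eigenvector[OF assms(2,3)] orthogonal_matrix_columns[OF assms(2), of i i] by simp
qed

text \<open>Stated over an arbitrary \<open>real_field\<close> so that one proof covers the complex
  z = i of the density and the real nodes z = m of the interpolation.\<close>

lemma det_id_plus_spectral:
  fixes z :: "'a::real_field" and A :: "real^'n^'n"
  assumes U: "orthogonal_matrix U" and A: "A = U ** diagm l ** transpose U"
  shows "det (\<chi> i j. (if i = j then 1 else 0) + z * of_real (A $ i $ j)) = (\<Prod>i\<in>UNIV. 1 + z * of_real (l i))"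
proof -
  define c :: "real^'n^'n \<Rightarrow> 'a^'n^'n" where "c = (\<lambda>M. \<chi> i j. of_real (M $ i $ j))"
  have cm: "c (M ** N) = c M ** c N" for M N
    by (simp add: c_def matrix_matrix_mult_def vec_eq_iff)
  have rdistrib: "(M + N) ** K = M ** K + N ** K" for M N K :: "'a^'n^'n"
    by (simp add: matrix_matrix_mult_def vec_eq_iff distrib_right sum.distrib)
  have c1: "c (mat 1) = mat 1" by (simp add: c_def mat_def vec_eq_iff)
  have UU: "c U ** c (transpose U) = mat 1"
    using U by (simp add: orthogonal_matrix_def c1 flip: cm)
  define D :: "'a^'n^'n" where "D = (\<chi> i j. if i = j then 1 + z * of_real (l i) else 0)"
  have D: "D = mat 1 + (\<chi> i j. z * c (diagm l) $ i $ j)"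
    by (simp add: D_def mat_def c_def diagm_def vec_eq_iff)
  have "(\<chi> i j. (if i = j then 1 else 0) + z * of_real (A $ i $ j)) = mat 1 + (\<chi> i j. z * c A $ i $ j)"
    by (simp add: mat_def c_def vec_eq_iff)
  also have "\<dots> = c U ** D ** c (transpose U)"
  proof -
    have "c U ** (\<chi> i j. z * c (diagm l) $ i $ j) ** c (transpose U) = (\<chi> i j. z * c A $ i $ j)"
      unfolding A cm by (simp add: matrix_matrix_mult_def vec_eq_iff sum_distrib_left sum_distrib_right mult_ac)
    then show ?thesis
      unfolding D by (simp add: matrix_add_ldistrib rdistrib UU)
  qed
  finally have "det (\<chi> i j. (if i = j then 1 else 0) + z * of_real (A $ i $ j)) = det D * (det (c U) * det (c (transpose U)))"
    by (simp add: det_mul)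
  also have "det (c U) * det (c (transpose U)) = 1" using UU by (simp flip: det_mul)
  also have "det D = (\<Prod>i\<in>UNIV. 1 + z * of_real (l i))"
    by (subst det_diagonal) (auto simp: D_def)
  finally show ?thesis by simp
qed

text \<open>The coefficients depend on \<open>n\<close> and \<open>z\<close> only, not on
  \<open>p\<close>; this uniformity is what the application needs. The n + 1 nodes 0, ..., n
  determine a polynomial of degree at most n.\<close>

lemma lagrange_interpolation:
  fixes z :: "'a::field_char_0"
  shows "\<exists>a. \<forall>p. degree p \<le> n \<longrightarrow> poly p z = (\<Sum>m\<le>n. a m * poly p (of_nat m))"
proof -
  define L :: "nat \<Rightarrow> 'a poly" where
    "L = (\<lambda>m. \<Prod>j\<in>{..n} - {m}. smult (1 / (of_nat m - of_nat j)) [:- of_nat j, 1:])"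
  have Lp: "poly (L m) (of_nat k) = (if k = m then 1 else 0)" if "k \<le> n" "m \<le> n" for k m
  proof (cases "k = m")
    case True
    then show ?thesis by (simp add: L_def poly_prod) (intro prod.neutral, auto simp: diff_divide_distrib[symmetric])
  next
    case False
    then have "(\<Prod>j\<in>{..n} - {m}. poly (smult (1 / (of_nat m - of_nat j)) [:- of_nat j, 1:]) (of_nat k)) = (0::'a)"
      using that by (intro prod_zero) (auto intro!: bexI[of _ k])
    then show ?thesis using False by (simp add: L_def poly_prod)
  qed
  have Ld: "degree (L m) \<le> n" if "m \<le> n" for m
  proof -
    have "degree (L m) \<le> sum (degree \<circ> (\<lambda>j. smult (1 / (of_nat m - of_nat j)) [:- of_nat j, 1::'a:])) ({..n} - {m})"
      unfolding L_def by (rule degree_prod_sum_le) simp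
    also have "\<dots> \<le> sum (\<lambda>_. 1) ({..n} - {m})" by (intro sum_mono) simp
    also have "\<dots> = n" using that by simp
    finally show ?thesis .
  qed
  have "poly p z = (\<Sum>m\<le>n. poly (L m) z * poly p (of_nat m))" if "degree p \<le> n" for p
  proof -
    have "p = (\<Sum>m\<le>n. smult (poly p (of_nat m)) (L m))"
    proof (rule poly_eqI_degree[where A = "of_nat ` {..n}"])
      fix x :: 'a assume "x \<in> of_nat ` {..n}"
      then show "poly p x = poly (\<Sum>m\<le>n. smult (poly p (of_nat m)) (L m)) x"
        by (auto simp: poly_sum Lp if_distrib[of "\<lambda>y. _ * y"] cong: if_cong)
    next
      have card: "card (of_nat ` {..n} :: 'a set) = Suc n" by (subst card_image) (auto simp: inj_on_def)
      show "card (of_nat ` {..n} :: 'a set) > degree p" using that card by simp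
      have "degree (\<Sum>m\<le>n. smult (poly p (of_nat m)) (L m)) \<le> n"
        by (intro degree_sum_le) (auto intro: order_trans[OF degree_smult_le] Ld)
      then show "card (of_nat ` {..n} :: 'a set) > degree (\<Sum>m\<le>n. smult (poly p (of_nat m)) (L m))" using card by simp
    qed
    then have "poly p z = poly (\<Sum>m\<le>n. smult (poly p (of_nat m)) (L m)) z" by simp
    then show ?thesis by (simp add: poly_sum mult_ac)
  qed
  then have "\<forall>p. degree p \<le> n \<longrightarrow> poly p z = (\<Sum>m\<le>n. poly (L m) z * poly p (of_nat m))" by simp
  then show ?thesis by (rule exI[of _ "\<lambda>m. poly (L m) z"])
qed

text \<open>For a fixed Hessian, det (I + z D^2 f) is a polynomial in z of degree at most n with
  real values at the nodes, so taking real parts affects the coefficients alone. These are the same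
  for all \<open>f\<close> and \<open>x\<close>.\<close>

lemma Cdens_interpolation:
  "\<exists>a. \<forall>(f :: real^'n \<Rightarrow> real) x. hess f x \<in> Sym \<longrightarrow>
     Cdens \<theta> f x = (\<Sum>m\<le>CARD('n). a m * det (mat 1 + real m *\<^sub>R hess f x))"
proof -
  let ?n = "CARD('n)"
  obtain a where a: "\<And>p::complex poly. degree p \<le> ?n \<Longrightarrow> poly p \<i> = (\<Sum>m\<le>?n. a m * poly p (of_nat m))"
    using lagrange_interpolation[of ?n \<i>] by blast
  have "Cdens \<theta> f x = (\<Sum>m\<le>?n. Re (exp (- \<i> * complex_of_real \<theta>) * a m) * det (mat 1 + real m *\<^sub>R hess f x))"
    if S: "hess f x \<in> Sym" for f :: "real^'n \<Rightarrow> real" and x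
  proof -
    obtain U l where U: "orthogonal_matrix U" "\<And>i. hess f x *v column i U = l i *\<^sub>R column i U"
      using symmetric_eigenbasis[OF S] by blast
    have A: "hess f x = U ** diagm l ** transpose U" using spectral_decomposition[OF U] .
    define p where "p = (\<Prod>i\<in>(UNIV::'n set). [:1, complex_of_real (l i):])"
    have pz: "poly p z = det (\<chi> i j. (if i = j then 1 else 0) + z * complex_of_real (hess f x $ i $ j))" for z
      unfolding det_id_plus_spectral[OF U(1) A] by (simp add: p_def poly_prod mult_ac)
    have pm: "poly p (of_nat m) = complex_of_real (det (mat 1 + real m *\<^sub>R hess f x))" for m
    proof -
      have "(\<chi> i j. (if i = j then 1 else 0) + real m * of_real (hess f x $ i $ j)) = mat 1 + real m *\<^sub>R hess f x"
        by (simp add: mat_def vec_eq_iff)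
      then have "det (mat 1 + real m *\<^sub>R hess f x) = (\<Prod>i\<in>UNIV. 1 + real m * l i)"
        using det_id_plus_spectral[OF U(1) A, of "real m"] by simp
      then show ?thesis by (simp add: p_def poly_prod mult_ac)
    qed
    have "degree p \<le> sum (degree \<circ> (\<lambda>i. [:1, complex_of_real (l i):])) (UNIV :: 'n set)"
      unfolding p_def by (rule degree_prod_sum_le) simp
    also have "\<dots> \<le> sum (\<lambda>_. 1) (UNIV :: 'n set)" by (intro sum_mono) simp
    finally have "degree p \<le> ?n" by simp
    from a[OF this] show ?thesis
      unfolding Cdens_def pz[symmetric] pm by (simp add: sum_distrib_left mult.assoc[symmetric])
  qed
  then show ?thesis by (intro exI[of _ "\<lambda>m. Re (exp (- \<i> * complex_of_real \<theta>) * a m)"]) blast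
qed

text \<open>Each factor 1 + i l is sqrt (1 + l^2) times the phase of angle arctan l, so the density
  is a positive multiple of cos (s - \<theta>) = sin (s - c), where s is the sum of the arctangents.
  Since s <= n pi/2 and c >= (n - 1) pi/2, the angle s - c lies between 0 and pi/2.\<close>

lemma Cdens_nonneg:
  fixes f :: "real^'n \<Rightarrow> real"
  assumes F: "hess f x \<in> Fc c" and c: "(real CARD('n) - 1) * pi / 2 \<le> c" "c = \<theta> - pi / 2 + 2 * pi * of_int k"
  shows "Cdens \<theta> f x \<ge> 0"
proof -
  obtain U l where U: "orthogonal_matrix U" "hess f x = U ** diagm l ** transpose U"
    and l: "(\<Sum>i\<in>UNIV. arctan (l i)) \<ge> c" using F by (auto simp: Fc_def)
  let ?s = "\<Sum>i\<in>UNIV. arctan (l i)"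
  have "?s \<le> (\<Sum>i\<in>(UNIV::'n set). pi / 2)" by (intro sum_mono) (rule less_imp_le[OF arctan_ubound])
  then have s: "?s - c \<le> pi / 2" using c(1) by (simp add: algebra_simps diff_divide_distrib)
  have f: "1 + \<i> * complex_of_real r = complex_of_real (sqrt (1 + r\<^sup>2)) * cis (arctan r)" for r
  proof -
    have "1 + r\<^sup>2 > 0" by (simp add: add_pos_nonneg)
    then show ?thesis by (simp add: complex_eq_iff cos_arctan sin_arctan)
  qed
  have p: "(\<Prod>i\<in>I. cis (g i)) = cis (\<Sum>i\<in>I. g i)" for I :: "'n set" and g
    by (induction I rule: infinite_finite_induct) (auto simp: cis_mult)
  have "Cdens \<theta> f x = Re (cis (- \<theta>) * (\<Prod>i\<in>UNIV. 1 + \<i> * complex_of_real (l i)))"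
    unfolding Cdens_def det_id_plus_spectral[OF U] by (simp add: cis_conv_exp)
  also have "\<dots> = Re (complex_of_real (\<Prod>i\<in>UNIV. sqrt (1 + (l i)\<^sup>2)) * cis (?s - \<theta>))"
  proof -
    have "cis (- \<theta>) * cis ?s = cis (?s - \<theta>)" by (simp add: cis_mult)
    then show ?thesis unfolding f prod.distrib p of_real_prod by (simp only: mult.left_commute[of "cis (- \<theta>)"])
  qed
  also have "\<dots> = (\<Prod>i\<in>UNIV. sqrt (1 + (l i)\<^sup>2)) * cos (?s - \<theta>)" by (simp del: of_real_prod)
  also have "cos (?s - \<theta>) = sin (?s - c)"
  proof -
    have "?s - \<theta> = ((?s - c) - pi / 2) + 2 * pi * of_int k" using c(2) by simp
    then have "cos (?s - \<theta>) = cos ((?s - c) - pi / 2)"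
      by (simp only: cos_add cos_int_2pin sin_int_2pin)
    then show ?thesis by (simp add: cos_diff)
  qed
  finally show ?thesis using s l by (auto intro!: mult_nonneg_nonneg prod_nonneg sin_ge_zero)
qed

text \<open>The other n - 1 arctangents add up to at most (n - 1) pi/2, hence to at most c, so this
  one must supply something nonnegative.\<close>

lemma Fc_eigenvalues_nonneg:
  fixes l :: "'n::finite \<Rightarrow> real"
  assumes "(\<Sum>i\<in>UNIV. arctan (l i)) \<ge> c" "(real CARD('n) - 1) * pi / 2 \<le> c"
  shows "l i \<ge> 0"
proof -
  have "(\<Sum>i\<in>UNIV. arctan (l i)) = arctan (l i) + (\<Sum>j\<in>UNIV - {i}. arctan (l j))"
    by (simp add: sum.remove)
  also have "(\<Sum>j\<in>UNIV - {i}. arctan (l j)) \<le> (\<Sum>j\<in>UNIV - {i}. pi / 2)"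
    by (intro sum_mono) (rule less_imp_le[OF arctan_ubound])
  also have "\<dots> = (real CARD('n) - 1) * pi / 2" by (simp add: of_nat_diff)
  finally have "arctan (l i) \<ge> 0" using assms by linarith
  then show ?thesis by simp
qed

lemma Fc_subset_PSD:
  assumes c: "(real CARD('n) - 1) * pi / 2 \<le> c"
  shows "(Fc c :: (real^'n^'n) set) \<subseteq> PSD"
proof
  fix A :: "real^'n^'n" assume A: "A \<in> Fc c"
  then obtain U l where U: "orthogonal_matrix U" "A = U ** diagm l ** transpose U"
    and l: "(\<Sum>i\<in>UNIV. arctan (l i)) \<ge> c" by (auto simp: Fc_def)
  have "x \<bullet> (A *v x) \<ge> 0" for x
    unfolding spectral_quadratic_form[OF U] by (intro sum_nonneg mult_nonneg_nonneg Fc_eigenvalues_nonneg[OF l c]) simp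
  then show "A \<in> PSD" using A by (simp add: PSD_def Fc_def)
qed

text \<open>Concavity on the nonnegative half-line, as a tangent bound. It fails in general for
  negative arguments, which is why nonnegative eigenvalues matter.\<close>

lemma arctan_tangent:
  assumes "0 \<le> a" "0 \<le> b"
  shows "arctan b \<le> arctan a + (b - a) / (1 + a\<^sup>2)"
proof -
  have d: "DERIV arctan x :> 1 / (1 + x\<^sup>2)" for x
    using DERIV_arctan[of x] by (simp add: divide_inverse)
  consider "a = b" | "a < b" | "b < a" by linarith
  then show ?thesis
  proof cases
    case 2
    obtain z where z: "a < z" "arctan b - arctan a = (b - a) * (1 / (1 + z\<^sup>2))"
      using MVT2[OF 2, of arctan "\<lambda>x. 1 / (1 + x\<^sup>2)"] d by blast
    have "1 / (1 + z\<^sup>2) \<le> 1 / (1 + a\<^sup>2)"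
      using z(1) assms by (intro divide_left_mono add_left_mono power_mono) (simp_all add: add_pos_nonneg)
    then have "(b - a) * (1 / (1 + z\<^sup>2)) \<le> (b - a) * (1 / (1 + a\<^sup>2))" using 2 by (intro mult_left_mono) auto
    then show ?thesis using z(2) by simp
  next
    case 3
    obtain z where z: "b < z" "z < a" "arctan a - arctan b = (a - b) * (1 / (1 + z\<^sup>2))"
      using MVT2[OF 3, of arctan "\<lambda>x. 1 / (1 + x\<^sup>2)"] d by blast
    have "1 / (1 + a\<^sup>2) \<le> 1 / (1 + z\<^sup>2)"
      using z assms by (intro divide_left_mono add_left_mono power_mono) (simp_all add: add_pos_nonneg)
    then have "(a - b) * (1 / (1 + a\<^sup>2)) \<le> (a - b) * (1 / (1 + z\<^sup>2))" using 3 by (intro mult_left_mono) auto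
    moreover have "(b - a) / (1 + a\<^sup>2) = - ((a - b) * (1 / (1 + a\<^sup>2)))"
      by (simp add: minus_divide_left)
    ultimately show ?thesis using z(3) by linarith
  qed simp
qed

text \<open>Concavity of tr arctan on the positive semidefinite matrices: A lies strictly outside a half-space
  that contains Fc c.\<close>
lemma Fc_separation:
  fixes A :: "real^'n^'n"
  assumes c: "(real CARD('n) - 1) * pi / 2 \<le> c" and A: "A \<in> PSD" "A \<notin> Fc c"
  obtains w :: "'n \<Rightarrow> real^'n" and \<beta> where "\<And>i. w i \<noteq> 0"
    "\<And>M. M \<in> Fc c \<Longrightarrow> (\<Sum>i\<in>UNIV. w i \<bullet> (M *v w i)) \<ge> \<beta>"
    "(\<Sum>i\<in>UNIV. w i \<bullet> (A *v w i)) < \<beta>"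
proof -
  have S: "A \<in> Sym" using A by (simp add: PSD_def)
  obtain U l where U0: "orthogonal_matrix U" "\<And>i. A *v column i U = l i *\<^sub>R column i U"
    using symmetric_eigenbasis[OF S] by blast
  have U: "orthogonal_matrix U" "A = U ** diagm l ** transpose U" using U0 spectral_decomposition[OF U0] by auto
  have l: "l i \<ge> 0" for i using PSD_eigenvalues_nonneg[OF A(1) U] .
  define s where "s = (\<Sum>i\<in>UNIV. arctan (l i))"
  have s: "s < c" using A(2) S U unfolding Fc_def s_def by force
  \<comment> \<open>Slopes of arctan at the eigenvalues of \<open>A\<close>, used as weights of the
    eigenvectors; \<beta> is the level at which the tangent bound for tr arctan reaches c.\<close>
  define b where "b = (\<lambda>i. 1 / (1 + (l i)\<^sup>2))"
  have b: "b i > 0" for i by (simp add: b_def add_pos_nonneg)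
  define w where "w = (\<lambda>i. sqrt (b i) *\<^sub>R column i U)"
  have wq: "w i \<bullet> (M *v w i) = b i * (column i U \<bullet> (M *v column i U))" for M i
    using b[of i] by (simp add: w_def matrix_vector_mult_scaleR mult.assoc[symmetric])
  define \<beta> where "\<beta> = (\<Sum>i\<in>UNIV. b i * l i) + (c - s)"
  have "w i \<noteq> 0" for i
    using b[of i] orthogonal_matrix_columns[OF U(1), of i i] by (auto simp: w_def)
  moreover have "(\<Sum>i\<in>UNIV. w i \<bullet> (A *v w i)) < \<beta>"
    using s orthogonal_matrix_columns[OF U(1)] by (simp add: wq U0(2) \<beta>_def)
  moreover have "(\<Sum>i\<in>UNIV. w i \<bullet> (M *v w i)) \<ge> \<beta>" if M: "M \<in> Fc c" for M
  proof -
    obtain V m where V: "orthogonal_matrix V" "M = V ** diagm m ** transpose V"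
      and m: "(\<Sum>i\<in>UNIV. arctan (m i)) \<ge> c" using M by (auto simp: Fc_def)
    have mn: "m j \<ge> 0" for j by (rule Fc_eigenvalues_nonneg[OF m c])
    \<comment> \<open>Squared products of two orthonormal bases form a doubly stochastic matrix; it
      couples the eigenvalues of \<open>M\<close> with those of \<open>A\<close>, so that the scalar
      tangent inequality can be averaged.\<close>
    define W where "W = (\<lambda>i j. (column j V \<bullet> column i U)\<^sup>2)"
    have W1: "(\<Sum>j\<in>UNIV. W i j) = 1" for i
      unfolding W_def orthogonal_matrix_parseval[OF V(1)] using orthogonal_matrix_columns[OF U(1), of i i] by simp
    have W2: "(\<Sum>i\<in>UNIV. W i j) = 1" for j
    proof -
      have "W i j = (column i U \<bullet> column j V)\<^sup>2" for i by (simp add: W_def inner_commute)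
      then show ?thesis
        using orthogonal_matrix_parseval[OF U(1), of "column j V"] orthogonal_matrix_columns[OF V(1), of j j] by simp
    qed
    have "(\<Sum>j\<in>UNIV. arctan (m j)) = (\<Sum>j\<in>UNIV. \<Sum>i\<in>UNIV. W i j * arctan (m j))"
      by (simp add: W2 flip: sum_distrib_right)
    also have "\<dots> \<le> (\<Sum>j\<in>UNIV. \<Sum>i\<in>UNIV. W i j * (arctan (l i) + b i * (m j - l i)))"
      using arctan_tangent[OF l mn] by (intro sum_mono mult_left_mono) (auto simp: b_def W_def)
    also have "\<dots> = (\<Sum>i\<in>UNIV. \<Sum>j\<in>UNIV. W i j * (arctan (l i) - b i * l i) + b i * (m j * W i j))"
      by (subst sum.swap) (simp add: algebra_simps)
    also have "\<dots> = (\<Sum>i\<in>UNIV. (arctan (l i) - b i * l i) + b i * (\<Sum>j\<in>UNIV. m j * W i j))"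
      by (simp add: sum.distrib W1 flip: sum_distrib_right sum_distrib_left)
    also have "\<dots> = s - (\<Sum>i\<in>UNIV. b i * l i) + (\<Sum>i\<in>UNIV. b i * (\<Sum>j\<in>UNIV. m j * W i j))"
      by (simp add: sum.distrib sum_subtractf s_def)
    also have "(\<Sum>i\<in>UNIV. b i * (\<Sum>j\<in>UNIV. m j * W i j)) = (\<Sum>i\<in>UNIV. w i \<bullet> (M *v w i))"
      by (simp only: wq spectral_quadratic_form[OF V, where x = "column i U" for i] W_def)
    finally show ?thesis using m by (simp add: \<beta>_def)
  qed
  ultimately show ?thesis using that by blast
qed

section \<open>Mollification\<close>

lemma DERIV_pos_part_power:
  "((\<lambda>s::real. (max 0 s) ^ Suc (Suc k)) has_real_derivative real (k + 2) * (max 0 s) ^ Suc k) (at s)"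
proof -
  consider "s > 0" | "s < 0" | "s = 0" by linarith
  then show ?thesis
  proof cases
    case 1
    have d: "((\<lambda>s::real. s ^ Suc (Suc k)) has_real_derivative real (k + 2) * (max 0 s) ^ Suc k) (at s)"
      using DERIV_pow[of "Suc (Suc k)" s] 1 by (simp add: max_def add.commute)
    show ?thesis
      by (rule has_field_derivative_transform_within_open[OF d, of "{0<..}"]) (use 1 in \<open>auto simp: max_def\<close>)
  next
    case 2
    have d: "((\<lambda>s::real. 0) has_real_derivative real (k + 2) * (max 0 s) ^ Suc k) (at s)"
      using 2 by (auto intro!: derivative_eq_intros simp: max_def)
    show ?thesis
      by (rule has_field_derivative_transform_within_open[OF d, of "{..<0}"]) (use 2 in \<open>auto simp: max_def\<close>)
  next
    case 3
    have "((\<lambda>h::real. ((max 0 (0 + h)) ^ Suc (Suc k) - (max 0 0) ^ Suc (Suc k)) / h) \<longlongrightarrow> 0) (at 0)"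
    proof (rule Lim_null_comparison)
      show "\<forall>\<^sub>F h in at (0::real). norm (((max 0 (0 + h)) ^ Suc (Suc k) - (max 0 0) ^ Suc (Suc k)) / h) \<le> \<bar>h\<bar> ^ Suc k"
      proof (intro always_eventually allI)
        fix h :: real
        consider "max 0 h = 0" | "max 0 h = h" "h > 0" by linarith
        then show "norm (((max 0 (0 + h)) ^ Suc (Suc k) - (max 0 0) ^ Suc (Suc k)) / h) \<le> \<bar>h\<bar> ^ Suc k"
        proof cases
          case 1
          then have "norm (((max 0 (0 + h)) ^ Suc (Suc k) - (max 0 0) ^ Suc (Suc k)) / h) = 0" by simp
          also have "0 \<le> \<bar>h\<bar> ^ Suc k" by (intro zero_le_power abs_ge_zero)
          finally show ?thesis .
        qed (simp add: abs_mult)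
      qed
      have "((\<lambda>h::real. \<bar>h\<bar> ^ Suc k) \<longlongrightarrow> \<bar>0\<bar> ^ Suc k) (at 0)" by (intro tendsto_intros)
      then show "((\<lambda>h::real. \<bar>h\<bar> ^ Suc k) \<longlongrightarrow> 0) (at 0)" by simp
    qed
    then show ?thesis using 3 by (simp add: DERIV_def)
  qed
qed

text \<open>The exponent exceeds the order by one: each differentiation lowers the power by one and
  the positive part itself is still continuous. Exponent 3, used in \<open>bump\<close> and
  \<open>cutoff\<close>, thus gives C2.\<close>

lemma Ck_pos_part_power: "Ck n UNIV (\<lambda>s::real. (max 0 s) ^ Suc n)"
proof (induction n)
  case 0
  then show ?case by (auto intro!: continuous_intros)
next
  case (Suc n)
  show ?case
  proof (rule Ck_SucI[where f' = "\<lambda>v s. (real (n + 2) * v) * (max 0 s) ^ Suc n"])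
    show "((\<lambda>s. max 0 s ^ Suc (Suc n)) has_derivative (\<lambda>v. real (n + 2) * v * max 0 x ^ Suc n)) (at x)" for x :: real
      by (rule has_derivative_eq_rhs[OF DERIV_pos_part_power[of n x, unfolded has_field_derivative_def]])
        (auto simp: fun_eq_iff)
  qed (auto intro!: Ck_cmult Suc simp del: power_Suc)
qed

text \<open>Smoothness is tested near each point separately, so auxiliary data such as an
  integration box may change with the point.\<close>

lemma Ck_local:
  assumes "\<And>x. x \<in> X \<Longrightarrow> \<exists>U. open U \<and> x \<in> U \<and> Ck n U f"
  shows "Ck n X f"
  using assms
proof (induction n arbitrary: f)
  case 0
  have "isCont f x" if "x \<in> X" for x
    using 0[OF that] continuous_on_eq_continuous_at by (auto simp: )
  then show ?case by (simp add: continuous_at_imp_continuous_on)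
next
  case (Suc n)
  show ?case unfolding Ck_Suc
  proof (intro conjI ballI allI)
    show "f differentiable (at x)" if "x \<in> X" for x using Suc.prems[OF that] by (auto simp: Ck_Suc)
    show "Ck n X (dd f v)" for v using Suc.prems by (intro Suc.IH) (fastforce simp: Ck_Suc)
  qed
qed

text \<open>A derivative in \<open>x\<close> falls on the kernel only, as its derivative in the
  direction \<open>(v, 0)\<close>. The integral keeps its shape, so continuity of \<open>f\<close>
  suffices and induction on the order applies.\<close>

lemma Ck_parametric_integral:
  fixes K :: "'a::euclidean_space \<times> 'a \<Rightarrow> real"
  assumes U: "open U" and f: "continuous_on UNIV f" and K: "Ck n (U \<times> UNIV) K"
  shows "Ck n U (\<lambda>x. integral (cbox a b) (\<lambda>z. K (x, z) * f z))"
  using K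
proof (induction n arbitrary: K)
  case 0
  have "continuous_on (U \<times> cbox a b) (\<lambda>p. K p * f (snd p))"
  proof (rule continuous_on_mult)
    show "continuous_on (U \<times> cbox a b) K" using 0 by (auto intro: continuous_on_subset)
    show "continuous_on (U \<times> cbox a b) (\<lambda>p. f (snd p))"
      by (rule continuous_on_compose2[OF f continuous_on_snd[OF continuous_on_id]]) auto
  qed
  then have "continuous_on (U \<times> cbox a b) (\<lambda>(x, z). K (x, z) * f z)" by (simp add: case_prod_beta)
  then show ?case by (simp add: integral_continuous_on_param)
next
  case (Suc n)
  let ?K' = "\<lambda>v. dd K (v, 0)"
  have KC: "Ck n (U \<times> UNIV) (?K' v)" for v using Suc.prems by (simp add: Ck_Suc)
  have Kc: "continuous_on (U \<times> UNIV) (?K' v)" for v using Ck_continuous[OF KC] .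
  have Kd: "(K has_derivative (\<lambda>v. dd K v p)) (at p)" if "p \<in> U \<times> UNIV" for p
    by (intro dd_works Ck_differentiable[OF Suc.prems that])
  \<comment> \<open>The Leibniz rule asks for the derivative as a bounded linear operator; it is
    assembled from its values on the basis.\<close>
  define D where "D = (\<lambda>x z. \<Sum>e\<in>Basis. (?K' e (x, z) * f z) *\<^sub>R blinfun_inner_right (e::'a))"
  have D: "blinfun_apply (D x z) v = ?K' v (x, z) * f z" if "x \<in> U" for x z v
  proof -
    have lin: "linear (\<lambda>v. ?K' v (x, z))"
      using has_derivative_linear[OF Kd[of "(x, z)"]] that
        linear_compose[of "\<lambda>v. (v, 0)" "\<lambda>v. dd K v (x, z)"]
      by (simp add: o_def linear_iff)
    have "?K' v (x, z) = (\<Sum>e\<in>Basis. (v \<bullet> e) * ?K' e (x, z))"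
      using linear_sum[OF lin, of "\<lambda>e. (v \<bullet> e) *\<^sub>R e" Basis] linear_scale[OF lin]
      by (simp add: euclidean_representation)
    then show ?thesis
      by (simp add: D_def blinfun.sum_left blinfun.scaleR_left inner_commute sum_distrib_left sum_distrib_right mult_ac)
  qed
  have Dc: "continuous_on (U \<times> UNIV) (\<lambda>(x, z). D x z)"
  proof -
    have "continuous_on (U \<times> UNIV) (\<lambda>p. \<Sum>e\<in>Basis. (?K' e p * f (snd p)) *\<^sub>R blinfun_inner_right (e::'a))"
      by (intro continuous_intros Kc continuous_on_compose2[OF f continuous_on_snd[OF continuous_on_id]]) auto
    then show ?thesis by (simp add: D_def case_prod_beta)
  qed
  show ?case
  proof (rule Ck_SucI[OF U])
    fix x assume x: "x \<in> U"
    obtain r where r: "r > 0" "ball x r \<subseteq> U" using U x open_contains_ball by blast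
    have int: "(\<lambda>z. K (y, z) * f z) integrable_on cbox a b" if "y \<in> U" for y
    proof -
      have "continuous_on UNIV (\<lambda>z. K (y, z) * f z)"
        using Ck_continuous[OF Suc.prems] that f
        by (intro continuous_intros) (auto intro!: continuous_on_compose2[of "U \<times> UNIV" K] continuous_intros)
      then show ?thesis by (intro integrable_continuous) (auto intro: continuous_on_subset)
    qed
    have "((\<lambda>x. integral (cbox a b) (\<lambda>z. K (x, z) * f z)) has_derivative integral (cbox a b) (D x)) (at x within ball x r)"
    proof (rule leibniz_rule)
      fix y z :: 'a assume y: "y \<in> ball x r"
      then have yU: "y \<in> U" using r by auto
      have "((\<lambda>y. (y, z)) has_derivative (\<lambda>v. (v, 0))) (at y)" by (auto intro!: derivative_eq_intros)
      from has_derivative_compose[OF this, of K "\<lambda>v. dd K v (y, z)"] Kd[of "(y, z)"] yU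
      have "((\<lambda>y. K (y, z)) has_derivative (\<lambda>v. ?K' v (y, z))) (at y)" by simp
      then have "((\<lambda>y. K (y, z) * f z) has_derivative (\<lambda>v. ?K' v (y, z) * f z)) (at y)"
        by (rule has_derivative_mult_left)
      moreover have "blinfun_apply (D y z) = (\<lambda>v. ?K' v (y, z) * f z)" using D[OF yU] by auto
      ultimately show "((\<lambda>y. K (y, z) * f z) has_derivative blinfun_apply (D y z)) (at y within ball x r)"
        by (simp add: has_derivative_at_withinI)
    qed (use r x int in \<open>auto intro!: continuous_on_subset[OF Dc]\<close>)
    then have der: "((\<lambda>x. integral (cbox a b) (\<lambda>z. K (x, z) * f z)) has_derivative integral (cbox a b) (D x)) (at x)"
      using r by (simp add: at_within_open[of x "ball x r"])
    have "continuous_on UNIV (D x)"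
    proof -
      have "continuous_on UNIV (\<lambda>z. (\<lambda>(x, z). D x z) (x, z))"
        by (rule continuous_on_compose2[OF Dc]) (use x in \<open>auto intro!: continuous_intros\<close>)
      then show ?thesis by simp
    qed
    then have Di: "D x integrable_on cbox a b"
      by (intro integrable_continuous) (auto intro: continuous_on_subset)
    have "blinfun_apply (integral (cbox a b) (D x)) = (\<lambda>v. integral (cbox a b) (\<lambda>z. ?K' v (x, z) * f z))"
    proof
      show "blinfun_apply (integral (cbox a b) (D x)) v = integral (cbox a b) (\<lambda>z. ?K' v (x, z) * f z)" for v
      using integral_linear[OF Di, of "\<lambda>B. blinfun_apply B v"] D[OF x]
      by (simp add: o_def blinfun.bounded_linear_left)
    qed
    then show "((\<lambda>x. integral (cbox a b) (\<lambda>z. K (x, z) * f z)) has_derivative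
        (\<lambda>v. integral (cbox a b) (\<lambda>z. ?K' v (x, z) * f z))) (at x)"
      using der by simp
  next
    show "Ck n U (\<lambda>x. integral (cbox a b) (\<lambda>z. ?K' v (x, z) * f z))" for v
      by (rule Suc.IH[OF KC])
  qed
qed

section \<open>Averages against a fixed bump and mollification\<close>

definition bump :: "'a::euclidean_space \<Rightarrow> real" where
  "bump y = (max 0 (1 - y \<bullet> y)) ^ 3"

text \<open>The box contains the unit ball, outside which \<open>bump\<close> vanishes; dividing by
  the mass of \<open>bump\<close> makes this a probability average over the ball.\<close>

definition avg :: "('a::euclidean_space \<Rightarrow> real) \<Rightarrow> real" where
  "avg h = integral (cbox (- One) One) (\<lambda>y. bump y * h y) / integral (cbox (- One) One) (bump :: 'a \<Rightarrow> real)"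

lemma bump_nonneg: "bump y \<ge> 0" by (simp add: bump_def)

lemma bump_zero: "norm y \<ge> 1 \<Longrightarrow> bump y = 0"
proof -
  assume "norm y \<ge> 1"
  then have "1 \<le> (norm y)\<^sup>2" by (simp add: one_le_power)
  then show ?thesis by (simp add: bump_def power2_norm_eq_inner)
qed

lemma continuous_bump: "continuous_on S bump"
  unfolding bump_def by (intro continuous_intros)

lemma bump_integral_pos: "integral (cbox (- One) One) (bump :: 'a::euclidean_space \<Rightarrow> real) > 0"
proof -
  have int: "(bump :: 'a \<Rightarrow> real) integrable_on cbox (- One) One"
    by (intro integrable_continuous continuous_bump)
  have "integral (cbox (- One) One) (bump :: 'a \<Rightarrow> real) \<noteq> 0"
  proof
    assume z: "integral (cbox (- One) One) (bump :: 'a \<Rightarrow> real) = 0"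
    have "bump (0::'a) = 0"
    proof (rule has_integral_0_cbox_imp_0[OF continuous_bump bump_nonneg])
      show "(bump has_integral 0) (cbox (- One) (One::'a))" using int z by (simp add: has_integral_integral)
      show "box (- One) (One::'a) \<noteq> {}" by (auto simp: box_ne_empty)
      show "(0::'a) \<in> cbox (- One) One" by (auto simp: mem_box)
    qed
    then show False by (simp add: bump_def)
  qed
  moreover have "integral (cbox (- One) One) (bump :: 'a \<Rightarrow> real) \<ge> 0"
    by (intro integral_nonneg int bump_nonneg)
  ultimately show ?thesis by simp
qed

text \<open>Composing with the projection onto the ball turns a function continuous only there into
  a globally continuous one with the same values on the ball, which can then be integrated over
  boxes.\<close>

lemma continuous_closest_extension:
  fixes h :: "'a::euclidean_space \<Rightarrow> real"
  assumes "continuous_on (cball c r) h" "r \<ge> 0"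
  shows "continuous_on UNIV (\<lambda>y. h (closest_point (cball c r) y))"
    and "\<And>y. y \<in> cball c r \<Longrightarrow> closest_point (cball c r) y = y"
    and "\<And>y. closest_point (cball c r) y \<in> cball c r"
proof -
  show *: "\<And>y. closest_point (cball c r) y \<in> cball c r"
    using assms(2) by (intro closest_point_in_set) auto
  show "continuous_on UNIV (\<lambda>y. h (closest_point (cball c r) y))"
    using assms * by (intro continuous_on_compose2[OF assms(1)] continuous_on_closest_point) auto
qed (simp add: closest_point_self)

lemma avg_integrable:
  assumes "continuous_on (cball 0 1) h"
  shows "(\<lambda>y. bump y * h y) integrable_on cbox (- One) One"
proof -
  have eq: "bump y * h y = bump y * h (closest_point (cball 0 1) y)" for y
  proof (cases "norm y \<le> 1")
    case True
    then show ?thesis using continuous_closest_extension(2)[OF assms] by simp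
  qed (simp add: bump_zero)
  show ?thesis
    unfolding eq using continuous_closest_extension(1)[OF assms]
    by (intro integrable_continuous continuous_intros continuous_bump) (auto intro: continuous_on_subset)
qed

lemma avg_add:
  assumes "continuous_on (cball 0 1) h" "continuous_on (cball 0 1) g"
  shows "avg (\<lambda>y. h y + g y) = avg h + avg g"
  using integral_add[OF avg_integrable avg_integrable, OF assms]
  by (simp add: avg_def distrib_left add_divide_distrib)

lemma avg_cmult: "avg (\<lambda>y. c * h y) = c * avg h"
  by (simp add: avg_def mult.left_commute[of _ c])

lemma avg_const: "avg (\<lambda>y :: 'a::euclidean_space. c) = c"
  using bump_integral_pos[where 'a='a] by (simp add: avg_def)

lemma avg_mono:
  assumes "continuous_on (cball 0 1) h" "continuous_on (cball 0 1) g" "\<And>y. norm y \<le> 1 \<Longrightarrow> h y \<le> g y"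
  shows "avg h \<le> avg g"
proof -
  have "bump y * h y \<le> bump y * g y" for y
    using assms(3)[of y] bump_nonneg[of y] bump_zero[of y] by (cases "norm y \<le> 1") (auto intro: mult_left_mono)
  then have "integral (cbox (- One) One) (\<lambda>y. bump y * h y) \<le> integral (cbox (- One) One) (\<lambda>y. bump y * g y)"
    by (intro integral_le avg_integrable assms(1,2)) auto
  then show ?thesis using bump_integral_pos[where 'a='a] by (simp add: avg_def divide_right_mono)
qed

definition moll :: "('a::euclidean_space \<Rightarrow> real) \<Rightarrow> real \<Rightarrow> 'a \<Rightarrow> real" where
  "moll f e x = avg (\<lambda>y. f (x + e *\<^sub>R y))"

lemma continuous_scaled:
  fixes f :: "'a::euclidean_space \<Rightarrow> real"
  assumes "continuous_on (cball x e) f" "e \<ge> 0"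
  shows "continuous_on (cball 0 1) (\<lambda>y. f (x + e *\<^sub>R y))"
proof (rule continuous_on_compose2[OF assms(1)])
  show "(\<lambda>y. x + e *\<^sub>R y) ` cball 0 1 \<subseteq> cball x e"
    using assms(2) by (auto simp: dist_norm mult_left_le)
qed (auto intro!: continuous_intros)

lemma moll_close:
  fixes f :: "'a::euclidean_space \<Rightarrow> real"
  assumes "continuous_on (cball x e) f" "e \<ge> 0" "\<And>z. z \<in> cball x e \<Longrightarrow> \<bar>f z - f x\<bar> \<le> \<eta>"
  shows "\<bar>moll f e x - f x\<bar> \<le> \<eta>"
proof -
  have z: "x + e *\<^sub>R y \<in> cball x e" if "norm y \<le> 1" for y
    using that assms(2) by (simp add: dist_norm mult_left_le)
  have "moll f e x \<le> avg (\<lambda>y::'a. f x + \<eta>)" unfolding moll_def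
    using assms(3)[OF z] by (intro avg_mono continuous_scaled assms(1,2)) (auto simp: abs_le_iff algebra_simps)
  moreover have "avg (\<lambda>y::'a. f x - \<eta>) \<le> moll f e x" unfolding moll_def
    using assms(3)[OF z] by (intro avg_mono continuous_scaled assms(1,2)) (auto simp: abs_le_iff algebra_simps)
  ultimately show ?thesis unfolding avg_const by (simp add: abs_le_iff)
qed

lemma has_integral_on_UNIV_iff:
  fixes f :: "'a::euclidean_space \<Rightarrow> real"
  assumes "\<And>x. x \<notin> S \<Longrightarrow> f x = 0"
  shows "(f has_integral i) S \<longleftrightarrow> (f has_integral i) UNIV"
proof -
  have "(\<lambda>x. if x \<in> S then f x else 0) = f" using assms by auto
  then show ?thesis using has_integral_restrict_UNIV[of S f i] by simp
qed

lemma has_integral_rescale: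
  fixes x :: "'a::euclidean_space" and f :: "'a \<Rightarrow> real"
  assumes e: "e > 0" and f: "(f has_integral I) (cbox (x - e *\<^sub>R One) (x + e *\<^sub>R One))"
  shows "((\<lambda>y. f (e *\<^sub>R y + x)) has_integral I /\<^sub>R e ^ DIM('a)) (cbox (- One) One)"
proof -
  have 1: "((\<lambda>y. f (e *\<^sub>R y + x)) has_integral I /\<^sub>R e ^ DIM('a))
      (cbox ((x - e *\<^sub>R One - x) /\<^sub>R e) ((x + e *\<^sub>R One - x) /\<^sub>R e))"
    using has_integral_affinity'[OF f e, of x] by assumption
  have 2: "(x - e *\<^sub>R u - x) /\<^sub>R e = - u" "(x + e *\<^sub>R u - x) /\<^sub>R e = u" for u
    using e by auto
  show ?thesis using 1 unfolding 2 .
qed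

text \<open>Substituting z = x + e y moves the dependence on centre and radius from \<open>f\<close>
  into the kernel, over a box that can stay fixed while they vary.\<close>

lemma moll_kernel:
  fixes f g :: "'a::euclidean_space \<Rightarrow> real"
  assumes e: "e > 0" and g: "continuous_on UNIV g" and fg: "\<And>z. z \<in> cball x e \<Longrightarrow> f z = g z"
    and C: "cball x e \<subseteq> cbox a b"
  shows "moll f e x = integral (cbox a b) (\<lambda>z. (max 0 (1 - (inverse e)\<^sup>2 * ((z - x) \<bullet> (z - x)))) ^ 3 * inverse e ^ DIM('a) * g z)
      / integral (cbox (- One) One) (bump :: 'a \<Rightarrow> real)"
proof -
  define G where "G = (\<lambda>z. bump (inverse e *\<^sub>R (z - x)) * g z)"
  have Gc: "continuous_on S G" for S unfolding G_def bump_def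
    by (intro continuous_intros continuous_on_subset[OF g]) auto
  have G0: "G z = 0" if "z \<notin> cball x e" for z
  proof -
    have "norm (inverse e *\<^sub>R (z - x)) = norm (z - x) / e" using e by (simp add: divide_inverse)
    then have "norm (inverse e *\<^sub>R (z - x)) \<ge> 1" using that e by (simp add: dist_norm norm_minus_commute)
    then show ?thesis by (simp add: G_def bump_zero)
  qed
  let ?I = "integral (cbox a b) G"
  have "(G has_integral ?I) (cbox a b)" by (intro integrable_integral integrable_continuous Gc)
  then have GU: "(G has_integral ?I) UNIV"
    by (rule has_integral_on_UNIV_iff[THEN iffD1, rotated]) (use G0 C in blast)
  have sub: "cball x e \<subseteq> cbox (x - e *\<^sub>R One) (x + e *\<^sub>R One)"
    proof
      fix z assume z: "z \<in> cball x e"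
      have "\<bar>(z - x) \<bullet> i\<bar> \<le> e" if "i \<in> Basis" for i
        using z Basis_le_norm[OF that, of "z - x"] by (simp add: dist_norm norm_minus_commute)
      then show "z \<in> cbox (x - e *\<^sub>R One) (x + e *\<^sub>R One)"
        by (fastforce simp: mem_box inner_diff_left inner_add_left abs_le_iff)
    qed
  have B: "(G has_integral ?I) (cbox (x - e *\<^sub>R One) (x + e *\<^sub>R One))"
  proof (rule iffD2[OF has_integral_on_UNIV_iff GU])
    fix z assume "z \<notin> cbox (x - e *\<^sub>R One) (x + e *\<^sub>R One)"
    then show "G z = 0" using sub G0 by blast
  qed
  have 1: "((\<lambda>y. G (e *\<^sub>R y + x)) has_integral ?I /\<^sub>R e ^ DIM('a)) (cbox (- One) One)"
    by (rule has_integral_rescale[OF e B])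
  have "G (e *\<^sub>R y + x) = bump y * f (x + e *\<^sub>R y)" for y
  proof (cases "norm y \<le> 1")
    case True
    then have "f (x + e *\<^sub>R y) = g (x + e *\<^sub>R y)" using e by (intro fg) (simp add: dist_norm mult_left_le)
    then show ?thesis using e by (simp add: G_def add.commute)
  next
    case False
    then show ?thesis using e by (simp add: G_def bump_zero)
  qed
  then have "integral (cbox (- One) One) (\<lambda>y. bump y * f (x + e *\<^sub>R y)) = ?I /\<^sub>R e ^ DIM('a)"
    using 1 by (simp add: integral_unique)
  also have "\<dots> = integral (cbox a b) (\<lambda>z. inverse e ^ DIM('a) * G z)"
    using e by (simp add: power_inverse)
  also have "(\<lambda>z. inverse e ^ DIM('a) * G z) =
      (\<lambda>z. (max 0 (1 - (inverse e)\<^sup>2 * ((z - x) \<bullet> (z - x)))) ^ 3 * inverse e ^ DIM('a) * g z)"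
    by (auto simp: G_def bump_def power2_eq_square mult_ac)
  finally show ?thesis by (simp add: moll_def avg_def)
qed

text \<open>Near \<open>x0\<close> the radius varies little, so all the balls involved lie in one
  larger ball: there \<open>f\<close> is replaced by a global continuous extension and the integral
  runs over a fixed box, as \<open>Ck_parametric_integral\<close> requires.\<close>

lemma Ck_moll:
  fixes f :: "'a::euclidean_space \<Rightarrow> real"
  assumes X: "open X" and e: "Ck 2 X e" "\<And>x. x \<in> X \<Longrightarrow> e x > 0" and f: "open Y" "continuous_on Y f"
    and sub: "\<And>x. x \<in> X \<Longrightarrow> cball x (e x) \<subseteq> Y"
  shows "Ck 2 X (\<lambda>x. moll f (e x) x)"
proof (rule Ck_local)
  fix x0 assume x0: "x0 \<in> X"
  obtain d where d: "d > 0" "cball x0 (e x0 + d) \<subseteq> Y"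
  proof -
    obtain d where d: "d > 0" "(\<Union>x\<in>cball x0 (e x0). ball x d) \<subseteq> Y"
      using compact_subset_open_imp_ball_epsilon_subset[OF compact_cball f(1) sub[OF x0]] by blast
    \<comment> \<open>A point of the enlarged ball is pulled towards \<open>x0\<close> by the factor
      \<open>t\<close>; this lands in the original ball, at distance at most
      \<open>d / 2\<close>.\<close>
    have "cball x0 (e x0 + d / 2) \<subseteq> Y"
    proof
      fix z assume z: "z \<in> cball x0 (e x0 + d / 2)"
      define t where "t = e x0 / (e x0 + d / 2)"
      have ep: "e x0 > 0" using e(2)[OF x0] .
      have t: "0 < t" "t < 1" "t * (e x0 + d / 2) = e x0" using ep d by (auto simp: t_def field_simps)
      define y where "y = x0 + t *\<^sub>R (z - x0)"
      have "dist x0 y = t * dist x0 z" using t by (simp add: y_def dist_norm norm_minus_commute)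
      also have "\<dots> \<le> t * (e x0 + d / 2)" using z t by (intro mult_left_mono) auto
      finally have "y \<in> cball x0 (e x0)" using t by simp
      moreover have "z - y = (1 - t) *\<^sub>R (z - x0)" by (simp add: y_def algebra_simps)
      then have "norm (z - y) = (1 - t) * norm (z - x0)" using t by simp
      then have "dist y z = (1 - t) * dist x0 z" by (simp add: dist_norm norm_minus_commute)
      then have "dist y z \<le> (1 - t) * (e x0 + d / 2)" using z t by (simp add: mult_left_mono)
      then have "dist y z \<le> d / 2" by (simp only: left_diff_distrib t(3)) simp
      then have "z \<in> ball y d" using d by simp
      ultimately show "z \<in> Y" using d(2) by blast
    qed
    then show ?thesis using that[of "d / 2"] d by simp
  qed
  let ?B = "cball x0 (e x0 + d)"
  have ec: "continuous_on X e" using Ck_continuous[OF e(1)] .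
  then have "isCont e x0" using X x0 continuous_on_eq_continuous_at by blast
  then obtain d1 where d1: "d1 > 0" "\<And>x. dist x x0 < d1 \<Longrightarrow> dist (e x) (e x0) < d / 2"
    using d unfolding continuous_at_eps_delta by (meson half_gt_zero)
  \<comment> \<open>Centre and radius may each change by less than \<open>d / 2\<close>, together
    within the margin \<open>d\<close>.\<close>
  define U where "U = X \<inter> ball x0 (min d1 (d / 2))"
  have U: "open U" "x0 \<in> U" using X x0 d d1 by (auto simp: U_def)
  define g where "g = (\<lambda>z. f (closest_point ?B z))"
  have fB: "continuous_on ?B f" using f d continuous_on_subset by blast
  have Bp: "e x0 + d \<ge> 0" using e(2)[OF x0] d by simp
  have g: "continuous_on UNIV g" "\<And>z. z \<in> ?B \<Longrightarrow> f z = g z"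
    unfolding g_def using continuous_closest_extension[OF fB Bp] by auto
  define a where "a = x0 - (e x0 + d) *\<^sub>R One"
  define b where "b = x0 + (e x0 + d) *\<^sub>R One"
  have Bbox: "?B \<subseteq> cbox a b"
  proof
    fix z assume z: "z \<in> ?B"
    have "\<bar>(z - x0) \<bullet> i\<bar> \<le> e x0 + d" if "i \<in> Basis" for i
      using z Basis_le_norm[OF that, of "z - x0"] by (simp add: dist_norm norm_minus_commute)
    then show "z \<in> cbox a b"
      unfolding a_def b_def by (fastforce simp: mem_box inner_diff_left inner_add_left abs_le_iff)
  qed
  have near: "cball x (e x) \<subseteq> ?B" if "x \<in> U" for x
  proof
    fix z assume "z \<in> cball x (e x)"
    then have "dist x0 z \<le> dist x0 x + e x" using dist_triangle[of x0 z x] by simp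
    moreover have "dist x0 x < d / 2" "dist x x0 < d1" using that by (auto simp: U_def dist_commute)
    moreover have "\<bar>e x - e x0\<bar> < d / 2" using d1(2)[of x] calculation by (simp add: dist_real_def)
    ultimately have "dist x0 z \<le> e x0 + d" by linarith
    then show "z \<in> ?B" by simp
  qed
  let ?Z = "integral (cbox (- One) One) (bump :: 'a \<Rightarrow> real)"
  let ?K = "\<lambda>p. (max 0 (1 - (inverse (e (fst p)))\<^sup>2 * ((snd p - fst p) \<bullet> (snd p - fst p)))) ^ 3 * inverse (e (fst p)) ^ DIM('a)"
  have "Ck 2 (U \<times> UNIV) ?K"
  proof -
    have o: "open (U \<times> (UNIV :: 'a set))" using U by (simp add: open_Times)
    have "Ck 2 U e" using e(1) by (rule Ck_subset) (auto simp: U_def)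
    then have "Ck 2 (U \<times> UNIV) (\<lambda>p::'a\<times>'a. e (fst p + 0))"
      by (intro Ck_compose_linear[OF o U(1) bounded_linear_fst]) auto
    then have "Ck 2 (U \<times> UNIV) (\<lambda>p::'a\<times>'a. inverse (e (fst p)))"
      using e(2) by (intro Ck_compose_real[OF o _ _ _ Ck_inverse]) (auto simp: U_def)
    then have i: "Ck 2 (U \<times> UNIV) (\<lambda>p::'a\<times>'a. inverse (e (fst p)) ^ m)" for m
      by (intro Ck_power o)
    have q: "Ck 2 (U \<times> UNIV) (\<lambda>p::'a\<times>'a. 1 - (inverse (e (fst p)))\<^sup>2 * ((snd p - fst p) \<bullet> (snd p - fst p)))"
      by (intro Ck_diff Ck_mult Ck_const o i Ck_inner bounded_linear_sub bounded_linear_fst bounded_linear_snd)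
    have "Ck 2 (U \<times> UNIV) (\<lambda>p::'a\<times>'a. (max 0 (1 - (inverse (e (fst p)))\<^sup>2 * ((snd p - fst p) \<bullet> (snd p - fst p)))) ^ Suc 2)"
      by (rule Ck_compose_real[OF o open_UNIV _ q Ck_pos_part_power]) auto
    then have "Ck 2 (U \<times> UNIV) (\<lambda>p::'a\<times>'a. (max 0 (1 - (inverse (e (fst p)))\<^sup>2 * ((snd p - fst p) \<bullet> (snd p - fst p)))) ^ 3)"
      by (simp only: Suc_numeral semiring_norm)
    then show ?thesis by (intro Ck_mult o i)
  qed
  from Ck_parametric_integral[OF U(1) g(1) this, of a b]
  have "Ck 2 U (\<lambda>x. (1 / ?Z) * integral (cbox a b) (\<lambda>z. ?K (x, z) * g z))"
    by (intro Ck_cmult U(1))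
  then have "Ck 2 U (\<lambda>x. moll f (e x) x)"
  proof (rule Ck_cong[OF U(1)])
    fix x assume x: "x \<in> U"
    then have xX: "x \<in> X" by (simp add: U_def)
    have "moll f (e x) x = integral (cbox a b) (\<lambda>z. ?K (x, z) * g z) / ?Z"
      unfolding fst_conv snd_conv
      by (rule moll_kernel[OF e(2)[OF xX] g(1)]) (use g(2) near[OF x] Bbox in blast)+
    then show "(1 / ?Z) * integral (cbox a b) (\<lambda>z. ?K (x, z) * g z) = moll f (e x) x" by simp
  qed
  then show "\<exists>U. open U \<and> x0 \<in> U \<and> Ck 2 U (\<lambda>x. moll f (e x) x)" using U by blast
qed

section \<open>Approximation of convex functions by smooth ones\<close>

lemma norm_convex_comb_power2:
  fixes a b :: "'a::real_inner"
  shows "(norm ((1 - t) *\<^sub>R a + t *\<^sub>R b))\<^sup>2 = (1 - t) * (norm a)\<^sup>2 + t * (norm b)\<^sup>2 - t * (1 - t) * (norm (a - b))\<^sup>2"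
  unfolding power2_norm_eq_inner
  by (simp add: inner_add_left inner_add_right inner_diff_left inner_diff_right inner_commute[of b a]) (simp add: algebra_simps)

text \<open>The segment from \<open>a\<close> to \<open>b\<close> is prolonged by R/2 to a point
  \<open>c\<close> of the ball. Convexity then bounds the slope from \<open>a\<close> to
  \<open>b\<close> by the oscillation 2B over the length R/2.\<close>

lemma convex_lipschitz_half_ball:
  fixes f :: "'a::euclidean_space \<Rightarrow> real"
  assumes f: "convex_on (cball x R) f" and R: "R > 0" and B: "\<And>y. y \<in> cball x R \<Longrightarrow> \<bar>f y\<bar> \<le> B"
    and ab: "a \<in> cball x (R / 2)" "b \<in> cball x (R / 2)"
  shows "\<bar>f a - f b\<bar> \<le> (4 * B / R) * dist a b"
proof -
  have *: "f b - f a \<le> (4 * B / R) * dist a b" if a: "a \<in> cball x (R / 2)" and b: "b \<in> cball x (R / 2)" for a b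
  proof (cases "a = b")
    case False
    define d where "d = dist a b"
    have d: "d > 0" using False by (simp add: d_def)
    have nd: "norm (b - a) = d" by (simp add: d_def dist_norm norm_minus_commute)
    define c where "c = b + (R / 2 / d) *\<^sub>R (b - a)"
    define l where "l = d / (d + R / 2)"
    have l: "0 < l" "l < 1" using d R by (auto simp: l_def)
    have "dist b c = R / 2" using d R nd by (simp add: c_def dist_norm)
    then have c: "c \<in> cball x R" using dist_triangle[of x c b] b by simp
    have aR: "a \<in> cball x R" using a R by simp
    have "(1 - l) *\<^sub>R a + l *\<^sub>R c = b"
    proof -
      have "1 + R / 2 / d = (d + R / 2) / d" using d by (simp add: field_simps)
      moreover have "d + R / 2 > 0" using d R by simp
      ultimately have "l * (1 + R / 2 / d) = 1" using d by (simp add: l_def)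
      moreover have "(1 - l) *\<^sub>R a + l *\<^sub>R c = a + (l * (1 + R / 2 / d)) *\<^sub>R (b - a)"
        by (simp add: c_def algebra_simps)
      ultimately show ?thesis by simp
    qed
    then have "f b \<le> (1 - l) * f a + l * f c"
      using f aR c l unfolding convex_on_def by (metis add_diff_cancel_left' add.commute diff_add_cancel diff_ge_0_iff_ge less_imp_le)
    then have "f b - f a \<le> l * (f c - f a)" by (simp add: algebra_simps)
    also have "\<dots> \<le> l * (2 * B)" using B[OF c] B[OF aR] l by (intro mult_left_mono) (auto simp: abs_le_iff)
    also have "\<dots> \<le> d / (R / 2) * (2 * B)"
    proof (rule mult_right_mono)
      show "l \<le> d / (R / 2)" unfolding l_def using d R by (intro divide_left_mono) auto
      show "0 \<le> 2 * B" using B[OF aR] by linarith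
    qed
    also have "\<dots> = (4 * B / R) * dist a b" by (simp add: d_def)
    finally show ?thesis .
  qed simp
  show ?thesis using *[OF ab] *[OF ab(2,1)] by (simp add: abs_le_iff dist_commute)
qed

text \<open>For fixed \<open>y\<close> the point c + e(c) y misses the convex combination of a +
  e(a) y and b + e(b) y by the convexity defect of \<open>e\<close> times y. The two bounds
  \<open>eM\<close> make this at most M/2 times t (1 - t)|a - b|^2, the Lipschitz constant turns it
  into a loss of at most \<delta>/2 times the same quantity, and that is what the quadratic term
  gains.\<close>

lemma moll_semiconvex:
  fixes f e :: "'a::euclidean_space \<Rightarrow> real"
  assumes e: "\<And>x. x \<in> ball x0 r \<Longrightarrow> e x \<ge> 0"
    and eR: "\<And>x y. x \<in> ball x0 r \<Longrightarrow> norm y \<le> 1 \<Longrightarrow> x + e x *\<^sub>R y \<in> ball x0 R"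
    and f: "convex_on (ball x0 R) f"
    and L: "\<And>a b. a \<in> ball x0 R \<Longrightarrow> b \<in> ball x0 R \<Longrightarrow> \<bar>f a - f b\<bar> \<le> L * dist a b" "L \<ge> 0"
    and eM: "convex_on (ball x0 r) (\<lambda>x. M / 2 * (norm x)\<^sup>2 + e x)" "convex_on (ball x0 r) (\<lambda>x. M / 2 * (norm x)\<^sup>2 - e x)"
    and LM: "L * M \<le> \<delta>"
  shows "convex_on (ball x0 r) (\<lambda>x. moll f (e x) x + \<delta> / 2 * (norm x)\<^sup>2)"
proof (rule convex_onI)
  have fc: "continuous_on (ball x0 R) f" by (rule convex_on_continuous[OF open_ball f])
  have cont: "continuous_on (cball 0 1) (\<lambda>y. f (x + e x *\<^sub>R y))" if "x \<in> ball x0 r" for x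
    by (rule continuous_on_compose2[OF fc]) (use eR[OF that] in \<open>auto intro!: continuous_intros\<close>)
  fix t a b assume t: "0 < t" "t < (1::real)" and a: "a \<in> ball x0 r" and b: "b \<in> ball x0 r"
  define c where "c = (1 - t) *\<^sub>R a + t *\<^sub>R b"
  have c: "c \<in> ball x0 r" unfolding c_def using t a b by (intro convexD[OF convex_ball]) auto
  define k where "k = t * (1 - t) * (norm (a - b))\<^sup>2"
  have k: "k \<ge> 0" using t by (simp add: k_def)
  have nc: "(norm c)\<^sup>2 = (1 - t) * (norm a)\<^sup>2 + t * (norm b)\<^sup>2 - k"
    unfolding c_def k_def by (rule norm_convex_comb_power2)
  define s where "s = e c - (1 - t) * e a - t * e b"
  \<comment> \<open>Stated with free reals, so that the arithmetic can treat the squared norms and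
    the values of \<open>e\<close> as atoms.\<close>
  have aux1: "ec - (1 - t) * ea - t * eb \<le> h * k"
    if "h * ((1 - t) * A + t * B - k) + ec \<le> (1 - t) * (h * A + ea) + t * (h * B + eb)" for h A B ea eb ec
    using that by (simp add: algebra_simps)
  have aux2: "- (ec - (1 - t) * ea - t * eb) \<le> h * k"
    if "h * ((1 - t) * A + t * B - k) - ec \<le> (1 - t) * (h * A - ea) + t * (h * B - eb)" for h A B ea eb ec
    using that by (simp add: algebra_simps)
  have aux3: "mc + h * ((1 - t) * A + t * B - k) \<le> (1 - t) * (ma + h * A) + t * (mb + h * B)"
    if "mc \<le> (1 - t) * ma + t * mb + h * k" for h A B ma mb mc
    using that by (simp add: algebra_simps)
  have "M / 2 * (norm c)\<^sup>2 + e c \<le> (1 - t) * (M / 2 * (norm a)\<^sup>2 + e a) + t * (M / 2 * (norm b)\<^sup>2 + e b)"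
    unfolding c_def using convex_onD[OF eM(1)] t a b by simp
  then have s1: "s \<le> M / 2 * k" unfolding nc s_def by (rule aux1)
  have "M / 2 * (norm c)\<^sup>2 - e c \<le> (1 - t) * (M / 2 * (norm a)\<^sup>2 - e a) + t * (M / 2 * (norm b)\<^sup>2 - e b)"
    unfolding c_def using convex_onD[OF eM(2)] t a b by simp
  then have s2: "- s \<le> M / 2 * k" unfolding nc s_def by (rule aux2)
  have Ls: "L * \<bar>s\<bar> \<le> \<delta> / 2 * k"
  proof -
    have "L * \<bar>s\<bar> \<le> L * (M / 2 * k)" using s1 s2 L(2) by (intro mult_left_mono) auto
    also have "\<dots> = (L * M) * (k / 2)" by simp
    also have "\<dots> \<le> \<delta> * (k / 2)" using LM k by (intro mult_right_mono) auto
    finally show ?thesis by simp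
  qed
  have pt: "f (c + e c *\<^sub>R y) \<le> ((1 - t) * f (a + e a *\<^sub>R y) + t * f (b + e b *\<^sub>R y)) + \<delta> / 2 * k" if y: "norm y \<le> 1" for y
  proof -
    define p where "p = (1 - t) *\<^sub>R (a + e a *\<^sub>R y) + t *\<^sub>R (b + e b *\<^sub>R y)"
    have p: "p \<in> ball x0 R" unfolding p_def
      using t eR[OF a y] eR[OF b y] by (intro convexD[OF convex_ball]) auto
    have "c + e c *\<^sub>R y - p = s *\<^sub>R y" by (simp add: p_def c_def s_def algebra_simps)
    then have "dist (c + e c *\<^sub>R y) p \<le> \<bar>s\<bar>" using y by (simp add: dist_norm mult_left_le)
    then have "L * dist (c + e c *\<^sub>R y) p \<le> L * \<bar>s\<bar>" using L(2) by (rule mult_left_mono)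
    then have "f (c + e c *\<^sub>R y) \<le> f p + \<delta> / 2 * k"
      using L(1)[OF eR[OF c y] p] Ls by linarith
    moreover have "f p \<le> (1 - t) * f (a + e a *\<^sub>R y) + t * f (b + e b *\<^sub>R y)"
      unfolding p_def using convex_onD[OF f, of t] t eR[OF a y] eR[OF b y] by simp
    ultimately show ?thesis by linarith
  qed
  have "moll f (e c) c \<le> avg (\<lambda>y. ((1 - t) * f (a + e a *\<^sub>R y) + t * f (b + e b *\<^sub>R y)) + \<delta> / 2 * k)"
    unfolding moll_def by (intro avg_mono cont c pt continuous_intros a b)
  also have "\<dots> = avg (\<lambda>y. (1 - t) * f (a + e a *\<^sub>R y) + t * f (b + e b *\<^sub>R y)) + \<delta> / 2 * k"
    by (subst avg_add) (auto intro!: continuous_intros cont a b simp: avg_const)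
  also have "avg (\<lambda>y. (1 - t) * f (a + e a *\<^sub>R y) + t * f (b + e b *\<^sub>R y)) = (1 - t) * moll f (e a) a + t * moll f (e b) b"
    by (subst avg_add) (auto intro!: continuous_intros cont a b simp: avg_cmult moll_def)
  finally show "moll f (e ((1 - t) *\<^sub>R a + t *\<^sub>R b)) ((1 - t) *\<^sub>R a + t *\<^sub>R b) + \<delta> / 2 * (norm ((1 - t) *\<^sub>R a + t *\<^sub>R b))\<^sup>2
    \<le> (1 - t) * (moll f (e a) a + \<delta> / 2 * (norm a)\<^sup>2) + t * (moll f (e b) b + \<delta> / 2 * (norm b)\<^sup>2)"
    unfolding c_def[symmetric] nc by (rule aux3)
qed simp

text \<open>Weierstrass test: the tail of \<open>C\<close> bounds the error of the partial sums of
  the derivatives uniformly in the point, which permits termwise differentiation.\<close>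

lemma has_derivative_series_dominated:
  fixes f :: "nat \<Rightarrow> 'a::euclidean_space \<Rightarrow> real"
  assumes d: "\<And>j x. (f j has_derivative f' j x) (at x)"
    and f: "\<And>j x. \<bar>f j x\<bar> \<le> C j" and f': "\<And>j x v. \<bar>f' j x v\<bar> \<le> C j * norm v" and C: "summable C"
  shows "((\<lambda>x. \<Sum>j. f j x) has_derivative (\<lambda>v. \<Sum>j. f' j x v)) (at x)"
proof -
  have sf: "summable (\<lambda>j. f j x)" for x by (rule summable_comparison_test'[OF C]) (use f in auto)
  have sC: "summable (\<lambda>j. C j * norm v)" for v :: 'a using C by (rule summable_mult2)
  have sf': "summable (\<lambda>j. f' j x v)" for x v by (rule summable_comparison_test'[OF sC[of v]]) (use f' in auto)
  have "\<exists>g. \<forall>x\<in>UNIV. (\<lambda>n. f n x) sums (g x) \<and> (g has_derivative (\<lambda>v. \<Sum>j. f' j x v)) (at x within UNIV)"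
  proof (rule has_derivative_series)
    fix e :: real assume e: "e > 0"
    have "(\<lambda>n. \<Sum>i<n. C i) \<longlonglongrightarrow> suminf C" using C by (rule summable_LIMSEQ)
    then have "\<forall>\<^sub>F n in sequentially. dist (\<Sum>i<n. C i) (suminf C) < e" using e by (rule tendstoD)
    then show "\<forall>\<^sub>F n in sequentially. \<forall>x\<in>UNIV. \<forall>h. norm ((\<Sum>i<n. f' i x h) - (\<Sum>j. f' j x h)) \<le> e * norm h"
    proof eventually_elim
      case (elim n)
      show ?case
      proof (intro ballI allI)
        fix x h :: 'a
        have "(\<Sum>i<n. f' i x h) - (\<Sum>j. f' j x h) = - (\<Sum>j. f' (j + n) x h)"
          using suminf_minus_initial_segment[OF sf'[of x h], of n] by simp
        moreover have "\<bar>\<Sum>j. f' (j + n) x h\<bar> \<le> (\<Sum>j. C (j + n) * norm h)"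
        proof -
          have s: "summable (\<lambda>j. C (j + n) * norm h)" using summable_ignore_initial_segment[OF sC] .
          have a: "summable (\<lambda>j. \<bar>f' (j + n) x h\<bar>)"
            by (rule summable_comparison_test'[OF s]) (use f' in auto)
          then have "\<bar>\<Sum>j. f' (j + n) x h\<bar> \<le> (\<Sum>j. \<bar>f' (j + n) x h\<bar>)" by (rule summable_rabs)
          also have "\<dots> \<le> (\<Sum>j. C (j + n) * norm h)" by (intro suminf_le a s f')
          finally show ?thesis .
        qed
        moreover have "(\<Sum>j. C (j + n) * norm h) = (suminf C - (\<Sum>i<n. C i)) * norm h"
          using suminf_mult2[OF summable_ignore_initial_segment[OF C], of n "norm h"]
            suminf_minus_initial_segment[OF C, of n] by simp
        moreover have "(suminf C - (\<Sum>i<n. C i)) * norm h \<le> e * norm h"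
          using elim by (intro mult_right_mono) (auto simp: dist_real_def)
        ultimately show "norm ((\<Sum>i<n. f' i x h) - (\<Sum>j. f' j x h)) \<le> e * norm h" by simp
      qed
    qed
  qed (use d sf in \<open>auto simp: summable_sums\<close>)
  then obtain g where g: "\<And>x. (\<lambda>n. f n x) sums (g x)" "\<And>x. (g has_derivative (\<lambda>v. \<Sum>j. f' j x v)) (at x)" by auto
  have "g = (\<lambda>x. \<Sum>j. f j x)" using g(1) sums_unique by blast
  then show ?thesis using g(2) by simp
qed

section \<open>Cutoff functions with explicit derivatives, and small positive C2 functions\<close>

definition cutoff :: "real \<Rightarrow> 'a::euclidean_space \<Rightarrow> 'a \<Rightarrow> real" where
  "cutoff r a x = (max 0 (r\<^sup>2 - (x - a) \<bullet> (x - a))) ^ 3"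

text \<open>First and second directional derivatives of \<open>cutoff\<close>, written out so that
  bounds can be read off; \<open>cutoff_derivative\<close> justifies them.\<close>

definition cutoff1 :: "real \<Rightarrow> 'a::euclidean_space \<Rightarrow> 'a \<Rightarrow> 'a \<Rightarrow> real" where
  "cutoff1 r a v x = - 6 * (max 0 (r\<^sup>2 - (x - a) \<bullet> (x - a)))\<^sup>2 * ((x - a) \<bullet> v)"

definition cutoff2 :: "real \<Rightarrow> 'a::euclidean_space \<Rightarrow> 'a \<Rightarrow> 'a \<Rightarrow> 'a \<Rightarrow> real" where
  "cutoff2 r a v w x = 24 * max 0 (r\<^sup>2 - (x - a) \<bullet> (x - a)) * ((x - a) \<bullet> w) * ((x - a) \<bullet> v)
     - 6 * (max 0 (r\<^sup>2 - (x - a) \<bullet> (x - a)))\<^sup>2 * (w \<bullet> v)"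

lemma has_derivative_pos_part_power:
  assumes "(q has_derivative q') (at x)"
  shows "((\<lambda>x. (max 0 (q x :: real)) ^ Suc (Suc k)) has_derivative (\<lambda>v. real (k + 2) * (max 0 (q x)) ^ Suc k * q' v)) (at x)"
  using has_derivative_compose[OF assms, of "\<lambda>s. (max 0 s) ^ Suc (Suc k)" "(*) (real (k + 2) * (max 0 (q x)) ^ Suc k)"]
    DERIV_pos_part_power[of k "q x"] unfolding has_field_derivative_def by blast

lemma cutoff_derivative:
  "(cutoff r a has_derivative (\<lambda>v. cutoff1 r a v x)) (at x)"
  "(cutoff1 r a v has_derivative (\<lambda>w. cutoff2 r a v w x)) (at x)"
proof -
  have d: "((\<lambda>x. x - a) has_derivative (\<lambda>v. v)) (at x)" by (auto intro!: derivative_eq_intros)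
  have "((\<lambda>x. r\<^sup>2 - (x - a) \<bullet> (x - a)) has_derivative (\<lambda>v. 0 - ((x - a) \<bullet> v + v \<bullet> (x - a)))) (at x)"
    by (intro has_derivative_diff has_derivative_const has_derivative_inner d)
  then have q: "((\<lambda>x. r\<^sup>2 - (x - a) \<bullet> (x - a)) has_derivative (\<lambda>v. - 2 * ((x - a) \<bullet> v))) (at x)"
    by (rule has_derivative_eq_rhs) (auto simp: inner_commute)
  show "(cutoff r a has_derivative (\<lambda>v. cutoff1 r a v x)) (at x)"
  proof -
    have "cutoff r a = (\<lambda>x. (max 0 (r\<^sup>2 - (x - a) \<bullet> (x - a))) ^ Suc (Suc 1))"
      by (simp add: cutoff_def fun_eq_iff numeral_eq_Suc)
    moreover have "(\<lambda>v. cutoff1 r a v x) = (\<lambda>v. real (1 + 2) * (max 0 (r\<^sup>2 - (x - a) \<bullet> (x - a))) ^ Suc 1 * (- 2 * ((x - a) \<bullet> v)))"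
      by (simp add: cutoff1_def fun_eq_iff power2_eq_square)
    ultimately show ?thesis using has_derivative_pos_part_power[OF q, of 1] by (simp only:)
  qed
  show "(cutoff1 r a v has_derivative (\<lambda>w. cutoff2 r a v w x)) (at x)"
  proof -
    have "((\<lambda>x. (max 0 (r\<^sup>2 - (x - a) \<bullet> (x - a)))\<^sup>2) has_derivative (\<lambda>w. 2 * max 0 (r\<^sup>2 - (x - a) \<bullet> (x - a)) * (- 2 * ((x - a) \<bullet> w)))) (at x)"
      using has_derivative_pos_part_power[OF q, of 0] by (simp add: numeral_2_eq_2)
    then have "(cutoff1 r a v has_derivative (\<lambda>w. - 6 * (max 0 (r\<^sup>2 - (x - a) \<bullet> (x - a)))\<^sup>2 * (w \<bullet> v)
        + - 6 * (2 * max 0 (r\<^sup>2 - (x - a) \<bullet> (x - a)) * (- 2 * ((x - a) \<bullet> w))) * ((x - a) \<bullet> v))) (at x)"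
      unfolding cutoff1_def[abs_def]
      by (intro has_derivative_mult has_derivative_mult_right has_derivative_inner_left d)
    then show ?thesis by (rule has_derivative_eq_rhs) (auto simp: cutoff2_def)
  qed
qed

lemma cutoff_outside:
  assumes "r > 0" "x \<notin> ball a r"
  shows "cutoff r a x = 0" "cutoff1 r a v x = 0" "cutoff2 r a v w x = 0"
proof -
  have "norm (x - a) \<ge> r" using assms by (simp add: dist_norm norm_minus_commute)
  then have "r\<^sup>2 \<le> (norm (x - a))\<^sup>2" using assms by (intro power_mono) auto
  then have "max 0 (r\<^sup>2 - (x - a) \<bullet> (x - a)) = 0" by (simp add: power2_norm_eq_inner)
  then show "cutoff r a x = 0" "cutoff1 r a v x = 0" "cutoff2 r a v w x = 0"
    by (simp_all add: cutoff_def cutoff1_def cutoff2_def)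
qed

lemma cutoff_pos: "x \<in> ball a r \<Longrightarrow> cutoff r a x > 0"
proof -
  assume "x \<in> ball a r"
  then have "norm (x - a) < r" by (simp add: dist_norm norm_minus_commute)
  then have "(norm (x - a))\<^sup>2 < r\<^sup>2" by (intro power_strict_mono) auto
  then show ?thesis by (simp add: cutoff_def power2_norm_eq_inner)
qed

text \<open>With radius at most 1 every factor is at most 1, up to norms of directions, and the
  coefficients of \<open>cutoff2\<close> add up to 24 + 6 = 30; the same 30 serves the lower
  orders.\<close>

lemma cutoff_bounds:
  assumes r: "0 < r" "r \<le> 1"
  shows "0 \<le> cutoff r a x" "cutoff r a x \<le> 30" "\<bar>cutoff1 r a v x\<bar> \<le> 30 * norm v"
    "\<bar>cutoff2 r a v w x\<bar> \<le> 30 * (norm v * norm w)"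
proof -
  define m where "m = max 0 (r\<^sup>2 - (x - a) \<bullet> (x - a))"
  have "r\<^sup>2 \<le> 1" using r by (simp add: power_le_one)
  then have m: "0 \<le> m" "m \<le> 1" unfolding m_def by (auto simp: max_def) (smt (verit) inner_ge_zero)
  have m2: "m\<^sup>2 \<le> 1" "0 \<le> m\<^sup>2" and m3: "m ^ 3 \<le> 1" using m by (auto simp: power_le_one)
  show "0 \<le> cutoff r a x" by (simp add: cutoff_def)
  show "cutoff r a x \<le> 30" using m3 by (simp add: cutoff_def m_def[symmetric])
  show "\<bar>cutoff1 r a v x\<bar> \<le> 30 * norm v"
  proof (cases "x \<in> ball a r")
    case True
    then have "norm (x - a) \<le> 1" using r by (simp add: dist_norm norm_minus_commute)
    then have "\<bar>(x - a) \<bullet> v\<bar> \<le> 1 * norm v"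
      by (rule order_trans[OF Cauchy_Schwarz_ineq2 mult_right_mono[OF _ norm_ge_zero]])
    then have "m\<^sup>2 * \<bar>(x - a) \<bullet> v\<bar> \<le> 1 * norm v" using m2 by (intro mult_mono) auto
    moreover have "\<bar>cutoff1 r a v x\<bar> = 6 * (m\<^sup>2 * \<bar>(x - a) \<bullet> v\<bar>)"
      by (simp add: cutoff1_def m_def[symmetric] abs_mult)
    ultimately show ?thesis using norm_ge_zero[of v] by linarith
  qed (use cutoff_outside[OF r(1), of x a] in simp)
  show "\<bar>cutoff2 r a v w x\<bar> \<le> 30 * (norm v * norm w)"
  proof (cases "x \<in> ball a r")
    case True
    then have n: "norm (x - a) \<le> 1" using r by (simp add: dist_norm norm_minus_commute)
    have i: "\<bar>(x - a) \<bullet> u\<bar> \<le> norm u" for u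
      using Cauchy_Schwarz_ineq2[of "x - a" u] mult_right_mono[OF n, of "norm u"] by simp
    have wv: "\<bar>(x - a) \<bullet> w\<bar> * \<bar>(x - a) \<bullet> v\<bar> \<le> norm w * norm v" by (intro mult_mono i) auto
    have 1: "m * (\<bar>(x - a) \<bullet> w\<bar> * \<bar>(x - a) \<bullet> v\<bar>) \<le> 1 * (norm w * norm v)"
      by (rule mult_mono[OF m(2) wv]) auto
    have 2: "m\<^sup>2 * \<bar>w \<bullet> v\<bar> \<le> 1 * (norm w * norm v)" using m2 Cauchy_Schwarz_ineq2[of w v] by (intro mult_mono) auto
    have "\<bar>cutoff2 r a v w x\<bar> \<le> \<bar>24 * m * ((x - a) \<bullet> w) * ((x - a) \<bullet> v)\<bar> + \<bar>6 * m\<^sup>2 * (w \<bullet> v)\<bar>"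
      unfolding cutoff2_def m_def[symmetric] by (rule abs_triangle_ineq4)
    also have "\<dots> = 24 * (m * (\<bar>(x - a) \<bullet> w\<bar> * \<bar>(x - a) \<bullet> v\<bar>)) + 6 * (m\<^sup>2 * \<bar>w \<bullet> v\<bar>)"
      using m by (simp add: abs_mult)
    also have "\<dots> \<le> 30 * (norm v * norm w)" using 1 2 by (simp add: mult_ac)
    finally show ?thesis .
  qed (use cutoff_outside[OF r(1), of x a] in simp)
qed

text \<open>Radii at most 1 are what \<open>cutoff_bounds\<close> asks for; closed balls inside
  \<open>X\<close> let a positive continuous function attain its minimum on each.\<close>

lemma open_countable_balls:
  fixes X :: "'a::euclidean_space set"
  assumes X: "open X" "X \<noteq> {}"
  shows "\<exists>(a :: nat \<Rightarrow> 'a) r. (\<forall>j. 0 < r j \<and> r j \<le> 1 \<and> cball (a j) (r j) \<subseteq> X) \<and>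
    X \<subseteq> (\<Union>j. ball (a j) (r j))"
proof -
  define F where "F = {ball a r |a r. 0 < r \<and> r \<le> 1 \<and> cball a r \<subseteq> X}"
  obtain F' where F': "F' \<subseteq> F" "countable F'" "\<Union>F' = \<Union>F"
  proof -
    have "\<And>S. S \<in> F \<Longrightarrow> open S" by (auto simp: F_def)
    from Lindelof[OF this] show ?thesis using that by blast
  qed
  have XF: "X \<subseteq> \<Union>F"
  proof
    fix x assume "x \<in> X"
    then obtain e where e: "e > 0" "cball x e \<subseteq> X" using X open_contains_cball by blast
    have "cball x (min e 1) \<subseteq> X" using e by auto
    then have "ball x (min e 1) \<in> F" using e unfolding F_def by (intro CollectI exI[of _ x] exI[of _ "min e 1"]) auto
    then show "x \<in> \<Union>F" using e by (intro UnionI[of "ball x (min e 1)"]) auto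
  qed
  have "F' \<noteq> {}"
  proof
    assume "F' = {}"
    then have "\<Union>F = {}" using F'(3) by simp
    then have "X \<subseteq> {}" using XF by (simp only:)
    then show False using X(2) by simp
  qed
  then have rng: "range (from_nat_into F') = F'" using F'(2) by (simp add: range_from_nat_into)
  have "\<forall>j. \<exists>a r. from_nat_into F' j = ball a r \<and> 0 < r \<and> r \<le> 1 \<and> cball a r \<subseteq> X"
    using rng F'(1) unfolding F_def by blast
  then obtain a r where ar: "\<And>j. from_nat_into F' j = ball (a j) (r j) \<and> 0 < r j \<and> r j \<le> 1 \<and> cball (a j) (r j) \<subseteq> X" by metis
  have "X \<subseteq> (\<Union>j. ball (a j) (r j))"
  proof
    fix x assume "x \<in> X"
    then obtain S where S: "S \<in> F'" "x \<in> S" using XF F'(3) by blast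
    then obtain j where "S = from_nat_into F' j" using rng by blast
    then show "x \<in> (\<Union>j. ball (a j) (r j))" using S(2) ar[of j] by blast
  qed
  then show ?thesis using ar by blast
qed

text \<open>A series of cutoffs with weights 2^(-j-1) m_j / 30, where m_j <= 1 lies below \<omega>
  on the j-th ball. The 30 cancels the bounds of the cutoffs, m_j <= 1 gives convergence on the
  whole space, and m_j <= \<omega> gives domination by \<omega> at points of \<open>X\<close>, since
  each cutoff lives on its own ball.\<close>

lemma small_C2_function:
  fixes X :: "'a::euclidean_space set"
  assumes X: "open X" "X \<noteq> {}" and \<omega>: "continuous_on X \<omega>" "\<And>x. x \<in> X \<Longrightarrow> \<omega> x > (0::real)"
  obtains \<epsilon> where "Ck 2 UNIV \<epsilon>" "\<And>x. x \<in> X \<Longrightarrow> 0 < \<epsilon> x \<and> \<epsilon> x \<le> \<omega> x"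
    "\<And>x v. x \<in> X \<Longrightarrow> \<bar>dd (dd \<epsilon> v) v x\<bar> \<le> \<omega> x * (norm v)\<^sup>2"
proof -
  obtain a r where ar: "\<And>j::nat. 0 < r j \<and> r j \<le> 1 \<and> cball (a j) (r j) \<subseteq> X" and cov: "X \<subseteq> (\<Union>j. ball (a j) (r j))"
    using open_countable_balls[OF X] by blast
  have "\<exists>m. 0 < m \<and> m \<le> 1 \<and> (\<forall>x\<in>cball (a j) (r j). m \<le> \<omega> x)" for j
  proof -
    have "cball (a j) (r j) \<noteq> {}" using ar[of j] by simp
    moreover have "continuous_on (cball (a j) (r j)) \<omega>" using \<omega>(1) ar continuous_on_subset by blast
    ultimately obtain z where z: "z \<in> cball (a j) (r j)" "\<And>x. x \<in> cball (a j) (r j) \<Longrightarrow> \<omega> z \<le> \<omega> x"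
      using continuous_attains_inf[OF compact_cball] by blast
    have "\<omega> z > 0" using \<omega>(2) z(1) ar by blast
    then show ?thesis using z(2) by (intro exI[of _ "min 1 (\<omega> z)"]) (auto simp: min.coboundedI2)
  qed
  then obtain m where m: "\<And>j. 0 < m j" "\<And>j. m j \<le> 1" "\<And>j x. x \<in> cball (a j) (r j) \<Longrightarrow> m j \<le> \<omega> x" by metis
  define C :: "nat \<Rightarrow> real" where "C = (\<lambda>j. (1 / 2) ^ Suc j)"
  have C: "C sums 1" unfolding C_def by (rule power_half_series)
  then have Cs: "summable C" and C1: "suminf C = 1" by (auto simp: sums_iff)
  have Cp: "C j > 0" for j by (simp add: C_def)
  define c where "c = (\<lambda>j. m j / 30 * C j)"
  have c: "c j > 0" for j using m Cp by (simp add: c_def)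
  have key: "\<bar>c j * y\<bar> \<le> C j * z" if "\<bar>y\<bar> \<le> 30 * z" "z \<ge> 0" for j y z
  proof -
    have "\<bar>c j * y\<bar> = c j * \<bar>y\<bar>" using c[of j] by (simp add: abs_mult)
    also have "\<dots> \<le> c j * (30 * z)" using that c[of j] by (intro mult_left_mono) auto
    also have "\<dots> = m j * (C j * z)" by (simp add: c_def)
    also have "\<dots> \<le> 1 * (C j * z)" using m that Cp[of j] by (intro mult_right_mono) auto
    finally show ?thesis by simp
  qed
  have key2: "\<bar>c j * y\<bar> \<le> C j * (\<omega> x * z)" if "\<bar>y\<bar> \<le> 30 * z" "z \<ge> 0" "x \<in> X" "x \<notin> ball (a j) (r j) \<Longrightarrow> y = 0" for j x y z
  proof (cases "x \<in> ball (a j) (r j)")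
    case True
    have "\<bar>c j * y\<bar> = c j * \<bar>y\<bar>" using c[of j] by (simp add: abs_mult)
    also have "\<dots> \<le> c j * (30 * z)" using that c[of j] by (intro mult_left_mono) auto
    also have "\<dots> = m j * (C j * z)" by (simp add: c_def)
    also have "\<dots> \<le> \<omega> x * (C j * z)" using m(3)[of x j] True that Cp[of j] by (intro mult_right_mono) auto
    finally show ?thesis by (simp add: mult_ac)
  next
    case False
    then show ?thesis using that Cp[of j] \<omega>(2)[of x] by simp
  qed
  let ?f = "\<lambda>j x. c j * cutoff (r j) (a j) x" and ?f1 = "\<lambda>j v x. c j * cutoff1 (r j) (a j) v x"
    and ?f2 = "\<lambda>j v w x. c j * cutoff2 (r j) (a j) v w x"
  define \<epsilon> where "\<epsilon> = (\<lambda>x. \<Sum>j. ?f j x)"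
  have b0: "\<bar>?f j x\<bar> \<le> C j" for j x using key[of "cutoff (r j) (a j) x" 1 j] cutoff_bounds[of "r j" "a j"] ar[of j] by simp
  have b1: "\<bar>?f1 j v x\<bar> \<le> C j * norm v" for j v x
    by (rule key) (use cutoff_bounds(3)[of "r j" "a j" v x] ar[of j] in auto)
  have b2: "\<bar>?f2 j v w x\<bar> \<le> C j * (norm v * norm w)" for j v w x
    by (rule key) (use cutoff_bounds(4)[of "r j" "a j" v w x] ar[of j] in auto)
  have d1: "(\<epsilon> has_derivative (\<lambda>v. \<Sum>j. ?f1 j v x)) (at x)" for x
    unfolding \<epsilon>_def
    by (rule has_derivative_series_dominated[OF _ b0 b1 Cs]) (intro has_derivative_mult_right cutoff_derivative)
  have d2: "((\<lambda>x. \<Sum>j. ?f1 j v x) has_derivative (\<lambda>w. \<Sum>j. ?f2 j v w x)) (at x)" for v x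
  proof (rule has_derivative_series_dominated[where C = "\<lambda>j. C j * norm v + C j * norm v"])
    show "(?f1 j v has_derivative (\<lambda>w. ?f2 j v w x)) (at x)" for j x by (intro has_derivative_mult_right cutoff_derivative)
    show "\<bar>?f1 j v x\<bar> \<le> C j * norm v + C j * norm v" for j x
      using b1[of j v x] Cp[of j] by (smt (verit) mult_nonneg_nonneg norm_ge_zero)
    show "\<bar>?f2 j v w x\<bar> \<le> (C j * norm v + C j * norm v) * norm w" for j x w
    proof -
      have "0 \<le> C j * (norm v * norm w)" using Cp[of j] by simp
      then show ?thesis using b2[of j v w x] by (simp add: algebra_simps)
    qed
    show "summable (\<lambda>j. C j * norm v + C j * norm v)" by (intro summable_add summable_mult2 Cs)
  qed
  have eq1: "dd \<epsilon> v = (\<lambda>x. \<Sum>j. ?f1 j v x)" for v using dd_eq[OF d1] by auto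
  have eq2: "dd (dd \<epsilon> v) w x = (\<Sum>j. ?f2 j v w x)" for v w x unfolding eq1 by (rule dd_eq[OF d2])
  have cont: "continuous_on UNIV (\<lambda>x. \<Sum>j. ?f2 j v w x)" for v w
  proof (rule uniform_limit_theorem)
    show "uniform_limit UNIV (\<lambda>n x. \<Sum>j<n. ?f2 j v w x) (\<lambda>x. \<Sum>j. ?f2 j v w x) sequentially"
      by (rule Weierstrass_m_test[where M = "\<lambda>j. C j * (norm v * norm w)"]) (use b2 in \<open>auto intro: summable_mult2 Cs\<close>)
    show "\<forall>\<^sub>F n in sequentially. continuous_on UNIV (\<lambda>x. \<Sum>j<n. ?f2 j v w x)"
      unfolding cutoff2_def by (intro always_eventually allI continuous_intros)
  qed simp
  have "Ck 2 UNIV \<epsilon>"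
  proof -
    have "Ck 1 UNIV (\<lambda>x. \<Sum>j. ?f1 j v x)" for v
      unfolding One_nat_def by (rule Ck_SucI[OF open_UNIV d2]) (simp add: cont)
    then have "Ck (Suc 1) UNIV \<epsilon>" by (rule Ck_SucI[OF open_UNIV d1])
    then show ?thesis by (simp add: numeral_2_eq_2)
  qed
  moreover have "0 < \<epsilon> x \<and> \<epsilon> x \<le> \<omega> x" if x: "x \<in> X" for x
  proof
    have s: "summable (\<lambda>j. ?f j x)" by (rule summable_comparison_test'[OF Cs]) (use b0 in auto)
    obtain i where "x \<in> ball (a i) (r i)" using cov x by auto
    then have pos: "?f i x > 0" using cutoff_pos c by (metis mult_pos_pos)
    have nn: "0 \<le> ?f j x" for j using c[of j] cutoff_bounds(1)[of "r j" "a j" x] ar[of j] by simp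
    show "0 < \<epsilon> x" unfolding \<epsilon>_def by (rule suminf_pos2[OF s nn pos])
    have "\<bar>?f j x\<bar> \<le> C j * (\<omega> x * 1)" for j
      by (rule key2) (use cutoff_bounds[of "r j" "a j" x] cutoff_outside[of "r j" x "a j"] ar[of j] x in auto)
    then have le: "?f j x \<le> C j * (\<omega> x * 1)" for j using abs_le_D1 by blast
    have "\<epsilon> x \<le> (\<Sum>j. C j * (\<omega> x * 1))"
      unfolding \<epsilon>_def by (intro suminf_le le s summable_mult2 Cs)
    then show "\<epsilon> x \<le> \<omega> x" using suminf_mult2[OF Cs, of "\<omega> x * 1"] C1 by simp
  qed
  moreover have "\<bar>dd (dd \<epsilon> v) v x\<bar> \<le> \<omega> x * (norm v)\<^sup>2" if x: "x \<in> X" for x v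
  proof -
    have b: "\<bar>?f2 j v v x\<bar> \<le> C j * (\<omega> x * (norm v * norm v))" for j
      by (rule key2) (use cutoff_bounds(4)[of "r j" "a j" v v x] cutoff_outside[of "r j" x "a j"] ar[of j] x in auto)
    have s: "summable (\<lambda>j. C j * (\<omega> x * (norm v * norm v)))" by (intro summable_mult2 Cs)
    have s': "summable (\<lambda>j. \<bar>?f2 j v v x\<bar>)" by (rule summable_comparison_test'[OF s]) (use b in auto)
    have "\<bar>dd (dd \<epsilon> v) v x\<bar> \<le> (\<Sum>j. \<bar>?f2 j v v x\<bar>)" unfolding eq2 using s' by (rule summable_rabs)
    also have "\<dots> \<le> (\<Sum>j. C j * (\<omega> x * (norm v * norm v)))" by (intro suminf_le b s s')
    also have "\<dots> = \<omega> x * (norm v)\<^sup>2" using suminf_mult2[OF Cs, of "\<omega> x * (norm v * norm v)"] C1 by (simp add: power2_eq_square)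
    finally show ?thesis .
  qed
  ultimately show ?thesis using that by blast
qed

lemma convex_gradient_inequality:
  fixes f :: "'a::euclidean_space \<Rightarrow> real"
  assumes f: "convex_on S f" and x: "x \<in> S" and y: "y \<in> S" and d: "f differentiable (at x)"
  shows "f x + dd f (y - x) x \<le> f y"
proof -
  let ?p = "\<lambda>t. f (x + t *\<^sub>R (y - x))"
  have "(?p has_real_derivative dd f (y - x) (x + 0 *\<^sub>R (y - x))) (at 0)"
    by (rule has_derivative_on_line) (use d in simp)
  then have "((\<lambda>h. (?p (0 + h) - ?p 0) / h) \<longlongrightarrow> dd f (y - x) x) (at 0)" by (simp add: DERIV_def)
  then have "((\<lambda>h. (?p (0 + h) - ?p 0) / h) \<longlongrightarrow> dd f (y - x) x) (at_right 0)"
    by (rule filterlim_mono) (auto simp: at_within_le_at)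
  moreover have "\<forall>\<^sub>F h in at_right 0. (?p (0 + h) - ?p 0) / h \<le> f y - f x"
    unfolding eventually_at_right_field
  proof (intro exI[of _ 1] conjI allI impI)
    fix h :: real assume h: "0 < h" "h < 1"
    have "x + h *\<^sub>R (y - x) = (1 - h) *\<^sub>R x + h *\<^sub>R y" by (simp add: algebra_simps)
    then have "f (x + h *\<^sub>R (y - x)) \<le> (1 - h) * f x + h * f y"
      using convex_onD[OF f, of h x y] h x y by simp
    then have "?p (0 + h) - ?p 0 \<le> (f y - f x) * h" by (simp add: algebra_simps)
    then show "(?p (0 + h) - ?p 0) / h \<le> f y - f x" using h by (simp add: pos_divide_le_eq)
  qed simp
  ultimately have "dd f (y - x) x \<le> f y - f x"
    by (intro tendsto_upperbound) auto
  then show ?thesis by simp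
qed

text \<open>The tangent affine function minus \<open>f\<close> has a maximum at \<open>x\<close>, by
  the gradient inequality.\<close>

lemma convex_second_derivative:
  fixes f :: "real^'n \<Rightarrow> real"
  assumes f: "convex_on (ball x r) f" and r: "r > 0" and C: "Ck 2 (ball x r) f"
  shows "dd (dd f v) v x \<ge> 0"
proof -
  have x: "x \<in> ball x r" using r by simp
  have d: "f differentiable (at x)" using Ck_2D(1)[OF C x] .
  define h where "h = (\<lambda>y. quad 0 (grad f x) (f x - grad f x \<bullet> x) y + (- 1) * f y)"
  have S0: "(0::real^'n^'n) \<in> Sym" by (auto simp: Sym_def transpose_def vec_eq_iff)
  have "dd (dd h v) v x \<le> 0"
  proof (rule second_derivative_max[OF open_ball x _ r])
    show "Ck 2 (ball x r) h" unfolding h_def by (intro Ck_add Ck_quad Ck_cmult C open_ball)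
    show "h y \<le> h x" if "dist y x < r" for y
      using convex_gradient_inequality[OF f x _ d, of y] that
      by (simp add: h_def quad_def dd_grad[OF d] inner_diff_right dist_commute)
  qed
  moreover have "dd (dd h v) v x = 0 + (- 1) * dd (dd f v) v x"
    unfolding h_def
    by (subst dd2_add[OF open_ball x Ck_quad Ck_cmult]) (auto simp: C dd_quad(2)[OF S0] dd2_cmult[OF open_ball x C, of "-1", simplified])
  ultimately show ?thesis by simp
qed

text \<open>Convexity near a point makes the second derivatives there nonnegative, and that
  condition is pointwise. So type P on all of \<open>X\<close> follows from estimates on small balls
  of varying size.\<close>

lemma C2_locally_convex_Pfun:
  fixes f :: "real^'n \<Rightarrow> real"
  assumes X: "open X" and C: "Ck 2 X f" and "\<And>x. x \<in> X \<Longrightarrow> \<exists>r>0. convex_on (ball x r) f"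
  shows "Pfun X f"
proof (rule C2_PSD_Pfun[OF X C])
  fix x v assume x: "x \<in> X"
  obtain r where r: "r > 0" "convex_on (ball x r) f" using assms(3)[OF x] by blast
  obtain s where s: "s > 0" "ball x s \<subseteq> X" using X x open_contains_ball by blast
  show "0 \<le> dd (dd f v) v x"
  proof (rule convex_second_derivative)
    show "convex_on (ball x (min r s)) f" using r(2) by (rule convex_on_subset) auto
    show "Ck 2 (ball x (min r s)) f" using C s by (elim Ck_subset) auto
  qed (use r s in simp)
qed

text \<open>The second derivative test comes from type P: such a function is of type P on the ball,
  and functions of type P are convex on balls.\<close>

lemma C2_PSD_convex_on_ball:
  fixes f :: "real^'n \<Rightarrow> real"
  assumes "Ck 2 (ball x r) f" "\<And>y v. y \<in> ball x r \<Longrightarrow> dd (dd f v) v y \<ge> 0"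
  shows "convex_on (ball x r) f"
  by (rule Pfun_convex_on_ball[OF open_ball C2_PSD_Pfun[OF open_ball assms]]) auto

section \<open>Semiconvexity and the local Lipschitz scale\<close>

lemma quad_scaled_norm: "quad (c *\<^sub>R mat 1) 0 0 x = c * (norm x)\<^sup>2"
  by (simp add: quad_def scaleR_matrix_vector_assoc[symmetric] power2_norm_eq_inner)

lemma scaled_id_Sym: "c *\<^sub>R mat 1 \<in> Sym"
  by (auto simp: Sym_def transpose_def vec_eq_iff mat_def)

lemma C2_semiconvex_on_ball:
  fixes f :: "real^'n \<Rightarrow> real"
  assumes C: "Ck 2 (ball x r) f" and b: "\<And>y v. y \<in> ball x r \<Longrightarrow> dd (dd f v) v y \<ge> - M * (norm v)\<^sup>2"
  shows "convex_on (ball x r) (\<lambda>x. M / 2 * (norm x)\<^sup>2 + f x)"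
proof (rule C2_PSD_convex_on_ball)
  let ?q = "quad ((M / 2) *\<^sub>R mat 1) 0 0 :: real^'n \<Rightarrow> real"
  have eq: "(\<lambda>x. M / 2 * (norm x)\<^sup>2 + f x) = (\<lambda>x. ?q x + f x)" by (simp only: quad_scaled_norm)
  show "Ck 2 (ball x r) (\<lambda>x. M / 2 * (norm x)\<^sup>2 + f x)" unfolding eq by (intro Ck_add Ck_quad C open_ball)
  fix y v assume y: "y \<in> ball x r"
  have "dd (dd (\<lambda>x. ?q x + f x) v) v y = M * (norm v)\<^sup>2 + dd (dd f v) v y"
    unfolding dd2_add[OF open_ball y Ck_quad[OF open_ball] C] dd_quad(2)[OF scaled_id_Sym]
    by (simp add: scaleR_matrix_vector_assoc[symmetric] power2_norm_eq_inner)
  then show "dd (dd (\<lambda>x. M / 2 * (norm x)\<^sup>2 + f x) v) v y \<ge> 0" unfolding eq using b[OF y, of v] by simp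
qed

text \<open>One number \<open>s\<close> controls both the room inside \<open>X\<close> and the size
  of a Lipschitz constant, through 1/s; decreasing \<open>s\<close> weakens both demands. A single
  function of the point can therefore govern the mollification radius.\<close>

definition lipscale :: "'a::euclidean_space set \<Rightarrow> ('a \<Rightarrow> real) \<Rightarrow> 'a \<Rightarrow> real \<Rightarrow> bool" where
  "lipscale X f x s \<longleftrightarrow> ball x (2 * s) \<subseteq> X \<and> (\<forall>a\<in>ball x (2 * s). \<forall>b\<in>ball x (2 * s). \<bar>f a - f b\<bar> \<le> 1 / s * dist a b)"

lemma lipscale_shift:
  assumes P: "lipscale X f x s" and s: "0 < s'" "s' + dist x y \<le> s"
  shows "lipscale X f y s'"
proof -
  have sub: "ball y (2 * s') \<subseteq> ball x (2 * s)"
  proof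
    fix z assume "z \<in> ball y (2 * s')"
    then have "dist x z < dist x y + 2 * s'" using dist_triangle[of x z y] by simp
    also have "\<dots> \<le> 2 * s" using s zero_le_dist[of x y] by linarith
    finally show "z \<in> ball x (2 * s)" by simp
  qed
  have ss: "s' \<le> s" using s zero_le_dist[of x y] by linarith
  have "\<bar>f a - f b\<bar> \<le> 1 / s' * dist a b" if "a \<in> ball y (2 * s')" "b \<in> ball y (2 * s')" for a b
  proof -
    have "\<bar>f a - f b\<bar> \<le> 1 / s * dist a b" using P sub that unfolding lipscale_def by blast
    also have "\<dots> \<le> 1 / s' * dist a b" using s ss by (intro mult_right_mono divide_left_mono) auto
    finally show ?thesis .
  qed
  then show ?thesis using P sub unfolding lipscale_def by blast
qed

lemma lipscale_exists:
  fixes f :: "'a::euclidean_space \<Rightarrow> real"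
  assumes X: "open X" "x \<in> X" and conv: "\<And>x r. ball x r \<subseteq> X \<Longrightarrow> convex_on (ball x r) f"
  shows "\<exists>s. 0 < s \<and> s \<le> 1 \<and> lipscale X f x s"
proof -
  obtain R0 where R0: "R0 > 0" "ball x R0 \<subseteq> X" using X open_contains_ball by blast
  define R where "R = R0 / 2"
  have R: "R > 0" "cball x R \<subseteq> ball x R0" using R0 by (auto simp: R_def)
  have c: "convex_on (cball x R) f" using conv[OF R0(2)] R(2) by (rule convex_on_subset) auto
  have "continuous_on (ball x R0) f" using conv[OF R0(2)] by (rule convex_on_continuous[OF open_ball])
  then have "compact (f ` cball x R)" using R(2) continuous_on_subset compact_continuous_image compact_cball by blast
  then obtain B where B: "\<And>y. y \<in> cball x R \<Longrightarrow> \<bar>f y\<bar> \<le> B"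
    using compact_imp_bounded bounded_iff by (metis imageI real_norm_def)
  define L where "L = 4 * B / R"
  have lip: "\<bar>f a - f b\<bar> \<le> L * dist a b" if "a \<in> cball x (R / 2)" "b \<in> cball x (R / 2)" for a b
    unfolding L_def by (rule convex_lipschitz_half_ball[OF c R(1) B that])
  \<comment> \<open>R / 4 keeps the ball of radius 2s in the half ball where \<open>lip\<close>
    holds; 1 / (|L| + 1) makes 1/s exceed the Lipschitz constant.\<close>
  define s where "s = min 1 (min (R / 4) (1 / (\<bar>L\<bar> + 1)))"
  have s: "0 < s" "s \<le> 1" "2 * s \<le> R / 2" "s \<le> 1 / (\<bar>L\<bar> + 1)" using R by (auto simp: s_def)
  have "s * (\<bar>L\<bar> + 1) \<le> 1" using s(4) by (simp add: pos_le_divide_eq)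
  then have "\<bar>L\<bar> + 1 \<le> 1 / s" using s(1) by (simp add: pos_le_divide_eq mult.commute)
  then have Ls: "L \<le> 1 / s" by linarith
  have sub: "ball x (2 * s) \<subseteq> cball x (R / 2)" using s by auto
  have "lipscale X f x s" unfolding lipscale_def
  proof (intro conjI ballI)
    show "ball x (2 * s) \<subseteq> X" using s R R0 by (auto simp: subset_iff R_def)
    fix a b assume "a \<in> ball x (2 * s)" "b \<in> ball x (2 * s)"
    then have "\<bar>f a - f b\<bar> \<le> L * dist a b" using lip sub by blast
    also have "\<dots> \<le> 1 / s * dist a b" using Ls by (intro mult_right_mono) auto
    finally show "\<bar>f a - f b\<bar> \<le> 1 / s * dist a b" .
  qed
  then show ?thesis using s by blast
qed

text \<open>The supremum of the admissible scales is 1-Lipschitz by \<open>lipscale_shift\<close>. A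
  quarter of it is taken: twice that is half the supremum, hence admissible, and the Lipschitz
  constant drops to 1/4, which keeps \<omega> nearly constant on balls of radius \<omega>.\<close>

lemma lipscale_function:
  fixes f :: "'a::euclidean_space \<Rightarrow> real"
  assumes X: "open X" and conv: "\<And>x r. ball x r \<subseteq> X \<Longrightarrow> convex_on (ball x r) f"
  obtains \<omega> where "continuous_on X \<omega>" "\<And>x. x \<in> X \<Longrightarrow> 0 < \<omega> x \<and> lipscale X f x (2 * \<omega> x)"
    "\<And>x y. x \<in> X \<Longrightarrow> y \<in> X \<Longrightarrow> \<bar>\<omega> x - \<omega> y\<bar> \<le> dist x y / 4"
proof -
  define A where "A = (\<lambda>x. {s. 0 < s \<and> s \<le> 1 \<and> lipscale X f x s})"
  have ne: "A x \<noteq> {}" if "x \<in> X" for x using lipscale_exists[OF X that conv] by (auto simp: A_def)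
  have bdd: "bdd_above (A x)" for x by (intro bdd_aboveI[of _ 1]) (auto simp: A_def)
  define \<omega> where "\<omega> = (\<lambda>x. Sup (A x) / 4)"
  have pos: "0 < Sup (A x)" if x: "x \<in> X" for x
  proof -
    obtain s where "s \<in> A x" using ne[OF x] by blast
    then have "s \<le> Sup (A x)" "0 < s" using bdd by (auto intro: cSup_upper simp: A_def)
    then show ?thesis by linarith
  qed
  have 1: "0 < \<omega> x \<and> lipscale X f x (2 * \<omega> x)" if x: "x \<in> X" for x
  proof -
    have "Sup (A x) / 2 < Sup (A x)" using pos[OF x] by simp
    then obtain s where s: "s \<in> A x" "Sup (A x) / 2 < s" using less_cSup_iff[OF ne[OF x] bdd] by blast
    have "lipscale X f x (2 * \<omega> x)"
      by (rule lipscale_shift[of _ _ x s]) (use s pos[OF x] in \<open>auto simp: \<omega>_def A_def\<close>)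
    then show ?thesis using pos[OF x] by (simp add: \<omega>_def)
  qed
  have le: "Sup (A x) \<le> Sup (A y) + dist x y" if "x \<in> X" "y \<in> X" for x y
  proof (rule cSup_least[OF ne[OF that(1)]])
    fix s assume s: "s \<in> A x"
    show "s \<le> Sup (A y) + dist x y"
    proof (cases "s \<le> dist x y")
      case True
      then show ?thesis using pos[OF that(2)] by simp
    next
      case False
      have "lipscale X f x s" using s by (simp add: A_def)
      then have "lipscale X f y (s - dist x y)" by (rule lipscale_shift) (use False in auto)
      then have "s - dist x y \<in> A y" using s False by (auto simp: A_def intro: order_trans[of _ s])
      then have "s - dist x y \<le> Sup (A y)" by (rule cSup_upper[OF _ bdd])
      then show ?thesis by simp
    qed
  qed
  have 2: "\<bar>\<omega> x - \<omega> y\<bar> \<le> dist x y / 4" if "x \<in> X" "y \<in> X" for x y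
    using le[OF that] le[OF that(2,1)] unfolding \<omega>_def dist_commute[of y x] by linarith
  have "continuous_on X \<omega>"
    unfolding continuous_on_iff
  proof (intro ballI allI impI)
    fix x e assume "x \<in> X" "(0::real) < e"
    then show "\<exists>d>0. \<forall>x'\<in>X. dist x' x < d \<longrightarrow> dist (\<omega> x') (\<omega> x) < e"
      using 2 by (intro exI[of _ e]) (fastforce simp: dist_real_def)
  qed
  then show ?thesis using that 1 2 by blast
qed

text \<open>Mollifying with a variable radius \<open>\<delta> \<epsilon>(x)\<close> costs at most \<open>\<delta>\<close> of convexity, since \<open>\<epsilon>\<close> and its second
  derivatives are small compared with the local Lipschitz scale; the quadratic term restores it.\<close>
lemma Pfun_C2_approximation:
  fixes f :: "real^'n \<Rightarrow> real"
  assumes X: "open X" "X \<noteq> {}" and P: "Pfun X f"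
  shows "\<exists>fs. (\<forall>k. Ck 2 X (fs k) \<and> Pfun X (fs k)) \<and>
    (\<forall>K. compact K \<and> K \<subseteq> X \<longrightarrow> uniform_limit K fs f sequentially)"
proof -
  have conv: "convex_on (ball x r) f" if "ball x r \<subseteq> X" for x r using Pfun_convex_on_ball[OF X(1) P that] .
  obtain \<omega> where \<omega>: "continuous_on X \<omega>" "\<And>x. x \<in> X \<Longrightarrow> 0 < \<omega> x \<and> lipscale X f x (2 * \<omega> x)"
    "\<And>x y. x \<in> X \<Longrightarrow> y \<in> X \<Longrightarrow> \<bar>\<omega> x - \<omega> y\<bar> \<le> dist x y / 4"
    using lipscale_function[OF X(1) conv] by blast
  obtain \<epsilon> where \<epsilon>: "Ck 2 UNIV \<epsilon>" "\<And>x. x \<in> X \<Longrightarrow> 0 < \<epsilon> x \<and> \<epsilon> x \<le> \<omega> x"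
    "\<And>x v. x \<in> X \<Longrightarrow> \<bar>dd (dd \<epsilon> v) v x\<bar> \<le> \<omega> x * (norm v)\<^sup>2"
    using small_C2_function[OF X \<omega>(1)] \<omega>(2) by blast
  have sub: "ball x (4 * \<omega> x) \<subseteq> X" and lip: "\<And>a b. a \<in> ball x (4 * \<omega> x) \<Longrightarrow> b \<in> ball x (4 * \<omega> x) \<Longrightarrow> \<bar>f a - f b\<bar> \<le> 1 / (2 * \<omega> x) * dist a b"
    if "x \<in> X" for x using \<omega>(2)[OF that] by (auto simp: lipscale_def)
  have fc: "continuous_on X f"
  proof -
    have "isCont f x" if x: "x \<in> X" for x
    proof -
      obtain r where "r > 0" "ball x r \<subseteq> X" using X x open_contains_ball by blast
      then show ?thesis using convex_on_continuous[OF open_ball conv] continuous_on_eq_continuous_at[OF open_ball]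
        by (metis centre_in_ball)
    qed
    then show ?thesis by (simp add: continuous_at_imp_continuous_on)
  qed
  define F where "F = (\<lambda>\<delta> x. moll f (\<delta> * \<epsilon> x) x + \<delta> / 2 * (norm x)\<^sup>2)"
  have e4: "cball x (\<delta> * \<epsilon> x) \<subseteq> ball x (4 * \<omega> x)" if "x \<in> X" "0 < \<delta>" "\<delta> \<le> 1" for x \<delta>
  proof -
    have "\<delta> * \<epsilon> x \<le> 1 * \<omega> x" using that \<epsilon>(2)[OF that(1)] by (intro mult_mono) auto
    then show ?thesis using \<omega>(2)[OF that(1)] by auto
  qed
  have FC: "Ck 2 X (F \<delta>)" if \<delta>: "0 < \<delta>" "\<delta> \<le> 1" for \<delta>
  proof -
    have "Ck 2 X (\<lambda>x. moll f (\<delta> * \<epsilon> x) x)"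
    proof (rule Ck_moll[OF X(1) _ _ X(1) fc])
      show "Ck 2 X (\<lambda>x. \<delta> * \<epsilon> x)" using \<epsilon>(1) X(1) by (intro Ck_cmult) (auto intro: Ck_subset)
      show "\<delta> * \<epsilon> x > 0" if "x \<in> X" for x using \<epsilon>(2)[OF that] \<delta> by simp
      show "cball x (\<delta> * \<epsilon> x) \<subseteq> X" if "x \<in> X" for x using e4[OF that \<delta>] sub[OF that] by blast
    qed
    moreover have "Ck 2 X (\<lambda>x. \<delta> / 2 * (norm x)\<^sup>2)"
      using Ck_quad[OF X(1), of 2 "(\<delta> / 2) *\<^sub>R mat 1" 0 0] by (simp add: quad_scaled_norm[abs_def])
    ultimately show ?thesis unfolding F_def by (intro Ck_add X(1))
  qed
  have FP: "Pfun X (F \<delta>)" if \<delta>: "0 < \<delta>" "\<delta> \<le> 1" for \<delta>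
  proof (rule C2_locally_convex_Pfun[OF X(1) FC[OF \<delta>]])
    fix x0 assume x0: "x0 \<in> X"
    define w where "w = \<omega> x0"
    have w: "w > 0" using \<omega>(2)[OF x0] by (simp add: w_def)
    have B: "ball x0 w \<subseteq> X" using sub[OF x0] w by (auto simp: w_def subset_iff)
    \<comment> \<open>The 1/4-Lipschitz bound for \<omega> gives this factor throughout the ball of
      radius \<open>w\<close>.\<close>
    have wx: "\<omega> x \<le> 5 / 4 * w" if "x \<in> ball x0 w" for x
    proof -
      have "x \<in> X" using B that by blast
      from \<omega>(3)[OF x0 this] have "\<omega> x - \<omega> x0 \<le> dist x0 x / 4" by linarith
      then show ?thesis using that by (simp add: w_def)
    qed
    have \<delta>C: "Ck 2 (ball x0 w) (\<lambda>x. \<delta> * \<epsilon> x)" using \<epsilon>(1) by (intro Ck_cmult open_ball) (auto intro: Ck_subset)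
    \<comment> \<open>With Lipschitz constant 1/(2w) for \<open>f\<close>, the product of the two is
      5\<delta>/8, within the \<delta> that the quadratic term provides. The ball of radius 4w has
      room for w plus the mollification radius, at most 5w/4.\<close>
    define M where "M = \<delta> * (5 / 4 * w)"
    have hb: "\<bar>dd (dd (\<lambda>x. \<delta> * \<epsilon> x) v) v y\<bar> \<le> M * (norm v)\<^sup>2" if y: "y \<in> ball x0 w" for y v
    proof -
      have "\<bar>dd (dd (\<lambda>x. \<delta> * \<epsilon> x) v) v y\<bar> = \<delta> * \<bar>dd (dd \<epsilon> v) v y\<bar>"
        using \<delta> dd2_cmult[OF open_UNIV _ \<epsilon>(1), of y \<delta> v v] by (simp add: abs_mult)
      also have "\<dots> \<le> \<delta> * ((5 / 4 * w) * (norm v)\<^sup>2)"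
        using \<epsilon>(3)[of y v] B y wx[OF y] \<delta> mult_right_mono[of "\<omega> y" "5 / 4 * w" "(norm v)\<^sup>2"]
        by (intro mult_left_mono) force+
      finally show ?thesis by (simp add: M_def mult_ac)
    qed
    have "convex_on (ball x0 w) (F \<delta>)" unfolding F_def
    proof (rule moll_semiconvex[where R = "4 * w" and L = "1 / (2 * w)" and M = M])
      show "\<delta> * \<epsilon> x \<ge> 0" if "x \<in> ball x0 w" for x using \<epsilon>(2) B that \<delta> by (meson less_imp_le mult_nonneg_nonneg subsetD)
      show "x + (\<delta> * \<epsilon> x) *\<^sub>R y \<in> ball x0 (4 * w)" if x: "x \<in> ball x0 w" and y: "norm y \<le> 1" for x y
      proof -
        have xX: "x \<in> X" using x B by blast
        have e0: "0 < \<epsilon> x" "\<epsilon> x \<le> 5 / 4 * w" using \<epsilon>(2)[OF xX] wx[OF x] by auto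
        have "\<delta> * \<epsilon> x \<le> 1 * (5 / 4 * w)" by (rule mult_mono[OF \<delta>(2) e0(2)]) (use e0 \<delta> in auto)
        moreover have "\<bar>\<delta> * \<epsilon> x\<bar> = \<delta> * \<epsilon> x" using e0 \<delta> by simp
        ultimately have "norm ((\<delta> * \<epsilon> x) *\<^sub>R y) \<le> (1 * (5 / 4 * w)) * 1"
          unfolding norm_scaleR by (intro mult_mono y) (use w in auto)
        moreover have "dist x0 (x + (\<delta> * \<epsilon> x) *\<^sub>R y) \<le> dist x0 x + norm ((\<delta> * \<epsilon> x) *\<^sub>R y)"
          using dist_triangle[of x0 "x + (\<delta> * \<epsilon> x) *\<^sub>R y" x] by (simp add: dist_norm)
        ultimately show ?thesis using x w by simp
      qed
      show "convex_on (ball x0 (4 * w)) f" using conv[OF sub[OF x0]] by (simp add: w_def)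
      show "\<bar>f a - f b\<bar> \<le> 1 / (2 * w) * dist a b" if "a \<in> ball x0 (4 * w)" "b \<in> ball x0 (4 * w)" for a b
        using lip[OF x0] that by (simp add: w_def)
      show "convex_on (ball x0 w) (\<lambda>x. M / 2 * (norm x)\<^sup>2 + \<delta> * \<epsilon> x)"
      proof (rule C2_semiconvex_on_ball[OF \<delta>C])
        show "- M * (norm v)\<^sup>2 \<le> dd (dd (\<lambda>x. \<delta> * \<epsilon> x) v) v y" if "y \<in> ball x0 w" for y v
          using hb[OF that, of v] by (simp add: abs_le_iff)
      qed
      have "convex_on (ball x0 w) (\<lambda>x. M / 2 * (norm x)\<^sup>2 + (- 1) * (\<delta> * \<epsilon> x))"
      proof (rule C2_semiconvex_on_ball)
        show "Ck 2 (ball x0 w) (\<lambda>x. (- 1) * (\<delta> * \<epsilon> x))" by (intro Ck_cmult[OF open_ball \<delta>C])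
        show "- M * (norm v)\<^sup>2 \<le> dd (dd (\<lambda>x. (- 1) * (\<delta> * \<epsilon> x)) v) v y" if "y \<in> ball x0 w" for y v
          unfolding dd2_cmult[OF open_ball that \<delta>C] using hb[OF that, of v] by (simp add: abs_le_iff)
      qed
      then show "convex_on (ball x0 w) (\<lambda>x. M / 2 * (norm x)\<^sup>2 - \<delta> * \<epsilon> x)" by simp
      show "1 / (2 * w) * M \<le> \<delta>" using w \<delta> by (simp add: M_def)
    qed (use w in simp)
    then show "\<exists>r>0. convex_on (ball x0 r) (F \<delta>)" using w by blast
  qed
  have Fclose: "\<bar>F \<delta> x - f x\<bar> \<le> \<delta> * (1 + (norm x)\<^sup>2)" if x: "x \<in> X" and \<delta>: "0 < \<delta>" "\<delta> \<le> 1" for x \<delta>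
  proof -
    have "\<bar>moll f (\<delta> * \<epsilon> x) x - f x\<bar> \<le> \<delta>"
    proof (rule moll_close)
      show "continuous_on (cball x (\<delta> * \<epsilon> x)) f" using fc e4[OF x \<delta>] sub[OF x] continuous_on_subset by blast
      show "\<delta> * \<epsilon> x \<ge> 0" using \<epsilon>(2)[OF x] \<delta> by simp
      fix z assume z: "z \<in> cball x (\<delta> * \<epsilon> x)"
      have w: "\<omega> x > 0" using \<omega>(2)[OF x] by simp
      have "\<bar>f z - f x\<bar> \<le> 1 / (2 * \<omega> x) * dist z x" using z e4[OF x \<delta>] w by (intro lip[OF x]) auto
      also have "\<dots> \<le> 1 / (2 * \<omega> x) * (\<delta> * \<omega> x)"
      proof (rule mult_left_mono)
        have "dist z x \<le> \<delta> * \<epsilon> x" using z by (simp add: dist_commute)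
        also have "\<dots> \<le> \<delta> * \<omega> x" using \<epsilon>(2)[OF x] \<delta> by (intro mult_left_mono) auto
        finally show "dist z x \<le> \<delta> * \<omega> x" .
      qed (use w in simp)
      also have "\<dots> \<le> \<delta>" using w \<delta> by simp
      finally show "\<bar>f z - f x\<bar> \<le> \<delta>" .
    qed
    moreover define q where "q = \<delta> * (norm x)\<^sup>2"
    moreover have "0 \<le> q" using \<delta> by (simp add: q_def)
    moreover have "F \<delta> x = moll f (\<delta> * \<epsilon> x) x + q / 2" by (simp add: F_def q_def)
    moreover have "\<delta> * (1 + (norm x)\<^sup>2) = \<delta> + q" by (simp add: q_def distrib_left)
    ultimately show ?thesis by linarith
  qed
  define fs where "fs = (\<lambda>k. F (1 / real (Suc k)))"
  have d: "0 < 1 / real (Suc k)" "1 / real (Suc k) \<le> 1" for k by auto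
  have "uniform_limit K fs f sequentially" if K: "compact K" "K \<subseteq> X" for K
  proof (rule uniform_limitI)
    fix e :: real assume e: "e > 0"
    obtain B where B: "B > 0" "\<And>x. x \<in> K \<Longrightarrow> norm x \<le> B" using compact_imp_bounded[OF K(1)] bounded_pos by metis
    have "(\<lambda>k. 1 / real (Suc k) * (1 + B\<^sup>2)) \<longlonglongrightarrow> 0 * (1 + B\<^sup>2)"
      using LIMSEQ_inverse_real_of_nat by (intro tendsto_mult_right) (simp add: divide_inverse)
    then have "\<forall>\<^sub>F k in sequentially. 1 / real (Suc k) * (1 + B\<^sup>2) < e"
      using e by (intro order_tendstoD) auto
    then show "\<forall>\<^sub>F k in sequentially. \<forall>x\<in>K. dist (fs k x) (f x) < e"
    proof eventually_elim
      case (elim k)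
      show ?case
      proof
        fix x assume x: "x \<in> K"
        have "\<bar>fs k x - f x\<bar> \<le> 1 / real (Suc k) * (1 + (norm x)\<^sup>2)"
          unfolding fs_def using x K by (intro Fclose d) auto
        also have "\<dots> \<le> 1 / real (Suc k) * (1 + B\<^sup>2)"
          using B(2)[OF x] by (intro mult_left_mono add_left_mono power_mono) auto
        finally show "dist (fs k x) (f x) < e" using elim by (simp add: dist_real_def)
      qed
    qed
  qed
  then show ?thesis using FC[OF d] FP[OF d] by (intro exI[of _ fs]) (auto simp: fs_def)
qed

section \<open>A change of variables formula\<close>

text \<open>The change of variables theorem of the library needs a well-ordered index type; \<open>'n idx\<close> is a
  well-ordered copy of an arbitrary finite type.\<close>
typedef ('a::finite) idx = "{..<CARD('a)}"
  by (rule exI[of _ 0]) simp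

instantiation idx :: (finite) wellorder
begin
definition "x \<le> y \<longleftrightarrow> Rep_idx x \<le> Rep_idx y"
definition "x < y \<longleftrightarrow> Rep_idx x < Rep_idx y"
instance
proof
  fix P :: "'a idx \<Rightarrow> bool" and a
  assume *: "\<And>x. (\<And>y. y < x \<Longrightarrow> P y) \<Longrightarrow> P x"
  show "P a"
    by (induction "Rep_idx a" arbitrary: a rule: less_induct) (auto intro: * simp: less_idx_def)
qed (auto simp: less_eq_idx_def less_idx_def Rep_idx_inject)
end

lemma UNIV_idx: "(UNIV :: 'a::finite idx set) = Abs_idx ` {..<CARD('a)}"
  by (metis Abs_idx_cases UNIV_eq_I image_eqI)

instance idx :: (finite) finite
  by standard (simp add: UNIV_idx)

lemma card_idx: "CARD('a::finite idx) = CARD('a)"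
  unfolding UNIV_idx by (subst card_image) (auto simp: inj_on_def Abs_idx_inject)

lemma idx_bijection: "\<exists>\<sigma> :: 'a::finite idx \<Rightarrow> 'a. bij \<sigma>"
  using finite_same_card_bij[of "UNIV :: 'a idx set" "UNIV :: 'a set"] by (simp add: card_idx)

text \<open>Induction over transpositions: conjugation by \<sigma> turns the transposition of a and
  b into that of their preimages.\<close>

lemma sign_conjugate:
  fixes \<sigma> :: "'m::finite \<Rightarrow> 'n::finite"
  assumes s: "bij \<sigma>" and p: "p permutes (UNIV :: 'n set)"
  shows "sign (inv \<sigma> \<circ> p \<circ> \<sigma>) = sign p"
  using p finite
proof (induction rule: permutes_induct)
  case id
  then show ?case using s by (simp add: bij_is_inj)
next
  case (swap a b p)
  have i: "\<sigma> (inv \<sigma> x) = x" "inv \<sigma> (\<sigma> y) = y" for x y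
    using s by (auto simp: bij_is_surj surj_f_inv_f bij_is_inj)
  have "inv \<sigma> \<circ> (Transposition.transpose a b \<circ> p) \<circ> \<sigma>
      = Transposition.transpose (inv \<sigma> a) (inv \<sigma> b) \<circ> (inv \<sigma> \<circ> p \<circ> \<sigma>)"
  proof
    fix y
    have "inv \<sigma> (Transposition.transpose a b z) = Transposition.transpose (inv \<sigma> a) (inv \<sigma> b) (inv \<sigma> z)" for z
      using i(1) by (metis Transposition.transpose_def)
    then show "(inv \<sigma> \<circ> (Transposition.transpose a b \<circ> p) \<circ> \<sigma>) y = (Transposition.transpose (inv \<sigma> a) (inv \<sigma> b) \<circ> (inv \<sigma> \<circ> p \<circ> \<sigma>)) y"
      by simp
  qed
  moreover have "permutation (inv \<sigma> \<circ> p \<circ> \<sigma>)"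
  proof -
    have "bij (inv \<sigma> \<circ> p \<circ> \<sigma>)"
      using s permutes_bij[OF swap(4)] by (intro bij_comp bij_imp_bij_inv)
    then show ?thesis by (simp add: permutation)
  qed
  moreover have "permutation p" using swap(4) by (rule permutes_imp_permutation[OF finite])
  moreover have "inv \<sigma> a \<noteq> inv \<sigma> b" using swap(3) i(1) by metis
  ultimately show ?case using swap(3,5)
    by (simp only: sign_compose permutation_swap_id sign_swap_id if_False)
qed

lemma det_reindex:
  fixes A :: "real^'n^'n" and \<sigma> :: "'m::finite \<Rightarrow> 'n"
  assumes s: "bij \<sigma>"
  shows "det (\<chi> i j. A $ \<sigma> i $ \<sigma> j :: real^'m^'m) = det A"
proof -
  have i: "\<sigma> (inv \<sigma> x) = x" "inv \<sigma> (\<sigma> y) = y" for x y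
    using s by (auto simp: bij_is_surj surj_f_inv_f bij_is_inj)
  have "det A = (\<Sum>p\<in>{p. p permutes (UNIV::'n set)}. of_int (sign p) * (\<Prod>i\<in>UNIV. A $ i $ p i))"
    by (simp add: det_def)
  also have "\<dots> = (\<Sum>p\<in>{p. p permutes (UNIV::'n set)}. of_int (sign (inv \<sigma> \<circ> p \<circ> \<sigma>)) *
      (\<Prod>i\<in>(UNIV::'m set). A $ \<sigma> i $ \<sigma> ((inv \<sigma> \<circ> p \<circ> \<sigma>) i)))"
  proof (rule sum.cong[OF refl])
    fix p assume p: "p \<in> {p. p permutes (UNIV::'n set)}"
    have "(\<Prod>i\<in>UNIV. A $ i $ p i) = (\<Prod>i\<in>UNIV. A $ \<sigma> i $ p (\<sigma> i))"
      by (rule prod.reindex_bij_betw[OF s, symmetric])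
    then show "of_int (sign p) * (\<Prod>i\<in>UNIV. A $ i $ p i) = of_int (sign (inv \<sigma> \<circ> p \<circ> \<sigma>)) *
      (\<Prod>i\<in>(UNIV::'m set). A $ \<sigma> i $ \<sigma> ((inv \<sigma> \<circ> p \<circ> \<sigma>) i))"
      using sign_conjugate[OF s] p by (simp add: i)
  qed
  also have "\<dots> = (\<Sum>q\<in>{q. q permutes (UNIV::'m set)}. of_int (sign q) * (\<Prod>i\<in>UNIV. A $ \<sigma> i $ \<sigma> (q i)))"
  proof (rule sum.reindex_bij_witness[where j = "\<lambda>p. inv \<sigma> \<circ> p \<circ> \<sigma>" and i = "\<lambda>q. \<sigma> \<circ> q \<circ> inv \<sigma>"])
    fix p assume "p \<in> {p. p permutes (UNIV::'n set)}"
    then have "bij p" by (simp add: permutes_bij)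
    then show "inv \<sigma> \<circ> p \<circ> \<sigma> \<in> {q. q permutes UNIV}"
      using s by (auto intro!: bij_imp_permutes bij_comp bij_imp_bij_inv)
    show "\<sigma> \<circ> (inv \<sigma> \<circ> p \<circ> \<sigma>) \<circ> inv \<sigma> = p" by (simp add: fun_eq_iff i)
  next
    fix q assume "q \<in> {q. q permutes (UNIV::'m set)}"
    then have "bij q" by (simp add: permutes_bij)
    then show "\<sigma> \<circ> q \<circ> inv \<sigma> \<in> {q. q permutes UNIV}"
      using s by (auto intro!: bij_imp_permutes bij_comp bij_imp_bij_inv)
    show "inv \<sigma> \<circ> (\<sigma> \<circ> q \<circ> inv \<sigma>) \<circ> \<sigma> = q" by (simp add: fun_eq_iff i)
  qed simp
  finally show ?thesis by (simp add: det_def)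
qed

section \<open>Compactly supported integrands and relabelling of coordinates\<close>

lemma compact_subset_cbox:
  fixes K :: "'a::euclidean_space set"
  assumes "compact K"
  obtains a b where "K \<subseteq> cbox a b"
  using bounded_subset_cbox_symmetric[OF compact_imp_bounded[OF assms]] by metis

lemma has_integral_compact_support:
  fixes f :: "'a::euclidean_space \<Rightarrow> real"
  assumes "continuous_on UNIV f" "\<And>x. x \<notin> cbox a b \<Longrightarrow> f x = 0"
  shows "(f has_integral integral (cbox a b) f) UNIV"
proof -
  have "(f has_integral integral (cbox a b) f) (cbox a b)"
    by (intro integrable_integral integrable_continuous continuous_on_subset[OF assms(1)]) auto
  then show ?thesis using has_integral_on_UNIV_iff assms(2) by blast
qed

lemma absolutely_integrable_compact_support:
  fixes f :: "'a::euclidean_space \<Rightarrow> real"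
  assumes "continuous_on UNIV f" "compact K" "\<And>x. x \<notin> K \<Longrightarrow> f x = 0"
  shows "f absolutely_integrable_on UNIV"
proof -
  obtain a b where ab: "K \<subseteq> cbox a b" using compact_subset_cbox[OF assms(2)] by blast
  have "(\<lambda>x. \<bar>f x\<bar>) integrable_on UNIV"
    using has_integral_compact_support[of "\<lambda>x. \<bar>f x\<bar>" a b] assms ab continuous_on_rabs[OF assms(1)]
    by (auto simp: integrable_on_def subset_iff)
  moreover have "f integrable_on UNIV"
    using has_integral_compact_support[of f a b] assms ab by (auto simp: integrable_on_def subset_iff)
  ultimately show ?thesis by (simp add: absolutely_integrable_on_def)
qed

definition recoord :: "('m \<Rightarrow> 'n) \<Rightarrow> real^'n \<Rightarrow> real^'m" where
  "recoord \<sigma> x = (\<chi> k. x $ \<sigma> k)"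

lemma recoord_inverse:
  assumes "bij \<sigma>"
  shows "recoord (inv \<sigma>) (recoord \<sigma> x) = x" "recoord \<sigma> (recoord (inv \<sigma>) y) = y"
  using assms by (auto simp: recoord_def vec_eq_iff bij_is_surj surj_f_inv_f bij_is_inj)

lemma bounded_linear_recoord: "bounded_linear (recoord \<sigma> :: real^'n \<Rightarrow> real^'m)"
  unfolding linear_conv_bounded_linear[symmetric] by (rule linearI) (auto simp: recoord_def vec_eq_iff)

text \<open>Relabelling permutes the sides of a box, so boxes go to boxes of the same volume; this
  is the input for transforming the integral in \<open>integral_recoord\<close>.\<close>

lemma recoord_cbox:
  fixes \<sigma> :: "'m::finite \<Rightarrow> 'n::finite"
  assumes s: "bij \<sigma>"
  shows "recoord \<sigma> ` cbox a b = cbox (recoord \<sigma> a) (recoord \<sigma> b)"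
    and "measure lborel (recoord \<sigma> ` cbox a b) = measure lborel (cbox a b)"
proof -
  have surj: "\<exists>k. \<sigma> k = i" for i using s by (metis bij_pointE)
  have mem: "recoord \<sigma> x \<in> cbox (recoord \<sigma> a) (recoord \<sigma> b) \<longleftrightarrow> x \<in> cbox a b" for x
    unfolding mem_box_cart recoord_def vec_lambda_beta using surj by metis
  show eq: "recoord \<sigma> ` cbox a b = cbox (recoord \<sigma> a) (recoord \<sigma> b)"
  proof
    show "recoord \<sigma> ` cbox a b \<subseteq> cbox (recoord \<sigma> a) (recoord \<sigma> b)" using mem by auto
    show "cbox (recoord \<sigma> a) (recoord \<sigma> b) \<subseteq> recoord \<sigma> ` cbox a b"
    proof
      fix y assume "y \<in> cbox (recoord \<sigma> a) (recoord \<sigma> b)"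
      then have "recoord (inv \<sigma>) y \<in> cbox a b" using mem[of "recoord (inv \<sigma>) y"] recoord_inverse(2)[OF s] by simp
      then show "y \<in> recoord \<sigma> ` cbox a b" using recoord_inverse(2)[OF s, of y] by (metis imageI)
    qed
  qed
  have "(\<Prod>k\<in>UNIV. recoord \<sigma> b $ k - recoord \<sigma> a $ k) = (\<Prod>i\<in>UNIV. b $ i - a $ i)"
    unfolding recoord_def vec_lambda_beta using prod.reindex_bij_betw[OF s, of "\<lambda>i. b $ i - a $ i"] by simp
  moreover have "cbox (recoord \<sigma> a) (recoord \<sigma> b) = {} \<longleftrightarrow> cbox a b = {}" unfolding eq[symmetric] by simp
  ultimately show "measure lborel (recoord \<sigma> ` cbox a b) = measure lborel (cbox a b)"
    unfolding eq content_cbox_if_cart by simp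
qed

lemma integral_recoord:
  fixes \<sigma> :: "'m::finite \<Rightarrow> 'n::finite" and f :: "real^'n \<Rightarrow> real"
  assumes s: "bij \<sigma>" and f: "continuous_on UNIV f" "compact K" "\<And>x. x \<notin> K \<Longrightarrow> f x = 0"
  shows "integral UNIV (\<lambda>y. f (recoord (inv \<sigma>) y)) = integral UNIV f"
proof -
  obtain a b where ab: "K \<subseteq> cbox a b" using compact_subset_cbox[OF f(2)] by blast
  then have z: "\<And>x. x \<notin> cbox a b \<Longrightarrow> f x = 0" using f(3) by blast
  have s': "bij (inv \<sigma>)" using s by (rule bij_imp_bij_inv)
  let ?I = "integral (cbox a b) f"
  have fi: "(f has_integral ?I) (cbox a b)"
    by (intro integrable_integral integrable_continuous continuous_on_subset[OF f(1)]) auto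
  have c: "measure lborel (recoord (inv \<sigma>) ` cbox u v) = 1 * measure lborel (cbox u v)" for u v :: "real^'m"
    using recoord_cbox(2)[OF s'] by simp
  have "((\<lambda>y. f (recoord (inv \<sigma>) y)) has_integral (1 / 1) *\<^sub>R ?I) (recoord \<sigma> ` cbox a b)"
  proof (rule has_integral_twiddle[OF _ _ _ _ _ _ c fi])
    show "recoord \<sigma> (recoord (inv \<sigma>) x) = x" "recoord (inv \<sigma>) (recoord \<sigma> y) = y" for x y
      using recoord_inverse[OF s] by auto
    show "isCont (recoord (inv \<sigma>)) x" for x :: "real^'m"
      by (rule linear_continuous_at[OF bounded_linear_recoord])
    show "\<exists>w z. recoord (inv \<sigma>) ` cbox u v = cbox w z" for u v :: "real^'m" using recoord_cbox(1)[OF s'] by blast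
    show "\<exists>w z. recoord \<sigma> ` cbox u v = cbox w z" for u v :: "real^'n" using recoord_cbox(1)[OF s] by blast
  qed simp
  then have "((\<lambda>y. f (recoord (inv \<sigma>) y)) has_integral ?I) UNIV"
  proof (subst has_integral_on_UNIV_iff[symmetric])
    fix y assume "y \<notin> recoord \<sigma> ` cbox a b"
    then have "recoord (inv \<sigma>) y \<notin> cbox a b" using recoord_inverse(2)[OF s, of y] by (metis imageI)
    then show "f (recoord (inv \<sigma>) y) = 0" by (rule z)
  qed simp
  moreover have "(f has_integral ?I) UNIV" using fi has_integral_on_UNIV_iff z by blast
  ultimately show ?thesis by (simp add: integral_unique)
qed

lemma integral_change_of_variables_wellorder:
  fixes \<Gamma> :: "real^'m::{finite,wellorder} \<Rightarrow> real^'m::_" and \<psi> :: "real^'m::_ \<Rightarrow> real"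
  assumes S: "open S" and der: "\<And>x. x \<in> S \<Longrightarrow> (\<Gamma> has_derivative \<Gamma>' x) (at x)" and inj: "inj_on \<Gamma> S"
    and \<psi>: "continuous_on UNIV \<psi>" "compact K" "\<And>p. p \<notin> K \<Longrightarrow> \<psi> p = 0" and z: "\<And>p. p \<notin> \<Gamma> ` S \<Longrightarrow> \<psi> p = 0"
  shows "integral UNIV \<psi> = integral S (\<lambda>x. \<bar>det (matrix (\<Gamma>' x))\<bar> * \<psi> (\<Gamma> x))"
proof -
  \<comment> \<open>The change of variables is applied to an integrand with values in
    \<open>real^1\<close> and read back through its single component.\<close>
  let ?v = "\<lambda>p. vec (\<psi> p) :: real^1"
  have a: "?v absolutely_integrable_on UNIV"
    using absolutely_integrable_linear[OF absolutely_integrable_compact_support[OF \<psi>], of "vec :: real \<Rightarrow> real^1"]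
    by (simp add: o_def linear_conv_bounded_linear[symmetric])
  have r: "(\<lambda>p. if p \<in> \<Gamma> ` S then ?v p else 0) = ?v" using z by (auto simp: vec_eq_iff fun_eq_iff)
  have a': "?v absolutely_integrable_on (\<Gamma> ` S)"
    using a absolutely_integrable_restrict_UNIV[of "\<Gamma> ` S" ?v] unfolding r by simp
  have Sl: "S \<in> sets lebesgue" using S by simp
  have dw: "\<And>x. x \<in> S \<Longrightarrow> (\<Gamma> has_derivative \<Gamma>' x) (at x within S)" using der has_derivative_at_withinI by blast
  have rhs: "(\<lambda>x. \<bar>det (matrix (\<Gamma>' x))\<bar> *\<^sub>R ?v (\<Gamma> x)) absolutely_integrable_on S"
    using absolutely_integrable_change_of_variables[OF Sl dw inj, of ?v] a' by blast
  have "integral (\<Gamma> ` S) ?v = integral S (\<lambda>x. \<bar>det (matrix (\<Gamma>' x))\<bar> *\<^sub>R ?v (\<Gamma> x))"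
    using integral_change_of_variables[OF Sl dw inj, of ?v] a' by blast
  then have "integral (\<Gamma> ` S) ?v $ 1 = integral S (\<lambda>x. \<bar>det (matrix (\<Gamma>' x))\<bar> *\<^sub>R ?v (\<Gamma> x)) $ 1" by simp
  moreover have "integral (\<Gamma> ` S) ?v $ 1 = integral (\<Gamma> ` S) \<psi>"
    using integral_component_eq_cart[OF set_lebesgue_integral_eq_integral(1)[OF a'], of 1] by simp
  moreover have "integral S (\<lambda>x. \<bar>det (matrix (\<Gamma>' x))\<bar> *\<^sub>R ?v (\<Gamma> x)) $ 1 = integral S (\<lambda>x. \<bar>det (matrix (\<Gamma>' x))\<bar> * \<psi> (\<Gamma> x))"
    using integral_component_eq_cart[OF set_lebesgue_integral_eq_integral(1)[OF rhs], of 1] by simp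
  moreover have "integral (\<Gamma> ` S) \<psi> = integral UNIV \<psi>"
  proof -
    have "(\<lambda>p. if p \<in> \<Gamma> ` S then \<psi> p else 0) = \<psi>" using z by auto
    then show ?thesis using integral_restrict_UNIV[of "\<Gamma> ` S" \<psi>] by simp
  qed
  ultimately show ?thesis by simp
qed

text \<open>Vanishing outside the image on one side and outside a compact part of \<open>S\<close>
  on the other lets both integrals run over the whole space, and det >= 0 removes the absolute
  value. Relabelling the coordinates by \<sigma> transports the well-ordered case.\<close>

lemma integral_change_of_variables_support:
  fixes \<Gamma> :: "real^'n \<Rightarrow> real^'n" and \<psi> \<phi> :: "real^'n \<Rightarrow> real" and D :: "real^'n \<Rightarrow> real^'n^'n"
  assumes S: "open S" and der: "\<And>x. x \<in> S \<Longrightarrow> (\<Gamma> has_derivative ((*v) (D x))) (at x)" and inj: "inj_on \<Gamma> S"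
    and \<psi>: "continuous_on UNIV \<psi>" "compact K" "\<And>p. p \<notin> K \<Longrightarrow> \<psi> p = 0" and z: "\<And>p. p \<notin> \<Gamma> ` S \<Longrightarrow> \<psi> p = 0"
    and \<psi>\<phi>: "\<And>x. x \<in> S \<Longrightarrow> \<psi> (\<Gamma> x) = \<phi> x" and det: "\<And>x. x \<in> S \<Longrightarrow> det (D x) \<ge> 0"
    and \<phi>: "continuous_on UNIV (\<lambda>x. \<phi> x * det (D x))" "compact L" "L \<subseteq> S" "\<And>x. x \<notin> L \<Longrightarrow> \<phi> x = 0"
  shows "integral UNIV \<psi> = integral UNIV (\<lambda>x. \<phi> x * det (D x))"
proof -
  obtain \<sigma> :: "'n idx \<Rightarrow> 'n" where s: "bij \<sigma>" using idx_bijection by blast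
  let ?h = "recoord \<sigma>" and ?k = "recoord (inv \<sigma>)"
  have hk: "\<And>x. ?k (?h x) = x" "\<And>y. ?h (?k y) = y" using recoord_inverse[OF s] by auto
  let ?S = "?k -` S" and ?\<Gamma> = "\<lambda>y. ?h (\<Gamma> (?k y))" and ?D = "\<lambda>y v. ?h (D (?k y) *v ?k v)"
  have kc: "continuous_on UNIV ?k" by (rule linear_continuous_on[OF bounded_linear_recoord])
  have hc: "continuous_on UNIV ?h" by (rule linear_continuous_on[OF bounded_linear_recoord])
  have m: "det (matrix (?D y)) = det (D (?k y))" for y
  proof -
    have "?D y (axis j 1) $ i = D (?k y) $ \<sigma> i $ \<sigma> j" for i j
    proof -
      have "?k (axis j 1) = axis (\<sigma> j) 1"
      proof -
        have "inv \<sigma> i = j \<longleftrightarrow> i = \<sigma> j" for i using bij_inv_eq_iff[OF s, of j i] by auto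
        then show ?thesis by (simp add: recoord_def axis_def vec_eq_iff)
      qed
      then show ?thesis by (simp add: recoord_def matrix_mult_axis column_def)
    qed
    then have "matrix (?D y) = (\<chi> i j. D (?k y) $ \<sigma> i $ \<sigma> j)" by (simp add: matrix_def vec_eq_iff)
    then show ?thesis using det_reindex[OF s] by simp
  qed
  have "integral UNIV \<psi> = integral UNIV (\<lambda>p. \<psi> (?k p))" using integral_recoord[OF s \<psi>] by simp
  also have "\<dots> = integral ?S (\<lambda>y. \<bar>det (matrix (?D y))\<bar> * \<psi> (?k (?\<Gamma> y)))"
  proof (rule integral_change_of_variables_wellorder)
    show "open ?S" using kc S by (simp add: open_vimage)
    show "(?\<Gamma> has_derivative ?D y) (at y)" if "y \<in> ?S" for y
    proof -
      have 1: "(?k has_derivative ?k) (at y)" by (rule bounded_linear_imp_has_derivative[OF bounded_linear_recoord])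
      have 2: "((\<lambda>y. \<Gamma> (?k y)) has_derivative (\<lambda>v. D (?k y) *v ?k v)) (at y)"
        using has_derivative_compose[OF 1, of \<Gamma> "(*v) (D (?k y))"] der that by simp
      show ?thesis by (rule bounded_linear.has_derivative[OF bounded_linear_recoord 2])
    qed
    show "inj_on ?\<Gamma> ?S"
    proof (rule inj_onI)
      fix y y' assume "y \<in> ?S" "y' \<in> ?S" "?\<Gamma> y = ?\<Gamma> y'"
      then have "?k y = ?k y'" using inj hk(1) by (metis inj_onD vimageD)
      then show "y = y'" using hk(2) by metis
    qed
    show "continuous_on UNIV (\<lambda>p. \<psi> (?k p))" by (rule continuous_on_compose2[OF \<psi>(1) kc]) auto
    show "compact (?h ` K)" by (rule compact_continuous_image[OF continuous_on_subset[OF hc] \<psi>(2)]) simp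
    show "\<psi> (?k p) = 0" if "p \<notin> ?h ` K" for p using that hk(2) \<psi>(3) by (metis imageI)
    show "\<psi> (?k p) = 0" if "p \<notin> ?\<Gamma> ` ?S" for p
    proof (rule z)
      show "?k p \<notin> \<Gamma> ` S"
      proof
        assume "?k p \<in> \<Gamma> ` S"
        then obtain x where x: "x \<in> S" "?k p = \<Gamma> x" by blast
        then have "p = ?\<Gamma> (?h x)" "?h x \<in> ?S" using hk by (metis, simp)
        then show False using that by blast
      qed
    qed
  qed
  also have "\<dots> = integral ?S (\<lambda>y. \<phi> (?k y) * det (D (?k y)))"
    by (rule integral_cong) (simp add: m det hk(1) \<psi>\<phi>)
  also have "\<dots> = integral UNIV (\<lambda>y. \<phi> (?k y) * det (D (?k y)))"
  proof -
    have "\<phi> (?k y) = 0" if "y \<notin> ?S" for y using that \<phi>(3,4) by blast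
    then have "(\<lambda>y. if y \<in> ?S then \<phi> (?k y) * det (D (?k y)) else 0) = (\<lambda>y. \<phi> (?k y) * det (D (?k y)))" by auto
    then show ?thesis using integral_restrict_UNIV[of ?S "\<lambda>y. \<phi> (?k y) * det (D (?k y))"] by simp
  qed
  also have "\<dots> = integral UNIV (\<lambda>x. \<phi> x * det (D x))"
    by (rule integral_recoord[OF s \<phi>(1,2)]) (simp add: \<phi>(4))
  finally show ?thesis .
qed

section \<open>Monge-Ampere functionals as integrals over gradients\<close>

text \<open>For a C2 convex f and \<open>g = |x|^2/2 + t f\<close>, the map \<open>argm\<close> inverts the gradient of g.\<close>
definition argm :: "'a::euclidean_space \<Rightarrow> real \<Rightarrow> real \<Rightarrow> ('a \<Rightarrow> real) \<Rightarrow> 'a \<Rightarrow> 'a" where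
  "argm x0 r t f p = (SOME x. x \<in> cball x0 r \<and>
     (\<forall>y\<in>cball x0 r. (norm x)\<^sup>2 / 2 + t * f x - p \<bullet> x \<le> (norm y)\<^sup>2 / 2 + t * f y - p \<bullet> y))"

lemma argm_min:
  assumes f: "continuous_on (cball x0 r) f" and r: "r \<ge> 0"
  shows "argm x0 r t f p \<in> cball x0 r"
    "y \<in> cball x0 r \<Longrightarrow> (norm (argm x0 r t f p))\<^sup>2 / 2 + t * f (argm x0 r t f p) - p \<bullet> argm x0 r t f p
      \<le> (norm y)\<^sup>2 / 2 + t * f y - p \<bullet> y"
proof -
  have "continuous_on (cball x0 r) (\<lambda>x. (norm x)\<^sup>2 / 2 + t * f x - p \<bullet> x)"
    by (intro continuous_intros f) auto
  then have "\<exists>x. x \<in> cball x0 r \<and> (\<forall>y\<in>cball x0 r. (norm x)\<^sup>2 / 2 + t * f x - p \<bullet> x \<le> (norm y)\<^sup>2 / 2 + t * f y - p \<bullet> y)"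
    using continuous_attains_inf[of "cball x0 r" "\<lambda>x. (norm x)\<^sup>2 / 2 + t * f x - p \<bullet> x"] r by auto
  from someI_ex[OF this]
  show "argm x0 r t f p \<in> cball x0 r"
    "y \<in> cball x0 r \<Longrightarrow> (norm (argm x0 r t f p))\<^sup>2 / 2 + t * f (argm x0 r t f p) - p \<bullet> argm x0 r t f p
      \<le> (norm y)\<^sup>2 / 2 + t * f y - p \<bullet> y"
    by (auto simp: argm_def)
qed

text \<open>The quadratic term is strongly convex with modulus 1. Comparing the minimiser with the
  point at parameter \<open>l\<close> of the segment to \<open>y\<close>, dividing by
  \<open>l\<close> and letting \<open>l\<close> tend to 0 leaves the gap |x - y|^2/2.\<close>

lemma min_strong:
  fixes f :: "'a::euclidean_space \<Rightarrow> real"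
  assumes f: "convex_on (cball x0 r) f" and t: "t \<ge> 0" and x: "x \<in> cball x0 r" and y: "y \<in> cball x0 r"
    and min: "\<And>y. y \<in> cball x0 r \<Longrightarrow> (norm x)\<^sup>2 / 2 + t * f x - p \<bullet> x \<le> (norm y)\<^sup>2 / 2 + t * f y - p \<bullet> y"
  shows "(norm x)\<^sup>2 / 2 + t * f x - p \<bullet> x + (norm (x - y))\<^sup>2 / 2 \<le> (norm y)\<^sup>2 / 2 + t * f y - p \<bullet> y"
proof -
  define D where "D = ((norm y)\<^sup>2 / 2 + t * f y - p \<bullet> y) - ((norm x)\<^sup>2 / 2 + t * f x - p \<bullet> x)"
  define k where "k = (norm (x - y))\<^sup>2 / 2"
  have "(1 - l) * k \<le> D" if l: "0 < l" "l < 1" for l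
  proof -
    let ?z = "(1 - l) *\<^sub>R x + l *\<^sub>R y"
    have z: "?z \<in> cball x0 r" using l x y by (intro convexD[OF convex_cball]) auto
    have "f ?z \<le> (1 - l) * f x + l * f y" using convex_onD[OF f, of l x y] l x y by simp
    then have "t * f ?z \<le> t * ((1 - l) * f x + l * f y)" using t by (rule mult_left_mono)
    moreover have "(norm ?z)\<^sup>2 = (1 - l) * (norm x)\<^sup>2 + l * (norm y)\<^sup>2 - l * (1 - l) * (norm (x - y))\<^sup>2"
      by (rule norm_convex_comb_power2)
    moreover have "p \<bullet> ?z = (1 - l) * (p \<bullet> x) + l * (p \<bullet> y)" by (simp add: inner_add_right)
    ultimately have "0 \<le> l * D - l * ((1 - l) * k)"
      using min[OF z] by (simp add: D_def k_def) (simp add: algebra_simps add_divide_distrib diff_divide_distrib)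
    then have "l * ((1 - l) * k) \<le> l * D" by simp
    then show ?thesis using l by simp
  qed
  then have ev: "\<forall>\<^sub>F l in at_right 0. (1 - l) * k \<le> D"
    unfolding eventually_at_right_field by (intro exI[of _ 1]) auto
  have "((\<lambda>l. (1 - l) * k) \<longlongrightarrow> (1 - 0) * k) (at_right 0)" by (intro tendsto_intros)
  then have "(1 - 0) * k \<le> D" by (rule tendsto_upperbound[OF _ ev]) simp
  then show ?thesis by (simp add: D_def k_def)
qed

lemma argm_strong:
  fixes f :: "'a::euclidean_space \<Rightarrow> real" and p :: 'a
  assumes f: "convex_on (cball x0 r) f" "continuous_on (cball x0 r) f" and r: "r \<ge> 0" and t: "t \<ge> 0" and y: "y \<in> cball x0 r"
  defines "x \<equiv> argm x0 r t f p"
  shows "(norm x)\<^sup>2 / 2 + t * f x - p \<bullet> x + (norm (x - y))\<^sup>2 / 2 \<le> (norm y)\<^sup>2 / 2 + t * f y - p \<bullet> y"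
  unfolding x_def by (rule min_strong[OF f(1) t argm_min(1)[OF f(2) r] y argm_min(2)[OF f(2) r]])

lemma argm_unique:
  fixes f :: "'a::euclidean_space \<Rightarrow> real"
  assumes f: "convex_on (cball x0 r) f" "continuous_on (cball x0 r) f" and r: "r \<ge> 0" and t: "t \<ge> 0" and x: "x \<in> cball x0 r"
    and min: "\<And>y. y \<in> cball x0 r \<Longrightarrow> (norm x)\<^sup>2 / 2 + t * f x - p \<bullet> x \<le> (norm y)\<^sup>2 / 2 + t * f y - p \<bullet> y"
  shows "argm x0 r t f p = x"
proof -
  have "(norm (argm x0 r t f p - x))\<^sup>2 / 2 \<le> 0"
    using argm_strong[OF f r t x, of p] min[OF argm_min(1)[OF f(2) r, of t p]] by linarith
  then show ?thesis by simp
qed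

text \<open>Adding the two gap inequalities, each tested at the other minimiser, cancels everything
  except the product of p - q with the difference of the minimisers.\<close>

lemma argm_lipschitz:
  fixes f :: "'a::euclidean_space \<Rightarrow> real"
  assumes f: "convex_on (cball x0 r) f" "continuous_on (cball x0 r) f" and r: "r \<ge> 0" and t: "t \<ge> 0"
  shows "dist (argm x0 r t f p) (argm x0 r t f q) \<le> dist p q"
proof -
  let ?x = "argm x0 r t f p" and ?y = "argm x0 r t f q"
  define d where "d = norm (?x - ?y)"
  have "d\<^sup>2 \<le> (p - q) \<bullet> (?x - ?y)"
    using argm_strong[OF f r t argm_min(1)[OF f(2) r, of t q], of p] argm_strong[OF f r t argm_min(1)[OF f(2) r, of t p], of q]
    unfolding norm_minus_commute[of ?y ?x] d_def by (simp add: inner_diff_left inner_diff_right)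
  also have "\<dots> \<le> norm (p - q) * d" unfolding d_def by (rule norm_cauchy_schwarz)
  finally have "d * d \<le> norm (p - q) * d" by (simp add: power2_eq_square)
  moreover have "d \<ge> 0" by (simp add: d_def)
  ultimately have "d \<le> norm (p - q)" by (cases "d = 0") auto
  then show ?thesis by (simp add: d_def dist_norm)
qed

lemma argm_continuous:
  fixes f :: "'a::euclidean_space \<Rightarrow> real"
  assumes f: "convex_on (cball x0 r) f" "continuous_on (cball x0 r) f" and r: "r \<ge> 0" and t: "t \<ge> 0"
  shows "continuous_on UNIV (argm x0 r t f)"
  unfolding continuous_on_iff using argm_lipschitz[OF assms] by (meson le_less_trans)

text \<open>The argument of \<open>argm_lipschitz\<close> with two functions in place of two slopes:
  the linear terms cancel, and what remains is t times two values of f - g.\<close>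

lemma argm_stable:
  fixes f :: "'a::euclidean_space \<Rightarrow> real"
  assumes f: "convex_on (cball x0 r) f" "continuous_on (cball x0 r) f" and g: "convex_on (cball x0 r) g" "continuous_on (cball x0 r) g"
    and r: "r \<ge> 0" and t: "t \<ge> 0" and e: "\<And>x. x \<in> cball x0 r \<Longrightarrow> \<bar>f x - g x\<bar> \<le> e"
  shows "(dist (argm x0 r t f p) (argm x0 r t g p))\<^sup>2 \<le> 2 * t * e"
proof -
  let ?x = "argm x0 r t f p" and ?y = "argm x0 r t g p"
  have x: "?x \<in> cball x0 r" and y: "?y \<in> cball x0 r" using argm_min(1)[OF f(2) r] argm_min(1)[OF g(2) r] by auto
  have "(norm (?x - ?y))\<^sup>2 \<le> t * f ?y - t * g ?y + (t * g ?x - t * f ?x)"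
    using argm_strong[OF f r t y, of p] argm_strong[OF g r t x, of p]
    unfolding norm_minus_commute[of ?y ?x] by linarith
  also have "\<dots> = t * ((f ?y - g ?y) + (g ?x - f ?x))" by (simp add: algebra_simps)
  also have "\<dots> \<le> t * (2 * e)" using e[OF x] e[OF y] by (intro mult_left_mono[OF _ t]) (simp add: abs_le_iff)
  finally show ?thesis by (simp add: dist_norm mult_ac)
qed

text \<open>Moving from the minimiser by r - s in the direction of \<open>p\<close> stays in the
  ball and gains (r - s)|p| in the linear term, which minimality and the bound on \<open>f\<close>
  allow only for bounded \<open>p\<close>. So integrands supported in the smaller ball vanish
  outside a fixed box.\<close>

lemma argm_bound:
  fixes f :: "'a::euclidean_space \<Rightarrow> real"
  assumes f: "continuous_on (cball x0 r) f" and r: "r \<ge> 0" and t: "t \<ge> 0" and s: "s < r" and p: "argm x0 r t f p \<in> cball x0 s"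
    and F: "\<And>x. x \<in> cball x0 r \<Longrightarrow> \<bar>f x\<bar> \<le> F"
  shows "norm p \<le> ((norm x0 + r)\<^sup>2 + 2 * t * F) / (r - s)"
proof (cases "p = 0")
  case True
  have "F \<ge> 0" using F[OF argm_min(1)[OF f r, of t p]] by linarith
  then show ?thesis using True s t by simp
next
  case False
  let ?x = "argm x0 r t f p"
  define y where "y = ?x + ((r - s) / norm p) *\<^sub>R p"
  have "dist ?x y = r - s" using False s by (simp add: y_def dist_norm)
  then have y: "y \<in> cball x0 r" using p dist_triangle[of x0 y ?x] by simp
  have x: "?x \<in> cball x0 r" by (rule argm_min(1)[OF f r])
  have py: "p \<bullet> y = p \<bullet> ?x + (r - s) * norm p"
    using False by (simp add: y_def inner_add_right power2_norm_eq_inner[symmetric] power2_eq_square)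
  have "norm y \<le> norm x0 + r" using y norm_triangle_ineq2[of y x0] by (simp add: dist_norm norm_minus_commute)
  then have "(norm y)\<^sup>2 \<le> (norm x0 + r)\<^sup>2" by (intro power_mono) auto
  moreover have "0 \<le> (norm ?x)\<^sup>2" by simp
  moreover have "t * f y - t * f ?x \<le> 2 * (t * F)"
  proof -
    have "t * (f y - f ?x) \<le> t * (2 * F)" using F[OF x] F[OF y] by (intro mult_left_mono[OF _ t]) (simp add: abs_le_iff)
    then show ?thesis by (simp add: algebra_simps)
  qed
  moreover have "0 \<le> (norm x0 + r)\<^sup>2" by simp
  ultimately have "(r - s) * norm p \<le> (norm x0 + r)\<^sup>2 + 2 * (t * F)"
    using argm_min(2)[OF f r y, of t p] py by linarith
  then show ?thesis using s by (simp add: pos_le_divide_eq mult_ac)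
qed

lemma argm_gradient:
  fixes f :: "real^'n \<Rightarrow> real"
  assumes f: "convex_on (cball x0 r) f" "continuous_on (cball x0 r) f" and r: "r \<ge> 0" and t: "t \<ge> 0" and x: "x \<in> cball x0 r"
    and d: "f differentiable (at x)"
  shows "argm x0 r t f (x + t *\<^sub>R grad f x) = x"
proof (rule argm_unique[OF f r t x])
  fix y assume y: "y \<in> cball x0 r"
  have "t * (f x + grad f x \<bullet> (y - x)) \<le> t * f y"
    using convex_gradient_inequality[OF f(1) x y d] by (intro mult_left_mono[OF _ t]) (simp add: dd_grad[OF d])
  moreover have "0 \<le> (norm (y - x))\<^sup>2" by simp
  moreover have "(norm (y - x))\<^sup>2 = (norm y)\<^sup>2 - 2 * (x \<bullet> y) + (norm x)\<^sup>2"
    by (simp add: power2_norm_eq_inner inner_diff_left inner_diff_right inner_commute)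
  ultimately show "(norm x)\<^sup>2 / 2 + t * f x - (x + t *\<^sub>R grad f x) \<bullet> x \<le> (norm y)\<^sup>2 / 2 + t * f y - (x + t *\<^sub>R grad f x) \<bullet> y"
    by (simp add: inner_add_left inner_diff_right power2_norm_eq_inner[of x] algebra_simps)
qed

text \<open>First-order condition at an interior minimiser. Together with
  \<open>argm_gradient\<close> it shows that \<open>argm\<close> inverts x + t grad f on the open
  ball.\<close>

lemma argm_interior_gradient:
  fixes f :: "real^'n \<Rightarrow> real" and p :: "real^'n"
  assumes f: "continuous_on (cball x0 r) f" and r: "r \<ge> 0"
    and x: "argm x0 r t f p \<in> ball x0 r" and d: "f differentiable (at (argm x0 r t f p))"
  defines "x \<equiv> argm x0 r t f p"
  shows "p = x + t *\<^sub>R grad f x"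
proof -
  have fd: "(f has_derivative (\<lambda>v. grad f x \<bullet> v)) (at x)"
    using dd_works[OF d] dd_grad[OF d] by (simp add: x_def)
  have "((\<lambda>y. (y \<bullet> y) / 2 + t * f y - p \<bullet> y) has_derivative (\<lambda>v. x \<bullet> v + t * (grad f x \<bullet> v) - p \<bullet> v)) (at x)"
    by (auto intro!: derivative_eq_intros fd simp: inner_commute)
  then have "(\<lambda>v. x \<bullet> v + t * (grad f x \<bullet> v) - p \<bullet> v) = (\<lambda>v. 0)"
  proof (rule differential_zero_maxmin[OF x[folded x_def] open_ball])
    show "(\<forall>y\<in>ball x0 r. (y \<bullet> y) / 2 + t * f y - p \<bullet> y \<le> (x \<bullet> x) / 2 + t * f x - p \<bullet> x) \<or>
      (\<forall>y\<in>ball x0 r. (x \<bullet> x) / 2 + t * f x - p \<bullet> x \<le> (y \<bullet> y) / 2 + t * f y - p \<bullet> y)"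
      using argm_min(2)[OF f r, of _ t p] by (auto simp: x_def power2_norm_eq_inner)
  qed
  then have "x \<bullet> v + t * (grad f x \<bullet> v) - p \<bullet> v = 0" for v by (rule fun_cong)
  then have "(x + t *\<^sub>R grad f x - p) \<bullet> v = 0" for v by (simp add: inner_add_left inner_diff_left)
  then have "x + t *\<^sub>R grad f x - p = 0" by (metis inner_eq_zero_iff)
  then show ?thesis by simp
qed

text \<open>The image of Lebesgue measure under \<open>argm\<close>, paired with a test function. It
  makes sense for nonsmooth convex f; for C2 ones, on test functions supported inside the ball, it
  is integration against det (I + t D^2 f), by \<open>integral_det_hess_eq_MAf\<close>.\<close>

definition MAf :: "'a::euclidean_space \<Rightarrow> real \<Rightarrow> real \<Rightarrow> ('a \<Rightarrow> real) \<Rightarrow> ('a \<Rightarrow> real) \<Rightarrow> real" where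
  "MAf x0 r t f \<phi> = integral UNIV (\<lambda>p. \<phi> (argm x0 r t f p))"

lemma MAf_support:
  fixes f :: "'a::euclidean_space \<Rightarrow> real"
  assumes "continuous_on (cball x0 r) f" "r \<ge> 0" "t \<ge> 0" "s < r" "\<And>x. x \<in> cball x0 r \<Longrightarrow> \<bar>f x\<bar> \<le> F"
    and \<phi>: "\<And>x. x \<notin> cball x0 s \<Longrightarrow> \<phi> x = (0::real)" and p: "p \<notin> cball 0 (((norm x0 + r)\<^sup>2 + 2 * t * F) / (r - s))"
  shows "\<phi> (argm x0 r t f p) = 0"
  using argm_bound[OF assms(1-4) _ assms(5), of p] p by (intro \<phi>) auto

lemma continuous_bounded_cball:
  fixes f :: "'a::euclidean_space \<Rightarrow> real"
  assumes "continuous_on (cball x0 r) f"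
  obtains F where "\<And>x. x \<in> cball x0 r \<Longrightarrow> \<bar>f x\<bar> \<le> F"
proof -
  have "compact (f ` cball x0 r)" using assms compact_continuous_image compact_cball by blast
  then obtain F where "\<forall>y\<in>f ` cball x0 r. norm y \<le> F" using compact_imp_bounded bounded_iff by metis
  then show ?thesis using that[of F] by auto
qed

text \<open>The constant is the volume of a box containing every slope whose minimiser lies in the
  smaller ball.\<close>

lemma MAf_bound:
  fixes f :: "'a::euclidean_space \<Rightarrow> real"
  assumes f: "convex_on (cball x0 r) f" "continuous_on (cball x0 r) f" and r: "r \<ge> 0" and t: "t \<ge> 0" and s: "s < r"
  shows "\<exists>C\<ge>0. \<forall>\<phi> m. continuous_on UNIV \<phi> \<longrightarrow> (\<forall>x. x \<notin> cball x0 s \<longrightarrow> \<phi> x = 0) \<longrightarrow> (\<forall>x. \<bar>\<phi> x\<bar> \<le> m) \<longrightarrow>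
    \<bar>MAf x0 r t f \<phi>\<bar> \<le> C * m"
proof -
  obtain F where F: "\<And>x. x \<in> cball x0 r \<Longrightarrow> \<bar>f x\<bar> \<le> F" using continuous_bounded_cball[OF f(2)] by blast
  obtain a b where ab: "cball (0::'a) (((norm x0 + r)\<^sup>2 + 2 * t * F) / (r - s)) \<subseteq> cbox a b"
    using compact_subset_cbox[OF compact_cball] by blast
  let ?C = "measure lborel (cbox a b)"
  have "\<bar>MAf x0 r t f \<phi>\<bar> \<le> ?C * m"
    if \<phi>: "continuous_on UNIV \<phi>" "\<forall>x. x \<notin> cball x0 s \<longrightarrow> \<phi> x = 0" "\<forall>x. \<bar>\<phi> x\<bar> \<le> m" for \<phi> m
  proof -
    let ?\<psi> = "\<lambda>p. \<phi> (argm x0 r t f p)"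
    have c: "continuous_on UNIV ?\<psi>" by (rule continuous_on_compose2[OF \<phi>(1) argm_continuous[OF f r t]]) auto
    have z: "?\<psi> p = 0" if "p \<notin> cbox a b" for p
      by (rule MAf_support[OF f(2) r t s F]) (use \<phi>(2) ab that in auto)
    have "(?\<psi> has_integral integral (cbox a b) ?\<psi>) UNIV" by (rule has_integral_compact_support[OF c z])
    then have eq: "MAf x0 r t f \<phi> = integral (cbox a b) ?\<psi>" by (simp add: MAf_def integral_unique)
    have "(?\<psi> has_integral integral (cbox a b) ?\<psi>) (cbox a b)"
      by (intro integrable_integral integrable_continuous continuous_on_subset[OF c]) auto
    then have "norm (integral (cbox a b) ?\<psi>) \<le> m * measure lborel (cbox a b)"
      using \<phi>(3) by (intro has_integral_bound) (auto intro: order_trans[OF abs_ge_zero])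
    then show ?thesis unfolding eq by (simp add: mult.commute)
  qed
  then show ?thesis by (intro exI[of _ ?C]) auto
qed

text \<open>Late approximants are bounded by F + 1 on the ball, so all integrands live in one box;
  there \<open>argm_stable\<close> and uniform continuity of \<phi> make them uniformly
  close.\<close>

lemma MAf_tendsto:
  fixes f :: "'a::euclidean_space \<Rightarrow> real"
  assumes f: "convex_on (cball x0 r) f" "continuous_on (cball x0 r) f" and r: "r \<ge> 0" and t: "t \<ge> 0" and s: "s < r"
    and fs: "\<And>k. convex_on (cball x0 r) (fs k)" "\<And>k. continuous_on (cball x0 r) (fs k)"
    and lim: "uniform_limit (cball x0 r) fs f sequentially"
    and \<phi>: "continuous_on UNIV \<phi>" "\<And>x. x \<notin> cball x0 s \<Longrightarrow> \<phi> x = 0"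
  shows "(\<lambda>k. MAf x0 r t (fs k) \<phi>) \<longlonglongrightarrow> MAf x0 r t f \<phi>"
proof -
  obtain F where F: "\<And>x. x \<in> cball x0 r \<Longrightarrow> \<bar>f x\<bar> \<le> F" using continuous_bounded_cball[OF f(2)] by blast
  obtain a b where ab: "cball (0::'a) (((norm x0 + r)\<^sup>2 + 2 * t * (F + 1)) / (r - s)) \<subseteq> cbox a b"
    using compact_subset_cbox[OF compact_cball] by blast
  have eq: "MAf x0 r t g \<phi> = integral (cbox a b) (\<lambda>p. \<phi> (argm x0 r t g p))" and cg: "continuous_on UNIV (\<lambda>p. \<phi> (argm x0 r t g p))"
    if g: "convex_on (cball x0 r) g" "continuous_on (cball x0 r) g" "\<And>x. x \<in> cball x0 r \<Longrightarrow> \<bar>g x\<bar> \<le> F + 1" for g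
  proof -
    show c: "continuous_on UNIV (\<lambda>p. \<phi> (argm x0 r t g p))"
      by (rule continuous_on_compose2[OF \<phi>(1) argm_continuous[OF g(1,2) r t]]) auto
    have z: "\<phi> (argm x0 r t g p) = 0" if "p \<notin> cbox a b" for p
      by (rule MAf_support[OF g(2) r t s g(3)]) (use \<phi>(2) ab that in auto)
    have "((\<lambda>p. \<phi> (argm x0 r t g p)) has_integral integral (cbox a b) (\<lambda>p. \<phi> (argm x0 r t g p))) UNIV"
      by (rule has_integral_compact_support[OF c z])
    then show "MAf x0 r t g \<phi> = integral (cbox a b) (\<lambda>p. \<phi> (argm x0 r t g p))" by (simp add: MAf_def integral_unique)
  qed
  have cu: "uniformly_continuous_on (cball x0 r) \<phi>"
    by (rule compact_uniformly_continuous[OF continuous_on_subset[OF \<phi>(1)]]) auto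
  show ?thesis
  proof (rule LIMSEQ_I)
    fix e :: real assume e: "e > 0"
    define C where "C = measure lborel (cbox a b)"
    define k0 where "k0 = C + 1"
    define e' where "e' = e / 2 / k0"
    have C0: "C \<ge> 0" by (simp add: C_def)
    then have k0: "k0 > 0" by (simp add: k0_def)
    then have e': "e' > 0" using e by (simp add: e'_def)
    obtain d where d: "d > 0" "\<And>x y. x \<in> cball x0 r \<Longrightarrow> y \<in> cball x0 r \<Longrightarrow> dist x y < d \<Longrightarrow> dist (\<phi> x) (\<phi> y) < e'"
      using cu e' unfolding uniformly_continuous_on_def by metis
    \<comment> \<open>The denominator makes 2 t \<eta> < d^2, so by \<open>argm_stable\<close> the
      minimisers are closer than \<open>d\<close>; t + 1 covers the case t = 0. The bound 1 keeps
      the approximants below F + 1.\<close>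
    define \<eta> where "\<eta> = min 1 (d\<^sup>2 / (4 * (t + 1)))"
    have \<eta>: "\<eta> > 0" "\<eta> \<le> 1" "2 * t * \<eta> < d\<^sup>2"
    proof -
      show "\<eta> > 0" "\<eta> \<le> 1" using d t by (auto simp: \<eta>_def)
      have "2 * t * \<eta> \<le> 2 * t * (d\<^sup>2 / (4 * (t + 1)))" using t by (intro mult_left_mono) (auto simp: \<eta>_def)
      also have "\<dots> = (t / (t + 1)) * (d\<^sup>2 / 2)" using t by (simp add: field_simps)
      also have "\<dots> \<le> 1 * (d\<^sup>2 / 2)" using t by (intro mult_right_mono) auto
      also have "\<dots> < d\<^sup>2" using d by simp
      finally show "2 * t * \<eta> < d\<^sup>2" .
    qed
    have "\<forall>\<^sub>F k in sequentially. \<forall>x\<in>cball x0 r. dist (fs k x) (f x) < \<eta>" using lim \<eta>(1) by (rule uniform_limitD)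
    then obtain N where N: "\<And>k x. k \<ge> N \<Longrightarrow> x \<in> cball x0 r \<Longrightarrow> \<bar>fs k x - f x\<bar> < \<eta>"
      unfolding eventually_sequentially dist_real_def by blast
    show "\<exists>no. \<forall>n\<ge>no. norm (MAf x0 r t (fs n) \<phi> - MAf x0 r t f \<phi>) < e"
    proof (intro exI[of _ N] allI impI)
      fix k assume k: "k \<ge> N"
      have bk: "\<bar>fs k x\<bar> \<le> F + 1" if "x \<in> cball x0 r" for x using N[OF k that] F[OF that] \<eta>(2) by linarith
      have bf: "\<bar>f x\<bar> \<le> F + 1" if "x \<in> cball x0 r" for x using F[OF that] by linarith
      let ?a = "\<lambda>p. \<phi> (argm x0 r t (fs k) p)" and ?b = "\<lambda>p. \<phi> (argm x0 r t f p)"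
      have eq1: "MAf x0 r t (fs k) \<phi> = integral (cbox a b) ?a" by (rule eq[OF fs(1,2) bk])
      have eq2: "MAf x0 r t f \<phi> = integral (cbox a b) ?b" by (rule eq[OF f bf])
      have ia: "?a integrable_on cbox a b" and ib: "?b integrable_on cbox a b"
        using cg[OF fs(1,2) bk] cg[OF f bf] by (auto intro: integrable_continuous continuous_on_subset)
      have close: "norm (?a p - ?b p) \<le> e'" for p
      proof -
        have "(dist (argm x0 r t (fs k) p) (argm x0 r t f p))\<^sup>2 \<le> 2 * t * \<eta>"
          using N[OF k] by (intro argm_stable[OF fs(1,2) f r t]) (auto intro: less_imp_le)
        then have "(dist (argm x0 r t (fs k) p) (argm x0 r t f p))\<^sup>2 < d\<^sup>2" using \<eta>(3) by linarith
        then have "dist (argm x0 r t (fs k) p) (argm x0 r t f p) < d" using d(1) by (simp add: power2_less_imp_less)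
        then show ?thesis
          using d(2)[OF argm_min(1)[OF fs(2) r] argm_min(1)[OF f(2) r]] by (auto simp: dist_norm intro: less_imp_le)
      qed
      have "((\<lambda>p. ?a p - ?b p) has_integral (integral (cbox a b) ?a - integral (cbox a b) ?b)) (cbox a b)"
        by (intro has_integral_diff integrable_integral ia ib)
      then have "norm (integral (cbox a b) ?a - integral (cbox a b) ?b) \<le> e' * C"
        unfolding C_def using close e' by (intro has_integral_bound) auto
      also have "\<dots> \<le> e' * k0" using e' by (intro mult_left_mono) (auto simp: k0_def)
      also have "\<dots> < e" using e k0 by (simp add: e'_def)
      finally show "norm (MAf x0 r t (fs k) \<phi> - MAf x0 r t f \<phi>) < e"
        by (simp only: eq1 eq2)
    qed
  qed
qed

section \<open>The determinant functional for C2 functions\<close>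

lemma det_continuous:
  fixes M :: "'a::topological_space \<Rightarrow> real^'n^'n"
  assumes "\<And>i j. continuous_on S (\<lambda>x. M x $ i $ j)"
  shows "continuous_on S (\<lambda>x. det (M x))"
  unfolding det_def by (intro continuous_intros assms)

lemma continuous_on_zero_extension:
  fixes \<phi> q :: "'a::euclidean_space \<Rightarrow> real"
  assumes \<phi>: "continuous_on UNIV \<phi>" "\<And>x. x \<notin> K \<Longrightarrow> \<phi> x = 0" and K: "closed K" "K \<subseteq> U" "open U" and q: "continuous_on U q"
  shows "continuous_on UNIV (\<lambda>x. \<phi> x * q x)"
proof -
  have "continuous_on (U \<union> - K) (\<lambda>x. \<phi> x * q x)"
  proof (rule continuous_on_open_Un)
    show "continuous_on U (\<lambda>x. \<phi> x * q x)" by (intro continuous_on_mult continuous_on_subset[OF \<phi>(1)] q) auto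
    have "continuous_on (- K) (\<lambda>x. 0::real)" by simp
    then show "continuous_on (- K) (\<lambda>x. \<phi> x * q x)"
      by (rule continuous_on_cong[THEN iffD1, rotated 2]) (use \<phi>(2) in auto)
  qed (use K in auto)
  moreover have "U \<union> - K = UNIV" using K by auto
  ultimately show ?thesis by simp
qed

lemma det_hess_continuous:
  fixes f :: "real^'n \<Rightarrow> real"
  assumes "open X" "Ck 2 X f"
  shows "continuous_on X (\<lambda>x. det (mat 1 + t *\<^sub>R hess f x))"
proof (rule det_continuous)
  fix i j
  have "continuous_on X (\<lambda>x. (mat 1 :: real^'n^'n) $ i $ j + t * dd (dd f (axis i 1)) (axis j 1) x)"
    by (intro continuous_intros Ck_2_cont[OF assms(2)])
  then show "continuous_on X (\<lambda>x. (mat 1 + t *\<^sub>R hess f x) $ i $ j)"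
    using hess_nth[OF assms(1) _ assms(2)] by (simp cong: continuous_on_cong)
qed

lemma has_derivative_grad:
  fixes f :: "real^'n \<Rightarrow> real"
  assumes "open X" "x \<in> X" "Ck 2 X f"
  shows "(grad f has_derivative ((*v) (hess f x))) (at x)"
proof -
  have "grad f differentiable (at x)" using assms C2_on_iff_Ck[OF assms(1), of f] by (auto simp: C2_on_def)
  then have g: "(grad f has_derivative (\<lambda>v. dd (grad f) v x)) (at x)" by (rule dd_works)
  have "(*v) (hess f x) = (\<lambda>v. dd (grad f) v x)"
    unfolding hess_def jacobian_def
    using matrix_works[OF linear_matrix_vector_mul_eq[THEN iffD2, OF has_derivative_linear[OF g]]] by auto
  then show ?thesis using g by simp
qed

lemma det_id_plus_PSD_nonneg:
  fixes A :: "real^'n^'n"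
  assumes "A \<in> PSD" "t \<ge> 0"
  shows "det (mat 1 + t *\<^sub>R A) \<ge> 0"
proof -
  have S: "A \<in> Sym" using assms by (simp add: PSD_def)
  obtain U l where U: "orthogonal_matrix U" "\<And>i. A *v column i U = l i *\<^sub>R column i U"
    using symmetric_eigenbasis[OF S] by blast
  have A: "A = U ** diagm l ** transpose U" using spectral_decomposition[OF U] .
  have "(\<chi> i j. (if i = j then 1 else 0) + t * of_real (A $ i $ j)) = mat 1 + t *\<^sub>R A"
    by (simp add: mat_def vec_eq_iff)
  then have "det (mat 1 + t *\<^sub>R A) = (\<Prod>i\<in>UNIV. 1 + t * l i)" using det_id_plus_spectral[OF U(1) A, of t] by simp
  then show ?thesis using PSD_eigenvalues_nonneg[OF assms(1) U(1) A] assms(2) by (simp add: prod_nonneg)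
qed

text \<open>Substitution p = x + t grad f(x), with Jacobian det (I + t D^2 f) and inverse
  \<open>argm\<close>. The nested radii s < r < R make the relevant minimisers interior and leave
  \<open>f\<close> smooth around the closed ball over which they are taken.\<close>

lemma integral_det_hess_eq_MAf:
  fixes f :: "real^'n \<Rightarrow> real"
  assumes C: "Ck 2 (ball x0 R) f" and conv: "convex_on (ball x0 R) f" and r: "0 < r" "r < R" and t: "t \<ge> 0" and s: "s < r"
    and \<phi>: "continuous_on UNIV \<phi>" "\<And>x. x \<notin> cball x0 s \<Longrightarrow> \<phi> x = 0"
  shows "integral UNIV (\<lambda>x. \<phi> x * det (mat 1 + t *\<^sub>R hess f x)) = MAf x0 r t f \<phi>"
proof -
  have r0: "r \<ge> 0" using r by simp
  have cR: "cball x0 r \<subseteq> ball x0 R" using r by auto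
  have f1: "convex_on (cball x0 r) f" using conv cR by (rule convex_on_subset) auto
  have f2: "continuous_on (cball x0 r) f" using Ck_continuous[OF C] cR continuous_on_subset by blast
  have bR: "x \<in> ball x0 R" if "x \<in> ball x0 r" for x using that r by auto
  obtain F where F: "\<And>x. x \<in> cball x0 r \<Longrightarrow> \<bar>f x\<bar> \<le> F" using continuous_bounded_cball[OF f2] by blast
  let ?K = "cball (0::real^'n) (((norm x0 + r)\<^sup>2 + 2 * t * F) / (r - s))"
  let ?G = "\<lambda>x. x + t *\<^sub>R grad f x"
  have d: "f differentiable (at x)" if "x \<in> ball x0 r" for x using Ck_2D(1)[OF C bR[OF that]] .
  have inv: "argm x0 r t f (?G x) = x" if "x \<in> ball x0 r" for x
    using argm_gradient[OF f1 f2 r0 t _ d[OF that]] that by simp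
  have "integral UNIV (\<lambda>p. \<phi> (argm x0 r t f p)) = integral UNIV (\<lambda>x. \<phi> x * det (mat 1 + t *\<^sub>R hess f x))"
  proof (rule integral_change_of_variables_support[where S = "ball x0 r" and \<Gamma> = ?G and K = ?K and L = "cball x0 s"])
    show "(?G has_derivative ((*v) (mat 1 + t *\<^sub>R hess f x))) (at x)" if "x \<in> ball x0 r" for x
    proof -
      have "(?G has_derivative (\<lambda>v. v + t *\<^sub>R (hess f x *v v))) (at x)"
        by (intro has_derivative_add has_derivative_ident has_derivative_scaleR_right has_derivative_grad[OF open_ball bR[OF that] C])
      moreover have "(\<lambda>v. v + t *\<^sub>R (hess f x *v v)) = (*v) (mat 1 + t *\<^sub>R hess f x)"
        by (auto simp: matrix_vector_mult_add_rdistrib scaleR_matrix_vector_assoc)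
      ultimately show ?thesis by simp
    qed
    show "inj_on ?G (ball x0 r)" by (rule inj_onI) (metis inv)
    show "continuous_on UNIV (\<lambda>p. \<phi> (argm x0 r t f p))"
      by (rule continuous_on_compose2[OF \<phi>(1) argm_continuous[OF f1 f2 r0 t]]) auto
    show "\<phi> (argm x0 r t f p) = 0" if "p \<notin> ?K" for p
      by (rule MAf_support[OF f2 r0 t s F]) (use \<phi>(2) that in auto)
    show "\<phi> (argm x0 r t f p) = 0" if p: "p \<notin> ?G ` ball x0 r" for p
    proof (rule ccontr)
      assume "\<phi> (argm x0 r t f p) \<noteq> 0"
      then have "argm x0 r t f p \<in> cball x0 s" using \<phi>(2) by blast
      then have x: "argm x0 r t f p \<in> ball x0 r" using s by auto
      have "p = ?G (argm x0 r t f p)" by (rule argm_interior_gradient[OF f2 r0 x d[OF x]])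
      then show False using p x by blast
    qed
    show "det (mat 1 + t *\<^sub>R hess f x) \<ge> 0" if x: "x \<in> ball x0 r" for x
    proof (rule det_id_plus_PSD_nonneg[OF _ t])
      define e where "e = R - dist x0 x"
      have e: "e > 0" "ball x e \<subseteq> ball x0 R" using bR[OF x] by (auto simp: e_def ball_subset_ball_iff dist_commute)
      have "convex_on (ball x e) f" using conv e(2) by (rule convex_on_subset) auto
      moreover have "Ck 2 (ball x e) f" using C e(2) by (rule Ck_subset)
      ultimately show "hess f x \<in> PSD"
        using convex_second_derivative[of x e f] e(1) hess_inner[OF open_ball bR[OF x] C] hess_Sym[OF open_ball bR[OF x] C]
        by (simp add: PSD_def)
    qed
    show "continuous_on UNIV (\<lambda>x. \<phi> x * det (mat 1 + t *\<^sub>R hess f x))"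
      by (rule continuous_on_zero_extension[OF \<phi> closed_cball _ open_ball det_hess_continuous[OF open_ball C]]) (use s r in auto)
  qed (use s inv \<phi>(2) in auto)
  then show ?thesis by (simp add: MAf_def)
qed

section \<open>The extension to nonsmooth functions\<close>

text \<open>The radii are kept below an eighth of the distance to the boundary of X, so that the local
  estimates have room.\<close>
lemma small_balls_partition:
  fixes X K :: "'a::euclidean_space set"
  assumes X: "open X" and K: "compact K" "K \<subseteq> X" and \<delta>: "\<delta> > 0"
  shows "\<exists>C s w. finite C \<and> C \<subseteq> K \<and> (\<forall>c\<in>C. 0 < s c \<and> s c \<le> \<delta> \<and> ball c (8 * s c) \<subseteq> X) \<and>
    (\<forall>c\<in>C. \<forall>x. 0 \<le> w c x \<and> w c x \<le> 1 \<and> (x \<notin> cball c (s c) \<longrightarrow> w c x = 0)) \<and>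
    (\<forall>\<phi> :: 'a \<Rightarrow> real. continuous_on UNIV \<phi> \<longrightarrow> (\<forall>x. x \<notin> K \<longrightarrow> \<phi> x = 0) \<longrightarrow>
      (\<forall>c\<in>C. continuous_on UNIV (\<lambda>x. \<phi> x * w c x)) \<and> (\<forall>x. \<phi> x = (\<Sum>c\<in>C. \<phi> x * w c x)))"
proof -
  have "\<forall>c\<in>K. \<exists>s. 0 < s \<and> s \<le> \<delta> \<and> ball c (8 * s) \<subseteq> X"
  proof
    fix c assume "c \<in> K"
    then obtain e where e: "e > 0" "ball c e \<subseteq> X" using X K open_contains_ball by blast
    then have "ball c (8 * min \<delta> (e / 8)) \<subseteq> X" by (auto simp: subset_iff)
    then show "\<exists>s. 0 < s \<and> s \<le> \<delta> \<and> ball c (8 * s) \<subseteq> X" using e \<delta> by (intro exI[of _ "min \<delta> (e / 8)"]) auto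
  qed
  then obtain s where s: "\<And>c. c \<in> K \<Longrightarrow> 0 < s c \<and> s c \<le> \<delta> \<and> ball c (8 * s c) \<subseteq> X" by metis
  have "K \<subseteq> (\<Union>c\<in>K. ball c (s c))" using s by force
  then obtain C where C: "C \<subseteq> K" "finite C" "K \<subseteq> (\<Union>c\<in>C. ball c (s c))"
    using compactE_image[OF K(1), of K "\<lambda>c. ball c (s c)"] by auto
  \<comment> \<open>Tent functions of the balls. Their sum \<open>S\<close> is positive on a
    neighbourhood of \<open>K\<close>; where it vanishes, division by zero yields 0, so the bounds
    on \<open>w\<close> hold everywhere.\<close>
  define b where "b = (\<lambda>c x. max 0 (s c - dist c x))"
  define S where "S = (\<lambda>x. \<Sum>c\<in>C. b c x)"
  define w where "w = (\<lambda>c x. b c x / S x)"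
  have b0: "0 \<le> b c x" for c x by (simp add: b_def)
  have S0: "0 \<le> S x" for x unfolding S_def by (intro sum_nonneg b0)
  have bS: "b c x \<le> S x" if "c \<in> C" for c x unfolding S_def by (rule member_le_sum[OF that b0 C(2)])
  have bc: "continuous_on UNIV (b c)" for c unfolding b_def by (intro continuous_intros)
  have Sc: "continuous_on UNIV S" unfolding S_def by (intro continuous_intros bc)
  define U where "U = {x. 0 < S x}"
  have U: "open U" unfolding U_def by (intro open_Collect_less Sc continuous_intros)
  have KU: "K \<subseteq> U"
  proof
    fix x assume "x \<in> K"
    then obtain c where c: "c \<in> C" "dist c x < s c" using C(3) by auto
    then have "0 < b c x" by (simp add: b_def)
    then show "x \<in> U" using bS[OF c(1), of x] by (simp add: U_def)
  qed
  have w: "0 \<le> w c x \<and> w c x \<le> 1 \<and> (x \<notin> cball c (s c) \<longrightarrow> w c x = 0)" if c: "c \<in> C" for c x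
    using b0[of c x] S0[of x] bS[OF c, of x] by (auto simp: w_def b_def divide_le_eq_1)
  have "(\<forall>c\<in>C. continuous_on UNIV (\<lambda>x. \<phi> x * w c x)) \<and> (\<forall>x. \<phi> x = (\<Sum>c\<in>C. \<phi> x * w c x))"
    if \<phi>: "continuous_on UNIV \<phi>" "\<forall>x. x \<notin> K \<longrightarrow> \<phi> x = 0" for \<phi> :: "'a \<Rightarrow> real"
  proof (intro conjI ballI allI)
    show "continuous_on UNIV (\<lambda>x. \<phi> x * w c x)" for c
    proof (rule continuous_on_zero_extension[OF \<phi>(1) _ compact_imp_closed[OF K(1)] KU U])
      show "continuous_on U (w c)" unfolding w_def
        by (intro continuous_on_divide continuous_on_subset[OF bc] continuous_on_subset[OF Sc]) (auto simp: U_def)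
    qed (use \<phi>(2) in blast)
    fix x
    have "(\<Sum>c\<in>C. \<phi> x * w c x) = \<phi> x * (S x / S x)"
      by (simp add: w_def S_def sum_distrib_left[symmetric] sum_divide_distrib[symmetric])
    then show "\<phi> x = (\<Sum>c\<in>C. \<phi> x * w c x)" using \<phi>(2) KU by (cases "x \<in> K") (auto simp: U_def)
  qed
  then show ?thesis
    by (intro exI[of _ C] exI[of _ s] exI[of _ w]) (use s C w in blast)
qed

lemma Cdens_continuous:
  fixes f :: "real^'n \<Rightarrow> real"
  assumes X: "open X" and C: "Ck 2 X f"
  shows "continuous_on X (Cdens \<theta> f)"
proof -
  obtain a where a: "\<And>(f :: real^'n \<Rightarrow> real) x. hess f x \<in> Sym \<Longrightarrow>
     Cdens \<theta> f x = (\<Sum>m\<le>CARD('n). a m * det (mat 1 + real m *\<^sub>R hess f x))"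
    using Cdens_interpolation by blast
  have "continuous_on X (\<lambda>x. \<Sum>m\<le>CARD('n). a m * det (mat 1 + real m *\<^sub>R hess f x))"
    by (intro continuous_intros det_hess_continuous[OF X C])
  then show ?thesis
    by (rule continuous_on_cong[THEN iffD1, rotated 2]) (use a hess_Sym[OF X _ C] in auto)
qed

lemma integrable_test:
  fixes \<phi> q :: "'a::euclidean_space \<Rightarrow> real"
  assumes \<phi>: "continuous_on UNIV \<phi>" "\<And>x. x \<notin> K \<Longrightarrow> \<phi> x = 0" and K: "compact K" "K \<subseteq> X" "open X" and q: "continuous_on X q"
  shows "(\<lambda>x. \<phi> x * q x) integrable_on X" "(\<lambda>x. \<phi> x * q x) integrable_on UNIV"
    "integral X (\<lambda>x. \<phi> x * q x) = integral UNIV (\<lambda>x. \<phi> x * q x)"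
proof -
  obtain a b where ab: "K \<subseteq> cbox a b" using compact_subset_cbox[OF K(1)] by blast
  have "continuous_on UNIV (\<lambda>x. \<phi> x * q x)"
    by (rule continuous_on_zero_extension[OF \<phi> compact_imp_closed[OF K(1)] K(2,3) q])
  then have h: "((\<lambda>x. \<phi> x * q x) has_integral integral (cbox a b) (\<lambda>x. \<phi> x * q x)) UNIV"
    by (rule has_integral_compact_support) (use \<phi>(2) ab in auto)
  then show "(\<lambda>x. \<phi> x * q x) integrable_on UNIV" by (auto simp: integrable_on_def)
  have "((\<lambda>x. \<phi> x * q x) has_integral integral (cbox a b) (\<lambda>x. \<phi> x * q x)) X"
    by (rule iffD2[OF has_integral_on_UNIV_iff h]) (use \<phi>(2) K(2) in auto)
  then show "(\<lambda>x. \<phi> x * q x) integrable_on X" "integral X (\<lambda>x. \<phi> x * q x) = integral UNIV (\<lambda>x. \<phi> x * q x)"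
    using h by (auto simp: integrable_on_def integral_unique)
qed

lemma Cmeas_sum:
  fixes f :: "real^'n \<Rightarrow> real"
  assumes X: "open X" and C: "Ck 2 X f" and K: "compact K" "K \<subseteq> X" and I: "finite I"
    and \<phi>: "\<And>i. i \<in> I \<Longrightarrow> continuous_on UNIV (\<phi> i)" "\<And>i x. i \<in> I \<Longrightarrow> x \<notin> K \<Longrightarrow> \<phi> i x = 0"
  shows "Cmeas X \<theta> f (\<lambda>x. \<Sum>i\<in>I. k i * \<phi> i x) = (\<Sum>i\<in>I. k i * Cmeas X \<theta> f (\<phi> i))"
proof -
  have "integral X (\<lambda>x. (\<Sum>i\<in>I. k i * \<phi> i x) * Cdens \<theta> f x) = integral X (\<lambda>x. \<Sum>i\<in>I. k i * (\<phi> i x * Cdens \<theta> f x))"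
    by (simp add: sum_distrib_right mult.assoc)
  also have "\<dots> = (\<Sum>i\<in>I. integral X (\<lambda>x. k i * (\<phi> i x * Cdens \<theta> f x)))"
    using integrable_test(1)[OF \<phi> K X Cdens_continuous[OF X C]]
    by (intro integral_sum I integrable_on_mult_right) auto
  finally show ?thesis by (simp add: Cmeas_def)
qed

lemma Cmeas_MAf:
  fixes f :: "real^'n \<Rightarrow> real"
  assumes a: "\<And>(f :: real^'n \<Rightarrow> real) x. hess f x \<in> Sym \<Longrightarrow>
     Cdens \<theta> f x = (\<Sum>m\<le>CARD('n). a m * det (mat 1 + real m *\<^sub>R hess f x))"
    and X: "open X" and C: "Ck 2 X f" and conv: "convex_on (ball x0 R) f" and R: "ball x0 R \<subseteq> X" "0 < r" "r < R" "s < r"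
    and \<phi>: "continuous_on UNIV \<phi>" "\<And>x. x \<notin> cball x0 s \<Longrightarrow> \<phi> x = 0"
  shows "Cmeas X \<theta> f \<phi> = (\<Sum>m\<le>CARD('n). a m * MAf x0 r (real m) f \<phi>)"
proof -
  have K: "cball x0 s \<subseteq> X" using R by (auto simp: subset_iff)
  have "Cmeas X \<theta> f \<phi> = integral X (\<lambda>x. \<Sum>m\<le>CARD('n). a m * (\<phi> x * det (mat 1 + real m *\<^sub>R hess f x)))"
    unfolding Cmeas_def
    by (rule integral_cong) (simp add: a[OF hess_Sym[OF X _ C]] sum_distrib_left mult.left_commute)
  also have "\<dots> = (\<Sum>m\<le>CARD('n). integral X (\<lambda>x. a m * (\<phi> x * det (mat 1 + real m *\<^sub>R hess f x))))"
    by (intro integral_sum integrable_on_mult_right integrable_test(1)[OF \<phi> compact_cball K X det_hess_continuous[OF X C]]) auto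
  also have "\<dots> = (\<Sum>m\<le>CARD('n). a m * MAf x0 r (real m) f \<phi>)"
    using integral_det_hess_eq_MAf[OF Ck_subset[OF C R(1)] conv R(2,3) _ R(4) \<phi>]
      integrable_test(3)[OF \<phi> compact_cball K X det_hess_continuous[OF X C]] by simp
  finally show ?thesis .
qed

definition approximates :: "(real^'n) set \<Rightarrow> (nat \<Rightarrow> real^'n \<Rightarrow> real) \<Rightarrow> (real^'n \<Rightarrow> real) \<Rightarrow> bool" where
  "approximates X fs f \<longleftrightarrow> (\<forall>k. Ck 2 X (fs k) \<and> Pfun X (fs k)) \<and>
    (\<forall>K. compact K \<and> K \<subseteq> X \<longrightarrow> uniform_limit K fs f sequentially)"

lemma convex_on_cball_of_Pfun:
  fixes f :: "real^'n \<Rightarrow> real"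
  assumes "open X" "Pfun X f" "ball x0 R \<subseteq> X" "r < R"
  shows "convex_on (cball x0 r) f" "continuous_on (cball x0 r) f"
proof -
  have c: "convex_on (ball x0 R) f" by (rule Pfun_convex_on_ball[OF assms(1-3)])
  have "cball x0 r \<subseteq> ball x0 R" using assms(4) by auto
  then show "convex_on (cball x0 r) f" "continuous_on (cball x0 r) f"
    by (auto intro: convex_on_subset[OF c] continuous_on_subset[OF convex_on_continuous[OF open_ball c]])
qed

text \<open>The limit is written in terms of \<open>f\<close> alone, which shows that it does not
  depend on the approximating sequence. The data of this formula are exported because the local
  bound and positivity are read off from it; \<open>C\<close>, \<open>s\<close> and \<open>w\<close>
  depend on \<open>K\<close> but not on the test function.\<close>

lemma Cmeas_converges:
  fixes X :: "(real^'n) set"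
  assumes X: "open X" and K: "compact K" "K \<subseteq> X"
  obtains a C s w where "\<And>(f :: real^'n \<Rightarrow> real) x. hess f x \<in> Sym \<Longrightarrow>
     Cdens \<theta> f x = (\<Sum>m\<le>CARD('n). a m * det (mat 1 + real m *\<^sub>R hess f x))"
    "finite C" "\<And>c. c \<in> C \<Longrightarrow> 0 < s c \<and> ball c (8 * s c) \<subseteq> X"
    "\<And>c x. c \<in> C \<Longrightarrow> 0 \<le> w c x \<and> w c x \<le> 1 \<and> (x \<notin> cball c (s c) \<longrightarrow> w c x = 0)"
    "\<And>\<phi> c. continuous_on UNIV \<phi> \<Longrightarrow> (\<And>x. x \<notin> K \<Longrightarrow> \<phi> x = 0) \<Longrightarrow> c \<in> C \<Longrightarrow> continuous_on UNIV (\<lambda>x. \<phi> x * w c x)"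
    "\<And>f fs \<phi>. Pfun X f \<Longrightarrow> approximates X fs f \<Longrightarrow> continuous_on UNIV \<phi> \<Longrightarrow> (\<And>x. x \<notin> K \<Longrightarrow> \<phi> x = 0) \<Longrightarrow>
      (\<lambda>k. Cmeas X \<theta> (fs k) \<phi>) \<longlonglongrightarrow> (\<Sum>c\<in>C. \<Sum>m\<le>CARD('n). a m * MAf c (2 * s c) (real m) f (\<lambda>x. \<phi> x * w c x))"
proof -
  obtain a where a: "\<And>(f :: real^'n \<Rightarrow> real) x. hess f x \<in> Sym \<Longrightarrow>
     Cdens \<theta> f x = (\<Sum>m\<le>CARD('n). a m * det (mat 1 + real m *\<^sub>R hess f x))"
    using Cdens_interpolation by blast
  obtain C s w where C: "finite C" "C \<subseteq> K" "\<forall>c\<in>C. 0 < s c \<and> s c \<le> 1 \<and> ball c (8 * s c) \<subseteq> X"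
    "\<forall>c\<in>C. \<forall>x. 0 \<le> w c x \<and> w c x \<le> 1 \<and> (x \<notin> cball c (s c) \<longrightarrow> w c x = (0::real))"
    "\<forall>\<phi> :: real^'n \<Rightarrow> real. continuous_on UNIV \<phi> \<longrightarrow> (\<forall>x. x \<notin> K \<longrightarrow> \<phi> x = 0) \<longrightarrow>
      (\<forall>c\<in>C. continuous_on UNIV (\<lambda>x. \<phi> x * w c x)) \<and> (\<forall>x. \<phi> x = (\<Sum>c\<in>C. \<phi> x * w c x))"
    using small_balls_partition[OF X K zero_less_one] by blast
  have lim: "(\<lambda>k. Cmeas X \<theta> (fs k) \<phi>) \<longlonglongrightarrow> (\<Sum>c\<in>C. \<Sum>m\<le>CARD('n). a m * MAf c (2 * s c) (real m) f (\<lambda>x. \<phi> x * w c x))"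
    if P: "Pfun X f" and ap: "approximates X fs f" and \<phi>: "continuous_on UNIV \<phi>" "\<And>x. x \<notin> K \<Longrightarrow> \<phi> x = 0" for f fs \<phi>
  proof -
    have fs: "Ck 2 X (fs k)" "Pfun X (fs k)" for k using ap by (auto simp: approximates_def)
    have \<phi>w: "continuous_on UNIV (\<lambda>x. \<phi> x * w c x)" if "c \<in> C" for c using C(5) \<phi> that by blast
    have \<phi>s: "\<phi> x * w c x = 0" if "c \<in> C" "x \<notin> cball c (s c)" for c x using C(4) that by simp
    have sc: "0 < s c" "ball c (8 * s c) \<subseteq> X" if "c \<in> C" for c using C(3) that by auto
    have "Cmeas X \<theta> (fs k) \<phi> = (\<Sum>c\<in>C. \<Sum>m\<le>CARD('n). a m * MAf c (2 * s c) (real m) (fs k) (\<lambda>x. \<phi> x * w c x))" for k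
    proof -
      have e: "\<phi> x = (\<Sum>c\<in>C. 1 * (\<phi> x * w c x))" for x using C(5) \<phi> by simp
      have "Cmeas X \<theta> (fs k) (\<lambda>x. \<Sum>c\<in>C. 1 * (\<phi> x * w c x)) = (\<Sum>c\<in>C. 1 * Cmeas X \<theta> (fs k) (\<lambda>x. \<phi> x * w c x))"
        by (rule Cmeas_sum[OF X fs(1) K C(1)]) (use \<phi>w \<phi>(2) in auto)
      then have "Cmeas X \<theta> (fs k) \<phi> = (\<Sum>c\<in>C. Cmeas X \<theta> (fs k) (\<lambda>x. \<phi> x * w c x))"
        unfolding e[symmetric] by simp
      also have "\<dots> = (\<Sum>c\<in>C. \<Sum>m\<le>CARD('n). a m * MAf c (2 * s c) (real m) (fs k) (\<lambda>x. \<phi> x * w c x))"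
      proof (rule sum.cong[OF refl])
        fix c assume c: "c \<in> C"
        show "Cmeas X \<theta> (fs k) (\<lambda>x. \<phi> x * w c x) = (\<Sum>m\<le>CARD('n). a m * MAf c (2 * s c) (real m) (fs k) (\<lambda>x. \<phi> x * w c x))"
          by (rule Cmeas_MAf[OF a X fs(1) Pfun_convex_on_ball[OF X fs(2) sc(2)[OF c]] sc(2)[OF c]])
            (use sc[OF c] \<phi>w[OF c] \<phi>s[OF c] in auto)
      qed
      finally show ?thesis .
    qed
    moreover have "(\<lambda>k. \<Sum>c\<in>C. \<Sum>m\<le>CARD('n). a m * MAf c (2 * s c) (real m) (fs k) (\<lambda>x. \<phi> x * w c x)) \<longlonglongrightarrow>
      (\<Sum>c\<in>C. \<Sum>m\<le>CARD('n). a m * MAf c (2 * s c) (real m) f (\<lambda>x. \<phi> x * w c x))"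
    proof (intro tendsto_sum tendsto_mult_left)
      fix c m assume c: "c \<in> C"
      have r: "2 * s c < 8 * s c" using sc[OF c] by simp
      have sub: "cball c (2 * s c) \<subseteq> X" using sc[OF c] by (auto simp: subset_iff)
      show "(\<lambda>k. MAf c (2 * s c) (real m) (fs k) (\<lambda>x. \<phi> x * w c x)) \<longlonglongrightarrow> MAf c (2 * s c) (real m) f (\<lambda>x. \<phi> x * w c x)"
      proof (rule MAf_tendsto[where s = "s c"])
        show "uniform_limit (cball c (2 * s c)) fs f sequentially" using ap sub by (simp add: approximates_def)
      qed (use convex_on_cball_of_Pfun[OF X P sc(2)[OF c] r] convex_on_cball_of_Pfun[OF X fs(2) sc(2)[OF c] r] sc[OF c] \<phi>w[OF c] \<phi>s[OF c] in auto)
    qed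
    ultimately show ?thesis by simp
  qed
  show ?thesis
    by (rule that[OF a C(1) _ _ _ lim]) (use C(3,4,5) in blast)+
qed

text \<open>A chosen sequence stands in for an explicit formula, since the formula of
  \<open>Cmeas_converges\<close> involves a partition adapted to the support of the test function.
  \<open>Cext_limit\<close> shows that the choice does not matter.\<close>

definition Cext :: "(real^'n) set \<Rightarrow> real \<Rightarrow> (real^'n \<Rightarrow> real) \<Rightarrow> (real^'n \<Rightarrow> real) \<Rightarrow> real" where
  "Cext X \<theta> f \<phi> = lim (\<lambda>k. Cmeas X \<theta> ((SOME fs. approximates X fs f) k) \<phi>)"

lemma approximates_exists:
  assumes "open X" "X \<noteq> {}" "Pfun X f"
  shows "\<exists>fs. approximates X fs f"
  using Pfun_C2_approximation[OF assms] unfolding approximates_def by blast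

lemma test_fun_support:
  assumes "test_fun X \<phi>"
  shows "continuous_on UNIV \<phi>" "compact (closure {x. \<phi> x \<noteq> 0})" "closure {x. \<phi> x \<noteq> 0} \<subseteq> X"
    "\<And>x. x \<notin> closure {x. \<phi> x \<noteq> 0} \<Longrightarrow> \<phi> x = 0"
  using assms closure_subset[of "{x. \<phi> x \<noteq> 0}"] by (auto simp: test_fun_def)

lemma Cext_limit:
  fixes X :: "(real^'n) set"
  assumes X: "open X" "X \<noteq> {}" and P: "Pfun X f" and ap: "approximates X fs f" and \<phi>: "test_fun X \<phi>"
  shows "(\<lambda>k. Cmeas X \<theta> (fs k) \<phi>) \<longlonglongrightarrow> Cext X \<theta> f \<phi>"
proof -
  have ap': "approximates X (SOME fs. approximates X fs f) f"
    using approximates_exists[OF X P] by (rule someI_ex)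
  note \<phi>' = test_fun_support[OF \<phi>]
  obtain V where V: "\<And>fs. approximates X fs f \<Longrightarrow> (\<lambda>k. Cmeas X \<theta> (fs k) \<phi>) \<longlonglongrightarrow> V"
    by (rule Cmeas_converges[OF X(1) \<phi>'(2,3), of \<theta>]) (use P \<phi>'(1,4) in blast)
  have "Cext X \<theta> f \<phi> = V" unfolding Cext_def using V[OF ap'] by (rule limI)
  then show ?thesis using V[OF ap] by simp
qed

lemma Cext_C2:
  fixes X :: "(real^'n) set"
  assumes X: "open X" "X \<noteq> {}" and P: "Pfun X f" and C: "C2_on X f" and \<phi>: "test_fun X \<phi>"
  shows "Cext X \<theta> f \<phi> = Cmeas X \<theta> f \<phi>"
proof -
  have "approximates X (\<lambda>k. f) f"
    using P C C2_on_iff_Ck[OF X(1)] by (auto simp: approximates_def uniform_limit_iff)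
  from Cext_limit[OF X P this \<phi>] show ?thesis using LIMSEQ_unique tendsto_const by blast
qed

lemma Cext_linear:
  fixes X :: "(real^'n) set"
  assumes X: "open X" "X \<noteq> {}" and P: "Pfun X f" and \<phi>: "test_fun X \<phi>" and \<psi>: "test_fun X \<psi>"
  shows "Cext X \<theta> f (\<lambda>x. a * \<phi> x + b * \<psi> x) = a * Cext X \<theta> f \<phi> + b * Cext X \<theta> f \<psi>"
proof -
  obtain fs where fs: "approximates X fs f" using approximates_exists[OF X P] by blast
  let ?K = "closure {x. \<phi> x \<noteq> 0} \<union> closure {x. \<psi> x \<noteq> 0}"
  note \<phi>' = test_fun_support[OF \<phi>] and \<psi>' = test_fun_support[OF \<psi>]
  have K: "compact ?K" "?K \<subseteq> X" using \<phi>'(2,3) \<psi>'(2,3) by auto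
  have "closure {x. a * \<phi> x + b * \<psi> x \<noteq> 0} \<subseteq> ?K"
  proof (rule closure_minimal[OF _ compact_imp_closed[OF K(1)]], rule subsetI)
    fix x assume "x \<in> {x. a * \<phi> x + b * \<psi> x \<noteq> 0}"
    then have "\<phi> x \<noteq> 0 \<or> \<psi> x \<noteq> 0" by auto
    then show "x \<in> ?K" using \<phi>'(4) \<psi>'(4) by blast
  qed
  then have sub: "?K \<inter> closure {x. a * \<phi> x + b * \<psi> x \<noteq> 0} = closure {x. a * \<phi> x + b * \<psi> x \<noteq> 0}" by blast
  then have "compact (closure {x. a * \<phi> x + b * \<psi> x \<noteq> 0})"
    using compact_Int_closed[OF K(1) closed_closure[of "{x. a * \<phi> x + b * \<psi> x \<noteq> 0}"]] by (simp only: sub)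
  then have t: "test_fun X (\<lambda>x. a * \<phi> x + b * \<psi> x)"
    unfolding test_fun_def using \<phi>'(1) \<psi>'(1) K(2) sub by (intro conjI continuous_intros) blast+
  have C: "Ck 2 X (fs k)" for k using fs by (simp add: approximates_def)
  have "Cmeas X \<theta> (fs k) (\<lambda>x. a * \<phi> x + b * \<psi> x) = a * Cmeas X \<theta> (fs k) \<phi> + b * Cmeas X \<theta> (fs k) \<psi>" for k
  proof -
    note q = Cdens_continuous[OF X(1) C, of \<theta> k]
    have i: "(\<lambda>x. \<phi> x * Cdens \<theta> (fs k) x) integrable_on X" "(\<lambda>x. \<psi> x * Cdens \<theta> (fs k) x) integrable_on X"
      by (rule integrable_test(1)[OF \<phi>'(1,4,2,3) X(1) q], assumption,
          rule integrable_test(1)[OF \<psi>'(1,4,2,3) X(1) q], assumption)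
    have "integral X (\<lambda>x. (a * \<phi> x + b * \<psi> x) * Cdens \<theta> (fs k) x) =
        integral X (\<lambda>x. a * (\<phi> x * Cdens \<theta> (fs k) x) + b * (\<psi> x * Cdens \<theta> (fs k) x))"
      by (simp add: algebra_simps)
    also have "\<dots> = a * integral X (\<lambda>x. \<phi> x * Cdens \<theta> (fs k) x) + b * integral X (\<lambda>x. \<psi> x * Cdens \<theta> (fs k) x)"
      using integral_add[OF integrable_on_mult_right[OF i(1), of a] integrable_on_mult_right[OF i(2), of b]] by simp
    finally show ?thesis by (simp add: Cmeas_def)
  qed
  moreover have "(\<lambda>k. a * Cmeas X \<theta> (fs k) \<phi> + b * Cmeas X \<theta> (fs k) \<psi>) \<longlonglongrightarrow> a * Cext X \<theta> f \<phi> + b * Cext X \<theta> f \<psi>"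
    by (intro tendsto_intros Cext_limit[OF X P fs] \<phi> \<psi>)
  ultimately show ?thesis using Cext_limit[OF X P fs t, of \<theta>] LIMSEQ_unique by auto
qed

text \<open>The partition is fixed by \<open>K\<close> before the test function is chosen, so
  finitely many constants from \<open>MAf_bound\<close> control all test functions supported in
  \<open>K\<close> at once.\<close>

lemma Cext_signed_radon:
  fixes X :: "(real^'n) set"
  assumes X: "open X" "X \<noteq> {}" and P: "Pfun X f"
  shows "signed_radon X (Cext X \<theta> f)"
  unfolding signed_radon_def
proof (intro conjI allI impI)
  fix K assume K: "compact K \<and> K \<subseteq> X"
  obtain fs where fs: "approximates X fs f" using approximates_exists[OF X P] by blast
  show "\<exists>C. \<forall>\<phi>. test_fun X \<phi> \<and> {x. \<phi> x \<noteq> 0} \<subseteq> K \<longrightarrow> \<bar>Cext X \<theta> f \<phi>\<bar> \<le> C * (SUP x. \<bar>\<phi> x\<bar>)"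
  proof (rule Cmeas_converges[OF X(1) K[THEN conjunct1] K[THEN conjunct2], of \<theta>])
    fix a C s w
    assume C: "finite C" and sc: "\<And>c. c \<in> C \<Longrightarrow> 0 < s c \<and> ball c (8 * s c) \<subseteq> X"
      and w: "\<And>c x. c \<in> C \<Longrightarrow> 0 \<le> w c x \<and> w c x \<le> 1 \<and> (x \<notin> cball c (s c) \<longrightarrow> w c x = (0::real))"
      and wc: "\<And>\<phi> c. continuous_on UNIV \<phi> \<Longrightarrow> (\<And>x. x \<notin> K \<Longrightarrow> \<phi> x = 0) \<Longrightarrow> c \<in> C \<Longrightarrow> continuous_on UNIV (\<lambda>x. \<phi> x * w c x)"
      and lim: "\<And>f fs \<phi>. Pfun X f \<Longrightarrow> approximates X fs f \<Longrightarrow> continuous_on UNIV \<phi> \<Longrightarrow> (\<And>x. x \<notin> K \<Longrightarrow> \<phi> x = 0) \<Longrightarrow>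
        (\<lambda>k. Cmeas X \<theta> (fs k) \<phi>) \<longlonglongrightarrow> (\<Sum>c\<in>C. \<Sum>m\<le>CARD('n). a m * MAf c (2 * s c) (real m) f (\<lambda>x. \<phi> x * w c x))"
    have "\<exists>B\<ge>0. \<forall>\<phi> M. continuous_on UNIV \<phi> \<longrightarrow> (\<forall>x. x \<notin> cball c (s c) \<longrightarrow> \<phi> x = 0) \<longrightarrow> (\<forall>x. \<bar>\<phi> x\<bar> \<le> M) \<longrightarrow>
      \<bar>MAf c (2 * s c) (real m) f \<phi>\<bar> \<le> B * M" if c: "c \<in> C" for c and m :: nat
    proof (rule MAf_bound)
      have "2 * s c < 8 * s c" using sc[OF c] by simp
      then show "convex_on (cball c (2 * s c)) f" "continuous_on (cball c (2 * s c)) f"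
        using convex_on_cball_of_Pfun[OF X(1) P] sc[OF c] by blast+
    qed (use sc[OF c] in auto)
    then obtain B where B: "\<And>c m \<phi> M. c \<in> C \<Longrightarrow> continuous_on UNIV \<phi> \<Longrightarrow> (\<And>x. x \<notin> cball c (s c) \<Longrightarrow> \<phi> x = 0) \<Longrightarrow> (\<And>x. \<bar>\<phi> x\<bar> \<le> M) \<Longrightarrow>
      \<bar>MAf c (2 * s c) (real (m::nat)) f \<phi>\<bar> \<le> B c m * M" by metis
    let ?B = "\<Sum>c\<in>C. \<Sum>m\<le>CARD('n). \<bar>a m\<bar> * B c m"
    have "\<bar>Cext X \<theta> f \<phi>\<bar> \<le> ?B * (SUP x. \<bar>\<phi> x\<bar>)" if \<phi>: "test_fun X \<phi>" "{x. \<phi> x \<noteq> 0} \<subseteq> K" for \<phi>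
    proof -
      define M where "M = (SUP x. \<bar>\<phi> x\<bar>)"
      note \<phi>' = test_fun_support[OF \<phi>(1)]
      have z: "\<phi> x = 0" if "x \<notin> K" for x using \<phi>(2) that by blast
      have "compact (\<phi> ` K)" using \<phi>'(1) K compact_continuous_image continuous_on_subset by blast
      then obtain D where D: "\<And>x. x \<in> K \<Longrightarrow> \<bar>\<phi> x\<bar> \<le> D" using compact_imp_bounded bounded_iff by (metis imageI real_norm_def)
      have "\<bar>\<phi> x\<bar> \<le> max D 0" for x using D[of x] z[of x] by (cases "x \<in> K") auto
      then have M: "\<bar>\<phi> x\<bar> \<le> M" for x unfolding M_def by (intro cSUP_upper bdd_aboveI2[of _ _ "max D 0"]) auto
      have "Cext X \<theta> f \<phi> = (\<Sum>c\<in>C. \<Sum>m\<le>CARD('n). a m * MAf c (2 * s c) (real m) f (\<lambda>x. \<phi> x * w c x))"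
        using LIMSEQ_unique[OF Cext_limit[OF X P fs \<phi>(1)] lim[OF P fs \<phi>'(1) z]] .
      also have "\<bar>\<dots>\<bar> \<le> (\<Sum>c\<in>C. \<Sum>m\<le>CARD('n). (\<bar>a m\<bar> * B c m) * M)"
      proof (rule order_trans[OF sum_abs], rule sum_mono, rule order_trans[OF sum_abs], rule sum_mono)
        fix c m assume c: "c \<in> C"
        have "\<bar>MAf c (2 * s c) (real m) f (\<lambda>x. \<phi> x * w c x)\<bar> \<le> B c m * M"
        proof (rule B[OF c wc[OF \<phi>'(1) z c]])
          show "\<bar>\<phi> x * w c x\<bar> \<le> M" for x
          proof -
            have "\<bar>\<phi> x\<bar> * \<bar>w c x\<bar> \<le> M * 1" using w[OF c, of x] M[of x] by (intro mult_mono) auto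
            then show ?thesis by (simp add: abs_mult)
          qed
        qed (use w[OF c] in auto)
        then show "\<bar>a m * MAf c (2 * s c) (real m) f (\<lambda>x. \<phi> x * w c x)\<bar> \<le> (\<bar>a m\<bar> * B c m) * M"
          by (simp add: abs_mult mult.assoc mult_left_mono)
      qed
      also have "\<dots> = ?B * M" by (simp add: sum_distrib_right)
      finally show ?thesis by (simp add: M_def)
    qed
    then show ?thesis by blast
  qed
qed (use Cext_linear[OF X P] in blast)

lemma cont_ext_Cext:
  fixes X :: "(real^'n) set"
  assumes X: "open X" "X \<noteq> {}"
  shows "cont_ext X \<theta> (Pfun X) (Cext X \<theta>)"
  unfolding cont_ext_def
proof (intro conjI allI impI)
  fix f \<phi> assume "Pfun X f \<and> C2_on X f" "test_fun X \<phi>"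
  then show "Cext X \<theta> f \<phi> = Cmeas X \<theta> f \<phi>" using Cext_C2[OF X] by blast
next
  fix fs f \<phi> assume h: "(\<forall>k. Pfun X (fs k) \<and> C2_on X (fs k)) \<and> Pfun X f \<and> (\<forall>K. compact K \<and> K \<subseteq> X \<longrightarrow> uniform_limit K fs f sequentially)"
    and \<phi>: "test_fun X \<phi>"
  have "approximates X fs f" using h C2_on_iff_Ck[OF X(1)] by (auto simp: approximates_def)
  then show "(\<lambda>k. Cext X \<theta> (fs k) \<phi>) \<longlonglongrightarrow> Cext X \<theta> f \<phi>"
    using Cext_limit[OF X _ _ \<phi>, of f fs \<theta>] Cext_C2[OF X _ _ \<phi>] h by simp
qed

text \<open>The value of any extension at \<open>f\<close> is the limit of its prescribed values on
  C2 approximants, and such approximants exist for every \<open>f\<close> of type P.\<close>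

lemma cont_ext_unique:
  fixes X :: "(real^'n) set"
  assumes X: "open X" "X \<noteq> {}" and T: "cont_ext X \<theta> (Pfun X) T" and P: "Pfun X f" and \<phi>: "test_fun X \<phi>"
  shows "T f \<phi> = Cext X \<theta> f \<phi>"
proof -
  obtain fs where fs: "approximates X fs f" using approximates_exists[OF X P] by blast
  then have C: "Pfun X (fs k)" "C2_on X (fs k)" for k
    using C2_on_iff_Ck[OF X(1)] by (auto simp: approximates_def)
  have "(\<lambda>k. T (fs k) \<phi>) \<longlonglongrightarrow> T f \<phi>"
    using T[unfolded cont_ext_def, THEN conjunct2, rule_format, of fs f \<phi>] C P fs \<phi>
    by (simp add: approximates_def)
  moreover have "T (fs k) \<phi> = Cmeas X \<theta> (fs k) \<phi>" for k using T C \<phi> unfolding cont_ext_def by blast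
  ultimately show ?thesis using Cext_limit[OF X P fs \<phi>, of \<theta>] LIMSEQ_unique by auto
qed

section \<open>A Dirichlet problem with polynomial data\<close>

text \<open>Polynomials of degree at most k are handled as a finite-dimensional subspace of the
  space of all functions, the span of \<open>monoms k\<close>; degree bounds become membership in a
  span.\<close>

interpretation fs: vector_space "\<lambda>(c::real) (f :: 'a \<Rightarrow> real) x. c * f x"
  by unfold_locales (auto simp: fun_eq_iff algebra_simps)

primrec monoms :: "nat \<Rightarrow> (real^'n \<Rightarrow> real) set" where
  "monoms 0 = {\<lambda>x. 1}"
| "monoms (Suc k) = monoms k \<union> (\<Union>i. (\<lambda>m x. x $ i * m x) ` monoms k)"

abbreviation polys :: "nat \<Rightarrow> (real^'n \<Rightarrow> real) set" where
  "polys k \<equiv> fs.span (monoms k)"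

lemma finite_monoms: "finite (monoms k :: (real^'n \<Rightarrow> real) set)"
  by (induction k) auto

lemma polys_zero: "(\<lambda>x. 0) \<in> polys k"
  using fs.span_zero[of "monoms k"] by (simp add: zero_fun_def)

lemma polys_add: "f \<in> polys k \<Longrightarrow> g \<in> polys k \<Longrightarrow> (\<lambda>x. f x + g x) \<in> polys k"
  using fs.span_add[of f "monoms k" g] by (simp add: plus_fun_def)

lemma polys_cmult: "f \<in> polys k \<Longrightarrow> (\<lambda>x. c * f x) \<in> polys k"
  by (rule fs.span_scale)

lemma polys_diff: "f \<in> polys k \<Longrightarrow> g \<in> polys k \<Longrightarrow> (\<lambda>x. f x - g x) \<in> polys k"
  using polys_add[of f k "\<lambda>x. (- 1) * g x"] polys_cmult[of g k "- 1"] by simp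

lemma polys_sum: "(\<And>i. i \<in> I \<Longrightarrow> f i \<in> polys k) \<Longrightarrow> (\<lambda>x. \<Sum>i\<in>I. f i x) \<in> polys k"
  by (induction I rule: infinite_finite_induct) (auto intro: polys_zero polys_add)

lemma polys_Suc: "polys k \<subseteq> polys (Suc k)"
  by (rule fs.span_mono) auto

lemma polys_mono: "k \<le> l \<Longrightarrow> polys k \<subseteq> polys l"
  by (rule lift_Suc_mono_le[of polys]) (rule polys_Suc)

lemma polys_induct [consumes 1, case_names mono zero add scale]:
  assumes "f \<in> polys k" "\<And>m. m \<in> monoms k \<Longrightarrow> P m" "P (\<lambda>x. 0)"
    "\<And>f g. f \<in> polys k \<Longrightarrow> g \<in> polys k \<Longrightarrow> P f \<Longrightarrow> P g \<Longrightarrow> P (\<lambda>x. f x + g x)"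
    "\<And>c f. f \<in> polys k \<Longrightarrow> P f \<Longrightarrow> P (\<lambda>x. c * f x)"
  shows "P f"
proof -
  have "f \<in> polys k \<and> P f"
    using assms(1)
  proof (rule fs.span_induct)
    show "fs.subspace {f. f \<in> polys k \<and> P f}"
      unfolding fs.subspace_def
      by (auto simp: zero_fun_def plus_fun_def intro!: assms(3-5) polys_zero polys_add polys_cmult)
  qed (use assms(2) fs.span_base in auto)
  then show ?thesis by simp
qed

lemma polys_coord: "f \<in> polys k \<Longrightarrow> (\<lambda>x. x $ i * f x) \<in> polys (Suc k)"
proof (induction rule: polys_induct)
  case (mono m)
  then show ?case by (intro fs.span_base) auto
next
  case (add f g)
  then show ?case using polys_add[of "\<lambda>x. x $ i * f x" "Suc k"] by (simp add: distrib_left)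
next
  case (scale c f)
  then show ?case using polys_cmult[of "\<lambda>x. x $ i * f x" "Suc k" c] by (simp add: mult.left_commute)
qed (simp only: mult_zero_right polys_zero)

lemma polys_mult_mono: "m \<in> monoms k \<Longrightarrow> g \<in> polys l \<Longrightarrow> (\<lambda>x. m x * g x) \<in> polys (k + l)"
proof (induction k arbitrary: m)
  case 0
  then show ?case by simp
next
  case (Suc k)
  from Suc.prems(1) consider "m \<in> monoms k" | i m' where "m' \<in> monoms k" "m = (\<lambda>x. x $ i * m' x)" by auto
  then show ?case
  proof cases
    case 1
    then show ?thesis using Suc.IH Suc.prems(2) polys_Suc by auto
  next
    case 2
    then show ?thesis using polys_coord[OF Suc.IH[OF 2(1) Suc.prems(2)], of i] by (simp add: mult.assoc)
  qed
qed

lemma polys_mult: "f \<in> polys k \<Longrightarrow> g \<in> polys l \<Longrightarrow> (\<lambda>x. f x * g x) \<in> polys (k + l)"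
proof (induction rule: polys_induct)
  case (mono m)
  then show ?case using polys_mult_mono by blast
next
  case (add f1 f2)
  then show ?case using polys_add[of "\<lambda>x. f1 x * g x" "k + l"] by (simp add: distrib_right)
next
  case (scale c f)
  then show ?case using polys_cmult[of "\<lambda>x. f x * g x" "k + l" c] by (simp add: mult.assoc)
qed (simp add: polys_zero)

lemma polys_const: "(\<lambda>x. c) \<in> polys k"
proof -
  have "(\<lambda>x. 1) \<in> polys 0" by (rule fs.span_base) simp
  then have "(\<lambda>x. c * 1) \<in> polys 0" by (rule polys_cmult)
  then show ?thesis using polys_mono[of 0 k] by auto
qed

lemma polys_nth: "(\<lambda>x. x $ i) \<in> polys 1"
  using polys_coord[OF polys_const[of 1 0], of i] by simp

text \<open>The last conjunct handles truncated subtraction: for k = 0 the bound k - 1 would still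
  allow nonzero constants, while in the product rule one degree up a coordinate times this
  derivative must stay in degree 0.\<close>

lemma monoms_derivative:
  "m \<in> monoms k \<Longrightarrow> \<exists>m'. (\<forall>x. (m has_derivative (\<lambda>v. m' v x)) (at x)) \<and> (\<forall>v. m' v \<in> polys (k - 1)) \<and> (k = 0 \<longrightarrow> (\<forall>v x. m' v x = 0))"
proof (induction k arbitrary: m)
  case 0
  then show ?case by (intro exI[of _ "\<lambda>v x. 0"]) (use polys_zero[of 0] in auto)
next
  case (Suc k)
  from Suc.prems consider "m \<in> monoms k" | i m1 where "m1 \<in> monoms k" "m = (\<lambda>x. x $ i * m1 x)" by auto
  then show ?case
  proof cases
    case 1
    then obtain m' where "\<And>x. (m has_derivative (\<lambda>v. m' v x)) (at x)" "\<And>v. m' v \<in> polys (k - 1)" using Suc.IH by blast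
    then show ?thesis using polys_mono[of "k - 1" k] by (intro exI[of _ m']) auto
  next
    case 2
    obtain m' where m': "\<And>x. (m1 has_derivative (\<lambda>v. m' v x)) (at x)" "\<And>v. m' v \<in> polys (k - 1)" "k = 0 \<Longrightarrow> \<forall>v x. m' v x = 0"
      using Suc.IH[OF 2(1)] by blast
    have "((\<lambda>x. x $ i * m1 x) has_derivative (\<lambda>v. x $ i * m' v x + v $ i * m1 x)) (at x)" for x
      by (intro has_derivative_mult m' bounded_linear_imp_has_derivative bounded_linear_vec_nth)
    moreover have "(\<lambda>x. x $ i * m' v x + v $ i * m1 x) \<in> polys (Suc k - 1)" for v
    proof -
      have "(\<lambda>x. x $ i * m' v x) \<in> polys k"
      proof (cases k)
        case 0
        then show ?thesis using m'(3) polys_zero[of k] by simp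
      next
        case (Suc j)
        then show ?thesis using polys_coord[OF m'(2)[of v], of i] by simp
      qed
      moreover have "(\<lambda>x. v $ i * m1 x) \<in> polys k" by (intro polys_cmult fs.span_base 2)
      ultimately show ?thesis using polys_add[of "\<lambda>x. x $ i * m' v x"] by simp
    qed
    ultimately show ?thesis unfolding 2(2) by (intro exI[of _ "\<lambda>v x. x $ i * m' v x + v $ i * m1 x"]) simp
  qed
qed

lemma polys_derivative:
  "f \<in> polys k \<Longrightarrow> (\<forall>x. f differentiable (at x)) \<and> (\<forall>v. dd f v \<in> polys (k - 1)) \<and> (k = 0 \<longrightarrow> (\<forall>v x. dd f v x = 0))"
proof (induction rule: polys_induct)
  case (mono m)
  then obtain m' where m': "\<And>x. (m has_derivative (\<lambda>v. m' v x)) (at x)" "\<And>v. m' v \<in> polys (k - 1)" "k = 0 \<Longrightarrow> \<forall>v x. m' v x = 0"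
    using monoms_derivative by blast
  have d: "dd m v = m' v" for v using dd_eq[OF m'(1)] by auto
  have "m differentiable (at x)" for x using m'(1) unfolding differentiable_def by blast
  moreover have "dd m v \<in> polys (k - 1)" for v unfolding d by (rule m'(2))
  moreover have "dd m v x = 0" if "k = 0" for v x using fun_cong[OF d[of v], of x] m'(3)[OF that] by simp
  ultimately show ?case by blast
next
  case zero
  have "dd (\<lambda>x. 0) v x = (0::real)" for v and x :: "real^'a" by (rule dd_eq) auto
  then have "dd (\<lambda>x::real^'a. 0::real) v = (\<lambda>x. 0)" for v by auto
  then show ?case by (simp add: polys_zero)
next
  case (add f g)
  then have d: "dd (\<lambda>x. f x + g x) v = (\<lambda>x. dd f v x + dd g v x)" for v
    by (intro ext, intro dd_eq[OF has_derivative_add] dd_works) auto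
  have "(\<lambda>x. dd f v x + dd g v x) \<in> polys (k - 1)" for v by (rule polys_add) (use add in blast)+
  then have "dd (\<lambda>x. f x + g x) v \<in> polys (k - 1)" for v unfolding d .
  moreover have "dd (\<lambda>x. f x + g x) v x = 0" if "k = 0" for v x using fun_cong[OF d[of v], of x] add that by simp
  ultimately show ?case using add by (intro conjI allI impI differentiable_add) auto
next
  case (scale c f)
  then have d: "dd (\<lambda>x. c * f x) v = (\<lambda>x. c * dd f v x)" for v
    by (intro ext, intro dd_eq[OF has_derivative_mult_right] dd_works) auto
  have "(\<lambda>x. c * dd f v x) \<in> polys (k - 1)" for v by (rule polys_cmult) (use scale in blast)
  then have "dd (\<lambda>x. c * f x) v \<in> polys (k - 1)" for v unfolding d .
  moreover have "dd (\<lambda>x. c * f x) v x = 0" if "k = 0" for v x using fun_cong[OF d[of v], of x] scale that by simp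
  ultimately show ?case using scale by (intro conjI allI impI differentiable_mult differentiable_const) auto
qed

lemma polys_Ck: "f \<in> polys k \<Longrightarrow> Ck n UNIV f"
proof (induction n arbitrary: f k)
  case 0
  have "isCont f x" for x using polys_derivative[OF 0] differentiable_imp_continuous_within by blast
  then show ?case by (simp add: continuous_at_imp_continuous_on)
next
  case (Suc n)
  then show ?case using polys_derivative[OF Suc.prems] by (auto simp: Ck_Suc)
qed

lemma real_polynomial_function_polys:
  fixes g :: "real^'n \<Rightarrow> real"
  assumes "real_polynomial_function g"
  shows "\<exists>k. g \<in> polys k"
  using assms
proof (induction rule: real_polynomial_function.induct)
  case (linear g)
  have "g = (\<lambda>x. \<Sum>i\<in>UNIV. g (axis i 1) * x $ i)"
  proof
    fix x
    have "g x = g (\<Sum>i\<in>UNIV. x $ i *\<^sub>R axis i 1)" using basis_expansion[of x] by (simp add: scalar_mult_eq_scaleR)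
    also have "\<dots> = (\<Sum>i\<in>UNIV. g (axis i 1) * x $ i)"
      by (simp only: linear_sum[OF bounded_linear.linear[OF linear]] linear_scale[OF bounded_linear.linear[OF linear]])
        (simp add: mult.commute)
    finally show "g x = (\<Sum>i\<in>UNIV. g (axis i 1) * x $ i)" .
  qed
  moreover have "(\<lambda>x. \<Sum>i\<in>UNIV. g (axis i 1) * x $ i) \<in> polys 1" by (intro polys_sum polys_cmult polys_nth)
  ultimately show ?case by metis
next
  case (const c)
  then show ?case using polys_const by blast
next
  case (add f g)
  then obtain k l where "f \<in> polys k" "g \<in> polys l" by blast
  then have "f \<in> polys (k + l)" "g \<in> polys (k + l)" using polys_mono[of k "k + l"] polys_mono[of l "k + l"] by auto
  then show ?case using polys_add by blast
next
  case (mult f g)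
  then show ?case using polys_mult by blast
qed

lemma polys_on_line:
  "f \<in> polys k \<Longrightarrow> \<exists>p :: real poly. \<forall>t. f (z + t *\<^sub>R v) = poly p t"
proof (induction rule: polys_induct)
  case (mono m)
  then show ?case
  proof (induction k arbitrary: m)
    case 0
    then show ?case by (intro exI[of _ 1]) simp
  next
    case (Suc k)
    from Suc.prems consider "m \<in> monoms k" | i m1 where "m1 \<in> monoms k" "m = (\<lambda>x. x $ i * m1 x)" by auto
    then show ?case
    proof cases
      case 2
      then obtain p where "\<forall>t. m1 (z + t *\<^sub>R v) = poly p t" using Suc.IH by blast
      then have "\<forall>t. m (z + t *\<^sub>R v) = poly ([:z $ i, v $ i:] * p) t" using 2(2) by (simp add: algebra_simps)
      then show ?thesis by blast
    qed (use Suc.IH in blast)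
  qed
next
  case zero
  then show ?case by (intro exI[of _ 0]) simp
next
  case (add f g)
  then show ?case by (metis poly_add)
next
  case (scale c f)
  then show ?case by (metis poly_smult)
qed

text \<open>On the line from the centre through \<open>x\<close> the function is a polynomial in one
  variable with infinitely many roots, hence zero; t = 1 reaches \<open>x\<close>.\<close>

lemma polys_zero_on_ball:
  assumes f: "f \<in> polys k" and r: "r > 0" and z: "\<And>x. x \<in> ball z r \<Longrightarrow> f x = 0"
  shows "f x = 0"
proof -
  obtain p :: "real poly" where p: "\<And>t. f (z + t *\<^sub>R (x - z)) = poly p t" using polys_on_line[OF f] by metis
  define d where "d = r / (norm (x - z) + 1)"
  have np: "norm (x - z) + 1 > 0" using norm_ge_zero[of "x - z"] by linarith
  have d: "d > 0" using r np by (simp add: d_def)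
  have "poly p t = 0" if t: "0 < t" "t < d" for t
  proof -
    have "t * norm (x - z) \<le> t * (norm (x - z) + 1)" using t by simp
    also have "\<dots> < r" using t np by (simp add: d_def pos_less_divide_eq)
    finally have "z + t *\<^sub>R (x - z) \<in> ball z r" using t by (simp add: dist_norm)
    then show ?thesis using z p by metis
  qed
  then have "{0<..<d} \<subseteq> {t. poly p t = 0}" by auto
  moreover have "infinite {0<..<d}" using d by (rule infinite_Ioo)
  ultimately have "p = 0" using poly_roots_finite finite_subset by blast
  then show ?thesis using p[of 1] by simp
qed

text \<open>An injective linear map sends a basis to an independent set of the same size, which must
  span. Linearity is asked only for combinations of members of the span, which is where
  \<open>Lop\<close> is linear.\<close>

lemma injective_on_span_surjective:
  fixes \<Lambda> :: "('a \<Rightarrow> real) \<Rightarrow> ('a \<Rightarrow> real)"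
  assumes M: "finite M" and into: "\<And>f. f \<in> fs.span M \<Longrightarrow> \<Lambda> f \<in> fs.span M"
    and lin: "\<And>B c. finite B \<Longrightarrow> B \<subseteq> fs.span M \<Longrightarrow> \<Lambda> (\<lambda>x. \<Sum>b\<in>B. c b * b x) = (\<lambda>x. \<Sum>b\<in>B. c b * \<Lambda> b x)"
    and inj: "\<And>f. f \<in> fs.span M \<Longrightarrow> \<Lambda> f = (\<lambda>x. 0) \<Longrightarrow> f = (\<lambda>x. 0)" and g: "g \<in> fs.span M"
  shows "\<exists>f\<in>fs.span M. \<Lambda> f = g"
proof -
  have sumfun: "(\<Sum>i\<in>I. h i) = (\<lambda>x. \<Sum>i\<in>I. h i x)" for h :: "('a \<Rightarrow> real) \<Rightarrow> 'a \<Rightarrow> real" and I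
    by (induction I rule: infinite_finite_induct) (auto simp: zero_fun_def plus_fun_def)
  obtain B where B: "B \<subseteq> M" "fs.independent B" "M \<subseteq> fs.span B" using fs.maximal_independent_subset by blast
  have fB: "finite B" using B(1) M finite_subset by blast
  have BM: "fs.span B = fs.span M"
    using fs.span_mono[OF B(1)] fs.span_mono[OF B(3)] fs.span_span by blast
  have Bs: "B \<subseteq> fs.span M" using B(1) fs.span_superset by blast
  have key: "\<forall>b\<in>B. u b = 0" if "(\<lambda>x. \<Sum>b\<in>B. u b * \<Lambda> b x) = (\<lambda>x. 0)" for u
  proof -
    have "(\<lambda>x. \<Sum>b\<in>B. u b * b x) \<in> fs.span M"
      using fs.span_sum[of B "\<lambda>b x. u b * b x" M] fs.span_scale Bs by (auto simp: sumfun)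
    moreover have "\<Lambda> (\<lambda>x. \<Sum>b\<in>B. u b * b x) = (\<lambda>x. 0)" using lin[OF fB Bs] that by simp
    ultimately have "(\<lambda>x. \<Sum>b\<in>B. u b * b x) = (\<lambda>x. 0)" by (rule inj)
    then show ?thesis using B(2) fs.dependent_finite[OF fB] by (auto simp: sumfun zero_fun_def)
  qed
  have injB: "inj_on \<Lambda> B"
  proof (rule inj_onI, rule ccontr)
    fix b b' assume b: "b \<in> B" "b' \<in> B" "\<Lambda> b = \<Lambda> b'" "b \<noteq> b'"
    let ?u = "\<lambda>a. if a = b then 1 else if a = b' then - 1 else (0::real)"
    have "(\<Sum>a\<in>B. ?u a * \<Lambda> a x) = 0" for x
    proof -
      have "(\<Sum>a\<in>B. ?u a * \<Lambda> a x) = (\<Sum>a\<in>{b, b'}. ?u a * \<Lambda> a x)"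
        using b fB by (intro sum.mono_neutral_right) auto
      then show ?thesis using b by simp
    qed
    then show False using key[of ?u] b by auto
  qed
  have ind: "fs.independent (\<Lambda> ` B)"
  proof
    assume "fs.dependent (\<Lambda> ` B)"
    then obtain u a where u: "a \<in> \<Lambda> ` B" "u a \<noteq> 0" "(\<Sum>v\<in>\<Lambda> ` B. (\<lambda>x. u v * v x)) = 0"
      using fs.dependent_finite[of "\<Lambda> ` B"] fB by auto
    then have "(\<lambda>x. \<Sum>b\<in>B. u (\<Lambda> b) * \<Lambda> b x) = (\<lambda>x. 0)"
      by (simp add: sumfun sum.reindex[OF injB] zero_fun_def)
    then show False using key[of "\<lambda>b. u (\<Lambda> b)"] u by auto
  qed
  have sub: "\<Lambda> ` B \<subseteq> fs.span B" using into Bs BM by auto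
  have "b \<in> fs.span (\<Lambda> ` B)" if b: "b \<in> B" for b
  proof (rule ccontr)
    assume n: "b \<notin> fs.span (\<Lambda> ` B)"
    then have "b \<notin> \<Lambda> ` B" using fs.span_base[of b "\<Lambda> ` B"] by auto
    moreover have "fs.independent (insert b (\<Lambda> ` B))" using fs.independent_insertI[OF n ind] .
    moreover have "insert b (\<Lambda> ` B) \<subseteq> fs.span B" using sub fs.span_base[OF b] by blast
    ultimately show False
      using fs.independent_span_bound[OF fB, of "insert b (\<Lambda> ` B)"] card_image[OF injB] fB by simp
  qed
  then have "fs.span B \<subseteq> fs.span (\<Lambda> ` B)" by (intro fs.span_minimal fs.subspace_span) blast
  then have "g \<in> fs.span (\<Lambda> ` B)" using g BM by blast
  then obtain u where u: "g = (\<Sum>v\<in>\<Lambda> ` B. (\<lambda>x. u v * v x))"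
    using fs.span_finite[of "\<Lambda> ` B"] fB by auto
  have "g = (\<lambda>x. \<Sum>b\<in>B. u (\<Lambda> b) * \<Lambda> b x)" unfolding u by (simp add: sumfun sum.reindex[OF injB])
  also have "\<dots> = \<Lambda> (\<lambda>x. \<Sum>b\<in>B. u (\<Lambda> b) * b x)" using lin[OF fB Bs] by simp
  finally have "\<Lambda> (\<lambda>x. \<Sum>b\<in>B. u (\<Lambda> b) * b x) = g" by simp
  moreover have "(\<lambda>x. \<Sum>b\<in>B. u (\<Lambda> b) * b x) \<in> fs.span M"
    using fs.span_sum[of B "\<lambda>b x. u (\<Lambda> b) * b x" M] fs.span_scale Bs by (auto simp: sumfun)
  ultimately show ?thesis by blast
qed

text \<open>This is tr (A D^2 f) with A the sum of the matrices w_i w_i^T; it turns the half-spaces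
  of \<open>Fc_separation\<close> into differential inequalities.\<close>

definition Lop :: "('n \<Rightarrow> real^'n) \<Rightarrow> (real^'n \<Rightarrow> real) \<Rightarrow> real^'n \<Rightarrow> real" where
  "Lop w f x = (\<Sum>i\<in>UNIV. dd (dd f (w i)) (w i) x)"

lemma Lop_add:
  "open S \<Longrightarrow> x \<in> S \<Longrightarrow> Ck 2 S f \<Longrightarrow> Ck 2 S g \<Longrightarrow> Lop w (\<lambda>x. f x + g x) x = Lop w f x + Lop w g x"
  unfolding Lop_def by (subst sum.distrib[symmetric], rule sum.cong[OF refl], rule dd2_add)

lemma Lop_cmult: "open S \<Longrightarrow> x \<in> S \<Longrightarrow> Ck 2 S f \<Longrightarrow> Lop w (\<lambda>x. c * f x) x = c * Lop w f x"
  unfolding Lop_def by (subst sum_distrib_left, rule sum.cong[OF refl], rule dd2_cmult)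

lemma Lop_zero: "Lop w (\<lambda>x. 0) x = 0"
  using Lop_cmult[of UNIV x "\<lambda>x. 0" w 0] by simp

lemma Lop_sum:
  assumes "finite I" "open S" "x \<in> S" "\<And>i. i \<in> I \<Longrightarrow> Ck 2 S (f i)"
  shows "Lop w (\<lambda>x. \<Sum>i\<in>I. c i * f i x) x = (\<Sum>i\<in>I. c i * Lop w (f i) x)"
  using assms(1,4)
proof induction
  case (insert i I)
  have "Lop w (\<lambda>x. c i * f i x + (\<Sum>i\<in>I. c i * f i x)) x
      = Lop w (\<lambda>x. c i * f i x) x + Lop w (\<lambda>x. \<Sum>i\<in>I. c i * f i x) x"
    using insert.prems by (intro Lop_add[OF assms(2,3)] Ck_cmult Ck_sum assms(2)) auto
  moreover have "Lop w (\<lambda>x. c i * f i x) x = c i * Lop w (f i) x"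
    using insert.prems by (intro Lop_cmult[OF assms(2,3)]) auto
  ultimately show ?case using insert by simp
qed (simp add: Lop_zero)

lemma Lop_continuous: "Ck 2 S f \<Longrightarrow> continuous_on S (Lop w f)"
  unfolding Lop_def[abs_def] by (intro continuous_on_sum Ck_2_cont)

lemma Lop_hess:
  assumes "open X" "x \<in> X" "Ck 2 X f"
  shows "(\<Sum>i\<in>UNIV. w i \<bullet> (hess f x *v w i)) = Lop w f x"
  by (simp add: Lop_def hess_inner[OF assms])

lemma scaled_norm_diff_quad:
  "(\<lambda>x. c * (norm (x - z))\<^sup>2) = quad (c *\<^sub>R mat 1) ((- 2 * c) *\<^sub>R z) (c * (norm z)\<^sup>2)"
  by (rule ext) (simp add: quad_def scaleR_matrix_vector_assoc[symmetric] power2_norm_eq_inner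
      inner_diff_left inner_diff_right inner_commute algebra_simps)

lemma Ck_norm_diff: "open S \<Longrightarrow> Ck n S (\<lambda>x :: real^'n. c * (norm (x - z))\<^sup>2)"
  unfolding scaled_norm_diff_quad by (rule Ck_quad)

lemma Lop_norm_diff: "Lop w (\<lambda>x. c * (norm (x - z))\<^sup>2) x = 2 * c * (\<Sum>i\<in>UNIV. (norm (w i))\<^sup>2)"
  unfolding scaled_norm_diff_quad Lop_def dd_quad(2)[OF scaled_id_Sym]
  by (simp add: scaleR_matrix_vector_assoc[symmetric] power2_norm_eq_inner sum_distrib_left mult.assoc)

text \<open>Adding \<epsilon>|x - z|^2 makes the operator strictly positive, which excludes an
  interior maximum; \<epsilon> is so small that on the sphere this adds only half of the supposed
  excess over \<open>M\<close>.\<close>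

lemma Lop_maximum_principle:
  fixes u :: "real^'n \<Rightarrow> real"
  assumes w: "\<And>i. w i \<noteq> 0" and U: "open U" "cball z \<rho> \<subseteq> U" and C: "Ck 2 U u" and \<rho>: "\<rho> > 0"
    and L: "\<And>x. x \<in> ball z \<rho> \<Longrightarrow> Lop w u x \<ge> 0" and bd: "\<And>x. dist z x = \<rho> \<Longrightarrow> u x \<le> M"
    and x: "x \<in> cball z \<rho>"
  shows "u x \<le> M"
proof (rule ccontr)
  assume n: "\<not> u x \<le> M"
  define \<epsilon> where "\<epsilon> = (u x - M) / (2 * \<rho>\<^sup>2)"
  have \<epsilon>: "\<epsilon> > 0" "\<epsilon> * \<rho>\<^sup>2 = (u x - M) / 2" using n \<rho> by (auto simp: \<epsilon>_def)
  define v where "v = (\<lambda>x. u x + \<epsilon> * (norm (x - z))\<^sup>2)"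
  have Cv: "Ck 2 U v" unfolding v_def by (intro Ck_add Ck_norm_diff U C)
  have "continuous_on (cball z \<rho>) v" using Ck_continuous[OF Cv] U(2) continuous_on_subset by blast
  then obtain y where y: "y \<in> cball z \<rho>" "\<And>y'. y' \<in> cball z \<rho> \<Longrightarrow> v y' \<le> v y"
    using continuous_attains_sup[OF compact_cball, of z \<rho> v] x by blast
  have "u x \<le> v x" using \<epsilon> by (simp add: v_def)
  then have "u x \<le> v y" using y(2)[OF x] by simp
  have "dist z y \<noteq> \<rho>"
  proof
    assume d: "dist z y = \<rho>"
    then have "v y \<le> M + \<epsilon> * \<rho>\<^sup>2" using bd[OF d] by (simp add: v_def dist_norm norm_minus_commute)
    then show False using \<open>u x \<le> v y\<close> \<epsilon>(2) n by (simp add: field_simps)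
  qed
  then have yb: "y \<in> ball z \<rho>" using y(1) by auto
  then obtain e where e: "e > 0" "ball y e \<subseteq> ball z \<rho>" using open_ball open_contains_ball by blast
  have neg: "dd (dd v (w i)) (w i) y \<le> 0" for i
  proof (rule second_derivative_max[OF U(1) _ Cv e(1)])
    show "y \<in> U" using y(1) U(2) by blast
    fix y' assume "dist y' y < e"
    then have "y' \<in> ball y e" by (simp add: dist_commute)
    then have "y' \<in> ball z \<rho>" using e(2) by blast
    then show "v y' \<le> v y" using y(2) by simp
  qed
  have "Lop w v y \<le> 0" unfolding Lop_def by (intro sum_nonpos neg)
  moreover have "Lop w v y = Lop w u y + 2 * \<epsilon> * (\<Sum>i\<in>UNIV. (norm (w i))\<^sup>2)"
    using Lop_add[OF U(1) _ C Ck_norm_diff[OF U(1)], of y w \<epsilon> z] y(1) U(2) unfolding v_def Lop_norm_diff by blast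
  moreover have "0 < (\<Sum>i\<in>UNIV. (norm (w i))\<^sup>2)" using w by (intro sum_pos) auto
  then have "0 < 2 * \<epsilon> * (\<Sum>i\<in>UNIV. (norm (w i))\<^sup>2)" using \<epsilon>(1) by simp
  ultimately show False using L[OF yb] by simp
qed

lemma polys_Lop: "f \<in> polys k \<Longrightarrow> Lop w f \<in> polys (k - 2)"
  unfolding Lop_def[abs_def]
proof (intro polys_sum)
  fix i assume "f \<in> polys k"
  then have "dd f (w i) \<in> polys (k - 1)" using polys_derivative by blast
  then have "dd (dd f (w i)) (w i) \<in> polys (k - 1 - 1)" using polys_derivative by blast
  then show "dd (dd f (w i)) (w i) \<in> polys (k - 2)" by (simp add: numeral_2_eq_2)
qed

lemma polys_sphere: "(\<lambda>x :: real^'n. \<rho>\<^sup>2 - (norm (x - z))\<^sup>2) \<in> polys 2"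
proof -
  have sq: "(\<lambda>x :: real^'n. (x $ i - z $ i) * (x $ i - z $ i)) \<in> polys (1 + 1)" for i
    by (intro polys_mult polys_diff polys_nth polys_const)
  have "(\<lambda>x :: real^'n. \<rho>\<^sup>2 - (\<Sum>i\<in>UNIV. (x $ i - z $ i) * (x $ i - z $ i))) \<in> polys (1 + 1)"
    by (intro polys_diff polys_const polys_sum sq)
  moreover have "(norm (x - z))\<^sup>2 = (\<Sum>i\<in>UNIV. (x $ i - z $ i) * (x $ i - z $ i))" for x
    by (simp add: power2_norm_eq_inner inner_vec_def)
  ultimately show ?thesis by (simp only: one_add_one)
qed

text \<open>Multiplying by a quadratic polynomial that vanishes on the sphere and then applying the operator
  is a linear map of a finite-dimensional space of polynomials, injective by the maximum principle.\<close>
lemma Lop_polynomial_solution: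
  fixes w :: "'n \<Rightarrow> real^'n"
  assumes w: "\<And>i. w i \<noteq> 0" and \<rho>: "\<rho> > 0" and p: "p \<in> polys k"
  shows "\<exists>q\<in>polys k. Lop w (\<lambda>x. (\<rho>\<^sup>2 - (norm (x - z))\<^sup>2) * q x) = Lop w p"
proof -
  let ?E = "\<lambda>x :: real^'n. \<rho>\<^sup>2 - (norm (x - z))\<^sup>2"
  let ?\<Lambda> = "\<lambda>q. Lop w (\<lambda>x. ?E x * q x)"
  \<comment> \<open>The quadratic factor raises the degree by 2 and the operator lowers it by 2, so
    degree at most k is preserved.\<close>
  have Eq: "(\<lambda>x. ?E x * q x) \<in> polys (2 + k)" if "q \<in> polys k" for q by (intro polys_mult polys_sphere that)
  show ?thesis
  proof (rule injective_on_span_surjective[of "monoms k" ?\<Lambda>])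
    fix f :: "real^'n \<Rightarrow> real" assume f: "f \<in> polys k"
    show "?\<Lambda> f \<in> polys k" using polys_Lop[OF Eq[OF f], of w] by simp
  next
    fix B :: "(real^'n \<Rightarrow> real) set" and c assume B: "finite B" "B \<subseteq> polys k"
    have "Lop w (\<lambda>x. \<Sum>b\<in>B. c b * (?E x * b x)) x = (\<Sum>b\<in>B. c b * ?\<Lambda> b x)" for x
      by (rule Lop_sum[OF B(1) open_UNIV]) (use polys_Ck[OF Eq] B in auto)
    moreover have "(\<lambda>x. ?E x * (\<Sum>b\<in>B. c b * b x)) = (\<lambda>x. \<Sum>b\<in>B. c b * (?E x * b x))"
      by (simp add: sum_distrib_left mult.left_commute)
    ultimately show "Lop w (\<lambda>x. ?E x * (\<Sum>b\<in>B. c b * b x)) = (\<lambda>x. \<Sum>b\<in>B. c b * ?\<Lambda> b x)" by auto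
  next
    fix f :: "real^'n \<Rightarrow> real" assume f: "f \<in> polys k" "?\<Lambda> f = (\<lambda>x. 0)"
    have C: "Ck 2 UNIV (\<lambda>x. ?E x * f x)" by (rule polys_Ck[OF Eq[OF f(1)]])
    have 0: "?E x * f x \<le> 0" "- 1 * (?E x * f x) \<le> 0" if x: "x \<in> cball z \<rho>" for x
    proof -
      show "?E x * f x \<le> 0"
        by (rule Lop_maximum_principle[where w = w, OF w open_UNIV _ C \<rho> _ _ x])
          (use fun_cong[OF f(2)] in \<open>auto simp: dist_norm norm_minus_commute\<close>)
      show "- 1 * (?E x * f x) \<le> 0"
        by (rule Lop_maximum_principle[where w = w, OF w open_UNIV _ Ck_cmult[OF open_UNIV C] \<rho> _ _ x])
          (use fun_cong[OF f(2)] Lop_cmult[OF open_UNIV UNIV_I C, of w "- 1"] in \<open>auto simp: dist_norm norm_minus_commute\<close>)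
    qed
    have "f x = 0" if x: "x \<in> ball z \<rho>" for x
    proof -
      have "norm (x - z) < \<rho>" using x by (simp add: dist_norm norm_minus_commute)
      then have "?E x > 0" using \<rho> by (simp add: power_strict_mono)
      moreover have "?E x * f x = 0" using 0[of x] x by simp
      ultimately show ?thesis by simp
    qed
    then show "f = (\<lambda>x. 0)" using polys_zero_on_ball[OF f(1) \<rho>] by blast
  next
    show "Lop w p \<in> polys k" using polys_Lop[OF p] polys_mono[of "k - 2" k] by auto
  qed (rule finite_monoms)
qed

text \<open>\<open>Q\<close> carries the right-hand side \<beta>. A polynomial \<open>p\<close>
  approximates the remaining boundary data g - Q by Stone-Weierstrass, and subtracting the product
  from \<open>Lop_polynomial_solution\<close>, which vanishes on the sphere, cancels the image of
  \<open>p\<close> under the operator. Only the boundary values are approximate.\<close>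

lemma Lop_Dirichlet_approximation:
  fixes w :: "'n \<Rightarrow> real^'n"
  assumes w: "\<And>i. w i \<noteq> 0" and \<rho>: "\<rho> > 0" and g: "continuous_on (cball z \<rho>) g" and \<eta>: "\<eta> > 0"
  shows "\<exists>H. Ck 2 UNIV H \<and> (\<forall>x. Lop w H x = \<beta>) \<and> (\<forall>x. dist z x = \<rho> \<longrightarrow> \<bar>H x - g x\<bar> \<le> \<eta>)"
proof -
  let ?W = "\<Sum>i\<in>UNIV. (norm (w i))\<^sup>2"
  have W: "0 < ?W" using w by (intro sum_pos) auto
  define Q :: "real^'n \<Rightarrow> real" where "Q = (\<lambda>x. (\<beta> / (2 * ?W)) * (norm (x - z))\<^sup>2)"
  have CQ: "Ck 2 UNIV Q" unfolding Q_def by (intro Ck_norm_diff open_UNIV)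
  have LQ: "Lop w Q x = \<beta>" for x unfolding Q_def Lop_norm_diff using W by simp
  have "continuous_on (cball z \<rho>) (\<lambda>x. g x - Q x)"
    by (intro continuous_on_diff g continuous_on_subset[OF Ck_continuous[OF CQ]]) auto
  then obtain p where p: "real_polynomial_function p" "\<And>x. x \<in> cball z \<rho> \<Longrightarrow> \<bar>g x - Q x - p x\<bar> < \<eta>"
    using Stone_Weierstrass_real_polynomial_function[OF compact_cball _ \<eta>, of z \<rho>] by blast
  obtain k where k: "p \<in> polys k" using real_polynomial_function_polys[OF p(1)] by blast
  let ?E = "\<lambda>x :: real^'n. \<rho>\<^sup>2 - (norm (x - z))\<^sup>2"
  obtain q where q: "q \<in> polys k" "Lop w (\<lambda>x. ?E x * q x) = Lop w p" using Lop_polynomial_solution[where w = w, OF w \<rho> k] by blast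
  have Cp: "Ck 2 UNIV p" by (rule polys_Ck[OF k])
  have CE: "Ck 2 UNIV (\<lambda>x. ?E x * q x)" by (rule polys_Ck[OF polys_mult[OF polys_sphere q(1)]])
  define H where "H = (\<lambda>x. Q x + (p x + (- 1) * (?E x * q x)))"
  have CE': "Ck 2 UNIV (\<lambda>x. (- 1) * (?E x * q x))" by (rule Ck_cmult[OF open_UNIV CE])
  have CH': "Ck 2 UNIV (\<lambda>x. p x + (- 1) * (?E x * q x))" by (rule Ck_add[OF open_UNIV Cp CE'])
  have "Ck 2 UNIV H" unfolding H_def by (rule Ck_add[OF open_UNIV CQ CH'])
  moreover have "Lop w H x = \<beta>" for x
    unfolding H_def Lop_add[OF open_UNIV UNIV_I CQ CH'] Lop_add[OF open_UNIV UNIV_I Cp CE']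
      Lop_cmult[OF open_UNIV UNIV_I CE] LQ using fun_cong[OF q(2), of x] by simp
  moreover have "\<bar>H x - g x\<bar> \<le> \<eta>" if x: "dist z x = \<rho>" for x
  proof -
    have "?E x = 0" using x by (simp add: dist_norm norm_minus_commute)
    then have "H x - g x = - (g x - Q x - p x)" by (simp add: H_def)
    moreover have "x \<in> cball z \<rho>" using x by simp
    ultimately show ?thesis using p(2)[of x] by (simp add: less_imp_le)
  qed
  ultimately show ?thesis by blast
qed

text \<open>Pieces of \<open>bump\<close> on small balls give the weights. Points and weights are
  chosen once for all \<open>x\<close> in \<open>S\<close>, so the average of translates is
  uniformly close to one convex combination of them, and translates can then be compared one at a
  time.\<close>

lemma avg_finite_approximation:
  fixes h :: "'b \<Rightarrow> 'a::euclidean_space \<Rightarrow> real"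
  assumes h: "\<And>x. x \<in> S \<Longrightarrow> continuous_on (cball 0 1) (h x)" and \<delta>: "\<delta> > 0"
    and osc: "\<And>x y y'. x \<in> S \<Longrightarrow> y \<in> cball 0 1 \<Longrightarrow> y' \<in> cball 0 1 \<Longrightarrow> dist y y' \<le> \<delta> \<Longrightarrow> \<bar>h x y - h x y'\<bar> \<le> \<eta>"
  shows "\<exists>C p. finite C \<and> C \<subseteq> cball 0 1 \<and> (\<forall>c\<in>C. 0 \<le> p c) \<and> sum p C = 1 \<and>
    (\<forall>x\<in>S. \<bar>avg (h x) - (\<Sum>c\<in>C. p c * h x c)\<bar> \<le> \<eta>)"
proof -
  obtain C s w where C: "finite C" "C \<subseteq> cball (0::'a) 1" and sC: "\<forall>c\<in>C. 0 < s c \<and> s c \<le> \<delta> \<and> ball c (8 * s c) \<subseteq> UNIV"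
    and w: "\<forall>c\<in>C. \<forall>x. 0 \<le> w c x \<and> w c x \<le> 1 \<and> (x \<notin> cball c (s c) \<longrightarrow> w c x = (0::real))"
    and wp: "\<forall>\<phi> :: 'a \<Rightarrow> real. continuous_on UNIV \<phi> \<longrightarrow> (\<forall>x. x \<notin> cball 0 1 \<longrightarrow> \<phi> x = 0) \<longrightarrow>
      (\<forall>c\<in>C. continuous_on UNIV (\<lambda>x. \<phi> x * w c x)) \<and> (\<forall>x. \<phi> x = (\<Sum>c\<in>C. \<phi> x * w c x))"
    using small_balls_partition[OF open_UNIV compact_cball[of "0::'a" 1] subset_UNIV \<delta>] by blast
  define b where "b = (\<lambda>c y. bump y * w c (y::'a))"
  have "bump y = 0" if "y \<notin> cball 0 1" for y :: 'a using that by (intro bump_zero) simp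
  then have b: "\<And>c. c \<in> C \<Longrightarrow> continuous_on UNIV (b c)" "\<And>y. bump y = (\<Sum>c\<in>C. b c y)"
    using wp[rule_format, OF continuous_bump] unfolding b_def by blast+
  have b0: "0 \<le> b c y" if "c \<in> C" for c y using w that bump_nonneg[of y] by (simp add: b_def)
  let ?Q = "cbox (- One) One :: 'a set"
  define Z where "Z = integral ?Q (bump :: 'a \<Rightarrow> real)"
  have Z: "Z > 0" using bump_integral_pos by (simp add: Z_def)
  define P where "P = (\<lambda>c. integral ?Q (b c))"
  have bi: "b c integrable_on ?Q" if "c \<in> C" for c
    by (intro integrable_continuous continuous_on_subset[OF b(1)[OF that]]) auto
  have sP: "sum P C = Z"
  proof -
    have "sum P C = integral ?Q (\<lambda>y. \<Sum>c\<in>C. b c y)" unfolding P_def by (rule integral_sum[symmetric, OF C(1) bi])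
    then show ?thesis unfolding Z_def by (simp add: b(2)[symmetric])
  qed
  have main: "\<bar>avg (h x) - (\<Sum>c\<in>C. P c / Z * h x c)\<bar> \<le> \<eta>" if x: "x \<in> S" for x
  proof -
    define I where "I = integral ?Q (\<lambda>y. bump y * h x y)"
    have i1: "(\<lambda>y. bump y * h x y) integrable_on ?Q" by (rule avg_integrable[OF h[OF x]])
    have i2: "(\<lambda>y. \<Sum>c\<in>C. b c y * h x c) integrable_on ?Q"
      by (intro integrable_sum C(1) integrable_on_mult_left bi)
    have s: "integral ?Q (\<lambda>y. \<Sum>c\<in>C. b c y * h x c) = (\<Sum>c\<in>C. P c * h x c)"
      unfolding P_def by (subst integral_sum) (auto intro!: C(1) integrable_on_mult_left bi)
    have "\<bar>integral ?Q (\<lambda>y. bump y * h x y - (\<Sum>c\<in>C. b c y * h x c))\<bar> \<le> integral ?Q (\<lambda>y. \<eta> * bump y)"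
    proof (subst real_norm_def[symmetric], rule integral_norm_bound_integral[OF integrable_diff[OF i1 i2]])
      show "(\<lambda>y. \<eta> * bump y) integrable_on ?Q"
        by (intro integrable_continuous continuous_intros continuous_bump)
      fix y :: 'a
      have "bump y * h x y - (\<Sum>c\<in>C. b c y * h x c) = (\<Sum>c\<in>C. b c y * (h x y - h x c))"
        unfolding b(2)[of y] by (simp add: sum_distrib_right sum_subtractf right_diff_distrib)
      moreover have t: "\<bar>b c y * (h x y - h x c)\<bar> \<le> b c y * \<eta>" if c: "c \<in> C" for c
      proof (cases "b c y = 0")
        case False
        then have "bump y \<noteq> 0" "w c y \<noteq> 0" by (auto simp: b_def)
        then have "y \<in> cball 0 1" "y \<in> cball c (s c)" using bump_zero[of y] w c by (cases "1 \<le> norm y", auto)+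
        then have "\<bar>h x y - h x c\<bar> \<le> \<eta>" using sC c C(2) by (intro osc[OF x]) (auto simp: dist_commute)
        then show ?thesis using b0[OF c, of y] by (simp add: abs_mult mult_left_mono)
      qed simp
      have "\<bar>\<Sum>c\<in>C. b c y * (h x y - h x c)\<bar> \<le> (\<Sum>c\<in>C. b c y * \<eta>)"
        by (intro order_trans[OF sum_abs] sum_mono t)
      ultimately show "norm (bump y * h x y - (\<Sum>c\<in>C. b c y * h x c)) \<le> \<eta> * bump y"
        unfolding b(2)[of y] by (simp add: sum_distrib_left mult.commute)
    qed
    then have "\<bar>I - (\<Sum>c\<in>C. P c * h x c)\<bar> \<le> \<eta> * Z"
      unfolding integral_diff[OF i1 i2] s by (simp add: I_def Z_def)
    moreover have "avg (h x) - (\<Sum>c\<in>C. P c / Z * h x c) = (I - (\<Sum>c\<in>C. P c * h x c)) / Z"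
      by (simp add: avg_def I_def Z_def diff_divide_distrib sum_divide_distrib)
    ultimately show ?thesis using Z by (simp add: pos_divide_le_eq)
  qed
  have "0 \<le> P c / Z" if "c \<in> C" for c
    unfolding P_def using Z b0[OF that] by (intro divide_nonneg_pos integral_nonneg bi that) auto
  moreover have "(\<Sum>c\<in>C. P c / Z) = 1" using sP Z by (simp add: sum_divide_distrib[symmetric])
  ultimately show ?thesis using C main by (intro exI[of _ C] exI[of _ "\<lambda>c. P c / Z"]) simp
qed

section \<open>Translation invariance of the operator\<close>

lemma has_derivative_shift:
  assumes "f differentiable (at (x + a))"
  shows "((\<lambda>x. f (x + a)) has_derivative (\<lambda>v. dd f v (x + a))) (at x)"
proof -
  have "((\<lambda>x. x + a) has_derivative (\<lambda>v. v)) (at x)" by (auto intro!: derivative_eq_intros)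
  from has_derivative_compose[OF this, of f "\<lambda>v. dd f v (x + a)"] show ?thesis using dd_works[OF assms] by simp
qed

lemma Ck_shift: "Ck n UNIV f \<Longrightarrow> Ck n UNIV (\<lambda>x. f (x + a))"
  using Ck_compose_linear[OF open_UNIV open_UNIV bounded_linear_ident, of a n f] by simp

lemma Lop_shift:
  assumes "Ck 2 UNIV f"
  shows "Lop w (\<lambda>x. f (x + a)) x = Lop w f (x + a)"
proof -
  have "dd (\<lambda>x. f (x + a)) v = (\<lambda>x. dd f v (x + a))" for v
    using dd_eq[OF has_derivative_shift] Ck_2D[OF assms UNIV_I] by blast
  moreover have "dd (\<lambda>x. dd f v (x + a)) v x = dd (dd f v) v (x + a)" for v
    using dd_eq[OF has_derivative_shift] Ck_2D[OF assms UNIV_I] by blast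
  ultimately show ?thesis by (simp add: Lop_def)
qed

section \<open>Positivity\<close>

text \<open>Translates of a linear subsolution lie below the solutions with the same boundary values; so does
  their average, which is C2 and hence a subsolution in the pointwise sense.\<close>
lemma moll_Lop_ge:
  fixes f :: "real^'n \<Rightarrow> real"
  assumes w: "\<And>i. w i \<noteq> 0" and X: "open X" and f: "continuous_on X f"
    and visc: "\<And>v. Ck 2 X v \<Longrightarrow> (\<And>x. x \<in> X \<Longrightarrow> Lop w v x \<ge> - \<beta>) \<Longrightarrow> subaffine X (\<lambda>x. f x + v x)"
    and e: "e > 0" and \<rho>: "\<rho> > 0" and B: "cball z (e + \<rho>) \<subseteq> X"
  shows "Lop w (moll f e) z \<ge> \<beta>"
proof (rule ccontr)
  let ?F = "moll f e"
  assume n: "\<not> Lop w ?F z \<ge> \<beta>"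
  have sub: "x + e *\<^sub>R y \<in> cball z (e + \<rho>)" if "x \<in> cball z \<rho>" "y \<in> cball 0 1" for x y
  proof -
    have "norm ((x - z) + e *\<^sub>R y) \<le> \<rho> + e"
      using that e by (intro norm_triangle_le add_mono) (auto simp: dist_norm norm_minus_commute mult_left_le)
    then show ?thesis by (simp add: dist_norm norm_minus_commute algebra_simps)
  qed
  have subX: "cball x e \<subseteq> X" if "x \<in> cball z \<rho>" for x
  proof
    fix y assume "y \<in> cball x e"
    then have "dist z y \<le> e + \<rho>" using that dist_triangle[of z y x] by simp
    then show "y \<in> X" using B by auto
  qed
  have CF: "Ck 2 (ball z \<rho>) ?F"
    using Ck_moll[of "ball z \<rho>" "\<lambda>x. e" X f] e X f subX by simp
  \<comment> \<open>The operator at \<open>z\<close> equals \<beta> - 2\<gamma>; near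
    \<open>z\<close> it stays below \<beta> - \<gamma>.\<close>
  define \<gamma> where "\<gamma> = (\<beta> - Lop w ?F z) / 2"
  have \<gamma>: "\<gamma> > 0" using n by (simp add: \<gamma>_def)
  obtain d where d: "d > 0" "\<And>x. x \<in> ball z \<rho> \<Longrightarrow> dist x z < d \<Longrightarrow> \<bar>Lop w ?F x - Lop w ?F z\<bar> < \<gamma>"
    using Lop_continuous[OF CF, of w] \<gamma> \<rho> unfolding continuous_on_iff dist_real_def
    by (metis centre_in_ball)
  define r where "r = min d \<rho> / 2"
  have r: "r > 0" "r < d" "r < \<rho>" using d(1) \<rho> by (auto simp: r_def min_def)
  have LF: "Lop w ?F x \<le> \<beta> - \<gamma>" if "x \<in> cball z r" for x
    using d(2)[of x] that r unfolding abs_less_iff by (auto simp: \<gamma>_def dist_commute field_simps)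
  define W where "W = (\<Sum>i\<in>UNIV. (norm (w i))\<^sup>2)"
  have W: "W > 0" unfolding W_def using w by (intro sum_pos) auto
  \<comment> \<open>With this factor the operator applied to \<epsilon>|x - z|^2 gives \<gamma>. The
    error \<eta> chosen next is an eighth of the value of this function on the sphere of radius
    \<open>r\<close>, enough to beat the four errors \<eta> that accumulate.\<close>
  define \<epsilon> where "\<epsilon> = \<gamma> / (2 * W)"
  have \<epsilon>: "\<epsilon> > 0" using \<gamma> W by (simp add: \<epsilon>_def)
  define \<eta> where "\<eta> = \<epsilon> * r\<^sup>2 / 8"
  have \<eta>: "\<eta> > 0" using \<epsilon> r by (simp add: \<eta>_def)
  have rsub: "x \<in> cball z \<rho>" if "x \<in> cball z r" for x using that r by simp
  have hc: "continuous_on (cball 0 1) (\<lambda>y. f (x + e *\<^sub>R y))" if "x \<in> cball z r" for x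
    using that e f subX[OF rsub[OF that]] by (intro continuous_scaled continuous_on_subset[OF f]) auto
  have "uniformly_continuous_on (cball z (e + \<rho>)) f"
    by (intro compact_uniformly_continuous continuous_on_subset[OF f] B compact_cball)
  then obtain \<delta> where \<delta>: "\<delta> > 0" "\<And>a b. a \<in> cball z (e + \<rho>) \<Longrightarrow> b \<in> cball z (e + \<rho>) \<Longrightarrow> dist b a < \<delta> \<Longrightarrow> dist (f b) (f a) < \<eta>"
    using \<eta> unfolding uniformly_continuous_on_def by metis
  have osc: "\<bar>f (x + e *\<^sub>R y) - f (x + e *\<^sub>R y')\<bar> \<le> \<eta>"
    if "x \<in> cball z r" "y \<in> cball 0 1" "y' \<in> cball 0 1" "dist y y' \<le> \<delta> / (2 * e)" for x y y'
  proof -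
    have "dist (x + e *\<^sub>R y) (x + e *\<^sub>R y') = e * dist y y'"
      using e by (simp add: dist_norm scaleR_diff_right[symmetric])
    also have "\<dots> < \<delta>" using that(4) e \<delta>(1) by (simp add: field_simps)
    finally have "dist (f (x + e *\<^sub>R y)) (f (x + e *\<^sub>R y')) < \<eta>"
      using that(1-3) rsub sub by (intro \<delta>(2)) auto
    then show ?thesis by (simp add: dist_real_def)
  qed
  have de: "\<delta> / (2 * e) > 0" using \<delta>(1) e by simp
  have "\<exists>C p. finite C \<and> C \<subseteq> cball 0 1 \<and> (\<forall>c\<in>C. 0 \<le> p c) \<and> sum p C = 1 \<and>
      (\<forall>x\<in>cball z r. \<bar>avg (\<lambda>y. f (x + e *\<^sub>R y)) - (\<Sum>c\<in>C. p c * f (x + e *\<^sub>R c))\<bar> \<le> \<eta>)"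
    by (rule avg_finite_approximation, erule hc, rule de, rule osc)
  then obtain C p where C: "finite C" "C \<subseteq> cball 0 1" "\<forall>c\<in>C. 0 \<le> p c" "sum p C = 1"
    and Fp: "\<forall>x\<in>cball z r. \<bar>avg (\<lambda>y. f (x + e *\<^sub>R y)) - (\<Sum>c\<in>C. p c * f (x + e *\<^sub>R c))\<bar> \<le> \<eta>"
    by (elim exE conjE) (rule that)
  have Fp: "\<bar>?F x - (\<Sum>c\<in>C. p c * f (x + e *\<^sub>R c))\<bar> \<le> \<eta>" if "x \<in> cball z r" for x
    using bspec[OF Fp that] by (simp only: moll_def)
  have "\<exists>H. Ck 2 UNIV H \<and> (\<forall>x. Lop w H x = \<beta>) \<and> (\<forall>x. dist z x = r \<longrightarrow> \<bar>H x - f (x + e *\<^sub>R c)\<bar> \<le> \<eta>)" if c: "c \<in> C" for c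
  proof (rule Lop_Dirichlet_approximation[where w = w, OF w r(1) _ \<eta>])
    have "(\<lambda>x. x + e *\<^sub>R c) ` cball z r \<subseteq> X" using sub rsub B C(2) c by blast
    then show "continuous_on (cball z r) (\<lambda>x. f (x + e *\<^sub>R c))"
      by (intro continuous_on_compose2[OF f]) (auto intro!: continuous_intros)
  qed
  then obtain H where H: "\<And>c. c \<in> C \<Longrightarrow> Ck 2 UNIV (H c)" "\<And>c x. c \<in> C \<Longrightarrow> Lop w (H c) x = \<beta>"
    "\<And>c x. c \<in> C \<Longrightarrow> dist z x = r \<Longrightarrow> \<bar>H c x - f (x + e *\<^sub>R c)\<bar> \<le> \<eta>" by metis
  have comp: "f (x + e *\<^sub>R c) \<le> H c x + \<eta>" if c: "c \<in> C" and x: "x \<in> cball z r" for c x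
  proof -
    \<comment> \<open>The negative of the solution, translated: the operator gives -\<beta> on it,
      so \<open>visc\<close> admits it as a test function.\<close>
    define v where "v = (\<lambda>y. (- 1) * H c (y + - (e *\<^sub>R c)))"
    have Cs: "Ck 2 UNIV (\<lambda>y. H c (y + - (e *\<^sub>R c)))" by (rule Ck_shift[OF H(1)[OF c]])
    have "Ck 2 X v" unfolding v_def by (intro Ck_cmult X Ck_subset[OF Cs]) auto
    moreover have "Lop w v y = - \<beta>" for y
      unfolding v_def Lop_cmult[OF open_UNIV UNIV_I Cs] Lop_shift[OF H(1)[OF c]] using H(2)[OF c] by simp
    ultimately have sa: "subaffine X (\<lambda>x. f x + v x)" by (intro visc) auto
    let ?K = "cball (z + e *\<^sub>R c) r"
    have "?K \<subseteq> X"
    proof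
      fix y assume "y \<in> ?K"
      then have "y - e *\<^sub>R c \<in> cball z r" by (simp add: dist_norm algebra_simps)
      then show "y \<in> X" using sub[OF rsub, of "y - e *\<^sub>R c" c] B subsetD[OF C(2) c] by auto
    qed
    moreover have "f y + v y \<le> 0 \<bullet> y + \<eta>" if y: "y \<in> frontier ?K" for y
    proof -
      have "dist z (y + - (e *\<^sub>R c)) = r" using y r(1) by (simp add: dist_norm frontier_cball algebra_simps)
      from H(3)[OF c this] show ?thesis by (simp add: v_def abs_le_iff)
    qed
    ultimately have "\<forall>y\<in>?K. f y + v y \<le> 0 \<bullet> y + \<eta>"
      using sa[unfolded subaffine_def, THEN conjunct2, rule_format, of ?K 0 \<eta>] by auto
    moreover have "x + e *\<^sub>R c \<in> ?K" using x by (simp add: dist_norm)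
    ultimately have "f (x + e *\<^sub>R c) + v (x + e *\<^sub>R c) \<le> 0 \<bullet> (x + e *\<^sub>R c) + \<eta>" by blast
    then show ?thesis by (simp add: v_def)
  qed
  define Hb where "Hb = (\<lambda>x. \<Sum>c\<in>C. p c * H c x)"
  have up: "?F x \<le> Hb x + 2 * \<eta>" if x: "x \<in> cball z r" for x
  proof -
    have "(\<Sum>c\<in>C. p c * f (x + e *\<^sub>R c)) \<le> (\<Sum>c\<in>C. p c * (H c x + \<eta>))"
      by (intro sum_mono mult_left_mono comp x C(3)[rule_format])
    also have "\<dots> = Hb x + \<eta>" using C(4) by (simp add: Hb_def distrib_left sum.distrib sum_distrib_right[symmetric])
    finally show ?thesis using Fp[OF x] by (simp add: abs_le_iff)
  qed
  have lo: "Hb x \<le> ?F x + 2 * \<eta>" if x: "dist z x = r" for x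
  proof -
    have "Hb x \<le> (\<Sum>c\<in>C. p c * (f (x + e *\<^sub>R c) + \<eta>))" unfolding Hb_def
      using H(3)[OF _ x] C(3) by (intro sum_mono mult_left_mono) (auto simp: abs_le_iff algebra_simps)
    also have "\<dots> = (\<Sum>c\<in>C. p c * f (x + e *\<^sub>R c)) + \<eta>"
      using C(4) by (simp add: distrib_left sum.distrib sum_distrib_right[symmetric])
    finally show ?thesis using Fp[of x] x by (simp add: abs_le_iff)
  qed
  define U where "U = ball z \<rho>"
  have U: "open U" "cball z r \<subseteq> U" using r by (auto simp: U_def)
  have CH: "Ck 2 U Hb" unfolding Hb_def by (intro Ck_sum Ck_cmult U Ck_subset[OF H(1)]) auto
  have CF': "Ck 2 U (\<lambda>x. (- 1) * ?F x)" using CF by (intro Ck_cmult U(1)) (simp add: U_def)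
  have CN: "Ck 2 U (\<lambda>x. (- \<epsilon>) * (norm (x - z))\<^sup>2)" by (rule Ck_norm_diff[OF U(1)])
  \<comment> \<open>Here the operator is at least \<beta> - (\<beta> - \<gamma>) - \<gamma> = 0, so
    the maximum principle bounds u at the centre by 2\<eta> - 8\<eta>, whereas \<open>up\<close>
    gives at least -2\<eta>.\<close>
  define u where "u = (\<lambda>x. Hb x + ((- 1) * ?F x + (- \<epsilon>) * (norm (x - z))\<^sup>2))"
  have Cu: "Ck 2 U u" unfolding u_def by (intro Ck_add U(1) CH CF' CN)
  have "u z \<le> 2 * \<eta> - \<epsilon> * r\<^sup>2"
  proof (rule Lop_maximum_principle[where w = w, OF w U Cu r(1)])
    fix x assume x: "x \<in> ball z r"
    then have xU: "x \<in> U" using U(2) by auto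
    have "Lop w Hb x = (\<Sum>c\<in>C. p c * \<beta>)" unfolding Hb_def
      using Lop_sum[where w = w and c = p and x = x, OF C(1) open_UNIV UNIV_I H(1)] H(2) by simp
    then have "Lop w Hb x = \<beta>" using C(4) by (simp add: sum_distrib_right[symmetric])
    moreover have "Lop w u x = Lop w Hb x + (Lop w (\<lambda>x. (- 1) * ?F x) x + Lop w (\<lambda>x. (- \<epsilon>) * (norm (x - z))\<^sup>2) x)"
      unfolding u_def Lop_add[OF U(1) xU CH Ck_add[OF U(1) CF' CN]] Lop_add[OF U(1) xU CF' CN] ..
    moreover have "Lop w (\<lambda>x. (- 1) * ?F x) x = (- 1) * Lop w ?F x"
      using CF xU by (intro Lop_cmult[OF U(1)]) (simp_all add: U_def)
    moreover have "Lop w (\<lambda>x. (- \<epsilon>) * (norm (x - z))\<^sup>2) x = - \<gamma>"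
      unfolding Lop_norm_diff W_def[symmetric] using W by (simp add: \<epsilon>_def)
    ultimately show "0 \<le> Lop w u x" using LF[of x] x by simp
  next
    fix x assume "dist z x = r"
    then show "u x \<le> 2 * \<eta> - \<epsilon> * r\<^sup>2" using lo[of x] by (simp add: u_def dist_norm norm_minus_commute)
  next
    show "z \<in> cball z r" using r by simp
  qed
  moreover have "u z = Hb z - ?F z" by (simp add: u_def)
  moreover have "?F z \<le> Hb z + 2 * \<eta>" using up[of z] r by simp
  moreover have "\<epsilon> * r\<^sup>2 = 8 * \<eta>" by (simp add: \<eta>_def)
  ultimately show False using \<eta> by linarith
qed

text \<open>Enlarging the set enlarges its interior, hence shrinks the dual and with it the class of
  test functions.\<close>

lemma Fsub_mono:
  assumes "F \<subseteq> G" "Fsub F X u"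
  shows "Fsub G X u"
proof -
  have "sym_interior F \<subseteq> sym_interior G" using assms(1) by (fastforce simp: sym_interior_def)
  then have "dual G \<subseteq> dual F" by (auto simp: dual_def)
  then show ?thesis using assms(2) unfolding Fsub_def by blast
qed

text \<open>If -B were interior to \<open>F\<close>, subtracting a small multiple of the identity
  would stay in \<open>F\<close> and push the linear functional strictly below its bound. So the
  inequality Lop w v >= -\<beta> makes a C2 function \<open>v\<close> a test function for
  \<open>F\<close>.\<close>

lemma dual_halfspace:
  fixes B :: "real^'n^'n"
  assumes w: "\<And>i. w i \<noteq> 0" and F: "\<And>M. M \<in> F \<Longrightarrow> (\<Sum>i\<in>UNIV. w i \<bullet> (M *v w i)) \<ge> \<beta>"
    and B: "B \<in> Sym" "(\<Sum>i\<in>(UNIV :: 'n set). w i \<bullet> (B *v w i)) \<ge> - \<beta>"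
  shows "B \<in> dual F"
proof (rule ccontr)
  assume "B \<notin> dual F"
  then obtain A where A: "A \<in> sym_interior F" "B = - A" using B(1) by (auto simp: dual_def)
  then obtain e where e: "e > 0" "\<And>C. C \<in> Sym \<Longrightarrow> dist A C < e \<Longrightarrow> C \<in> F" by (auto simp: sym_interior_def)
  define N where "N = norm (mat 1 :: real^'n^'n) + 1"
  define s where "s = e / (2 * N)"
  have p: "N > 0" unfolding N_def using norm_ge_zero[of "mat 1 :: real^'n^'n"] by linarith
  have s: "s > 0" using e(1) p by (simp add: s_def)
  define C where "C = A - s *\<^sub>R mat 1"
  have AS: "A \<in> Sym" using B(1) A(2) by (simp add: Sym_def transpose_def vec_eq_iff)
  then have CS: "C \<in> Sym" using scaled_id_Sym[of s] by (simp add: C_def Sym_def transpose_def vec_eq_iff)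
  have "dist A C = s * norm (mat 1 :: real^'n^'n)" using s by (simp add: C_def dist_norm)
  also have "\<dots> \<le> s * N" using s by (simp add: N_def)
  also have "\<dots> < e" using e(1) p by (simp add: s_def)
  finally have "C \<in> F" using e(2)[OF CS] by blast
  then have "\<beta> \<le> (\<Sum>i\<in>UNIV. w i \<bullet> (C *v w i))" by (rule F)
  also have "\<dots> = (\<Sum>i\<in>UNIV. w i \<bullet> (A *v w i) - s * (norm (w i))\<^sup>2)"
    by (simp add: C_def matrix_vector_mult_diff_rdistrib scaleR_matrix_vector_assoc[symmetric] inner_diff_right power2_norm_eq_inner)
  also have "\<dots> = (\<Sum>i\<in>UNIV. w i \<bullet> (A *v w i)) - s * (\<Sum>i\<in>UNIV. (norm (w i))\<^sup>2)"
    by (simp add: sum_subtractf sum_distrib_left)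
  also have "\<dots> < (\<Sum>i\<in>UNIV. w i \<bullet> (A *v w i))"
  proof -
    have "0 < (\<Sum>i\<in>(UNIV :: 'n set). (norm (w i))\<^sup>2)" using w by (intro sum_pos) auto
    then show ?thesis using s by simp
  qed
  also have "\<dots> = - (\<Sum>i\<in>UNIV. w i \<bullet> (B *v w i))"
    unfolding A(2) by (simp add: uminus_matrix_vector_mult sum_negf)
  finally show False using B(2) by simp
qed

lemma moll_convex:
  fixes f :: "'a::euclidean_space \<Rightarrow> real"
  assumes f: "convex_on (ball x0 R) f" and e: "0 \<le> e" "r + e \<le> R"
  shows "convex_on (ball x0 r) (moll f e)"
proof (rule convex_onI)
  have fc: "continuous_on (ball x0 R) f" by (rule convex_on_continuous[OF open_ball f])
  have sub: "cball a e \<subseteq> ball x0 R" if "a \<in> ball x0 r" for a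
  proof
    fix y assume "y \<in> cball a e"
    then show "y \<in> ball x0 R" using that e(2) dist_triangle[of x0 y a] by simp
  qed
  have c: "continuous_on (cball 0 1) (\<lambda>y. f (a + e *\<^sub>R y))" if "a \<in> ball x0 r" for a
    by (intro continuous_scaled e(1) continuous_on_subset[OF fc sub[OF that]])
  have i: "a + e *\<^sub>R y \<in> ball x0 R" if "a \<in> ball x0 r" "norm y \<le> 1" for a y
    using sub[OF that(1)] that(2) e(1) by (auto simp: subset_iff dist_norm mult_left_le)
  fix t a b assume t: "0 < t" "t < (1::real)" and ab: "a \<in> ball x0 r" "b \<in> ball x0 r"
  let ?m = "(1 - t) *\<^sub>R a + t *\<^sub>R b"
  have m: "?m \<in> ball x0 r" using convexD_alt[OF convex_ball ab] t by simp
  have c2: "continuous_on (cball 0 1) (\<lambda>y. (1 - t) * f (a + e *\<^sub>R y) + t * f (b + e *\<^sub>R y))"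
    by (intro continuous_intros c ab)
  have "moll f e ?m \<le> avg (\<lambda>y. (1 - t) * f (a + e *\<^sub>R y) + t * f (b + e *\<^sub>R y))"
    unfolding moll_def
  proof (rule avg_mono[OF c[OF m] c2])
    fix y :: 'a assume y: "norm y \<le> 1"
    have "?m + e *\<^sub>R y = (1 - t) *\<^sub>R (a + e *\<^sub>R y) + t *\<^sub>R (b + e *\<^sub>R y)" by (simp add: algebra_simps)
    then show "f (?m + e *\<^sub>R y) \<le> (1 - t) * f (a + e *\<^sub>R y) + t * f (b + e *\<^sub>R y)"
      using convex_onD[OF f _ _ i[OF ab(1) y] i[OF ab(2) y], of t] t by simp
  qed
  also have "\<dots> = (1 - t) * moll f e a + t * moll f e b"
    unfolding moll_def avg_cmult[symmetric] by (intro avg_add continuous_intros c ab)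
  finally show "moll f e ?m \<le> (1 - t) * moll f e a + t * moll f e b" .
qed simp

lemma Fsub_continuous:
  assumes X: "open X" and P: "Pfun X f"
  shows "continuous_on X f"
proof (rule continuous_at_imp_continuous_on, rule ballI)
  fix x assume "x \<in> X"
  then obtain r where r: "r > 0" "ball x r \<subseteq> X" using X open_contains_ball by blast
  then have "continuous_on (ball x r) f" using convex_on_continuous[OF open_ball Pfun_convex_on_ball[OF X P r(2)]] by blast
  then show "isCont f x" using r(1) by (simp add: continuous_on_eq_continuous_at)
qed

text \<open>Otherwise the Hessian, positive semidefinite by convexity, is cut off from
  \<open>Fc c\<close> by some \<open>w\<close> and \<beta>; but \<open>moll_Lop_ge\<close> gives the
  opposite inequality. Radius 3e leaves room for the closed ball of radius 2e used there.\<close>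

lemma moll_hess_Fc:
  fixes f :: "real^'n \<Rightarrow> real"
  assumes X: "open X" and F: "Fsub (Fc c) X f" and c: "(real CARD('n) - 1) * pi / 2 \<le> c"
    and e: "e > 0" and B: "ball x (3 * e) \<subseteq> X"
  shows "hess (moll f e) x \<in> Fc c"
proof (rule ccontr)
  assume n: "hess (moll f e) x \<notin> Fc c"
  have P: "Pfun X f" by (rule Fsub_mono[OF Fc_subset_PSD[OF c] F])
  have fc: "continuous_on X f" by (rule Fsub_continuous[OF X P])
  have sub: "cball y e \<subseteq> X" if "y \<in> ball x e" for y
  proof
    fix u assume "u \<in> cball y e"
    then have "dist x u < 3 * e" using that e dist_triangle[of x u y] by simp
    then show "u \<in> X" using B by auto
  qed
  have CF: "Ck 2 (ball x e) (moll f e)" using Ck_moll[of "ball x e" "\<lambda>x. e" X f] e X fc sub by simp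
  have "convex_on (ball x e) (moll f e)"
    using e by (intro moll_convex[OF Pfun_convex_on_ball[OF X P B]]) auto
  then have "dd (dd (moll f e) v) v x \<ge> 0" for v by (rule convex_second_derivative[OF _ e CF])
  moreover have xb: "x \<in> ball x e" using e by simp
  ultimately have "hess (moll f e) x \<in> PSD"
    using hess_inner[OF open_ball xb CF] hess_Sym[OF open_ball xb CF] by (simp add: PSD_def)
  then obtain w :: "'n \<Rightarrow> real^'n" and \<beta> where w: "\<And>i. w i \<noteq> 0"
    and M: "\<And>M. M \<in> Fc c \<Longrightarrow> (\<Sum>i\<in>UNIV. w i \<bullet> (M *v w i)) \<ge> \<beta>"
    and lt: "(\<Sum>i\<in>UNIV. w i \<bullet> (hess (moll f e) x *v w i)) < \<beta>"
    using Fc_separation[OF c _ n] by blast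
  have B2: "cball x (e + e) \<subseteq> X" using B e by (auto simp: subset_iff)
  have "Lop w (moll f e) x \<ge> \<beta>"
  proof (rule moll_Lop_ge[where w = w, OF w X fc _ e e B2])
    fix v assume v: "Ck 2 X v" "\<And>x. x \<in> X \<Longrightarrow> Lop w v x \<ge> - \<beta>"
    have "hess v y \<in> dual (Fc c)" if y: "y \<in> X" for y
    proof (rule dual_halfspace[where w = w, OF w M])
      show "hess v y \<in> Sym" by (rule hess_Sym[OF X y v(1)])
      show "- \<beta> \<le> (\<Sum>i\<in>UNIV. w i \<bullet> (hess v y *v w i))" unfolding Lop_hess[OF X y v(1)] by (rule v(2)[OF y])
    qed
    then show "subaffine X (\<lambda>x. f x + v x)" using F C2_on_iff_Ck[OF X] v(1) unfolding Fsub_def by blast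
  qed
  then show False using lt unfolding Lop_hess[OF open_ball xb CF] by simp
qed

lemma moll_uniform_limit:
  fixes f :: "'a::euclidean_space \<Rightarrow> real"
  assumes f: "continuous_on (cball c R) f" and r: "r < R" and e: "\<And>k. 0 \<le> e k" "e \<longlonglongrightarrow> 0"
    and eR: "\<And>k. r + e k \<le> R"
  shows "uniform_limit (cball c r) (\<lambda>k. moll f (e k)) f sequentially"
proof (rule uniform_limitI)
  fix \<eta> :: real assume \<eta>: "\<eta> > 0"
  have "uniformly_continuous_on (cball c R) f" by (intro compact_uniformly_continuous f compact_cball)
  then obtain d where d: "d > 0" "\<And>a b. a \<in> cball c R \<Longrightarrow> b \<in> cball c R \<Longrightarrow> dist b a < d \<Longrightarrow> dist (f b) (f a) < \<eta> / 2"
    using \<eta> unfolding uniformly_continuous_on_def by (metis half_gt_zero)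
  have "\<forall>\<^sub>F k in sequentially. e k < d" using order_tendstoD(2)[OF e(2) d(1)] .
  then show "\<forall>\<^sub>F k in sequentially. \<forall>x\<in>cball c r. dist (moll f (e k) x) (f x) < \<eta>"
  proof eventually_elim
    case (elim k)
    show ?case
    proof
      fix x assume x: "x \<in> cball c r"
      have sub: "z \<in> cball c R" if "z \<in> cball x (e k)" for z
        using that x eR[of k] dist_triangle[of c z x] by simp
      have "\<bar>moll f (e k) x - f x\<bar> \<le> \<eta> / 2"
      proof (rule moll_close[OF continuous_on_subset[OF f] e(1)])
        show "cball x (e k) \<subseteq> cball c R" using sub by blast
        fix z assume z: "z \<in> cball x (e k)"
        have "dist (f z) (f x) < \<eta> / 2" using d(2)[of x z] sub[OF z] sub[of x] z elim e(1)[of k] by (simp add: dist_commute)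
        then show "\<bar>f z - f x\<bar> \<le> \<eta> / 2" by (simp add: dist_real_def)
      qed
      then show "dist (moll f (e k) x) (f x) < \<eta>" using \<eta> by (simp add: dist_real_def)
    qed
  qed
qed

text \<open>The limit formula splits over the pieces of the partition, and each piece is the limit
  of integrals of nonnegative densities of constant-radius mollifications, taken on a ball around
  that piece only.\<close>

lemma Cext_positive:
  fixes X :: "(real^'n) set"
  assumes X: "open X" "X \<noteq> {}" and F: "Fsub (Fc c) X f"
    and c: "(real CARD('n) - 1) * pi / 2 \<le> c" "c = \<theta> - pi / 2 + 2 * pi * of_int k"
  shows "positive_measure X (Cext X \<theta> f)"
  unfolding positive_measure_def
proof (intro allI impI)
  fix \<phi> assume \<phi>: "test_fun X \<phi> \<and> (\<forall>x. \<phi> x \<ge> 0)"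
  note \<phi>' = test_fun_support[OF \<phi>[THEN conjunct1]]
  let ?K = "closure {x. \<phi> x \<noteq> 0}"
  have P: "Pfun X f" by (rule Fsub_mono[OF Fc_subset_PSD[OF c(1)] F])
  have fc: "continuous_on X f" by (rule Fsub_continuous[OF X(1) P])
  obtain fs where fs: "approximates X fs f" using approximates_exists[OF X P] by blast
  show "Cext X \<theta> f \<phi> \<ge> 0"
  proof (rule Cmeas_converges[OF X(1) \<phi>'(2,3), of \<theta>])
    fix a C s w
    assume a: "\<And>(f :: real^'n \<Rightarrow> real) x. hess f x \<in> Sym \<Longrightarrow>
        Cdens \<theta> f x = (\<Sum>m\<le>CARD('n). a m * det (mat 1 + real m *\<^sub>R hess f x))"
      and sc: "\<And>c. c \<in> C \<Longrightarrow> 0 < s c \<and> ball c (8 * s c) \<subseteq> X"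
      and w: "\<And>c x. c \<in> C \<Longrightarrow> 0 \<le> w c x \<and> w c x \<le> 1 \<and> (x \<notin> cball c (s c) \<longrightarrow> w c x = (0::real))"
      and wc: "\<And>\<phi> c. continuous_on UNIV \<phi> \<Longrightarrow> (\<And>x. x \<notin> ?K \<Longrightarrow> \<phi> x = 0) \<Longrightarrow> c \<in> C \<Longrightarrow> continuous_on UNIV (\<lambda>x. \<phi> x * w c x)"
      and lim: "\<And>f fs \<phi>. Pfun X f \<Longrightarrow> approximates X fs f \<Longrightarrow> continuous_on UNIV \<phi> \<Longrightarrow> (\<And>x. x \<notin> ?K \<Longrightarrow> \<phi> x = 0) \<Longrightarrow>
        (\<lambda>k. Cmeas X \<theta> (fs k) \<phi>) \<longlonglongrightarrow> (\<Sum>c\<in>C. \<Sum>m\<le>CARD('n). a m * MAf c (2 * s c) (real m) f (\<lambda>x. \<phi> x * w c x))"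
    have "Cext X \<theta> f \<phi> = (\<Sum>c\<in>C. \<Sum>m\<le>CARD('n). a m * MAf c (2 * s c) (real m) f (\<lambda>x. \<phi> x * w c x))"
      using LIMSEQ_unique[OF Cext_limit[OF X P fs \<phi>[THEN conjunct1]] lim[OF P fs \<phi>'(1,4)]] .
    moreover have "(\<Sum>m\<le>CARD('n). a m * MAf x0 (2 * s x0) (real m) f (\<lambda>x. \<phi> x * w x0 x)) \<ge> 0" if x0: "x0 \<in> C" for x0
    proof -
      let ?s = "s x0" and ?\<psi> = "\<lambda>x. \<phi> x * w x0 x"
      have s: "?s > 0" "ball x0 (8 * ?s) \<subseteq> X" using sc[OF x0] by auto
      define e where "e = (\<lambda>j :: nat. ?s * inverse (real (Suc j)))"
      have e: "e j > 0" "e j \<le> ?s" for j using s(1) by (auto simp: e_def mult_left_le inverse_le_1_iff)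
      have "e \<longlonglongrightarrow> ?s * 0" unfolding e_def by (intro tendsto_intros LIMSEQ_inverse_real_of_nat)
      then have e0: "e \<longlonglongrightarrow> 0" by simp
      \<comment> \<open>Points within 4s of the centre, moved by less than 3e <= 3s, stay inside the
        ball of radius 8s.\<close>
      let ?B = "ball x0 (4 * ?s)"
      have B: "ball x (3 * e j) \<subseteq> X" if x: "x \<in> ?B" for x j
      proof
        fix u assume "u \<in> ball x (3 * e j)"
        then have "dist x0 u < 8 * ?s" using x e(2)[of j] s(1) dist_triangle[of x0 u x] by simp
        then show "u \<in> X" using s(2) by auto
      qed
      have C: "Ck 2 ?B (moll f (e j))" for j
      proof (rule Ck_moll[of ?B "\<lambda>x. e j" X f])
        fix x assume "x \<in> ?B"
        then show "cball x (e j) \<subseteq> X" using B[of x j] e(1)[of j] by (auto simp: subset_iff)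
      qed (use e X fc in auto)
      have conv: "convex_on ?B (moll f (e j))" for j
        using e[of j] s(1) by (intro moll_convex[OF Pfun_convex_on_ball[OF X(1) P s(2)]]) auto
      have \<psi>: "continuous_on UNIV ?\<psi>" by (rule wc[OF \<phi>'(1,4) x0])
      have \<psi>0: "?\<psi> x = 0" if "x \<notin> cball x0 ?s" for x using w[OF x0, of x] that by simp
      have "(\<Sum>m\<le>CARD('n). a m * MAf x0 (2 * ?s) (real m) (moll f (e j)) ?\<psi>) \<ge> 0" for j
      proof -
        have "Cmeas ?B \<theta> (moll f (e j)) ?\<psi> = (\<Sum>m\<le>CARD('n). a m * MAf x0 (2 * ?s) (real m) (moll f (e j)) ?\<psi>)"
          by (rule Cmeas_MAf[OF a open_ball C conv subset_refl _ _ _ \<psi> \<psi>0]) (use s in auto)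
        moreover have "Cmeas ?B \<theta> (moll f (e j)) ?\<psi> \<ge> 0" unfolding Cmeas_def
        proof (rule integral_nonneg)
          show "(\<lambda>x. ?\<psi> x * Cdens \<theta> (moll f (e j)) x) integrable_on ?B"
            by (rule integrable_test(1)[OF \<psi> \<psi>0 compact_cball _ open_ball Cdens_continuous[OF open_ball C]]) (use s in auto)
          fix x assume x: "x \<in> ?B"
          have "Cdens \<theta> (moll f (e j)) x \<ge> 0"
            by (rule Cdens_nonneg[OF moll_hess_Fc[OF X(1) F c(1) e(1) B[OF x]] c])
          then show "0 \<le> ?\<psi> x * Cdens \<theta> (moll f (e j)) x" using \<phi> w[OF x0, of x] by simp
        qed
        ultimately show ?thesis by simp
      qed
      moreover have "(\<lambda>j. \<Sum>m\<le>CARD('n). a m * MAf x0 (2 * ?s) (real m) (moll f (e j)) ?\<psi>)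
          \<longlonglongrightarrow> (\<Sum>m\<le>CARD('n). a m * MAf x0 (2 * ?s) (real m) f ?\<psi>)"
      proof (intro tendsto_sum tendsto_mult_left MAf_tendsto)
        have sub: "cball x0 (2 * ?s) \<subseteq> ?B" using s(1) by auto
        show "convex_on (cball x0 (2 * ?s)) (moll f (e j))" for j
          by (rule convex_on_subset[OF conv sub]) simp
        show "continuous_on (cball x0 (2 * ?s)) (moll f (e j))" for j
          by (rule continuous_on_subset[OF Ck_continuous[OF C] sub])
        have "2 * ?s < 8 * ?s" using s(1) by simp
        then show "convex_on (cball x0 (2 * ?s)) f" "continuous_on (cball x0 (2 * ?s)) f"
          using convex_on_cball_of_Pfun[OF X(1) P s(2)] by blast+
        have "4 * ?s < 8 * ?s" using s(1) by simp
        then have "continuous_on (cball x0 (4 * ?s)) f" using convex_on_cball_of_Pfun(2)[OF X(1) P s(2)] by blast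
        moreover have e4: "e j \<le> 2 * ?s" for j using e(2)[of j] s(1) by simp
        ultimately show "uniform_limit (cball x0 (2 * ?s)) (\<lambda>j. moll f (e j)) f sequentially"
          using s(1) e by (intro moll_uniform_limit[of x0 "4 * ?s"] e0) (auto simp: less_imp_le e4)
      qed (use s \<psi> \<psi>0 in auto)
      ultimately show ?thesis by (intro LIMSEQ_le_const) auto
    qed
    ultimately show ?thesis by (simp add: sum_nonneg)
  qed
qed

section \<open>Concave functions\<close>

lemma C2_on_uminus:
  assumes "open X" "C2_on X f"
  shows "C2_on X (\<lambda>x. - f x)"
  using assms Ck_cmult[of X 2 f "- 1"] by (simp add: C2_on_iff_Ck)

lemma hess_uminus:
  assumes X: "open X" "x \<in> X" and f: "C2_on X f"
  shows "hess (\<lambda>x. - f x) x = - hess f x"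
proof -
  have C: "Ck 2 X f" using f C2_on_iff_Ck[OF X(1)] by blast
  have "Ck 2 X (\<lambda>x. - f x)" using Ck_cmult[OF X(1) C, of "- 1"] by simp
  then show ?thesis
    using dd2_cmult[OF X C, of "- 1"] by (simp add: vec_eq_iff hess_nth[OF X] C)
qed

text \<open>Changing the sign of \<open>f\<close> conjugates the determinant, and conjugating the
  phase as well turns \<theta> into -\<theta>. This reduces concave functions to convex
  ones.\<close>

lemma Cdens_uminus:
  assumes X: "open X" "x \<in> X" and f: "C2_on X f"
  shows "Cdens \<theta> (\<lambda>x. - f x) x = Cdens (- \<theta>) f x"
proof -
  let ?M = "\<lambda>z. (\<chi> i j. (if i = j then 1 else 0) + z * complex_of_real (hess f x $ i $ j)) :: complex^'a^'a"
  have "(\<chi> i j. (if i = j then 1 else 0) + \<i> * complex_of_real (hess (\<lambda>x. - f x) x $ i $ j)) = ?M (- \<i>)"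
    by (simp add: hess_uminus[OF assms])
  moreover have "det (?M (- \<i>)) = cnj (det (?M \<i>))"
    unfolding det_def by (simp add: if_distrib[of cnj] cong: if_cong)
  moreover have "exp (- \<i> * complex_of_real \<theta>) = cnj (exp (- \<i> * complex_of_real (- \<theta>)))"
    by (simp add: exp_cnj)
  ultimately have "Cdens \<theta> (\<lambda>x. - f x) x = Re (cnj (exp (- \<i> * complex_of_real (- \<theta>)) * det (?M \<i>)))"
    by (simp only: Cdens_def complex_cnj_mult)
  then show ?thesis by (simp only: Cdens_def cnj.simps)
qed

lemma Cmeas_uminus:
  assumes "open X" "C2_on X f"
  shows "Cmeas X \<theta> (\<lambda>x. - f x) \<phi> = Cmeas X (- \<theta>) f \<phi>"
  unfolding Cmeas_def by (rule integral_cong) (simp add: Cdens_uminus[OF assms(1) _ assms(2)])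

lemma cont_ext_uminus:
  assumes X: "open X" and T: "cont_ext X \<theta> S T"
  shows "cont_ext X (- \<theta>) (\<lambda>f. S (\<lambda>x. - f x)) (\<lambda>f. T (\<lambda>x. - f x))"
  unfolding cont_ext_def
proof (intro conjI allI impI)
  fix f \<phi> assume f: "S (\<lambda>x. - f x) \<and> C2_on X f" and \<phi>: "test_fun X \<phi>"
  have "T (\<lambda>x. - f x) \<phi> = Cmeas X \<theta> (\<lambda>x. - f x) \<phi>"
    using T f \<phi> C2_on_uminus[OF X] unfolding cont_ext_def by blast
  then show "T (\<lambda>x. - f x) \<phi> = Cmeas X (- \<theta>) f \<phi>" using Cmeas_uminus[OF X] f by simp
next
  fix fs f \<phi>
  assume h: "(\<forall>k :: nat. S (\<lambda>x. - fs k x) \<and> C2_on X (fs k)) \<and> S (\<lambda>x. - f x) \<and>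
      (\<forall>K. compact K \<and> K \<subseteq> X \<longrightarrow> uniform_limit K fs f sequentially)" and \<phi>: "test_fun X \<phi>"
  have "(\<forall>k. S (\<lambda>x. - fs k x) \<and> C2_on X (\<lambda>x. - fs k x)) \<and> S (\<lambda>x. - f x) \<and>
      (\<forall>K. compact K \<and> K \<subseteq> X \<longrightarrow> uniform_limit K (\<lambda>k x. - fs k x) (\<lambda>x. - f x) sequentially)"
    using h C2_on_uminus[OF X] by (blast intro: uniform_limit_uminus)
  then show "(\<lambda>k. T (\<lambda>x. - fs k x) \<phi>) \<longlonglongrightarrow> T (\<lambda>x. - f x) \<phi>"
    using T[unfolded cont_ext_def, THEN conjunct2, rule_format, of "\<lambda>k x. - fs k x" "\<lambda>x. - f x" \<phi>] \<phi> by blast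
qed

theorem theorem10p1:
  fixes X :: "(real^'n) set" and \<theta> :: real
  assumes "domain X" and "-pi < \<theta>" and "\<theta> \<le> pi"
  defines "n \<equiv> real CARD('n)"
  shows
   "(\<exists>T. cont_ext X \<theta> (Pfun X) T
        \<and> (\<forall>f. Pfun X f \<longrightarrow> signed_radon X (T f))
        \<and> (\<forall>T'. cont_ext X \<theta> (Pfun X) T' \<longrightarrow>
               (\<forall>f \<phi>. Pfun X f \<and> test_fun X \<phi> \<longrightarrow> T' f \<phi> = T f \<phi>))
        \<and> (\<forall>c f. (n - 1) * pi / 2 \<le> c \<and> c < n * pi / 2 \<and>
                 (\<exists>k::int. c = \<theta> - pi / 2 + 2 * pi * of_int k) \<and> Fsub (Fc c) X f
                 \<longrightarrow> positive_measure X (T f)))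
    \<and>
    (\<exists>T. cont_ext X \<theta> (\<lambda>f. Pfun X (\<lambda>x. - f x)) T
        \<and> (\<forall>f. Pfun X (\<lambda>x. - f x) \<longrightarrow> signed_radon X (T f))
        \<and> (\<forall>T'. cont_ext X \<theta> (\<lambda>f. Pfun X (\<lambda>x. - f x)) T' \<longrightarrow>
               (\<forall>f \<phi>. Pfun X (\<lambda>x. - f x) \<and> test_fun X \<phi> \<longrightarrow> T' f \<phi> = T f \<phi>))
        \<and> (\<forall>c f. - n * pi / 2 < c \<and> c \<le> - (n - 1) * pi / 2 \<and>
                 (\<exists>k::int. c = \<theta> + pi / 2 + 2 * pi * of_int k) \<and> Fsub (Fc (- c)) X (\<lambda>x. - f x)
                 \<longrightarrow> positive_measure X (T f)))"
proof -
  have X: "open X" "X \<noteq> {}" using assms(1) by (auto simp: domain_def)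
  show ?thesis
  proof (rule conjI; rule exI; intro conjI allI impI)
    show "cont_ext X \<theta> (Pfun X) (Cext X \<theta>)" by (rule cont_ext_Cext[OF X])
    show "signed_radon X (Cext X \<theta> f)" if "Pfun X f" for f using that by (rule Cext_signed_radon[OF X])
    show "T' f \<phi> = Cext X \<theta> f \<phi>" if "cont_ext X \<theta> (Pfun X) T'" "Pfun X f \<and> test_fun X \<phi>" for T' f \<phi>
      using cont_ext_unique[OF X that(1)] that(2) by blast
    show "positive_measure X (Cext X \<theta> f)"
      if "(n - 1) * pi / 2 \<le> c \<and> c < n * pi / 2 \<and>
         (\<exists>k::int. c = \<theta> - pi / 2 + 2 * pi * of_int k) \<and> Fsub (Fc c) X f" for c f
      using that Cext_positive[OF X] unfolding n_def by blast
  next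
    show "cont_ext X \<theta> (\<lambda>f. Pfun X (\<lambda>x. - f x)) (\<lambda>f. Cext X (- \<theta>) (\<lambda>x. - f x))"
      using cont_ext_uminus[OF X(1) cont_ext_Cext[OF X, of "- \<theta>"]] by simp
    show "signed_radon X (Cext X (- \<theta>) (\<lambda>x. - f x))" if "Pfun X (\<lambda>x. - f x)" for f
      using that by (rule Cext_signed_radon[OF X])
    show "T' f \<phi> = Cext X (- \<theta>) (\<lambda>x. - f x) \<phi>"
      if "cont_ext X \<theta> (\<lambda>f. Pfun X (\<lambda>x. - f x)) T'" "Pfun X (\<lambda>x. - f x) \<and> test_fun X \<phi>" for T' f \<phi>
      using cont_ext_unique[OF X cont_ext_uminus[OF X(1) that(1), simplified]] that(2) by fastforce
    show "positive_measure X (Cext X (- \<theta>) (\<lambda>x. - f x))"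
      if h: "- n * pi / 2 < c \<and> c \<le> - (n - 1) * pi / 2 \<and>
         (\<exists>k::int. c = \<theta> + pi / 2 + 2 * pi * of_int k) \<and> Fsub (Fc (- c)) X (\<lambda>x. - f x)" for c f
    proof -
      obtain k :: int where "c = \<theta> + pi / 2 + 2 * pi * of_int k" using h by blast
      \<comment> \<open>In terms of -\<theta> and -c this is the congruence of the convex
        case.\<close>
      then have "- c = - \<theta> - pi / 2 + 2 * pi * of_int (- k)" by simp
      moreover have "- (n - 1) * pi / 2 = - ((n - 1) * pi / 2)" by (simp add: field_simps)
      then have "(real CARD('n) - 1) * pi / 2 \<le> - c" using h unfolding n_def by linarith
      ultimately show ?thesis using Cext_positive[OF X _ _ , of "- c"] h by blast
    qed
  qed
qed

end
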